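(* Suppose $0 < q < 1$. Suppose $g: [1, \infty) \to [1, \infty)$ is a function such that $\lim_{x \to \infty} g(x) = \infty$. Then there exists a real-valued strictly stationary, countable-state, irreducible, aperiodic Markov chain $X := (X_k, k \in \mathbb{Z})$ which is reversible, such that $E[X_0^2] < \infty$ and $E[X_0] = 0$, and such that all of the following hold: (1) $\displaystyle \int_0^{\exp(-x^q)} Q_{|X(0)|}^2(u)\, du \ll (1/x)^{1-q} \cdot g(x)$ as $x \to \infty$; (2) $\alpha_X(n) \leq \beta_X(n) \leq \exp(-n^q)$ for all $n \in \mathbb{N}$; (3) $\lim_{n \to \infty} n^{-1}\,\mathrm{Var}\bigl(\sum_{k=1}^n X_k\bigr) = \infty$, and for every $c > 0$, $$\lim_{n \to \infty} \Bigl[\, \sup_{r \in \mathbb{R}} P\Bigl(r - c < n^{-1/2} \sum_{k=1}^n X_k < r + c\Bigr)\Bigr] = 0;$$ (4) there exist a strictly increasing sequence $(J(1), J(2), J(3), \dots)$ of positive integers and a sequence $(b_1, b_2, b_3, \dots)$ of positive constants satisfying $b_n \to \infty$ as $n \to \infty$, such that $$b_n^{-1} \sum_{k=1}^{J(n)} X_k \to \mu_{\mathrm{P1sL}} \quad \text{in distribution as } n \to \infty;$$ (5) defining $\mathbf{h}(n) := n^{-1}\,\mathrm{Var}\bigl(\sum_{k=1}^n X_k\bigr)$ for every $n \in \mathbb{N}$, one has $\mathbf{h}(n) \leq g(n)$ for every $n \in \mathbb{N}$, and for every $N \in \mathbb{N}$, $\limsup_{n \to \infty} \mathbf{h}(Nn)/\mathbf{h}(n)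 = N$.
   Context: $\mathbb{N}$ is the set of positive integers. Markov chains are indexed by the set $\mathbb{Z}$ of all integers; "countable-state" means that the state space is a finite or countably infinite subset of $\mathbb{R}$. The notation $a(x) \ll b(x)$ as $x \to \infty$ means $a(x) = O(b(x))$ as $x \to \infty$. Reversible: a strictly stationary Markov chain $(X_k, k \in \mathbb{Z})$ is reversible if the time-reversed sequence $(X_{-k}, k \in \mathbb{Z})$ has the same distribution on $\mathbb{R}^{\mathbb{Z}}$ as $(X_k, k\in\mathbb{Z})$ (equivalently, $(X_1, X_0)$ has the same distribution as $(X_0, X_1)$). Quantile function: for a nonnegative random variable $W$, $Q_W: (0,1) \to [0,\infty)$ is defined by $Q_W(u) := \inf\{t \geq 0 : P(W > t) \leq u\}$. $Q_{|X(0)|}$ denotes $Q_W$ for $W = |X_0|$. Dependence coefficients: for $\sigma$-fields $\mathcal{A}, \mathcal{B}$ on the probability space, $\alpha(\mathcal{A},\mathcal{B}) := \sup_{A \in \mathcal{A}, B \in \mathcal{B}} |P(A \cap B) - P(A)P(B)|$ and $\beta(\mathcal{A}, \mathcal{B}) := \sup \frac12 \sum_{i=1}^I \sum_{j=1}^J |P(A_i \cap B_j) - P(A_i)P(B_j)|$, the latter supremum being over all pairs of finite partitions $\{A_1,\dots,A_I\}$, $\{B_1,\dots,B_J\}$ of $\Omega$ with $A_i \in \mathcal{A}$, $B_j \in \mathcal{B}$. For a strictly stationary sequence $X$ and $n \in \mathbb{N}$, $\alpha_X(n) := \alpha(\sigma(X_k, k \le 0), \sigma(X_k, k \ge n))$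 and $\beta_X(n) := \beta(\sigma(X_k, k \le 0), \sigma(X_k, k \ge n))$. The distribution $\mu_{\mathrm{P1sL}}$: the distribution of the random variable $Y := \sum_{k=1}^{N} \eta_k$ (with empty sum equal to $0$), where $\eta_1, \eta_2, \dots$ are i.i.d. with the Laplace density $\frac12 e^{-|x|}$, $x \in \mathbb{R}$, and $N$ is a Poisson random variable with mean $1$, independent of $(\eta_1, \eta_2, \dots)$. *)

theory Defs
  imports "HOL-Probability.Probability" "HOL-Library.Landau_Symbols"
begin

definition strictly_stationary :: "'a measure \<Rightarrow> (int \<Rightarrow> 'a \<Rightarrow> real) \<Rightarrow> bool" where
  "strictly_stationary M X \<longleftrightarrow>
     (\<forall>k. X k \<in> borel_measurable M) \<and>
     (\<forall>j. distr M (\<Pi>\<^sub>M k\<in>UNIV. borel) (\<lambda>\<omega> k. X (k + j) \<omega>)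
        = distr M (\<Pi>\<^sub>M k\<in>UNIV. borel) (\<lambda>\<omega> k. X k \<omega>))"

definition reversible :: "'a measure \<Rightarrow> (int \<Rightarrow> 'a \<Rightarrow> real) \<Rightarrow> bool" where
  "reversible M X \<longleftrightarrow>
     distr M (\<Pi>\<^sub>M k\<in>UNIV. borel) (\<lambda>\<omega> k. X (- k) \<omega>)
       = distr M (\<Pi>\<^sub>M k\<in>UNIV. borel) (\<lambda>\<omega> k. X k \<omega>)"

text \<open>The state space \<open>S\<close> consists of the values that are taken with positive probability, so
  the conditional probabilities given a state at time \<open>0\<close> below are never \<open>0 / 0\<close>. In the Markov
  property, \<open>s l\<close> is the state at time \<open>k - l\<close>.\<close>

definition countable_markov_chain ::
    "'a measure \<Rightarrow> (int \<Rightarrow> 'a \<Rightarrow> real) \<Rightarrow> real set \<Rightarrow> bool" where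
  "countable_markov_chain M X S \<longleftrightarrow>
     countable S \<and>
     (\<forall>k. X k \<in> borel_measurable M) \<and>
     (\<forall>k. \<forall>\<omega>\<in>space M. X k \<omega> \<in> S) \<and>
     (\<forall>k. \<forall>s\<in>S. \<P>(\<omega> in M. X k \<omega> = s) > 0) \<and>
     (\<forall>k. \<forall>m::nat. \<forall>s :: nat \<Rightarrow> real. \<forall>j.
        \<P>(\<omega> in M. \<forall>l\<le>m. X (k - int l) \<omega> = s l) > 0 \<longrightarrow>
        \<P>(\<omega> in M. X (k + 1) \<omega> = j \<bar> \<forall>l\<le>m. X (k - int l) \<omega> = s l)
          = \<P>(\<omega> in M. X (k + 1) \<omega> = j \<bar> X k \<omega> = s 0))"

text \<open>The next two notions are meant for stationary chains, whose \<open>n\<close>-step transition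
  probabilities can be read off at time \<open>0\<close>.\<close>

definition chain_irreducible ::
    "'a measure \<Rightarrow> (int \<Rightarrow> 'a \<Rightarrow> real) \<Rightarrow> real set \<Rightarrow> bool" where
  "chain_irreducible M X S \<longleftrightarrow>
     (\<forall>i\<in>S. \<forall>j\<in>S. \<exists>n\<ge>1. \<P>(\<omega> in M. X (int n) \<omega> = j \<bar> X 0 \<omega> = i) > 0)"

definition chain_aperiodic ::
    "'a measure \<Rightarrow> (int \<Rightarrow> 'a \<Rightarrow> real) \<Rightarrow> real set \<Rightarrow> bool" where
  "chain_aperiodic M X S \<longleftrightarrow>
     (\<forall>i\<in>S. Gcd {n::nat. 1 \<le> n \<and> \<P>(\<omega> in M. X (int n) \<omega> = i \<bar> X 0 \<omega> = i) > 0} = 1)"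

definition quantile :: "'a measure \<Rightarrow> ('a \<Rightarrow> real) \<Rightarrow> real \<Rightarrow> real" where
  "quantile M W u = Inf {t. 0 \<le> t \<and> \<P>(\<omega> in M. W \<omega> > t) \<le> u}"

definition alpha_coeff :: "'a measure \<Rightarrow> 'a set set \<Rightarrow> 'a set set \<Rightarrow> real" where
  "alpha_coeff M \<A> \<B> =
     (SUP (A, B)\<in>\<A> \<times> \<B>. \<bar>measure M (A \<inter> B) - measure M A * measure M B\<bar>)"

text \<open>The blocks of a \<^const>\<open>partition_on\<close> are nonempty; empty blocks would contribute \<open>0\<close>.\<close>

definition beta_coeff :: "'a measure \<Rightarrow> 'a set set \<Rightarrow> 'a set set \<Rightarrow> real" where
  "beta_coeff M \<A> \<B> =
     Sup {(1 / 2) * (\<Sum>A\<in>\<P>. \<Sum>B\<in>\<Q>. \<bar>measure M (A \<inter> B) - measure M A * measure M B\<bar>) | \<P> \<Q>.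
       finite \<P> \<and> partition_on (space M) \<P> \<and> \<P> \<subseteq> \<A> \<and>
       finite \<Q> \<and> partition_on (space M) \<Q> \<and> \<Q> \<subseteq> \<B>}"

definition sigma_gen_by ::
    "'a measure \<Rightarrow> (int \<Rightarrow> 'a \<Rightarrow> real) \<Rightarrow> int set \<Rightarrow> 'a set set" where
  "sigma_gen_by M X K =
     sigma_sets (space M) {X k -` B \<inter> space M | k B. k \<in> K \<and> B \<in> sets borel}"

definition alpha_mix :: "'a measure \<Rightarrow> (int \<Rightarrow> 'a \<Rightarrow> real) \<Rightarrow> nat \<Rightarrow> real" where
  "alpha_mix M X n = alpha_coeff M (sigma_gen_by M X {..0}) (sigma_gen_by M X {int n..})"

definition beta_mix :: "'a measure \<Rightarrow> (int \<Rightarrow> 'a \<Rightarrow> real) \<Rightarrow> nat \<Rightarrow> real" where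
  "beta_mix M X n = beta_coeff M (sigma_gen_by M X {..0}) (sigma_gen_by M X {int n..})"

definition psum :: "(int \<Rightarrow> 'a \<Rightarrow> real) \<Rightarrow> nat \<Rightarrow> 'a \<Rightarrow> real" where
  "psum X n \<omega> = (\<Sum>k=1..n. X (int k) \<omega>)"

definition norm_var :: "'a measure \<Rightarrow> (int \<Rightarrow> 'a \<Rightarrow> real) \<Rightarrow> nat \<Rightarrow> real" where
  "norm_var M X n = prob_space.variance M (psum X n) / real n"

definition laplace_measure :: "real measure" where
  "laplace_measure = density lborel (\<lambda>x. ennreal (exp (- \<bar>x\<bar>) / 2))"

definition mu_P1sL :: "real measure" where
  "mu_P1sL = distr (measure_pmf (poisson_pmf 1) \<Otimes>\<^sub>M (\<Pi>\<^sub>M k\<in>(UNIV :: nat set). laplace_measure))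
     borel (\<lambda>(N, \<eta>). \<Sum>k=1..N. \<eta> k)"

end

theory Submission
  imports Defs "HOL-Real_Asymp.Real_Asymp"
begin

text \<open>A state of the chain is a pair of a type \<open>t\<close> and a sign, with value \<open>\<plusminus> a
  t\<close>. At each step a random level is drawn; if it is at least the current type, the state is drawn afresh
  among the types up to that level, otherwise it is kept. This kernel is reversible, and every odd function supported
  on type \<open>t\<close> is an eigenfunction with eigenvalue \<open>s t = 1 - 1 / L t\<close>. Hence the variance
  of a partial sum is the mixture \<open>\<Sum>t. p t * (a t)\<^sup>2 * \<Gamma> n (s t)\<close>, and the mixing
  coefficients are at most \<open>2 \<Sum>t. p t * s t ^ n\<close>. If \<open>L t\<close> grows very fast, a single
  type matters at each time scale: on the scale on which type \<open>j\<close> is seen about once in expectation, its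
  visits are Poisson in number and have geometric lengths, which become exponential after scaling, and with the
  random sign this gives the compound Poisson law. Conditionally on the innovations the signs are independent, so the
  characteristic function of a partial sum is an average of products of cosines of cluster lengths; it is small
  because the asymptotic variance contributed by type \<open>j\<close> tends to infinity with \<open>j\<close>, and
  comparison with a Gaussian kernel yields the vanishing concentration function.\<close>

section \<open>Expectations over iterated probability mass functions\<close>

text \<open>Refreshing from \<pi> conditioned on the types up to the level keeps the laws inside one
  family of conditioned measures: once a level has reached the types of \<open>x\<close> and
  \<open>y\<close>, the probability of \<open>y\<close> never falls below its stationary value. This
  bounds the \<open>n\<close>-step kernel from below with an explicit deficit, and for the beta
  coefficient a lower bound is enough.

  The two distributional statements take their limits in different orders. For the concentration
  function one type is fixed while \<open>n\<close> tends to infinity, and only then does the type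
  grow, so the interplay of several types never enters. For the limit law type and time grow
  together, and the gaps between successive \<open>L t\<close> must hide all other types.

  The exponent \<open>- 2 * \<Lambda> t\<close> has its factor 2 because one half pays for the
  mixing rate and the other for a geometric series over the types. The rates \<open>vv t\<close> are
  cubes of factorials so that the earlier types stay negligible even at time \<open>L t / t\<close>,
  when type \<open>t\<close> has built up only a small part of its own rate.\<close>

lemma integral_bind_pmf_real:
  fixes f :: "'b \<Rightarrow> real"
  assumes "\<And>x. \<bar>f x\<bar> \<le> B"
  shows "measure_pmf.expectation (bind_pmf p K) f
       = measure_pmf.expectation p (\<lambda>x. measure_pmf.expectation (K x) f)"
proof -
  have f: "integrable (measure_pmf r) f" for r :: "'b pmf"
    using assms by (intro measure_pmf.integrable_const_bound[of _ B]) auto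
  have le: "\<bar>measure_pmf.expectation r f\<bar> \<le> B" for r :: "'b pmf"
    by (rule order_trans[OF integral_abs_bound])
       (metis assms f integrable_abs measure_pmf.integral_le_const AE_I2)
  \<comment> \<open>The nonnegative integral passes through \<open>bind_pmf\<close> without
    integrability conditions; the shift by \<open>B\<close> makes \<open>f + B\<close> nonnegative
    so that this applies.\<close>
  have 1: "ennreal (measure_pmf.expectation r f + B) = (\<integral>\<^sup>+ x. ennreal (f x + B) \<partial>measure_pmf r)"
    for r :: "'b pmf"
  proof -
    have "f x + B \<ge> 0" for x using assms[of x] by linarith
    then have "(\<integral>\<^sup>+ x. ennreal (f x + B) \<partial>measure_pmf r) = ennreal (measure_pmf.expectation r (\<lambda>x. f x + B))"
      using f by (intro nn_integral_eq_integral) auto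
    also have "measure_pmf.expectation r (\<lambda>x. f x + B) = measure_pmf.expectation r f + B"
      using f by (simp add: measure_pmf.prob_space)
    finally show ?thesis ..
  qed
  have i: "integrable (measure_pmf p) (\<lambda>x. measure_pmf.expectation (K x) f)"
    using le by (intro measure_pmf.integrable_const_bound[of _ B]) auto
  have nn: "measure_pmf.expectation r f + B \<ge> 0" for r
    using le[of r] by linarith
  have "ennreal (measure_pmf.expectation (bind_pmf p K) f + B)
      = (\<integral>\<^sup>+ x. ennreal (measure_pmf.expectation (K x) f + B) \<partial>measure_pmf p)"
    unfolding 1 by simp
  also have "\<dots> = ennreal (measure_pmf.expectation p (\<lambda>x. measure_pmf.expectation (K x) f + B))"
    using i nn by (intro nn_integral_eq_integral) auto
  also have "measure_pmf.expectation p (\<lambda>x. measure_pmf.expectation (K x) f + B)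
      = measure_pmf.expectation p (\<lambda>x. measure_pmf.expectation (K x) f) + B"
    using i by (simp add: measure_pmf.prob_space)
  finally have eq: "ennreal (measure_pmf.expectation (bind_pmf p K) f + B)
     = ennreal (measure_pmf.expectation p (\<lambda>x. measure_pmf.expectation (K x) f) + B)" .
  have "0 \<le> measure_pmf.expectation p (\<lambda>x. measure_pmf.expectation (K x) f + B)"
    using nn by (intro integral_nonneg_AE) auto
  also have "\<dots> = measure_pmf.expectation p (\<lambda>x. measure_pmf.expectation (K x) f) + B"
    using i by (simp add: measure_pmf.prob_space)
  finally show ?thesis using eq nn by (subst (asm) ennreal_inj) auto
qed

lemma integrable_pmf_bounded:
  fixes f :: "'a \<Rightarrow> 'b :: {banach, second_countable_topology}"
  assumes "\<And>x. norm (f x) \<le> B"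
  shows "integrable (measure_pmf p) f"
  using assms by (intro measure_pmf.integrable_const_bound[of _ B]) auto

lemma integral_bind_pmf_complex:
  fixes f :: "'b \<Rightarrow> complex"
  assumes B: "\<And>x. norm (f x) \<le> B"
  shows "measure_pmf.expectation (bind_pmf p K) f
       = measure_pmf.expectation p (\<lambda>x. measure_pmf.expectation (K x) f)"
proof -
  have i: "integrable (measure_pmf r) f" for r :: "'b pmf"
    by (rule integrable_pmf_bounded[OF B])
  have n: "norm (measure_pmf.expectation r f) \<le> B" for r
    by (rule order_trans[OF integral_norm_bound])
       (metis B i integrable_norm measure_pmf.integral_le_const AE_I2)
  have i2: "integrable (measure_pmf p) (\<lambda>x. measure_pmf.expectation (K x) f)"
    by (rule integrable_pmf_bounded[OF n])
  have "\<bar>Re (f x)\<bar> \<le> B" "\<bar>Im (f x)\<bar> \<le> B" for x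
    using abs_Re_le_cmod[of "f x"] abs_Im_le_cmod[of "f x"] B[of x] by linarith+
  then have "measure_pmf.expectation (bind_pmf p K) (\<lambda>x. Re (f x))
      = measure_pmf.expectation p (\<lambda>x. measure_pmf.expectation (K x) (\<lambda>x. Re (f x)))"
    "measure_pmf.expectation (bind_pmf p K) (\<lambda>x. Im (f x))
      = measure_pmf.expectation p (\<lambda>x. measure_pmf.expectation (K x) (\<lambda>x. Im (f x)))"
    by (blast intro: integral_bind_pmf_real)+
  then show ?thesis
    by (intro complex_eqI) (simp_all add: integral_Re[OF i] integral_Im[OF i] integral_Re[OF i2] integral_Im[OF i2])
qed

lemma pmf_bind_map_Cons:
  "pmf (bind_pmf p (\<lambda>x. map_pmf ((#) x) (q x))) (y # ys) = pmf p y * pmf (q y) ys"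
proof -
  have "pmf (map_pmf ((#) x) (q x)) (y # ys) = indicator {y} x * pmf (q y) ys" for x
  proof (cases "x = y")
    case True
    then show ?thesis using pmf_map_inj'[of "(#) y" "q y" ys] by (simp add: inj_def)
  next
    case False
    then have "y # ys \<notin> set_pmf (map_pmf ((#) x) (q x))" by auto
    then show ?thesis using False by (simp add: set_pmf_iff del: set_map_pmf)
  qed
  then have "pmf (bind_pmf p (\<lambda>x. map_pmf ((#) x) (q x))) (y # ys)
     = measure_pmf.expectation p (\<lambda>x. indicator {y} x * pmf (q y) ys)"
    by (simp add: pmf_bind)
  also have "\<dots> = pmf p y * pmf (q y) ys"
    by (simp add: measure_pmf_single)
  finally show ?thesis .
qed

section \<open>Reversible Markov chains indexed by the integers\<close>

text \<open>Detailed balance is the only assumption: stationarity of \<pi> follows from it, and it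
  makes the weight of a path computable from either end.\<close>

locale reversible_kernel =
  fixes \<pi> :: "'s :: countable pmf" and K :: "'s \<Rightarrow> 's pmf"
  assumes rev: "pmf \<pi> x * pmf (K x) y = pmf \<pi> y * pmf (K y) x"
begin

primrec paths :: "nat \<Rightarrow> 's \<Rightarrow> 's list pmf" where
  "paths 0 x = return_pmf []"
| "paths (Suc n) x = bind_pmf (K x) (\<lambda>y. map_pmf ((#) y) (paths n y))"

definition law :: "nat \<Rightarrow> 's list pmf" where
  "law n = bind_pmf \<pi> (\<lambda>x. map_pmf ((#) x) (paths n x))"

text \<open>The stationary probability of following \<open>x\<close> on the window from
  \<open>k\<close> to \<open>k + n\<close>. With a two-sided \<open>x\<close>, windows can be
  enlarged, shrunk and reflected without reindexing.\<close>

definition weight :: "int \<Rightarrow> nat \<Rightarrow> (int \<Rightarrow> 's) \<Rightarrow> real" where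
  "weight k n x = pmf \<pi> (x k) * (\<Prod>i<n. pmf (K (x (k + int i))) (x (k + int i + 1)))"

lemma pmf_paths:
  "length ys = n \<Longrightarrow> pmf (paths n x) ys = (\<Prod>i<n. pmf (K ((x # ys) ! i)) (ys ! i))"
proof (induction n arbitrary: x ys)
  case 0
  then show ?case by simp
next
  case (Suc n)
  then obtain z zs where ys: "ys = z # zs" "length zs = n" by (cases ys) auto
  have "pmf (paths (Suc n) x) ys = pmf (K x) z * pmf (paths n z) zs"
    by (simp add: ys pmf_bind_map_Cons)
  also have "\<dots> = (\<Prod>i<Suc n. pmf (K ((x # ys) ! i)) (ys ! i))"
    using Suc.IH[OF ys(2), of z] by (simp only: prod.lessThan_Suc_shift) (simp add: ys)
  finally show ?case .
qed

lemma length_paths: "ys \<in> set_pmf (paths n x) \<Longrightarrow> length ys = n"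
  by (induction n arbitrary: x ys) auto

lemma length_law: "ys \<in> set_pmf (law n) \<Longrightarrow> length ys = Suc n"
  by (auto simp: law_def dest: length_paths)

lemma pmf_law:
  assumes "\<And>i. i \<le> n \<Longrightarrow> xs ! i = x (k + int i)" "length xs = Suc n"
  shows "pmf (law n) xs = weight k n x"
proof -
  obtain z zs where xs: "xs = z # zs" "length zs = n" using assms(2) by (cases xs) auto
  have z: "z = x k" using assms(1)[of 0] xs by simp
  have "pmf (law n) xs = pmf \<pi> z * pmf (paths n z) zs"
    by (simp add: law_def xs pmf_bind_map_Cons)
  also have "pmf (paths n z) zs = (\<Prod>i<n. pmf (K (x (k + int i))) (x (k + int i + 1)))"
    unfolding pmf_paths[OF xs(2)]
  proof (rule prod.cong[OF refl])
    fix i assume "i \<in> {..<n}"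
    then show "pmf (K ((z # zs) ! i)) (zs ! i) = pmf (K (x (k + int i))) (x (k + int i + 1))"
      using assms(1)[of i] assms(1)[of "Suc i"] xs by (simp add: algebra_simps)
  qed
  finally show ?thesis by (simp add: weight_def z)
qed

lemma bind_stationary: "bind_pmf \<pi> K = \<pi>"
proof (rule pmf_eqI)
  fix y
  have "ennreal (pmf (bind_pmf \<pi> K) y) = (\<integral>\<^sup>+x. ennreal (pmf \<pi> x) * ennreal (pmf (K x) y) \<partial>count_space UNIV)"
    by (simp add: ennreal_pmf_bind nn_integral_measure_pmf)
  also have "\<dots> = (\<integral>\<^sup>+x. ennreal (pmf \<pi> y) * ennreal (pmf (K y) x) \<partial>count_space UNIV)"
    by (simp flip: ennreal_mult' add: rev)
  also have "\<dots> = ennreal (pmf \<pi> y)"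
    by (simp add: nn_integral_cmult nn_integral_pmf)
  finally show "pmf (bind_pmf \<pi> K) y = pmf \<pi> y" by simp
qed

lemma weight_nonneg: "weight k n x \<ge> 0"
  by (simp add: weight_def prod_nonneg)

lemma weight_cong:
  assumes "\<And>i. k \<le> i \<Longrightarrow> i \<le> k + int n \<Longrightarrow> x i = y i"
  shows "weight k n x = weight k n y"
  unfolding weight_def using assms by (intro arg_cong2[where f="(*)"] prod.cong) auto

lemma weight_Suc_right: "weight k (Suc n) x = weight k n x * pmf (K (x (k + int n))) (x (k + int n + 1))"
  by (simp add: weight_def)

text \<open>Detailed balance moves the stationary factor from \<open>x (k - 1)\<close> to
  \<open>x k\<close>, so a window grows to the left by a transition that runs backwards in
  time.\<close>

lemma weight_Suc_left: "weight (k - 1) (Suc n) x = pmf (K (x k)) (x (k - 1)) * weight k n x"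
proof -
  have "weight (k - 1) (Suc n) x = pmf \<pi> (x (k - 1)) * (pmf (K (x (k - 1))) (x k) *
      (\<Prod>i<n. pmf (K (x (k + int i))) (x (k + int i + 1))))"
    unfolding weight_def prod.lessThan_Suc_shift by (simp add: algebra_simps)
  also have "\<dots> = pmf (K (x k)) (x (k - 1)) * weight k n x"
    using rev[of "x (k - 1)" "x k"] by (simp add: weight_def)
  finally show ?thesis .
qed

lemma weight_reflect: "weight k n (\<lambda>i. x (- i)) = weight (- k - int n) n x"
proof (induction n arbitrary: k)
  case 0
  then show ?case by (simp add: weight_def)
next
  case (Suc n)
  have "weight k (Suc n) (\<lambda>i. x (- i)) = weight (- k - int n) n x * pmf (K (x (- k - int n))) (x (- k - int n - 1))"
    using Suc by (simp add: weight_Suc_right)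
  also have "\<dots> = weight (- k - int n - 1) (Suc n) x"
    by (simp add: weight_Suc_left)
  finally show ?case by (simp add: algebra_simps)
qed

text \<open>The chain is run forwards and backwards from time \<open>0\<close> with independent innovations;
  reversibility lets both directions use the same kernel.\<close>

definition \<Omega> :: "(int \<times> 's \<Rightarrow> 's) measure" where
  "\<Omega> = (\<Pi>\<^sub>M (k, x)\<in>UNIV. measure_pmf (if k = 0 then \<pi> else K x))"

text \<open>Coordinate \<open>(k, y)\<close> holds the successor at time \<open>k\<close> of a chain
  that was in \<open>y\<close> one step closer to time 0; all these choices are independent and the
  chain reads only those along its path. At time 0 the second index is a dummy.\<close>

primrec fwd :: "nat \<Rightarrow> (int \<times> 's \<Rightarrow> 's) \<Rightarrow> 's" where
  "fwd 0 \<omega> = \<omega> (0, undefined)"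
| "fwd (Suc n) \<omega> = \<omega> (int (Suc n), fwd n \<omega>)"

primrec bwd :: "nat \<Rightarrow> (int \<times> 's \<Rightarrow> 's) \<Rightarrow> 's" where
  "bwd 0 \<omega> = \<omega> (0, undefined)"
| "bwd (Suc n) \<omega> = \<omega> (- int (Suc n), bwd n \<omega>)"

definition Z\<^sub>0 :: "int \<Rightarrow> (int \<times> 's \<Rightarrow> 's) \<Rightarrow> 's" where
  "Z\<^sub>0 k \<omega> = (if k \<ge> 0 then fwd (nat k) \<omega> else bwd (nat (- k)) \<omega>)"

lemma prob_space_\<Omega>: "prob_space \<Omega>"
  unfolding \<Omega>_def by (intro prob_space_PiM) (auto simp: measure_pmf.prob_space_axioms split: prod.split)

lemma sets_\<Omega>: "sets \<Omega> = sets (PiM UNIV (\<lambda>_. count_space UNIV))"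
  unfolding \<Omega>_def by (intro sets_PiM_cong) (auto split: prod.split)

lemma space_\<Omega>: "space \<Omega> = UNIV"
  using sets_eq_imp_space_eq[OF sets_\<Omega>] by (simp add: space_PiM)

lemma measurable_coordinate_random:
  assumes "f \<in> measurable \<Omega> (count_space UNIV)"
  shows "(\<lambda>\<omega>. \<omega> (k, f \<omega>)) \<in> measurable \<Omega> (count_space UNIV)"
proof (rule measurable_compose_countable[OF _ assms])
  fix i
  show "(\<lambda>\<omega>. \<omega> (k, i)) \<in> measurable \<Omega> (count_space UNIV)"
    unfolding measurable_cong_sets[OF sets_\<Omega> refl] by measurable
qed

lemma measurable_fwd: "fwd n \<in> measurable \<Omega> (count_space UNIV)"
proof (induction n)
  case 0
  have "(\<lambda>\<omega>. \<omega> (0, undefined)) \<in> measurable \<Omega> (count_space UNIV)"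
    unfolding measurable_cong_sets[OF sets_\<Omega> refl] by measurable
  then show ?case by (simp add: fun_eq_iff[THEN iffD2])
next
  case (Suc n)
  show ?case using measurable_coordinate_random[OF Suc, of "int (Suc n)"] by simp
qed

lemma measurable_bwd: "bwd n \<in> measurable \<Omega> (count_space UNIV)"
proof (induction n)
  case 0
  have "(\<lambda>\<omega>. \<omega> (0, undefined)) \<in> measurable \<Omega> (count_space UNIV)"
    unfolding measurable_cong_sets[OF sets_\<Omega> refl] by measurable
  then show ?case by (simp add: fun_eq_iff[THEN iffD2])
next
  case (Suc n)
  show ?case using measurable_coordinate_random[OF Suc, of "- int (Suc n)"] by simp
qed

lemma measurable_Z\<^sub>0: "Z\<^sub>0 k \<in> measurable \<Omega> (count_space UNIV)"
  unfolding Z\<^sub>0_def[abs_def] using measurable_fwd[of "nat k"] measurable_bwd[of "nat (- k)"]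
  by (cases "k \<ge> 0") auto

text \<open>The state one step closer to time 0 along \<open>x\<close>: the second index of the
  coordinate that is read at time \<open>i\<close>, with \<open>undefined\<close> at time 0 as in
  \<open>fwd\<close> and \<open>bwd\<close>.\<close>

definition parent :: "(int \<Rightarrow> 's) \<Rightarrow> int \<Rightarrow> 's" where
  "parent x i = (if i = 0 then undefined else if i > 0 then x (i - 1) else x (i + 1))"

lemma Z\<^sub>0_parent: "Z\<^sub>0 i \<omega> = \<omega> (i, parent (\<lambda>i. Z\<^sub>0 i \<omega>) i)"
proof -
  consider "i = 0" | n where "i = int (Suc n)" | n where "i = - int (Suc n)"
    by (cases i rule: int_cases3) (metis One_nat_def Suc_pred)+
  then show ?thesis
  proof cases
    case 2
    then have "nat i = Suc n" "nat (i - 1) = n" "i > 0" by auto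
    then show ?thesis using 2 by (simp add: parent_def Z\<^sub>0_def del: of_nat_Suc)
  next
    case 3
    have n: "nat (- i) = Suc n" "i < 0" "nat (- (i + 1)) = n" using 3 by auto
    have "Z\<^sub>0 (i + 1) \<omega> = bwd n \<omega>"
    proof (cases n)
      case 0
      then show ?thesis using 3 by (simp add: Z\<^sub>0_def)
    next
      case (Suc m)
      then show ?thesis using 3 by (simp add: Z\<^sub>0_def nat_add_distrib)
    qed
    moreover have "Z\<^sub>0 i \<omega> = bwd (Suc n) \<omega>" using n by (simp add: Z\<^sub>0_def)
    ultimately show ?thesis using n 3 by (simp add: parent_def)
  qed (simp add: parent_def Z\<^sub>0_def)
qed

text \<open>Makes a path event a cylinder in pairwise distinct coordinates, whose probability is a
  product. Given the path, the coordinates to be read are known in advance; the converse is an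
  induction on the distance from time 0.\<close>

lemma Z\<^sub>0_eq_iff:
  assumes "m \<ge> 0" "n \<ge> 0"
  shows "(\<forall>i\<in>{- m..n}. Z\<^sub>0 i \<omega> = x i) \<longleftrightarrow> (\<forall>i\<in>{- m..n}. \<omega> (i, parent x i) = x i)"
proof
  assume *: "\<forall>i\<in>{- m..n}. Z\<^sub>0 i \<omega> = x i"
  have "parent (\<lambda>i. Z\<^sub>0 i \<omega>) i = parent x i" if "i \<in> {- m..n}" for i
  proof -
    have "i > 0 \<Longrightarrow> i - 1 \<in> {- m..n}" "i < 0 \<Longrightarrow> i + 1 \<in> {- m..n}" using that assms by auto
    then show ?thesis using * by (auto simp: parent_def)
  qed
  then show "\<forall>i\<in>{- m..n}. \<omega> (i, parent x i) = x i"
    using * Z\<^sub>0_parent[of _ \<omega>] by metis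
next
  assume *: "\<forall>i\<in>{- m..n}. \<omega> (i, parent x i) = x i"
  have "i \<in> {- m..n} \<longrightarrow> Z\<^sub>0 i \<omega> = x i" for i
  proof (induction "nat \<bar>i\<bar>" arbitrary: i rule: less_induct)
    case less
    show ?case
    proof
      assume i: "i \<in> {- m..n}"
      have "i > 0 \<Longrightarrow> i - 1 \<in> {- m..n}" "i < 0 \<Longrightarrow> i + 1 \<in> {- m..n}" using i assms by auto
      then have "parent (\<lambda>i. Z\<^sub>0 i \<omega>) i = parent x i"
        using less[of "i - 1"] less[of "i + 1"] by (auto simp: parent_def)
      then show "Z\<^sub>0 i \<omega> = x i" using * i Z\<^sub>0_parent[of i \<omega>] by metis
    qed
  qed
  then show "\<forall>i\<in>{- m..n}. Z\<^sub>0 i \<omega> = x i" by blast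
qed

lemma weight_split:
  "weight (- int m) (m + n) x = (\<Prod>i\<in>{- int m..int n}. pmf (if i = 0 then \<pi> else K (parent x i)) (x i))"
proof -
  have 1: "weight 0 n x = (\<Prod>i\<in>{0..int n}. pmf (if i = 0 then \<pi> else K (parent x i)) (x i))"
  proof (induction n)
    case (Suc n)
    have "{0..int (Suc n)} = insert (int (Suc n)) {0..int n}" by auto
    then show ?case using Suc by (simp add: weight_Suc_right parent_def algebra_simps)
  qed (simp add: weight_def)
  show ?thesis
  proof (induction m)
    case (Suc m)
    have e: "- int (Suc m) = - int m - 1" by simp
    have "{- int m - 1..int n} = insert (- int m - 1) {- int m..int n}" by auto
    moreover have "parent x (- int m - 1) = x (- int m)" by (simp add: parent_def)
    ultimately show ?case unfolding e add_Suc weight_Suc_left using Suc by simp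
  qed (simp add: 1)
qed

lemma prob_path_around_0:
  "measure \<Omega> {\<omega>\<in>space \<Omega>. \<forall>i\<in>{- int m..int n}. Z\<^sub>0 i \<omega> = x i} = weight (- int m) (m + n) x"
proof -
  let ?J = "(\<lambda>i. (i, parent x i)) ` {- int m..int n}"
  let ?N = "\<lambda>(k, y). measure_pmf (if k = 0 then \<pi> else K y)"
  have "{\<omega>\<in>space \<Omega>. \<forall>i\<in>{- int m..int n}. Z\<^sub>0 i \<omega> = x i}
     = prod_emb UNIV ?N ?J (\<Pi>\<^sub>E j\<in>?J. {x (fst j)})"
    by (subst Z\<^sub>0_eq_iff) (auto simp: space_\<Omega> prod_emb_def space_PiM PiE_iff extensional_def restrict_def)
  then have "emeasure \<Omega> {\<omega>\<in>space \<Omega>. \<forall>i\<in>{- int m..int n}. Z\<^sub>0 i \<omega> = x i}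
     = (\<Prod>j\<in>?J. emeasure (?N j) {x (fst j)})"
    unfolding \<Omega>_def
    by (simp only:, intro emeasure_PiM_emb) (auto simp: measure_pmf.prob_space_axioms)
  also have "\<dots> = (\<Prod>i\<in>{- int m..int n}. ennreal (pmf (if i = 0 then \<pi> else K (parent x i)) (x i)))"
    by (subst prod.reindex) (auto simp: inj_on_def emeasure_pmf_single intro!: prod.cong)
  also have "\<dots> = ennreal (weight (- int m) (m + n) x)"
    unfolding weight_split by (rule prod_ennreal) simp
  finally show ?thesis
    by (simp add: measure_def weight_def prod_nonneg)
qed

lemma prob_path_split:
  "ennreal (measure \<Omega> {\<omega>\<in>space \<Omega>. \<forall>i\<in>I. Z\<^sub>0 i \<omega> = x i})
   = (\<integral>\<^sup>+y. ennreal (measure \<Omega> {\<omega>\<in>space \<Omega>. \<forall>i\<in>insert j I. Z\<^sub>0 i \<omega> = (x(j := y)) i}) \<partial>count_space UNIV)"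
  if "finite I" "j \<notin> I"
proof -
  interpret prob_space \<Omega> by (rule prob_space_\<Omega>)
  note [measurable] = measurable_Z\<^sub>0
  let ?A = "\<lambda>y. {\<omega>\<in>space \<Omega>. \<forall>i\<in>insert j I. Z\<^sub>0 i \<omega> = (x(j := y)) i}"
  have "{\<omega>\<in>space \<Omega>. \<forall>i\<in>I. Z\<^sub>0 i \<omega> = x i} = (\<Union>y. ?A y)"
    using that by auto
  moreover have "emeasure \<Omega> (\<Union>y. ?A y) = (\<integral>\<^sup>+y. emeasure \<Omega> (?A y) \<partial>count_space UNIV)"
  proof (rule emeasure_UN_countable)
    show "?A y \<in> sets \<Omega>" for y using that(1) by measurable
    show "disjoint_family_on ?A UNIV" by (auto simp: disjoint_family_on_def)
  qed simp
  ultimately show ?thesis by (simp add: emeasure_eq_measure)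
qed

lemma weight_upd: "j < k \<or> j > k + int n \<Longrightarrow> weight k n (x(j := y)) = weight k n x"
  by (intro weight_cong) auto

text \<open>Windows around 0 are known. Summing out the last state shrinks a window from the right
  (\<open>R\<close>), summing out the first one shrinks it from the left (\<open>Lf\<close>, through
  detailed balance); in this way windows that miss 0 are reached from those that contain it.\<close>

lemma prob_path:
  "measure \<Omega> {\<omega>\<in>space \<Omega>. \<forall>i\<in>{k..k + int n}. Z\<^sub>0 i \<omega> = x i} = weight k n x"
proof -
  define Q where "Q k n \<longleftrightarrow> (\<forall>x. measure \<Omega> {\<omega>\<in>space \<Omega>. \<forall>i\<in>{k..k + int n}. Z\<^sub>0 i \<omega> = x i} = weight k n x)"
    for k n
  have R: "Q k n" if Q: "Q k (Suc n)" for k n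
    unfolding Q_def
  proof
    fix x
    have "insert (k + int n + 1) {k..k + int n} = {k..k + int (Suc n)}" by auto
    then have "ennreal (measure \<Omega> {\<omega>\<in>space \<Omega>. \<forall>i\<in>{k..k + int n}. Z\<^sub>0 i \<omega> = x i})
      = (\<integral>\<^sup>+y. ennreal (weight k (Suc n) (x(k + int n + 1 := y))) \<partial>count_space UNIV)"
      using Q by (subst prob_path_split[of _ "k + int n + 1"]) (simp_all only: Q_def, simp_all)
    also have "\<dots> = (\<integral>\<^sup>+y. ennreal (weight k n x) * ennreal (pmf (K (x (k + int n))) y) \<partial>count_space UNIV)"
      by (intro nn_integral_cong) (simp add: weight_Suc_right weight_upd ennreal_mult' weight_nonneg)
    also have "\<dots> = ennreal (weight k n x)"
      by (simp add: nn_integral_cmult nn_integral_pmf)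
    finally show "measure \<Omega> {\<omega>\<in>space \<Omega>. \<forall>i\<in>{k..k + int n}. Z\<^sub>0 i \<omega> = x i} = weight k n x"
      by (simp add: weight_def prod_nonneg)
  qed
  have Lf: "Q k n" if Q: "Q (k - 1) (Suc n)" for k n
    unfolding Q_def
  proof
    fix x
    have "insert (k - 1) {k..k + int n} = {k - 1..k - 1 + int (Suc n)}" by auto
    then have "ennreal (measure \<Omega> {\<omega>\<in>space \<Omega>. \<forall>i\<in>{k..k + int n}. Z\<^sub>0 i \<omega> = x i})
      = (\<integral>\<^sup>+y. ennreal (weight (k - 1) (Suc n) (x(k - 1 := y))) \<partial>count_space UNIV)"
      using Q by (subst prob_path_split[of _ "k - 1"]) (simp_all only: Q_def, simp_all)
    also have "\<dots> = (\<integral>\<^sup>+y. ennreal (weight k n x) * ennreal (pmf (K (x k)) y) \<partial>count_space UNIV)"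
      by (intro nn_integral_cong) (simp add: weight_Suc_left weight_upd ennreal_mult'[symmetric] weight_nonneg mult.commute)
    also have "\<dots> = ennreal (weight k n x)"
      by (simp add: nn_integral_cmult nn_integral_pmf)
    finally show "measure \<Omega> {\<omega>\<in>space \<Omega>. \<forall>i\<in>{k..k + int n}. Z\<^sub>0 i \<omega> = x i} = weight k n x"
      by (simp add: weight_def prod_nonneg)
  qed
  have around_0: "Q (- int m) (m + n)" for m n
    unfolding Q_def using prob_path_around_0[of m n] by (simp add: algebra_simps)
  have "Q k n"
  proof (cases "k \<ge> 0")
    case True
    then obtain j where j: "k = int j" using nonneg_int_cases by blast
    have "Q (int j) n" for n
    proof (induction j arbitrary: n)
      case 0
      show ?case using around_0[of 0 n] by simp
    next
      case (Suc j)
      show ?case using Lf[of "int (Suc j)" n] Suc[of "Suc n"] by simp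
    qed
    then show ?thesis by (simp add: j)
  next
    case False
    then obtain m where m: "k = - int m" using int_cases4 by (metis nonneg_int_cases not_le neg_0_le_iff_le minus_minus nle_le)
    have "Q (- int m) (n + i) \<Longrightarrow> Q (- int m) n" for i
      by (induction i) (auto intro: R)
    then show ?thesis using around_0[of m n] by (simp add: m add.commute)
  qed
  then show ?thesis by (simp add: Q_def)
qed

end

section \<open>Iterated kernels and concatenation of paths\<close>

context reversible_kernel
begin

definition Kn :: "nat \<Rightarrow> 's \<Rightarrow> 's pmf" where
  "Kn n x = map_pmf (\<lambda>ys. last (x # ys)) (paths n x)"

lemma Kn_0 [simp]: "Kn 0 x = return_pmf x"
  by (simp add: Kn_def)

lemma Kn_Suc: "Kn (Suc n) x = bind_pmf (K x) (Kn n)"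
  unfolding Kn_def by (simp add: map_bind_pmf map_pmf_comp cong: map_pmf_cong)

lemma Kn_Suc': "Kn (Suc n) x = bind_pmf (Kn n x) K"
proof (induction n arbitrary: x)
  case 0
  have "K x \<bind> Kn 0 = K x" by (metis (no_types, lifting) Kn_0 bind_pmf_cong bind_return_pmf')
  then show ?case by (simp add: Kn_Suc[of 0] bind_return_pmf)
next
  case (Suc n)
  have "Kn (Suc (Suc n)) x = bind_pmf (K x) (\<lambda>y. bind_pmf (Kn n y) K)"
    using Suc by (subst Kn_Suc) (simp cong: bind_pmf_cong)
  also have "\<dots> = bind_pmf (Kn (Suc n) x) K"
    by (simp add: Kn_Suc bind_assoc_pmf)
  finally show ?case .
qed

text \<open>The induction splits off the first step on one side and the last step on the other,
  hence both \<open>Kn_Suc\<close> and \<open>Kn_Suc'\<close>.\<close>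

lemma rev_Kn: "pmf \<pi> x * pmf (Kn n x) y = pmf \<pi> y * pmf (Kn n y) x"
proof (induction n arbitrary: x y)
  case 0
  show ?case by (cases "x = y") auto
next
  case (Suc n)
  have "ennreal (pmf \<pi> x) * ennreal (pmf (Kn (Suc n) x) y)
      = (\<integral>\<^sup>+z. ennreal (pmf \<pi> x) * (ennreal (pmf (K x) z) * ennreal (pmf (Kn n z) y)) \<partial>count_space UNIV)"
    by (simp add: Kn_Suc ennreal_pmf_bind nn_integral_measure_pmf nn_integral_cmult)
  also have "\<dots> = (\<integral>\<^sup>+z. ennreal (pmf (K z) x) * (ennreal (pmf \<pi> z) * ennreal (pmf (Kn n z) y)) \<partial>count_space UNIV)"
    by (intro nn_integral_cong) (simp flip: ennreal_mult' mult.assoc, metis mult.commute rev)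
  also have "\<dots> = (\<integral>\<^sup>+z. ennreal (pmf \<pi> y) * (ennreal (pmf (Kn n y) z) * ennreal (pmf (K z) x)) \<partial>count_space UNIV)"
    by (intro nn_integral_cong) (simp flip: ennreal_mult', metis Suc mult.commute mult.left_commute)
  also have "\<dots> = ennreal (pmf \<pi> y) * ennreal (pmf (Kn (Suc n) y) x)"
    by (simp add: Kn_Suc' ennreal_pmf_bind nn_integral_measure_pmf nn_integral_cmult)
  finally show ?case by (simp flip: ennreal_mult')
qed

lemma paths_add:
  "paths (a + b) x = bind_pmf (paths a x) (\<lambda>xs. map_pmf ((@) xs) (paths b (last (x # xs))))"
proof (induction a arbitrary: x)
  case 0
  have "(@) [] = (\<lambda>x :: 's list. x)" by auto
  then show ?case by (simp add: bind_return_pmf map_pmf_ident)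
next
  case (Suc a)
  have "(@) (y # xs) = (\<lambda>ys. y # xs @ ys)" for y :: 's and xs by auto
  then show ?case
    by (simp add: Suc map_bind_pmf bind_map_pmf bind_assoc_pmf map_pmf_comp)
qed

lemma law_add:
  "law (a + b) = bind_pmf (law a) (\<lambda>xs. map_pmf ((@) xs) (paths b (last xs)))"
proof -
  have "(@) (y # xs) = (\<lambda>ys. y # xs @ ys)" for y :: 's and xs by auto
  then show ?thesis
    unfolding law_def by (simp add: paths_add map_bind_pmf bind_map_pmf bind_assoc_pmf map_pmf_comp)
qed

lemma map_last_law: "map_pmf last (law n) = \<pi>"
proof -
  have "map_pmf last (law n) = bind_pmf \<pi> (Kn n)"
    unfolding law_def Kn_def by (simp add: map_bind_pmf map_pmf_comp)
  also have "\<dots> = \<pi>"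
  proof (induction n)
    case 0
    show ?case by (simp add: bind_return_pmf' cong: bind_pmf_cong)
  next
    case (Suc n)
    have "bind_pmf \<pi> (Kn (Suc n)) = bind_pmf (bind_pmf \<pi> (Kn n)) K"
      by (simp add: Kn_Suc' bind_assoc_pmf cong: bind_pmf_cong)
    then show ?case using Suc bind_stationary by simp
  qed
  finally show ?thesis .
qed

text \<open>A Feynman-Kac formula: a product over the visited states is evaluated by iterating the
  kernel weighted by \<open>F\<close>.\<close>

lemma expectation_paths_prod:
  fixes F :: "'s \<Rightarrow> complex"
  assumes F: "\<And>x. norm (F x) \<le> 1"
  shows "measure_pmf.expectation (paths n x) (\<lambda>ys. prod_list (map F ys))
       = ((\<lambda>u x. measure_pmf.expectation (K x) (\<lambda>y. F y * u y)) ^^ n) (\<lambda>_. 1) x"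
proof (induction n arbitrary: x)
  case (Suc n)
  have b: "norm (prod_list (map F ys)) \<le> 1" for ys
    by (induction ys) (auto simp: norm_mult intro!: mult_le_one F)
  show ?case
    using b by (simp add: integral_bind_pmf_complex[where B=1] Suc)
qed simp

end

text \<open>Only the finite-dimensional laws are prescribed, so shifts and time reversals of
  \<open>Z\<close> are again instances; stationarity and reversibility then amount to uniqueness of
  the law.\<close>

locale chain_process = prob_space M + reversible_kernel \<pi> K
  for M :: "'a measure" and \<pi> :: "'s :: countable pmf" and K +
  fixes Z :: "int \<Rightarrow> 'a \<Rightarrow> 's"
  assumes measurable_Z [measurable]: "Z k \<in> measurable M (count_space UNIV)"
    and path: "prob {\<omega>\<in>space M. \<forall>i\<in>{k..k + int n}. Z i \<omega> = x i} = weight k n x"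
begin

definition V :: "int \<Rightarrow> nat \<Rightarrow> 'a \<Rightarrow> 's list" where
  "V k n \<omega> = map (\<lambda>i. Z (k + int i) \<omega>) [0..<Suc n]"

lemma measurable_V [measurable]: "V k n \<in> measurable M (count_space UNIV)"
proof (rule measurable_count_space_eq_countable[THEN iffD2], simp, intro conjI ballI)
  fix xs :: "'s list"
  have "V k n -` {xs} \<inter> space M = {\<omega>\<in>space M. length xs = Suc n \<and> (\<forall>i<Suc n. Z (k + int i) \<omega> = xs ! i)}"
    by (auto simp: V_def list_eq_iff_nth_eq simp del: upt_Suc)
  also have "\<dots> \<in> sets M" by measurable
  finally show "V k n -` {xs} \<inter> space M \<in> sets M" .
qed auto

lemma length_V [simp]: "length (V k n \<omega>) = Suc n"
  by (simp add: V_def)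

lemma nth_V: "i \<le> n \<Longrightarrow> V k n \<omega> ! i = Z (k + int i) \<omega>"
  unfolding V_def by (subst nth_map) (auto simp del: upt_Suc)

lemma V_eq_iff:
  assumes "length xs = Suc n"
  shows "V k n \<omega> = xs \<longleftrightarrow> (\<forall>i\<in>{k..k + int n}. Z i \<omega> = xs ! nat (i - k))"
proof -
  have "V k n \<omega> = xs \<longleftrightarrow> (\<forall>i\<le>n. Z (k + int i) \<omega> = xs ! i)"
    using assms by (auto simp: list_eq_iff_nth_eq nth_V less_Suc_eq_le)
  also have "\<dots> \<longleftrightarrow> (\<forall>i\<in>{k..k + int n}. Z i \<omega> = xs ! nat (i - k))"
  proof safe
    fix i assume *: "\<forall>i\<le>n. Z (k + int i) \<omega> = xs ! i" and i: "i \<in> {k..k + int n}"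
    then show "Z i \<omega> = xs ! nat (i - k)" using *[rule_format, of "nat (i - k)"] by auto
  next
    fix i assume *: "\<forall>i\<in>{k..k + int n}. Z i \<omega> = xs ! nat (i - k)" and i: "i \<le> n"
    then show "Z (k + int i) \<omega> = xs ! i" using *[rule_format, of "k + int i"] by auto
  qed
  finally show ?thesis .
qed

lemma distr_V: "distr M (count_space UNIV) (V k n) = measure_pmf (law n)"
proof (rule measure_eqI_countable[where A=UNIV])
  fix xs :: "'s list"
  show "emeasure (distr M (count_space UNIV) (V k n)) {xs} = emeasure (measure_pmf (law n)) {xs}"
  proof (cases "length xs = Suc n")
    case True
    have "emeasure (distr M (count_space UNIV) (V k n)) {xs}
        = ennreal (prob {\<omega>\<in>space M. \<forall>i\<in>{k..k + int n}. Z i \<omega> = xs ! nat (i - k)})"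
    proof -
      have "V k n -` {xs} \<inter> space M = {\<omega>\<in>space M. \<forall>i\<in>{k..k + int n}. Z i \<omega> = xs ! nat (i - k)}"
        using V_eq_iff[OF True, of k] by auto
      then show ?thesis by (simp add: emeasure_distr emeasure_eq_measure)
    qed
    also have "\<dots> = ennreal (pmf (law n) xs)"
      by (subst path, subst pmf_law[of n xs "\<lambda>i. xs ! nat (i - k)" k]) (auto simp: True)
    finally show ?thesis by (simp add: emeasure_pmf_single)
  next
    case False
    then have "V k n -` {xs} = {}" using length_V[of k n] by auto
    moreover have "pmf (law n) xs = 0"
      using False length_law by (meson pmf_eq_0_set_pmf)
    ultimately show ?thesis by (simp add: emeasure_distr emeasure_pmf_single)
  qed
qed auto

lemma emeasure_V: "emeasure M {\<omega>\<in>space M. V k n \<omega> \<in> C} = emeasure (measure_pmf (law n)) C"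
  unfolding distr_V[of k n, symmetric]
  by (subst emeasure_distr) (auto intro!: arg_cong[where f="emeasure M"])

lemma expectation_V:
  fixes f :: "'s list \<Rightarrow> 'b :: {banach, second_countable_topology}"
  shows "expectation (\<lambda>\<omega>. f (V k n \<omega>)) = measure_pmf.expectation (law n) f"
  unfolding distr_V[of k n, symmetric] by (subst integral_distr) auto

lemma distr_Z: "distr M (count_space UNIV) (Z k) = measure_pmf \<pi>"
proof -
  have "Z k = (\<lambda>\<omega>. last (V k 0 \<omega>))" by (simp add: V_def)
  then have "distr M (count_space UNIV) (Z k) = distr (distr M (count_space UNIV) (V k 0)) (count_space UNIV) last"
    by (subst distr_distr) (auto simp: comp_def)
  then show ?thesis unfolding distr_V by (simp add: map_last_law flip: map_pmf_rep_eq)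
qed

lemma prob_Z: "prob {\<omega>\<in>space M. Z k \<omega> \<in> C} = measure (measure_pmf \<pi>) C"
  unfolding distr_Z[of k, symmetric]
  by (subst measure_distr) (auto intro!: arg_cong[where f="measure M"])

lemma expectation_Z:
  fixes f :: "'s \<Rightarrow> 'b :: {banach, second_countable_topology}"
  shows "expectation (\<lambda>\<omega>. f (Z k \<omega>)) = measure_pmf.expectation \<pi> f"
  unfolding distr_Z[of k, symmetric] by (subst integral_distr) auto

lemma integrable_Z:
  fixes f :: "'s \<Rightarrow> 'b :: {banach, second_countable_topology}"
  shows "integrable M (\<lambda>\<omega>. f (Z k \<omega>)) \<longleftrightarrow> integrable (measure_pmf \<pi>) f"
  unfolding distr_Z[of k, symmetric] by (subst integrable_distr_eq) auto

lemma expectation_Z_Z: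
  fixes f g :: "'s \<Rightarrow> real"
  assumes f: "\<And>x. \<bar>f x\<bar> \<le> B" and g: "\<And>x. \<bar>g x\<bar> \<le> C"
  shows "expectation (\<lambda>\<omega>. f (Z k \<omega>) * g (Z (k + int n) \<omega>))
       = measure_pmf.expectation \<pi> (\<lambda>x. f x * measure_pmf.expectation (Kn n x) g)"
proof -
  have B: "B \<ge> 0" "C \<ge> 0" using f[of undefined] g[of undefined] by auto
  have V: "hd (V k n \<omega>) = Z k \<omega>" "last (V k n \<omega>) = Z (k + int n) \<omega>" for \<omega>
    using nth_V[of 0 n k \<omega>] nth_V[of n n k \<omega>]
    by (simp_all add: hd_conv_nth last_conv_nth flip: length_0_conv)
  have "expectation (\<lambda>\<omega>. f (Z k \<omega>) * g (Z (k + int n) \<omega>))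
     = measure_pmf.expectation (law n) (\<lambda>xs. f (hd xs) * g (last xs))"
    unfolding expectation_V[of _ k n, symmetric] V ..
  also have "\<dots> = measure_pmf.expectation \<pi> (\<lambda>x. measure_pmf.expectation (paths n x) (\<lambda>ys. f x * g (last (x # ys))))"
    unfolding law_def using B
    by (subst integral_bind_pmf_real[where B="B * C"]) (auto simp: abs_mult intro!: mult_mono f g)
  also have "\<dots> = measure_pmf.expectation \<pi> (\<lambda>x. f x * measure_pmf.expectation (Kn n x) g)"
    by (simp add: Kn_def)
  finally show ?thesis .
qed

lemma expectation_prod:
  fixes F :: "'s \<Rightarrow> complex"
  assumes F: "\<And>x. norm (F x) \<le> 1"
  shows "expectation (\<lambda>\<omega>. \<Prod>i=1..n. F (Z (int i) \<omega>))
    = measure_pmf.expectation \<pi> (((\<lambda>u x. measure_pmf.expectation (K x) (\<lambda>y. F y * u y)) ^^ n) (\<lambda>_. 1))"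
proof -
  have b: "norm (prod_list (map F ys)) \<le> 1" for ys
    by (induction ys) (auto simp: norm_mult intro!: mult_le_one F)
  have "(\<Prod>i=1..n. F (Z (int i) \<omega>)) = prod_list (map F (tl (V 0 n \<omega>)))" for \<omega>
  proof -
    have "tl (V 0 n \<omega>) = map (\<lambda>i. Z (int i) \<omega>) [1..<Suc n]"
      unfolding V_def by (simp del: upt_Suc flip: map_tl)
    moreover have "prod_list (map G [1..<Suc n]) = (\<Prod>i=1..n. G i)" for G :: "nat \<Rightarrow> complex"
      by (subst prod.distinct_set_conv_list[symmetric])
        (simp_all only: distinct_upt set_upt atLeastLessThanSuc_atLeastAtMost)
    ultimately show ?thesis by (simp add: comp_def del: upt_Suc)
  qed
  then have "expectation (\<lambda>\<omega>. \<Prod>i=1..n. F (Z (int i) \<omega>))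
     = measure_pmf.expectation (law n) (\<lambda>xs. prod_list (map F (tl xs)))"
    using expectation_V[of "\<lambda>xs. prod_list (map F (tl xs))" 0 n] by presburger
  also have "\<dots> = measure_pmf.expectation \<pi> (\<lambda>x. measure_pmf.expectation (paths n x) (\<lambda>ys. prod_list (map F ys)))"
    unfolding law_def by (subst integral_bind_pmf_complex[where B=1]) (auto simp: b)
  finally show ?thesis by (simp add: expectation_paths_prod[OF F] fun_eq_iff[THEN iffD2])
qed

lemma chain_process_shift: "chain_process M \<pi> K (\<lambda>k. Z (k + j))"
proof
  fix k n and x :: "int \<Rightarrow> 's"
  have "(\<forall>i\<in>{k..k + int n}. Z (i + j) \<omega> = x i) \<longleftrightarrow> (\<forall>i\<in>{k + j..k + j + int n}. Z i \<omega> = x (i - j))" for \<omega>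
  proof safe
    fix i assume *: "\<forall>i\<in>{k..k + int n}. Z (i + j) \<omega> = x i" and i: "i \<in> {k + j..k + j + int n}"
    then show "Z i \<omega> = x (i - j)" using *[rule_format, of "i - j"] by auto
  next
    fix i assume *: "\<forall>i\<in>{k + j..k + j + int n}. Z i \<omega> = x (i - j)" and i: "i \<in> {k..k + int n}"
    then show "Z (i + j) \<omega> = x i" using *[rule_format, of "i + j"] by auto
  qed
  then show "prob {\<omega>\<in>space M. \<forall>i\<in>{k..k + int n}. Z (i + j) \<omega> = x i} = weight k n x"
    using path[of "k + j" n "\<lambda>i. x (i - j)"] by (simp add: weight_def algebra_simps)
qed simp

lemma chain_process_reflect: "chain_process M \<pi> K (\<lambda>k. Z (- k))"
proof
  fix k n and x :: "int \<Rightarrow> 's"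
  have "(\<forall>i\<in>{k..k + int n}. Z (- i) \<omega> = x i)
     \<longleftrightarrow> (\<forall>i\<in>{- k - int n..- k - int n + int n}. Z i \<omega> = x (- i))" for \<omega>
  proof safe
    fix i assume *: "\<forall>i\<in>{k..k + int n}. Z (- i) \<omega> = x i" and i: "i \<in> {- k - int n..- k - int n + int n}"
    then show "Z i \<omega> = x (- i)" using *[rule_format, of "- i"] by auto
  next
    fix i assume *: "\<forall>i\<in>{- k - int n..- k - int n + int n}. Z i \<omega> = x (- i)" and i: "i \<in> {k..k + int n}"
    then show "Z (- i) \<omega> = x i" using *[rule_format, of "- i"] by auto
  qed
  then show "prob {\<omega>\<in>space M. \<forall>i\<in>{k..k + int n}. Z (- i) \<omega> = x i} = weight k n x"
    using path[of "- k - int n" n "\<lambda>i. x (- i)"] weight_reflect[of "- k - int n" n x]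
    by (simp add: algebra_simps)
qed simp

lemma measurable_values:
  "(\<lambda>\<omega> k. v (Z k \<omega>)) \<in> measurable M (\<Pi>\<^sub>M k\<in>UNIV. borel)" for v :: "'s \<Rightarrow> real"
  by (rule measurable_PiM_single') (auto intro: measurable_compose[OF measurable_Z])

text \<open>Cylinders determine the law on the product space, and every finite index set lies in an
  interval, on which any instance of the locale is distributed as \<open>law n\<close>.\<close>

lemma process_distr_eq:
  fixes v :: "'s \<Rightarrow> real"
  assumes "chain_process M \<pi> K Z'"
  shows "distr M (\<Pi>\<^sub>M k\<in>UNIV. borel) (\<lambda>\<omega> k. v (Z' k \<omega>)) = distr M (\<Pi>\<^sub>M k\<in>UNIV. borel) (\<lambda>\<omega> k. v (Z k \<omega>))"
proof (rule measure_eqI_PiM_infinite)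
  interpret Z': chain_process M \<pi> K Z' by fact
  fix A :: "int \<Rightarrow> real set" and J assume J: "finite J" "J \<subseteq> UNIV" and A: "\<And>i. i \<in> J \<Longrightarrow> A i \<in> sets borel"
  obtain k n where kn: "J \<subseteq> {k..k + int n}"
  proof (cases "J = {}")
    case False
    have "J \<subseteq> {Min J..Min J + int (nat (Max J - Min J))}"
      using J(1) False by (auto simp: Min_le Max_ge)
    then show ?thesis by (rule that)
  qed (use that in auto)
  define C where "C = {xs. \<forall>i\<in>J. v (xs ! nat (i - k)) \<in> A i}"
  have eq: "emeasure (distr M (\<Pi>\<^sub>M k\<in>UNIV. borel) (\<lambda>\<omega> k. v (Y k \<omega>))) (prod_emb UNIV (\<lambda>_. borel) J (Pi\<^sub>E J A))
     = emeasure (measure_pmf (law n)) C" if Y: "chain_process M \<pi> K Y" for Y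
  proof -
    interpret Y: chain_process M \<pi> K Y by fact
    have "(\<lambda>\<omega> k. v (Y k \<omega>)) -` prod_emb UNIV (\<lambda>_. borel) J (Pi\<^sub>E J A) \<inter> space M
       = {\<omega>\<in>space M. Y.V k n \<omega> \<in> C}"
    proof -
      have "Y.V k n \<omega> ! nat (i - k) = Y i \<omega>" if "i \<in> J" for i \<omega>
      proof -
        have "i \<in> {k..k + int n}" using that kn by auto
        then show ?thesis using Y.nth_V[of "nat (i - k)" n k \<omega>] by auto
      qed
      then show ?thesis
        by (auto simp: prod_emb_def C_def PiE_iff space_PiM extensional_def)
    qed
    then show ?thesis
      using Y.measurable_values J A
      by (subst emeasure_distr) (auto simp: Y.emeasure_V intro!: sets_PiM_I)
  qed
  show "emeasure (distr M (\<Pi>\<^sub>M k\<in>UNIV. borel) (\<lambda>\<omega> k. v (Z' k \<omega>))) (prod_emb UNIV (\<lambda>_. borel) J (Pi\<^sub>E J A))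
     = emeasure (distr M (\<Pi>\<^sub>M k\<in>UNIV. borel) (\<lambda>\<omega> k. v (Z k \<omega>))) (prod_emb UNIV (\<lambda>_. borel) J (Pi\<^sub>E J A))"
    using eq[OF assms] eq[OF chain_process_axioms] by simp
next
  interpret Z': chain_process M \<pi> K Z' by fact
  interpret P: prob_space "distr M (\<Pi>\<^sub>M k\<in>UNIV. borel) (\<lambda>\<omega> k. v (Z' k \<omega>))"
    by (rule prob_space_distr[OF Z'.measurable_values])
  show "finite_measure (distr M (\<Pi>\<^sub>M k\<in>UNIV. borel) (\<lambda>\<omega> k. v (Z' k \<omega>)))"
    by (rule P.finite_measure_axioms)
qed auto

lemma strictly_stationary_values: "strictly_stationary M (\<lambda>k \<omega>. v (Z k \<omega>))"
  unfolding strictly_stationary_def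
  using process_distr_eq[OF chain_process_shift] by (auto intro: measurable_compose[OF measurable_Z])

lemma reversible_values: "reversible M (\<lambda>k \<omega>. v (Z k \<omega>))"
  unfolding reversible_def using process_distr_eq[OF chain_process_reflect] by blast

lemma prob_Z_single: "prob {\<omega>\<in>space M. Z k \<omega> = x} = pmf \<pi> x"
  using prob_Z[of k "{x}"] by (simp add: measure_pmf_single)

lemma prob_Z_Z_single:
  "prob {\<omega>\<in>space M. Z k \<omega> = x \<and> Z (k + 1) \<omega> = y} = pmf \<pi> x * pmf (K x) y"
proof -
  have "{k..k + 1} = {k, k + 1}" by auto
  then show ?thesis
    using path[of k 1 "\<lambda>i. if i = k then x else y"] by (simp add: weight_def)
qed

lemma countable_markov_chain_values:
  fixes v :: "'s \<Rightarrow> real"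
  assumes v: "inj v" and full: "set_pmf \<pi> = UNIV"
  shows "countable_markov_chain M (\<lambda>k \<omega>. v (Z k \<omega>)) (range v)"
  unfolding countable_markov_chain_def
proof (intro conjI allI impI ballI)
  show "(\<lambda>\<omega>. v (Z k \<omega>)) \<in> borel_measurable M" for k by measurable
  have pos: "pmf \<pi> x > 0" for x using full by (simp add: pmf_positive)
  show "0 < \<P>(\<omega> in M. v (Z k \<omega>) = s)" if "s \<in> range v" for k s
    using that v pos by (auto simp: inj_eq prob_Z_single)
  fix k :: int and m :: nat and s :: "nat \<Rightarrow> real" and j :: real
  assume P: "0 < \<P>(\<omega> in M. \<forall>l\<le>m. v (Z (k - int l) \<omega>) = s l)"
  obtain \<omega>0 where \<omega>0: "\<forall>l\<le>m. v (Z (k - int l) \<omega>0) = s l"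
    using P by (metis (mono_tags, lifting) Collect_empty_eq measure_empty order_less_irrefl)
  \<comment> \<open>The past comes from an actual trajectory, so every \<open>s l\<close> has a
    preimage under \<open>v\<close> at hand; only the value at time \<open>k + 1\<close> is
    prescribed.\<close>
  define x where "x i = (if i = k + 1 then inv v j else Z i \<omega>0)" for i
  have past: "(\<forall>l\<le>m. v (Z (k - int l) \<omega>) = s l) \<longleftrightarrow> (\<forall>i\<in>{k - int m..k - int m + int m}. Z i \<omega> = x i)" for \<omega>
  proof safe
    fix i assume *: "\<forall>l\<le>m. v (Z (k - int l) \<omega>) = s l" and i: "i \<in> {k - int m..k - int m + int m}"
    then have "nat (k - i) \<le> m" "k - int (nat (k - i)) = i" by auto
    then have "v (Z i \<omega>) = v (Z i \<omega>0)" using * \<omega>0 by metis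
    then show "Z i \<omega> = x i" using v i by (auto simp: x_def inj_eq)
  next
    fix l assume *: "\<forall>i\<in>{k - int m..k - int m + int m}. Z i \<omega> = x i" and l: "l \<le> m"
    then show "v (Z (k - int l) \<omega>) = s l" using *[rule_format, of "k - int l"] \<omega>0 by (auto simp: x_def)
  qed
  have s0: "v (Z k \<omega>) = s 0 \<longleftrightarrow> Z k \<omega> = x k" for \<omega>
    using \<omega>0[rule_format, of 0] inj_eq[OF v, of "Z k \<omega>" "Z k \<omega>0"] by (auto simp: x_def)
  show "\<P>(\<omega> in M. v (Z (k + 1) \<omega>) = j \<bar> \<forall>l\<le>m. v (Z (k - int l) \<omega>) = s l)
      = \<P>(\<omega> in M. v (Z (k + 1) \<omega>) = j \<bar> v (Z k \<omega>) = s 0)"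
  proof (cases "j \<in> range v")
    case False
    then have "v (Z (k + 1) \<omega>) \<noteq> j" for \<omega> by auto
    then show ?thesis by (simp add: cond_prob_def)
  next
    case True
    then have j: "v (Z (k + 1) \<omega>) = j \<longleftrightarrow> Z (k + 1) \<omega> = x (k + 1)" for \<omega>
      using v by (auto simp: x_def inv_f_f dest: injD)
    have W: "weight (k - int m) m x > 0"
      using P unfolding past path .
    have "(v (Z (k + 1) \<omega>) = j \<and> (\<forall>l\<le>m. v (Z (k - int l) \<omega>) = s l))
       \<longleftrightarrow> (\<forall>i\<in>{k - int m..k - int m + int (Suc m)}. Z i \<omega> = x i)" for \<omega>
    proof -
      have "{k - int m..k - int m + int (Suc m)} = insert (k + 1) {k - int m..k - int m + int m}" by auto
      then show ?thesis unfolding past j by auto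
    qed
    then have "\<P>(\<omega> in M. v (Z (k + 1) \<omega>) = j \<bar> \<forall>l\<le>m. v (Z (k - int l) \<omega>) = s l)
      = weight (k - int m) (Suc m) x / weight (k - int m) m x"
      unfolding cond_prob_def by (simp only: past path)
    also have "\<dots> = pmf (K (x k)) (x (k + 1))"
      using W by (simp add: weight_Suc_right)
    also have "\<dots> = \<P>(\<omega> in M. v (Z (k + 1) \<omega>) = j \<bar> v (Z k \<omega>) = s 0)"
      unfolding cond_prob_def s0 j using pos[of "x k"]
      by (simp add: prob_Z_single prob_Z_Z_single conj_commute)
    finally show ?thesis .
  qed
qed auto

lemma one_step_values:
  assumes v: "inj v" and full: "set_pmf \<pi> = UNIV" and K: "\<And>x y. pmf (K x) y > 0"
  shows "\<P>(\<omega> in M. v (Z (int 1) \<omega>) = v y \<bar> v (Z 0 \<omega>) = v x) > 0"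
proof -
  have "pmf \<pi> x > 0" using full by (simp add: pmf_positive)
  then show ?thesis
    using v K[of x y] prob_Z_Z_single[of 0 x y]
    by (simp add: cond_prob_def inj_eq prob_Z_single conj_commute)
qed

lemma irreducible_values:
  assumes "inj v" and "set_pmf \<pi> = UNIV" and "\<And>x y. pmf (K x) y > 0"
  shows "chain_irreducible M (\<lambda>k \<omega>. v (Z k \<omega>)) (range v)"
  unfolding chain_irreducible_def using one_step_values[OF assms] by blast

lemma aperiodic_values:
  assumes "inj v" and "set_pmf \<pi> = UNIV" and "\<And>x y. pmf (K x) y > 0"
  shows "chain_aperiodic M (\<lambda>k \<omega>. v (Z k \<omega>)) (range v)"
  unfolding chain_aperiodic_def
proof (intro ballI)
  fix i assume "i \<in> range v"
  then have "(1 :: nat) \<in> {n. 1 \<le> n \<and> \<P>(\<omega> in M. v (Z (int n) \<omega>) = i \<bar> v (Z 0 \<omega>) = i) > 0}"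
    using one_step_values[OF assms] by auto
  then have "Gcd {n. 1 \<le> n \<and> \<P>(\<omega> in M. v (Z (int n) \<omega>) = i \<bar> v (Z 0 \<omega>) = i) > 0} dvd 1"
    by (rule Gcd_dvd)
  then show "Gcd {n. 1 \<le> n \<and> \<P>(\<omega> in M. v (Z (int n) \<omega>) = i \<bar> v (Z 0 \<omega>) = i) > 0} = 1"
    by simp
qed

end

lemma (in reversible_kernel) chain_process_\<Omega>: "chain_process \<Omega> \<pi> K Z\<^sub>0"
  using prob_space_\<Omega> measurable_Z\<^sub>0 prob_path reversible_kernel_axioms
  by (auto simp: chain_process_def chain_process_axioms_def)

text \<open>The chain \<open>Z\<^sub>0\<close> lives on the space of innovations; moving it to the space of its real-valued
  trajectories makes the type of the probability space independent of \<open>'s\<close>.\<close>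

lemma (in reversible_kernel) exists_chain_process:
  fixes v :: "'s \<Rightarrow> real"
  assumes v: "inj v"
  shows "\<exists>(M :: (int \<Rightarrow> real) measure) Z. chain_process M \<pi> K Z"
proof -
  interpret \<Omega>: chain_process \<Omega> \<pi> K Z\<^sub>0 by (rule chain_process_\<Omega>)
  let ?N = "PiM UNIV (\<lambda>_ :: int. borel :: real measure)"
  let ?T = "\<lambda>\<omega> k. v (Z\<^sub>0 k \<omega>)"
  let ?M = "distr \<Omega> ?N ?T"
  define r where "r t = (if t \<in> range v then inv v t else undefined)" for t
  let ?Z = "\<lambda>k \<omega>. r (\<omega> k)"
  have T: "?T \<in> measurable \<Omega> ?N" by (rule \<Omega>.measurable_values)
  have rv: "r (v x) = x" for x using v by (simp add: r_def inv_f_f)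
  have r [measurable]: "r \<in> measurable borel (count_space UNIV)"
  proof (rule measurable_count_space_eq_countable[THEN iffD2], simp, intro conjI ballI)
    fix x
    have "r -` {x} \<inter> space borel = {v x} \<union> (if x = undefined then - range v else {})"
      using v by (auto simp: r_def inv_f_f)
    also have "\<dots> \<in> sets borel"
    proof -
      have "range v \<in> sets borel" by (rule sets.countable) auto
      then show ?thesis by simp
    qed
    finally show "r -` {x} \<inter> space borel \<in> sets borel" .
  qed auto
  have "chain_process ?M \<pi> K ?Z"
  proof (intro chain_process.intro chain_process_axioms.intro)
    show "prob_space ?M" by (rule \<Omega>.prob_space_distr[OF T])
    show m: "?Z k \<in> measurable ?M (count_space UNIV)" for k by measurable
    fix k n x
    have "{\<omega>\<in>space ?M. \<forall>i\<in>{k..k + int n}. ?Z i \<omega> = x i} \<in> sets ?M"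
      using m by measurable
    moreover have "?T -` {\<omega>\<in>space ?M. \<forall>i\<in>{k..k + int n}. ?Z i \<omega> = x i} \<inter> space \<Omega>
       = {\<omega>\<in>space \<Omega>. \<forall>i\<in>{k..k + int n}. Z\<^sub>0 i \<omega> = x i}"
      by (auto simp: rv space_PiM)
    ultimately show "measure ?M {\<omega>\<in>space ?M. \<forall>i\<in>{k..k + int n}. ?Z i \<omega> = x i} = weight k n x"
      using T prob_path by (subst measure_distr) auto
  qed (rule reversible_kernel_axioms)
  then show ?thesis by blast
qed

section \<open>Mixing coefficients\<close>

lemma ennreal_integral_le_nn_integral:
  fixes f :: "'a \<Rightarrow> real"
  assumes "integrable M f"
  shows "ennreal (integral\<^sup>L M f) \<le> (\<integral>\<^sup>+x. ennreal (f x) \<partial>M)"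
proof -
  have i: "integrable M (\<lambda>x. max 0 (f x))" using assms by simp
  have "integral\<^sup>L M f \<le> integral\<^sup>L M (\<lambda>x. max 0 (f x))"
    using assms i by (intro integral_mono) auto
  then have "ennreal (integral\<^sup>L M f) \<le> ennreal (integral\<^sup>L M (\<lambda>x. max 0 (f x)))"
    by (rule ennreal_leI)
  also have "\<dots> = (\<integral>\<^sup>+x. ennreal (max 0 (f x)) \<partial>M)"
    using i by (intro nn_integral_eq_integral[symmetric]) auto
  also have "\<dots> = (\<integral>\<^sup>+x. ennreal (f x) \<partial>M)"
    by (intro nn_integral_cong) (simp add: max_def ennreal_neg)
  finally show ?thesis .
qed

text \<open>The uniqueness theorem for measures speaks of a generator of the whole sigma-algebra, so
  both measures are first restricted to the one generated by \<open>G\<close>.\<close>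

lemma emeasure_eq_on_sigma_sets:
  assumes sets: "sets N = sets M" "sets N' = sets M" and G: "G \<subseteq> sets M" "Int_stable G" "space M \<in> G"
    and fin: "emeasure N (space M) \<noteq> \<infinity>"
    and eq: "\<And>A. A \<in> G \<Longrightarrow> emeasure N A = emeasure N' A"
    and A: "A \<in> sigma_sets (space M) G"
  shows "emeasure N A = emeasure N' A"
proof -
  let ?F = "sigma (space M) G"
  have GP: "G \<subseteq> Pow (space M)" using G(1) sets.sets_into_space by blast
  have SF: "sets ?F = sigma_sets (space M) G" using GP by (rule sets_measure_of)
  have sub: "sigma_sets (space M) G \<subseteq> sets M" by (rule sets.sigma_sets_subset[OF G(1)])
  have sp: "space N = space M" "space N' = space M" using sets by (auto dest: sets_eq_imp_space_eq)
  have s: "subalgebra N ?F" "subalgebra N' ?F"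
    using sub sets sp GP by (auto simp: subalgebra_def SF)
  have "restr_to_subalg N ?F = restr_to_subalg N' ?F"
  proof (rule measure_eqI_generator_eq[OF G(2) GP])
    show "emeasure (restr_to_subalg N ?F) B = emeasure (restr_to_subalg N' ?F) B" if "B \<in> G" for B
      using that s by (simp add: emeasure_restr_to_subalg SF eq sigma_sets.Basic)
    show "sets (restr_to_subalg N ?F) = sigma_sets (space M) G" "sets (restr_to_subalg N' ?F) = sigma_sets (space M) G"
      using s by (simp_all add: sets_restr_to_subalg SF)
    show "range (\<lambda>_ :: nat. space M) \<subseteq> G" "(\<Union>i :: nat. space M) = space M" using G(3) by auto
    show "emeasure (restr_to_subalg N ?F) (space M) \<noteq> \<infinity>"
      using fin s G(3) by (simp add: emeasure_restr_to_subalg SF sigma_sets.Basic)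
  qed
  then show ?thesis using A s by (metis SF emeasure_restr_to_subalg)
qed

context prob_space
begin

text \<open>Since the differences \<open>P(A \<inter> B) - P(A) P(B)\<close> sum to \<open>0\<close> over a pair of partitions, the sum of
  their absolute values is twice the sum of their negative parts, so one-sided bounds suffice.\<close>

lemma partition_sum_bound:
  fixes f g :: "'a \<Rightarrow> real"
  assumes fg: "integrable M f" "integrable M g" "\<And>\<omega>. f \<omega> \<ge> 0" "\<And>\<omega>. g \<omega> \<ge> 0"
    and lower: "\<And>A B. A \<in> \<A> \<Longrightarrow> B \<in> \<B> \<Longrightarrow>
       prob (A \<inter> B) \<ge> prob A * prob B - (prob B * (\<integral>\<omega>. indicator A \<omega> * f \<omega> \<partial>M) + prob A * (\<integral>\<omega>. indicator B \<omega> * g \<omega> \<partial>M))"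
    and ev: "\<A> \<subseteq> events" "\<B> \<subseteq> events"
    and P: "finite P" "partition_on (space M) P" "P \<subseteq> \<A>"
    and Q: "finite Q" "partition_on (space M) Q" "Q \<subseteq> \<B>"
  shows "(1 / 2) * (\<Sum>A\<in>P. \<Sum>B\<in>Q. \<bar>prob (A \<inter> B) - prob A * prob B\<bar>) \<le> expectation f + expectation g"
proof -
  have sum_int: "(\<Sum>A\<in>R. \<integral>\<omega>. indicator A \<omega> * h \<omega> \<partial>M) = expectation h"
    if R: "finite R" "partition_on (space M) R" "R \<subseteq> events" and h: "integrable M h" for R and h :: "'a \<Rightarrow> real"
  proof -
    have "(\<Sum>A\<in>R. \<integral>\<omega>. indicator A \<omega> * h \<omega> \<partial>M) = (\<integral>\<omega>. (\<Sum>A\<in>R. indicator A \<omega> * h \<omega>) \<partial>M)"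
      using R h by (intro Bochner_Integration.integral_sum[symmetric]) (auto intro!: integrable_real_mult_indicator simp: mult.commute)
    also have "\<dots> = expectation h"
    proof (rule Bochner_Integration.integral_cong[OF refl])
      fix \<omega> assume "\<omega> \<in> space M"
      then obtain A where A: "A \<in> R" "\<omega> \<in> A" using R(2) by (auto simp: partition_on_def)
      have "indicator B \<omega> = (if B = A then 1 else 0 :: real)" if "B \<in> R" for B
        using that A R(2) by (auto simp: partition_on_def disjoint_def indicator_def)
      then have "(\<Sum>A\<in>R. indicator A \<omega> * h \<omega>) = (\<Sum>B\<in>R. if B = A then h \<omega> else 0)"
        by (intro sum.cong) auto
      then show "(\<Sum>A\<in>R. indicator A \<omega> * h \<omega>) = h \<omega>" using R(1) A by simp
    qed
    finally show ?thesis .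
  qed
  have sum_prob: "(\<Sum>A\<in>R. prob (A \<inter> C)) = prob C"
    if R: "finite R" "partition_on (space M) R" "R \<subseteq> events" and C: "C \<in> events" for R C
  proof -
    have "(\<Sum>A\<in>R. \<integral>\<omega>. indicator A \<omega> * indicator C \<omega> \<partial>M) = (\<integral>\<omega>. indicator C \<omega> \<partial>M :: real)"
      using R C by (intro sum_int) (auto simp: integrable_indicator_iff emeasure_eq_measure)
    moreover have "(\<integral>\<omega>. indicator A \<omega> * indicator C \<omega> \<partial>M :: real) = prob (A \<inter> C)" if "A \<in> R" for A
      using that R C by (subst indicator_inter_arith[symmetric]) (auto intro: sets.Int)
    ultimately show ?thesis using C by simp
  qed
  have Pe: "P \<subseteq> events" and Qe: "Q \<subseteq> events" using P Q ev by auto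
  define d where "d A B = prob (A \<inter> B) - prob A * prob B" for A B
  \<comment> \<open>The error splits into a term weighted by \<open>f\<close> on \<open>A\<close>
    and a term weighted by \<open>g\<close> on \<open>B\<close>, each multiplied by the plain
    probability of the other block; summed over its partition that probability gives 1.\<close>
  define e where "e A B = prob B * (\<integral>\<omega>. indicator A \<omega> * f \<omega> \<partial>M) + prob A * (\<integral>\<omega>. indicator B \<omega> * g \<omega> \<partial>M)" for A B
  have sP: "(\<Sum>A\<in>P. prob A) = 1" "(\<Sum>B\<in>Q. prob B) = 1"
  proof -
    have "A \<inter> space M = A" if "A \<in> events" for A using that sets.sets_into_space by blast
    then show "(\<Sum>A\<in>P. prob A) = 1" "(\<Sum>B\<in>Q. prob B) = 1"
      using sum_prob[OF P(1,2) Pe, of "space M"] sum_prob[OF Q(1,2) Qe, of "space M"] Pe Qe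
      by (auto simp: prob_space subset_iff)
  qed
  have "(\<Sum>A\<in>P. \<Sum>B\<in>Q. prob (A \<inter> B)) = (\<Sum>A\<in>P. prob A)"
  proof (intro sum.cong refl)
    fix A assume "A \<in> P"
    then show "(\<Sum>B\<in>Q. prob (A \<inter> B)) = prob A"
      using sum_prob[OF Q(1,2) Qe, of A] Pe by (auto simp: Int_commute)
  qed
  then have d0: "(\<Sum>A\<in>P. \<Sum>B\<in>Q. d A B) = 0"
    by (simp add: d_def sum_subtractf sP flip: sum_product)
  have e0: "(\<Sum>A\<in>P. \<Sum>B\<in>Q. e A B) = expectation f + expectation g"
  proof -
    have "(\<Sum>A\<in>P. \<Sum>B\<in>Q. e A B) = (\<Sum>A\<in>P. (\<integral>\<omega>. indicator A \<omega> * f \<omega> \<partial>M) * (\<Sum>B\<in>Q. prob B))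
       + (\<Sum>A\<in>P. prob A) * (\<Sum>B\<in>Q. \<integral>\<omega>. indicator B \<omega> * g \<omega> \<partial>M)"
    proof -
      define F where "F A = (\<integral>\<omega>. indicator A \<omega> * f \<omega> \<partial>M)" for A
      define G where "G B = (\<integral>\<omega>. indicator B \<omega> * g \<omega> \<partial>M)" for B
      have "(\<Sum>A\<in>P. \<Sum>B\<in>Q. prob B * F A) = (\<Sum>A\<in>P. F A * (\<Sum>B\<in>Q. prob B))"
        by (simp add: sum_distrib_left mult.commute)
      moreover have "(\<Sum>A\<in>P. \<Sum>B\<in>Q. prob A * G B) = (\<Sum>A\<in>P. prob A) * (\<Sum>B\<in>Q. G B)"
        by (simp add: sum_product)
      ultimately show ?thesis by (simp add: e_def sum.distrib F_def G_def)
    qed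
    then show ?thesis
      using sum_int[OF P(1,2) Pe fg(1)] sum_int[OF Q(1,2) Qe fg(2)] by (simp add: sP)
  qed
  have "\<bar>d A B\<bar> \<le> d A B + 2 * e A B" if "A \<in> P" "B \<in> Q" for A B
  proof -
    have "A \<in> \<A>" "B \<in> \<B>" using that P Q by auto
    then have "d A B \<ge> - e A B" using lower[of A B] unfolding d_def e_def by linarith
    moreover have "e A B \<ge> 0"
      unfolding e_def using fg by (intro add_nonneg_nonneg mult_nonneg_nonneg integral_nonneg_AE) auto
    ultimately show ?thesis by linarith
  qed
  then have "(\<Sum>A\<in>P. \<Sum>B\<in>Q. \<bar>d A B\<bar>) \<le> (\<Sum>A\<in>P. \<Sum>B\<in>Q. d A B + 2 * e A B)"
    by (intro sum_mono)
  also have "\<dots> = 2 * (expectation f + expectation g)"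
    using d0 e0 by (simp add: sum.distrib flip: sum_distrib_left)
  finally show ?thesis by (simp add: d_def)
qed

lemma beta_coeff_le:
  fixes \<A> \<B> :: "'a set set"
  assumes "space M \<in> \<A>" "space M \<in> \<B>"
    and "\<And>P Q. finite P \<Longrightarrow> partition_on (space M) P \<Longrightarrow> P \<subseteq> \<A> \<Longrightarrow>
           finite Q \<Longrightarrow> partition_on (space M) Q \<Longrightarrow> Q \<subseteq> \<B> \<Longrightarrow>
           (1 / 2) * (\<Sum>A\<in>P. \<Sum>B\<in>Q. \<bar>prob (A \<inter> B) - prob A * prob B\<bar>) \<le> c"
  shows "beta_coeff M \<A> \<B> \<le> c"
  unfolding beta_coeff_def
proof (rule cSup_least)
  have "partition_on (space M) {space M}" using not_empty by (auto simp: partition_on_def)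
  then show "{(1 / 2) * (\<Sum>A\<in>P. \<Sum>B\<in>Q. \<bar>prob (A \<inter> B) - prob A * prob B\<bar>) |P Q.
     finite P \<and> partition_on (space M) P \<and> P \<subseteq> \<A> \<and> finite Q \<and> partition_on (space M) Q \<and> Q \<subseteq> \<B>} \<noteq> {}"
    using assms(1,2) by blast
  fix x assume "x \<in> {(1 / 2) * (\<Sum>A\<in>P. \<Sum>B\<in>Q. \<bar>prob (A \<inter> B) - prob A * prob B\<bar>) |P Q.
     finite P \<and> partition_on (space M) P \<and> P \<subseteq> \<A> \<and> finite Q \<and> partition_on (space M) Q \<and> Q \<subseteq> \<B>}"
  then obtain P Q where x: "x = (1 / 2) * (\<Sum>A\<in>P. \<Sum>B\<in>Q. \<bar>prob (A \<inter> B) - prob A * prob B\<bar>)"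
    and "finite P" "partition_on (space M) P" "P \<subseteq> \<A>" "finite Q" "partition_on (space M) Q" "Q \<subseteq> \<B>"
    by blast
  then show "x \<le> c" unfolding x by (intro assms(3))
qed

text \<open>For the partitions into a set and its complement, the terms of \<open>A\<close> with
  \<open>B\<close> and of the complement of \<open>A\<close> with \<open>B\<close> have the same
  absolute value, which cancels the factor 1/2. Trivial sets are treated apart because blocks are
  nonempty. The bound \<open>c\<close> guarantees that the supremum defining beta is taken over a
  bounded set.\<close>

lemma alpha_coeff_le_beta_coeff:
  fixes \<A> \<B> :: "'a set set"
  assumes A: "sigma_algebra (space M) \<A>" "\<A> \<subseteq> events" and B: "sigma_algebra (space M) \<B>" "\<B> \<subseteq> events"
    and bound: "\<And>P Q. finite P \<Longrightarrow> partition_on (space M) P \<Longrightarrow> P \<subseteq> \<A> \<Longrightarrow>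
           finite Q \<Longrightarrow> partition_on (space M) Q \<Longrightarrow> Q \<subseteq> \<B> \<Longrightarrow>
           (1 / 2) * (\<Sum>A\<in>P. \<Sum>B\<in>Q. \<bar>prob (A \<inter> B) - prob A * prob B\<bar>) \<le> c"
  shows "alpha_coeff M \<A> \<B> \<le> beta_coeff M \<A> \<B>"
proof -
  interpret A: sigma_algebra "space M" \<A> by fact
  interpret B: sigma_algebra "space M" \<B> by fact
  let ?S = "{(1 / 2) * (\<Sum>A\<in>P. \<Sum>B\<in>Q. \<bar>prob (A \<inter> B) - prob A * prob B\<bar>) |P Q.
     finite P \<and> partition_on (space M) P \<and> P \<subseteq> \<A> \<and> finite Q \<and> partition_on (space M) Q \<and> Q \<subseteq> \<B>}"
  have bdd: "bdd_above ?S"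
  proof (rule bdd_aboveI)
    fix x assume "x \<in> ?S"
    then obtain P Q where x: "x = (1 / 2) * (\<Sum>A\<in>P. \<Sum>B\<in>Q. \<bar>prob (A \<inter> B) - prob A * prob B\<bar>)"
      and "finite P" "partition_on (space M) P" "P \<subseteq> \<A>" "finite Q" "partition_on (space M) Q" "Q \<subseteq> \<B>"
      by blast
    then show "x \<le> c" unfolding x by (intro bound)
  qed
  have in_S: "(1 / 2) * (\<Sum>A\<in>P. \<Sum>B\<in>Q. \<bar>prob (A \<inter> B) - prob A * prob B\<bar>) \<le> beta_coeff M \<A> \<B>"
    if "finite P" "partition_on (space M) P" "P \<subseteq> \<A>" "finite Q" "partition_on (space M) Q" "Q \<subseteq> \<B>" for P Q
    unfolding beta_coeff_def using that by (intro cSup_upper bdd) blast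
  have triv: "partition_on (space M) {space M}" using not_empty by (auto simp: partition_on_def)
  have nonneg: "0 \<le> beta_coeff M \<A> \<B>"
    using in_S[of "{space M}" "{space M}"] triv by (simp add: prob_space)
  show ?thesis
    unfolding alpha_coeff_def
  proof (rule cSUP_least)
    show "\<A> \<times> \<B> \<noteq> {}" using A.top B.top by blast
    fix x assume "x \<in> \<A> \<times> \<B>"
    then obtain A B where x: "x = (A, B)" and AB: "A \<in> \<A>" "B \<in> \<B>" by auto
    then have ev: "A \<in> events" "B \<in> events" using A(2) B(2) by auto
    have sub: "A \<subseteq> space M" "B \<subseteq> space M" using ev sets.sets_into_space by auto
    have "\<bar>prob (A \<inter> B) - prob A * prob B\<bar> \<le> beta_coeff M \<A> \<B>"
    proof (cases "A = {} \<or> A = space M \<or> B = {} \<or> B = space M")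
      case True
      then have "prob (A \<inter> B) - prob A * prob B = 0"
        using sub by (auto simp: prob_space Int_absorb1 Int_absorb2)
      then show ?thesis using nonneg by simp
    next
      case False
      have p: "partition_on (space M) {A, space M - A}" "partition_on (space M) {B, space M - B}"
        using False sub by (auto simp: partition_on_def disjoint_def)
      have ne: "A \<noteq> space M - A" "B \<noteq> space M - B" using False by auto
      have c: "prob (space M - A) = 1 - prob A" "prob ((space M - A) \<inter> B) = prob B - prob (A \<inter> B)"
      proof -
        show "prob (space M - A) = 1 - prob A" by (rule prob_compl[OF ev(1)])
        have "(space M - A) \<inter> B = B - A \<inter> B" using sub by auto
        then show "prob ((space M - A) \<inter> B) = prob B - prob (A \<inter> B)"
          using ev by (simp add: finite_measure_Diff)
      qed
      have e: "prob ((space M - A) \<inter> B) - prob (space M - A) * prob B = - (prob (A \<inter> B) - prob A * prob B)"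
        unfolding c by (simp add: algebra_simps)
      have "\<bar>prob (A \<inter> B) - prob A * prob B\<bar>
         = (1 / 2) * (\<bar>prob (A \<inter> B) - prob A * prob B\<bar> + \<bar>prob ((space M - A) \<inter> B) - prob (space M - A) * prob B\<bar>)"
        unfolding e abs_minus_cancel by simp
      also have "\<dots> \<le> (1 / 2) * (\<Sum>A\<in>{A, space M - A}. \<Sum>B\<in>{B, space M - B}. \<bar>prob (A \<inter> B) - prob A * prob B\<bar>)"
        using ne by simp
      also have "\<dots> \<le> beta_coeff M \<A> \<B>"
        using p AB by (intro in_S) auto
      finally show ?thesis .
    qed
    then show "(case x of (A, B) \<Rightarrow> \<bar>prob (A \<inter> B) - prob A * prob B\<bar>) \<le> beta_coeff M \<A> \<B>"
      by (simp add: x)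
  qed
qed

end

section \<open>The Markov property for the sigma-algebras of past and future\<close>

context chain_process
begin

definition past_cylinders :: "'a set set" where
  "past_cylinders = (\<Union>m. range (\<lambda>C. {\<omega>\<in>space M. V (- int m) m \<omega> \<in> C}))"

definition future_cylinders :: "nat \<Rightarrow> 'a set set" where
  "future_cylinders n = (\<Union>m. range (\<lambda>C. {\<omega>\<in>space M. V (int n) m \<omega> \<in> C}))"

lemma V_drop: "j \<le> m \<Longrightarrow> V (k + int j) (m - j) \<omega> = drop j (V k m \<omega>)"
  by (rule nth_equalityI) (auto simp: nth_V algebra_simps)

lemma V_take: "j \<le> m \<Longrightarrow> V k j \<omega> = take (Suc j) (V k m \<omega>)"
  by (rule nth_equalityI) (auto simp: nth_V)

lemma past_cylinders_extend:
  assumes "m \<le> m'"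
  shows "{\<omega>\<in>space M. V (- int m) m \<omega> \<in> C} = {\<omega>\<in>space M. V (- int m') m' \<omega> \<in> {xs. drop (m' - m) xs \<in> C}}"
  using V_drop[of "m' - m" m' "- int m'"] assms by simp

lemma Int_stable_past: "Int_stable past_cylinders"
proof (rule Int_stableI)
  fix a b assume "a \<in> past_cylinders" "b \<in> past_cylinders"
  then obtain m1 C1 m2 C2 where a: "a = {\<omega>\<in>space M. V (- int m1) m1 \<omega> \<in> C1}"
    and b: "b = {\<omega>\<in>space M. V (- int m2) m2 \<omega> \<in> C2}"
    by (auto simp: past_cylinders_def)
  let ?m = "max m1 m2"
  have "a \<inter> b = {\<omega>\<in>space M. V (- int ?m) ?m \<omega> \<in> {xs. drop (?m - m1) xs \<in> C1} \<inter> {xs. drop (?m - m2) xs \<in> C2}}"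
    unfolding a b past_cylinders_extend[of m1 ?m C1, OF max.cobounded1] past_cylinders_extend[of m2 ?m C2, OF max.cobounded2]
    by auto
  then show "a \<inter> b \<in> past_cylinders" unfolding past_cylinders_def by blast
qed

lemma Int_stable_future: "Int_stable (future_cylinders n)"
proof (rule Int_stableI)
  fix a b assume "a \<in> future_cylinders n" "b \<in> future_cylinders n"
  then obtain m1 C1 m2 C2 where a: "a = {\<omega>\<in>space M. V (int n) m1 \<omega> \<in> C1}"
    and b: "b = {\<omega>\<in>space M. V (int n) m2 \<omega> \<in> C2}"
    by (auto simp: future_cylinders_def)
  let ?m = "max m1 m2"
  have "a \<inter> b = {\<omega>\<in>space M. V (int n) ?m \<omega> \<in> {xs. take (Suc m1) xs \<in> C1} \<inter> {xs. take (Suc m2) xs \<in> C2}}"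
    unfolding a b using V_take[of m1 ?m "int n"] V_take[of m2 ?m "int n"] by auto
  then show "a \<inter> b \<in> future_cylinders n" unfolding future_cylinders_def by blast
qed

lemma cylinders_events: "past_cylinders \<subseteq> events" "future_cylinders n \<subseteq> events"
  by (auto simp: past_cylinders_def future_cylinders_def)

lemma space_cylinders: "space M \<in> past_cylinders" "space M \<in> future_cylinders n"
proof -
  have *: "space M = {\<omega>\<in>space M. V k m \<omega> \<in> UNIV}" for k m by auto
  show "space M \<in> past_cylinders" unfolding past_cylinders_def using *[of "- int 0" 0] by blast
  show "space M \<in> future_cylinders n" unfolding future_cylinders_def using *[of "int n" 0] by blast
qed

lemma sigma_gen_by_past:
  fixes v :: "'s \<Rightarrow> real"
  shows "sigma_gen_by M (\<lambda>k \<omega>. v (Z k \<omega>)) {..0} \<subseteq> sigma_sets (space M) past_cylinders"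
  unfolding sigma_gen_by_def
proof (rule sigma_sets_mono, safe)
  fix k :: int and B :: "real set" assume k: "k \<le> 0"
  define m where "m = nat (- k)"
  have "(\<lambda>\<omega>. v (Z k \<omega>)) -` B \<inter> space M = {\<omega>\<in>space M. V (- int m) m \<omega> \<in> {xs. v (xs ! 0) \<in> B}}"
    using nth_V[of 0 m "- int m"] k by (auto simp: m_def)
  then show "(\<lambda>\<omega>. v (Z k \<omega>)) -` B \<inter> space M \<in> sigma_sets (space M) past_cylinders"
    unfolding past_cylinders_def by blast
qed

lemma sigma_gen_by_future:
  fixes v :: "'s \<Rightarrow> real"
  shows "sigma_gen_by M (\<lambda>k \<omega>. v (Z k \<omega>)) {int n..} \<subseteq> sigma_sets (space M) (future_cylinders n)"
  unfolding sigma_gen_by_def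
proof (rule sigma_sets_mono, safe)
  fix k :: int and B :: "real set" assume k: "int n \<le> k"
  define m where "m = nat (k - int n)"
  have "(\<lambda>\<omega>. v (Z k \<omega>)) -` B \<inter> space M = {\<omega>\<in>space M. V (int n) m \<omega> \<in> {xs. v (xs ! m) \<in> B}}"
    using nth_V[of m m "int n"] k by (auto simp: m_def)
  then show "(\<lambda>\<omega>. v (Z k \<omega>)) -` B \<inter> space M \<in> sigma_sets (space M) (future_cylinders n)"
    unfolding future_cylinders_def by blast
qed

definition start_in :: "'s list set \<Rightarrow> nat \<Rightarrow> 's \<Rightarrow> ennreal" where
  "start_in D m y = emeasure (measure_pmf (paths m y)) {ws. y # ws \<in> D}"

lemma nn_integral_V: "(\<integral>\<^sup>+\<omega>. f (V k n \<omega>) \<partial>M) = (\<integral>\<^sup>+xs. f xs \<partial>measure_pmf (law n))"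
  unfolding distr_V[of k n, symmetric] by (subst nn_integral_distr) auto

lemma hd_V: "hd (V k n \<omega>) = Z k \<omega>"
proof -
  have "V k n \<omega> \<noteq> []" using length_V[of k n \<omega>] by (metis list.size(3) nat.distinct(1))
  then show ?thesis using nth_V[of 0 n k \<omega>] by (simp add: hd_conv_nth)
qed

lemma last_V: "last (V k n \<omega>) = Z (k + int n) \<omega>"
proof -
  have "V k n \<omega> \<noteq> []" using length_V[of k n \<omega>] by (metis list.size(3) nat.distinct(1))
  then show ?thesis using nth_V[of n n k \<omega>] by (simp add: last_conv_nth)
qed

text \<open>The window from \<open>- m\<close> to \<open>n + m'\<close> is cut at the times 0 and
  \<open>n\<close>: a past in \<open>C\<close>, then \<open>n\<close> steps of the kernel from
  \<open>Z 0\<close>, then a path in \<open>D\<close> from the state reached.\<close>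

lemma cylinders_Int:
  "emeasure M ({\<omega>\<in>space M. V (- int m) m \<omega> \<in> C} \<inter> {\<omega>\<in>space M. V (int n) m' \<omega> \<in> D})
    = (\<integral>\<^sup>+\<omega>. indicator {\<omega>\<in>space M. V (- int m) m \<omega> \<in> C} \<omega> * (\<integral>\<^sup>+y. start_in D m' y \<partial>measure_pmf (Kn n (Z 0 \<omega>))) \<partial>M)"
proof -
  let ?N = "m + (n + m')"
  have 1: "V (- int m) m \<omega> = take (Suc m) (V (- int m) ?N \<omega>)" "V (int n) m' \<omega> = drop (m + n) (V (- int m) ?N \<omega>)" for \<omega>
    using V_take[of m ?N "- int m" \<omega>] V_drop[of "m + n" ?N "- int m" \<omega>] by auto
  have "emeasure M ({\<omega>\<in>space M. V (- int m) m \<omega> \<in> C} \<inter> {\<omega>\<in>space M. V (int n) m' \<omega> \<in> D})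
    = emeasure M {\<omega>\<in>space M. V (- int m) ?N \<omega> \<in> {zs. take (Suc m) zs \<in> C \<and> drop (m + n) zs \<in> D}}"
    unfolding 1 by (rule arg_cong[where f="emeasure M"]) auto
  also have "\<dots> = (\<integral>\<^sup>+xs. emeasure (measure_pmf (map_pmf ((@) xs) (paths (n + m') (last xs))))
       {zs. take (Suc m) zs \<in> C \<and> drop (m + n) zs \<in> D} \<partial>measure_pmf (law m))"
    unfolding emeasure_V law_add by simp
  also have "\<dots> = (\<integral>\<^sup>+xs. indicator C xs * (\<integral>\<^sup>+y. start_in D m' y \<partial>measure_pmf (Kn n (last xs))) \<partial>measure_pmf (law m))"
  proof (intro nn_integral_cong_AE AE_pmfI)
    fix xs assume xs: "xs \<in> set_pmf (law m)"
    then have l: "length xs = Suc m" by (rule length_law)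
    obtain xs' where xs': "xs = xs' @ [last xs]" "length xs' = m"
      using l by (metis append_butlast_last_id length_butlast diff_Suc_1 list.size(3) nat.distinct(1))
    have "emeasure (measure_pmf (map_pmf ((@) xs) (paths (n + m') (last xs)))) {zs. take (Suc m) zs \<in> C \<and> drop (m + n) zs \<in> D}
      = emeasure (measure_pmf (paths (n + m') (last xs))) {ys. xs \<in> C \<and> drop n (last xs # ys) \<in> D}"
    proof -
      have "drop (m + n) (xs @ ys) = drop n (last xs # ys)" for ys
        by (subst xs'(1)) (simp add: xs'(2))
      then show ?thesis by (simp add: vimage_def l)
    qed
    also have "\<dots> = indicator C xs * emeasure (measure_pmf (paths (n + m') (last xs))) {ys. drop n (last xs # ys) \<in> D}"
      by (simp add: indicator_def)
    also have "emeasure (measure_pmf (paths (n + m') (last xs))) {ys. drop n (last xs # ys) \<in> D}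
      = (\<integral>\<^sup>+zs. emeasure (measure_pmf (map_pmf ((@) zs) (paths m' (last (last xs # zs))))) {ys. drop n (last xs # ys) \<in> D}
          \<partial>measure_pmf (paths n (last xs)))"
      unfolding paths_add by simp
    also have "\<dots> = (\<integral>\<^sup>+zs. start_in D m' (last (last xs # zs)) \<partial>measure_pmf (paths n (last xs)))"
    proof (intro nn_integral_cong_AE AE_pmfI)
      fix zs assume "zs \<in> set_pmf (paths n (last xs))"
      then have lz: "length zs = n" by (rule length_paths)
      obtain zs' where zs': "last xs # zs = zs' @ [last (last xs # zs)]" "length zs' = n"
        using lz by (metis append_butlast_last_id length_butlast diff_Suc_1 length_Cons list.distinct(1))
      have "drop n (last xs # (zs @ ws)) = last (last xs # zs) # ws" for ws
      proof -
        have "last xs # (zs @ ws) = zs' @ [last (last xs # zs)] @ ws" using zs'(1) by (metis append_Cons append_assoc)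
        then have "drop n (last xs # (zs @ ws)) = drop n (zs' @ [last (last xs # zs)] @ ws)" by (rule arg_cong)
        also have "\<dots> = last (last xs # zs) # ws" using zs'(2) by simp
        finally show ?thesis .
      qed
      then show "emeasure (measure_pmf (map_pmf ((@) zs) (paths m' (last (last xs # zs))))) {ys. drop n (last xs # ys) \<in> D}
         = start_in D m' (last (last xs # zs))"
        by (simp add: start_in_def vimage_def del: last.simps drop.simps)
    qed
    also have "\<dots> = (\<integral>\<^sup>+y. start_in D m' y \<partial>measure_pmf (Kn n (last xs)))"
      by (simp add: Kn_def)
    finally show "emeasure (measure_pmf (map_pmf ((@) xs) (paths (n + m') (last xs)))) {zs. take (Suc m) zs \<in> C \<and> drop (m + n) zs \<in> D}
      = indicator C xs * (\<integral>\<^sup>+y. start_in D m' y \<partial>measure_pmf (Kn n (last xs)))" .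
  qed
  also have "\<dots> = (\<integral>\<^sup>+\<omega>. indicator C (V (- int m) m \<omega>) * (\<integral>\<^sup>+y. start_in D m' y \<partial>measure_pmf (Kn n (Z 0 \<omega>))) \<partial>M)"
    unfolding nn_integral_V[where k="- int m", symmetric] last_V by simp
  also have "\<dots> = (\<integral>\<^sup>+\<omega>. indicator {\<omega>\<in>space M. V (- int m) m \<omega> \<in> C} \<omega> * (\<integral>\<^sup>+y. start_in D m' y \<partial>measure_pmf (Kn n (Z 0 \<omega>))) \<partial>M)"
    by (intro nn_integral_cong) (auto simp: indicator_def)
  finally show ?thesis .
qed

lemma past_cylinder_Int:
  assumes A: "A \<in> sigma_sets (space M) past_cylinders"
  shows "emeasure M (A \<inter> {\<omega>\<in>space M. V (int n) m' \<omega> \<in> D})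
    = (\<integral>\<^sup>+\<omega>. indicator A \<omega> * (\<integral>\<^sup>+y. start_in D m' y \<partial>measure_pmf (Kn n (Z 0 \<omega>))) \<partial>M)"
proof -
  define B where "B = {\<omega>\<in>space M. V (int n) m' \<omega> \<in> D}"
  let ?h = "\<lambda>\<omega>. \<integral>\<^sup>+y. start_in D m' y \<partial>measure_pmf (Kn n (Z 0 \<omega>))"
  have h[measurable]: "?h \<in> borel_measurable M"
    by (rule measurable_compose[OF measurable_Z]) simp
  have ev: "A \<in> events" if "A \<in> sigma_sets (space M) past_cylinders" for A
    using that sets.sigma_sets_subset[OF cylinders_events(1)] by blast
  have B[measurable]: "B \<in> events" unfolding B_def by measurable
  have eqB: "emeasure (density M (indicator B)) A = emeasure M (A \<inter> B)" if "A \<in> events" for A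
  proof -
    have "(\<integral>\<^sup>+\<omega>. indicator B \<omega> * indicator A \<omega> \<partial>M) = (\<integral>\<^sup>+\<omega>. indicator (A \<inter> B) \<omega> \<partial>M)"
      by (intro nn_integral_cong) (auto simp: indicator_def)
    then show ?thesis using that B by (simp add: emeasure_density sets.Int)
  qed
  have eqh: "emeasure (density M ?h) A = (\<integral>\<^sup>+\<omega>. indicator A \<omega> * ?h \<omega> \<partial>M)" if "A \<in> events" for A
    using that by (simp add: emeasure_density mult.commute)
  have "emeasure (density M (indicator B)) A = emeasure (density M ?h) A"
  proof (rule emeasure_eq_on_sigma_sets[OF _ _ cylinders_events(1) Int_stable_past space_cylinders(1) _ _ A])
    show "emeasure (density M (indicator B)) (space M) \<noteq> \<infinity>" by (simp add: eqB)
    fix A assume A: "A \<in> past_cylinders"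
    then obtain m C where "A = {\<omega>\<in>space M. V (- int m) m \<omega> \<in> C}" by (auto simp: past_cylinders_def)
    then have "emeasure M (A \<inter> B) = (\<integral>\<^sup>+\<omega>. indicator A \<omega> * ?h \<omega> \<partial>M)"
      using cylinders_Int[of m C n m' D] by (simp only: B_def)
    moreover have "A \<in> events" using A cylinders_events(1) by blast
    ultimately show "emeasure (density M (indicator B)) A = emeasure (density M ?h) A"
      by (simp only: eqB eqh)
  qed auto
  then show ?thesis using ev[OF A] by (simp add: eqB eqh flip: B_def)
qed

lemma nn_integral_Z_split:
  assumes [measurable]: "A \<in> events"
  shows "(\<integral>\<^sup>+\<omega>. indicator A \<omega> * f (Z k \<omega>) \<partial>M) = (\<integral>\<^sup>+x. emeasure M (A \<inter> {\<omega>\<in>space M. Z k \<omega> = x}) * f x \<partial>count_space UNIV)"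
proof -
  have "(\<integral>\<^sup>+\<omega>. indicator A \<omega> * f (Z k \<omega>) \<partial>M)
      = (\<integral>\<^sup>+\<omega>. (\<integral>\<^sup>+x. indicator (A \<inter> {\<omega>\<in>space M. Z k \<omega> = x}) \<omega> * f x \<partial>count_space UNIV) \<partial>M)"
  proof (intro nn_integral_cong)
    fix \<omega> assume "\<omega> \<in> space M"
    then have "(\<integral>\<^sup>+x. indicator (A \<inter> {\<omega>\<in>space M. Z k \<omega> = x}) \<omega> * f x \<partial>count_space UNIV)
       = (\<integral>\<^sup>+x. (indicator A \<omega> * f (Z k \<omega>)) * indicator {Z k \<omega>} x \<partial>count_space UNIV)"
      by (intro nn_integral_cong) (auto simp: indicator_def)
    then show "indicator A \<omega> * f (Z k \<omega>) = (\<integral>\<^sup>+x. indicator (A \<inter> {\<omega>\<in>space M. Z k \<omega> = x}) \<omega> * f x \<partial>count_space UNIV)"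
      by (simp add: nn_integral_cmult)
  qed
  also have "\<dots> = (\<integral>\<^sup>+x. (\<integral>\<^sup>+\<omega>. indicator (A \<inter> {\<omega>\<in>space M. Z k \<omega> = x}) \<omega> * f x \<partial>M) \<partial>count_space UNIV)"
    by (rule nn_integral_count_space_nn_integral) auto
  also have "\<dots> = (\<integral>\<^sup>+x. emeasure M (A \<inter> {\<omega>\<in>space M. Z k \<omega> = x}) * f x \<partial>count_space UNIV)"
    by (intro nn_integral_cong) (simp add: nn_integral_multc)
  finally show ?thesis .
qed

text \<open>The Markov property read backwards from time \<open>n\<close>: by detailed balance of
  \<open>Kn\<close>, the state at 0 given the future is a draw from \<open>Kn n\<close> started at
  \<open>Z (int n)\<close>, and the quotient is the conditional probability of \<open>A\<close>
  given that state. In this form both sides are measures in \<open>B\<close>, so cylinders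
  suffice.\<close>

lemma past_future_Int:
  assumes full: "set_pmf \<pi> = UNIV"
    and A: "A \<in> sigma_sets (space M) past_cylinders"
    and B: "B \<in> sigma_sets (space M) (future_cylinders n)"
  shows "emeasure M (A \<inter> B)
    = (\<integral>\<^sup>+\<omega>. indicator B \<omega> * (\<integral>\<^sup>+x. emeasure M (A \<inter> {\<omega>\<in>space M. Z 0 \<omega> = x}) / ennreal (pmf \<pi> x)
          \<partial>measure_pmf (Kn n (Z (int n) \<omega>))) \<partial>M)"
proof -
  have pos: "pmf \<pi> x > 0" for x using full by (simp add: pmf_positive)
  have evA[measurable]: "A \<in> events" using A sets.sigma_sets_subset[OF cylinders_events(1)] by blast
  have evB: "B \<in> events" using B sets.sigma_sets_subset[OF cylinders_events(2)] by blast
  define a where "a x = emeasure M (A \<inter> {\<omega>\<in>space M. Z 0 \<omega> = x})" for x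
  define c where "c x = a x / ennreal (pmf \<pi> x)" for x
  have ac: "a x = c x * ennreal (pmf \<pi> x)" for x
    using pos[of x] by (simp add: c_def ennreal_divide_times ennreal_times_divide mult_divide_eq_ennreal)
  let ?h = "\<lambda>\<omega>. \<integral>\<^sup>+x. c x \<partial>measure_pmf (Kn n (Z (int n) \<omega>))"
  have h[measurable]: "?h \<in> borel_measurable M"
    by (rule measurable_compose[OF measurable_Z]) simp
  have eqA: "emeasure (density M (indicator A)) B = emeasure M (A \<inter> B)" if "B \<in> events" for B
  proof -
    have "(\<integral>\<^sup>+\<omega>. indicator A \<omega> * indicator B \<omega> \<partial>M) = (\<integral>\<^sup>+\<omega>. indicator (A \<inter> B) \<omega> \<partial>M)"
      by (intro nn_integral_cong) (simp add: indicator_def)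
    then show ?thesis using that by (simp add: emeasure_density sets.Int)
  qed
  have eqh: "emeasure (density M ?h) B = (\<integral>\<^sup>+\<omega>. indicator B \<omega> * ?h \<omega> \<partial>M)" if "B \<in> events" for B
    using that by (simp add: emeasure_density mult.commute)
  have "emeasure (density M (indicator A)) B = emeasure (density M ?h) B"
  proof (rule emeasure_eq_on_sigma_sets[OF _ _ cylinders_events(2) Int_stable_future space_cylinders(2) _ _ B])
    show "emeasure (density M (indicator A)) (space M) \<noteq> \<infinity>" by (simp add: eqA)
    fix B assume B: "B \<in> future_cylinders n"
    then obtain m D where BD: "B = {\<omega>\<in>space M. V (int n) m \<omega> \<in> D}" by (auto simp: future_cylinders_def)
    let ?g = "start_in D m"
    have evB: "B \<in> events" using B cylinders_events(2) by blast
    have "emeasure M (A \<inter> B) = (\<integral>\<^sup>+x. a x * (\<integral>\<^sup>+y. ?g y \<partial>measure_pmf (Kn n x)) \<partial>count_space UNIV)"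
      unfolding BD past_cylinder_Int[OF A] a_def
      by (rule nn_integral_Z_split[of A "\<lambda>x. \<integral>\<^sup>+y. ?g y \<partial>measure_pmf (Kn n x)" 0]) simp
    also have "\<dots> = (\<integral>\<^sup>+x. (\<integral>\<^sup>+y. (c x * ?g y) * ennreal (pmf \<pi> x * pmf (Kn n x) y) \<partial>count_space UNIV) \<partial>count_space UNIV)"
      by (intro nn_integral_cong)
         (simp add: nn_integral_measure_pmf ac nn_integral_cmult[symmetric] ennreal_mult' mult_ac)
    also have "\<dots> = (\<integral>\<^sup>+y. (\<integral>\<^sup>+x. (c x * ?g y) * ennreal (pmf \<pi> x * pmf (Kn n x) y) \<partial>count_space UNIV) \<partial>count_space UNIV)"
      by (rule nn_integral_count_space_nn_integral) auto
    also have "\<dots> = (\<integral>\<^sup>+y. (\<integral>\<^sup>+x. (c x * ?g y) * ennreal (pmf \<pi> y * pmf (Kn n y) x) \<partial>count_space UNIV) \<partial>count_space UNIV)"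
      by (simp only: rev_Kn)
    also have "\<dots> = (\<integral>\<^sup>+y. (\<integral>\<^sup>+x. c x \<partial>measure_pmf (Kn n y)) * ?g y \<partial>measure_pmf \<pi>)"
      by (subst nn_integral_measure_pmf, intro nn_integral_cong)
         (simp add: nn_integral_measure_pmf nn_integral_cmult[symmetric] nn_integral_multc[symmetric] ennreal_mult' mult_ac)
    also have "\<dots> = (\<integral>\<^sup>+ys. indicator D ys * (\<integral>\<^sup>+x. c x \<partial>measure_pmf (Kn n (hd ys))) \<partial>measure_pmf (law m))"
    proof -
      have "(\<integral>\<^sup>+ws. indicator D (y # ws) * (\<integral>\<^sup>+x. c x \<partial>measure_pmf (Kn n y)) \<partial>measure_pmf (paths m y))
         = (\<integral>\<^sup>+x. c x \<partial>measure_pmf (Kn n y)) * ?g y" for y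
      proof -
        have "(\<lambda>ws. indicator D (y # ws)) = (indicator {ws. y # ws \<in> D} :: _ \<Rightarrow> ennreal)"
          by (auto simp: indicator_def)
        then have "(\<integral>\<^sup>+ws. indicator D (y # ws) \<partial>measure_pmf (paths m y)) = ?g y"
          unfolding start_in_def by (simp only: nn_integral_indicator sets_measure_pmf UNIV_I)
        then show ?thesis by (simp add: nn_integral_multc mult.commute)
      qed
      then show ?thesis unfolding law_def by simp
    qed
    also have "\<dots> = (\<integral>\<^sup>+\<omega>. indicator D (V (int n) m \<omega>) * ?h \<omega> \<partial>M)"
      unfolding nn_integral_V[where k="int n", symmetric] hd_V ..
    also have "\<dots> = (\<integral>\<^sup>+\<omega>. indicator B \<omega> * ?h \<omega> \<partial>M)"
      unfolding BD by (intro nn_integral_cong) (auto simp: indicator_def)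
    finally show "emeasure (density M (indicator A)) B = emeasure (density M ?h) B"
      using evB by (simp add: eqA eqh)
  qed auto
  then have "emeasure M (A \<inter> B) = (\<integral>\<^sup>+\<omega>. indicator B \<omega> * ?h \<omega> \<partial>M)"
    using evB by (simp add: eqA eqh)
  then show ?thesis by (simp only: c_def a_def)
qed

text \<open>By reversibility the lower bound on \<open>Kn n\<close> is inserted with the future as
  starting point; the deficits \<open>d\<close> at both ends become the two error terms.\<close>

lemma past_future_lower:
  fixes d :: "'s \<Rightarrow> real"
  assumes full: "set_pmf \<pi> = UNIV"
    and d: "\<And>x. 0 \<le> d x" "\<And>x. d x \<le> 1"
    and lower: "\<And>x y. pmf (Kn n x) y \<ge> pmf \<pi> y * (1 - d x - d y)"
    and A: "A \<in> sigma_sets (space M) past_cylinders"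
    and B: "B \<in> sigma_sets (space M) (future_cylinders n)"
  shows "prob (A \<inter> B) \<ge> prob A * prob B -
    (prob B * (\<integral>\<omega>. indicator A \<omega> * d (Z 0 \<omega>) \<partial>M) + prob A * (\<integral>\<omega>. indicator B \<omega> * d (Z (int n) \<omega>) \<partial>M))"
proof -
  have pos: "pmf \<pi> x > 0" for x using full by (simp add: pmf_positive)
  have [measurable]: "A \<in> events" "B \<in> events"
    using A B sets.sigma_sets_subset[OF cylinders_events(1)] sets.sigma_sets_subset[OF cylinders_events(2)] by blast+
  define e where "e = (\<integral>\<omega>. indicator A \<omega> * d (Z 0 \<omega>) \<partial>M)"
  have iA: "integrable M (\<lambda>\<omega>. indicator A \<omega> * d (Z k \<omega>))" "integrable M (\<lambda>\<omega>. indicator B \<omega> * d (Z k \<omega>))" for k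
    using d by (auto intro!: integrable_const_bound[where B=1] simp: indicator_def)
  have iI: "integrable M (\<lambda>\<omega>. indicator A \<omega> :: real)" "integrable M (\<lambda>\<omega>. indicator B \<omega> :: real)"
    by (auto simp: integrable_indicator_iff emeasure_eq_measure)
  \<comment> \<open>A lower bound for the conditional probability of \<open>A\<close> given the
    state \<open>y\<close> at time \<open>n\<close>. It may be negative, in which case
    \<open>ennreal\<close> truncates it to 0; every estimate below has the direction in which this
    is harmless.\<close>
  define r where "r y = prob A - e - prob A * d y" for y
  let ?\<rho> = "\<lambda>y. \<integral>\<^sup>+x. emeasure M (A \<inter> {\<omega>\<in>space M. Z 0 \<omega> = x}) / ennreal (pmf \<pi> x) \<partial>measure_pmf (Kn n y)"
  have \<rho>: "ennreal (r y) \<le> ?\<rho> y" for y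
  proof -
    have "r y = (\<integral>\<omega>. indicator A \<omega> * (1 - d (Z 0 \<omega>) - d y) \<partial>M)"
    proof -
      have "(\<integral>\<omega>. indicator A \<omega> * (1 - d (Z 0 \<omega>) - d y) \<partial>M)
        = (\<integral>\<omega>. (1 - d y) * indicator A \<omega> - indicator A \<omega> * d (Z 0 \<omega>) \<partial>M)"
        by (intro Bochner_Integration.integral_cong) (auto simp: algebra_simps)
      also have "\<dots> = (1 - d y) * prob A - e"
        unfolding e_def using iA(1)[of 0] iI(1) by (subst Bochner_Integration.integral_diff) auto
      finally show ?thesis by (simp add: r_def algebra_simps)
    qed
    moreover have "integrable M (\<lambda>\<omega>. indicator A \<omega> * (1 - d (Z 0 \<omega>) - d y))"
    proof (intro integrable_const_bound[where B=3] AE_I2)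
      fix \<omega>
      show "norm (indicator A \<omega> * (1 - d (Z 0 \<omega>) - d y)) \<le> 3"
        using d(1)[of "Z 0 \<omega>"] d(2)[of "Z 0 \<omega>"] d(1)[of y] d(2)[of y] by (auto simp: indicator_def)
    qed simp
    ultimately have "ennreal (r y) \<le> (\<integral>\<^sup>+\<omega>. ennreal (indicator A \<omega> * (1 - d (Z 0 \<omega>) - d y)) \<partial>M)"
      using ennreal_integral_le_nn_integral by metis
    also have "\<dots> = (\<integral>\<^sup>+\<omega>. indicator A \<omega> * ennreal (1 - d (Z 0 \<omega>) - d y) \<partial>M)"
      by (intro nn_integral_cong) (auto simp: indicator_def)
    also have "\<dots> = (\<integral>\<^sup>+x. emeasure M (A \<inter> {\<omega>\<in>space M. Z 0 \<omega> = x}) * ennreal (1 - d x - d y) \<partial>count_space UNIV)"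
      by (rule nn_integral_Z_split[of A "\<lambda>x. ennreal (1 - d x - d y)"]) simp
    also have "\<dots> \<le> (\<integral>\<^sup>+x. ennreal (pmf (Kn n y) x) * (emeasure M (A \<inter> {\<omega>\<in>space M. Z 0 \<omega> = x}) / ennreal (pmf \<pi> x)) \<partial>count_space UNIV)"
    proof (intro nn_integral_mono)
      fix x
      have "ennreal (1 - d x - d y) \<le> ennreal (pmf (Kn n y) x / pmf \<pi> x)"
        using lower[of x y] lower[of y x] pos[of x] by (intro ennreal_leI) (simp add: field_simps)
      also have "\<dots> = ennreal (pmf (Kn n y) x) / ennreal (pmf \<pi> x)"
        using pos[of x] by (simp add: divide_ennreal)
      finally have "emeasure M (A \<inter> {\<omega>\<in>space M. Z 0 \<omega> = x}) * ennreal (1 - d x - d y)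
         \<le> emeasure M (A \<inter> {\<omega>\<in>space M. Z 0 \<omega> = x}) * (ennreal (pmf (Kn n y) x) / ennreal (pmf \<pi> x))"
        by (rule mult_left_mono) simp
      then show "emeasure M (A \<inter> {\<omega>\<in>space M. Z 0 \<omega> = x}) * ennreal (1 - d x - d y)
         \<le> ennreal (pmf (Kn n y) x) * (emeasure M (A \<inter> {\<omega>\<in>space M. Z 0 \<omega> = x}) / ennreal (pmf \<pi> x))"
        unfolding ennreal_times_divide by (simp only: mult.commute)
    qed
    also have "\<dots> = ?\<rho> y" by (simp add: nn_integral_measure_pmf)
    finally show ?thesis .
  qed
  have "(\<integral>\<omega>. indicator B \<omega> * r (Z (int n) \<omega>) \<partial>M)
      = (\<integral>\<omega>. (prob A - e) * indicator B \<omega> - prob A * (indicator B \<omega> * d (Z (int n) \<omega>)) \<partial>M)"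
    by (intro Bochner_Integration.integral_cong) (auto simp: r_def algebra_simps)
  also have "\<dots> = (prob A - e) * prob B - prob A * (\<integral>\<omega>. indicator B \<omega> * d (Z (int n) \<omega>) \<partial>M)"
    using iA(2)[of "int n"] iI(2) by (subst Bochner_Integration.integral_diff) auto
  finally have eq: "(\<integral>\<omega>. indicator B \<omega> * r (Z (int n) \<omega>) \<partial>M)
      = (prob A - e) * prob B - prob A * (\<integral>\<omega>. indicator B \<omega> * d (Z (int n) \<omega>) \<partial>M)" .
  have "integrable M (\<lambda>\<omega>. (prob A - e) * indicator B \<omega> - prob A * (indicator B \<omega> * d (Z (int n) \<omega>)))"
    using iA(2)[of "int n"] iI(2) by auto
  then have "integrable M (\<lambda>\<omega>. indicator B \<omega> * r (Z (int n) \<omega>))"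
    by (rule Bochner_Integration.integrable_cong[THEN iffD1, rotated 2]) (auto simp: r_def algebra_simps)
  then have "ennreal (\<integral>\<omega>. indicator B \<omega> * r (Z (int n) \<omega>) \<partial>M) \<le> (\<integral>\<^sup>+\<omega>. ennreal (indicator B \<omega> * r (Z (int n) \<omega>)) \<partial>M)"
    by (rule ennreal_integral_le_nn_integral)
  also have "\<dots> \<le> (\<integral>\<^sup>+\<omega>. indicator B \<omega> * ?\<rho> (Z (int n) \<omega>) \<partial>M)"
    using \<rho> by (intro nn_integral_mono) (auto simp: indicator_def)
  also have "\<dots> = ennreal (prob (A \<inter> B))"
    using past_future_Int[OF full A B] by (simp add: emeasure_eq_measure)
  finally have "(\<integral>\<omega>. indicator B \<omega> * r (Z (int n) \<omega>) \<partial>M) \<le> prob (A \<inter> B)"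
    by (simp add: ennreal_le_iff)
  then show ?thesis unfolding eq e_def by (simp add: algebra_simps)
qed

lemma mixing_bounds:
  fixes d :: "'s \<Rightarrow> real" and v :: "'s \<Rightarrow> real"
  assumes full: "set_pmf \<pi> = UNIV"
    and d: "\<And>x. 0 \<le> d x" "\<And>x. d x \<le> 1"
    and lower: "\<And>x y. pmf (Kn n x) y \<ge> pmf \<pi> y * (1 - d x - d y)"
  shows "alpha_mix M (\<lambda>k \<omega>. v (Z k \<omega>)) n \<le> beta_mix M (\<lambda>k \<omega>. v (Z k \<omega>)) n"
    and "beta_mix M (\<lambda>k \<omega>. v (Z k \<omega>)) n \<le> 2 * measure_pmf.expectation \<pi> d"
proof -
  let ?A = "sigma_gen_by M (\<lambda>k \<omega>. v (Z k \<omega>)) {..0}"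
  let ?B = "sigma_gen_by M (\<lambda>k \<omega>. v (Z k \<omega>)) {int n..}"
  have sub: "{(\<lambda>\<omega>. v (Z k \<omega>)) -` B \<inter> space M | k B. k \<in> I \<and> B \<in> sets borel} \<subseteq> Pow (space M)" for I
    by auto
  have sa: "sigma_algebra (space M) ?A" "sigma_algebra (space M) ?B"
    unfolding sigma_gen_by_def by (rule sigma_algebra_sigma_sets[OF sub])+
  have ev: "?A \<subseteq> events" "?B \<subseteq> events"
    using sigma_gen_by_past[of v] sigma_gen_by_future[of v n]
      sets.sigma_sets_subset[OF cylinders_events(1)] sets.sigma_sets_subset[OF cylinders_events(2)] by blast+
  have i: "integrable M (\<lambda>\<omega>. d (Z k \<omega>))" for k
    using d by (intro integrable_const_bound[where B=1]) auto
  have *: "(1 / 2) * (\<Sum>A\<in>P. \<Sum>B\<in>Q. \<bar>prob (A \<inter> B) - prob A * prob B\<bar>) \<le> 2 * measure_pmf.expectation \<pi> d"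
    if "finite P" "partition_on (space M) P" "P \<subseteq> ?A" "finite Q" "partition_on (space M) Q" "Q \<subseteq> ?B" for P Q
  proof -
    have "(1 / 2) * (\<Sum>A\<in>P. \<Sum>B\<in>Q. \<bar>prob (A \<inter> B) - prob A * prob B\<bar>)
        \<le> expectation (\<lambda>\<omega>. d (Z 0 \<omega>)) + expectation (\<lambda>\<omega>. d (Z (int n) \<omega>))"
    proof (rule partition_sum_bound[OF i i _ _ _ ev that])
      fix A B assume "A \<in> ?A" "B \<in> ?B"
      then show "prob (A \<inter> B) \<ge> prob A * prob B -
        (prob B * (\<integral>\<omega>. indicator A \<omega> * d (Z 0 \<omega>) \<partial>M) + prob A * (\<integral>\<omega>. indicator B \<omega> * d (Z (int n) \<omega>) \<partial>M))"
        using sigma_gen_by_past[of v] sigma_gen_by_future[of v n]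
        by (intro past_future_lower[OF full d lower]) auto
    qed (use d in auto)
    then show ?thesis by (simp add: expectation_Z)
  qed
  show "alpha_mix M (\<lambda>k \<omega>. v (Z k \<omega>)) n \<le> beta_mix M (\<lambda>k \<omega>. v (Z k \<omega>)) n"
    unfolding alpha_mix_def beta_mix_def by (rule alpha_coeff_le_beta_coeff[OF sa(1) ev(1) sa(2) ev(2) *])
  show "beta_mix M (\<lambda>k \<omega>. v (Z k \<omega>)) n \<le> 2 * measure_pmf.expectation \<pi> d"
    unfolding beta_mix_def
    by (rule beta_coeff_le[OF _ _ *]) (auto simp: sigma_gen_by_def sigma_sets_top)
qed

end

section \<open>A chain with hierarchical refreshment\<close>

definition sg :: "bool \<Rightarrow> real" where
  "sg b = (if b then 1 else - 1)"

lemma abs_mult_le_squares: "\<bar>x * y\<bar> \<le> x\<^sup>2 + (y :: real)\<^sup>2"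
proof -
  have "2 * (\<bar>x\<bar> * \<bar>y\<bar>) \<le> x\<^sup>2 + y\<^sup>2"
    using sum_squares_bound[of "\<bar>x\<bar>" "\<bar>y\<bar>"] by simp
  moreover have "0 \<le> \<bar>x\<bar> * \<bar>y\<bar>" by simp
  ultimately show ?thesis unfolding abs_mult by linarith
qed

lemma abs_sg [simp]: "\<bar>sg b\<bar> = 1"
  by (simp add: sg_def)

lemma sg_square [simp]: "sg b * sg b = 1" "(sg b)\<^sup>2 = 1"
  by (simp_all add: sg_def)

definition coin :: "bool pmf" where
  "coin = pmf_of_set UNIV"

lemma pmf_coin [simp]: "pmf coin b = 1 / 2"
  by (simp add: coin_def)

lemma expectation_coin:
  fixes f :: "bool \<Rightarrow> 'b :: {banach, second_countable_topology}"
  shows "measure_pmf.expectation coin f = (1 / 2) *\<^sub>R (f True + f False)"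
  by (simp add: coin_def integral_pmf_of_set UNIV_bool scaleR_conv_of_real[symmetric] add.commute
      flip: scaleR_right_distrib) (simp add: integral_measure_pmf[of UNIV] UNIV_bool scaleR_right_distrib coin_def[symmetric])

text \<open>At each step a level is drawn from \<open>lev\<close>. If the type of the current state does not exceed the
  level, the state is drawn afresh, the type from \<open>p\<close> conditioned on being at most the level;
  otherwise the state is kept. A state of type \<open>t\<close> is thus held with probability \<open>s t\<close>.\<close>

locale level_chain =
  fixes p lev :: "nat pmf"
  assumes full: "set_pmf p = UNIV"
    and lev_unbounded: "measure (measure_pmf lev) {..<t} < 1"
begin

definition \<pi> :: "(nat \<times> bool) pmf" where
  "\<pi> = pair_pmf p coin"

definition \<pi>\<^sub>l :: "nat \<Rightarrow> (nat \<times> bool) pmf" where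
  "\<pi>\<^sub>l l = pair_pmf (cond_pmf p {..l}) coin"

definition K :: "nat \<times> bool \<Rightarrow> (nat \<times> bool) pmf" where
  "K x = bind_pmf lev (\<lambda>l. if fst x \<le> l then \<pi>\<^sub>l l else return_pmf x)"

definition s :: "nat \<Rightarrow> real" where
  "s t = measure (measure_pmf lev) {..<t}"

definition P\<^sub>l :: "nat \<Rightarrow> real" where
  "P\<^sub>l l = measure (measure_pmf p) {..l}"

lemma s_bounds: "0 \<le> s t" "s t < 1" "s t \<le> 1"
  using lev_unbounded[of t] by (auto simp: s_def)

lemma pmf_p_pos: "pmf p t > 0"
  using full by (simp add: pmf_positive)

lemma P\<^sub>l_pos: "P\<^sub>l l > 0"
proof -
  have "pmf p 0 \<le> P\<^sub>l l"
    unfolding P\<^sub>l_def measure_pmf_single[symmetric] by (intro measure_pmf.finite_measure_mono) auto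
  then show ?thesis using pmf_p_pos[of 0] by linarith
qed

lemma P\<^sub>l_le_1: "P\<^sub>l l \<le> 1"
  by (simp add: P\<^sub>l_def)

lemma cond_nonempty: "set_pmf p \<inter> {..l} \<noteq> {}"
  by (auto simp: full)

lemma pmf_\<pi>: "pmf \<pi> x = pmf p (fst x) / 2"
  by (cases x) (simp add: \<pi>_def pmf_pair)

lemma set_\<pi>: "set_pmf \<pi> = UNIV"
  by (simp add: \<pi>_def full coin_def)

lemma pmf_\<pi>\<^sub>l: "pmf (\<pi>\<^sub>l l) x = (if fst x \<le> l then pmf \<pi> x / P\<^sub>l l else 0)"
  by (cases x) (simp add: \<pi>\<^sub>l_def pmf_pair pmf_\<pi> pmf_cond[OF cond_nonempty] P\<^sub>l_def)

lemma set_\<pi>\<^sub>l: "set_pmf (\<pi>\<^sub>l l) = {x. fst x \<le> l}"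
  by (auto simp: \<pi>\<^sub>l_def full set_cond_pmf[OF cond_nonempty] coin_def)

text \<open>A move from \<open>x\<close> to a different \<open>y\<close> happens at a level
  \<open>l\<close> that is at least both types and then has probability
  \<open>pmf \<pi> y / P\<^sub>l l\<close>; after multiplication by \<open>pmf \<pi> x\<close> this
  is symmetric.\<close>

lemma reversible_kernel: "reversible_kernel \<pi> K"
proof
  fix x y
  show "pmf \<pi> x * pmf (K x) y = pmf \<pi> y * pmf (K y) x"
  proof (cases "x = y")
    case False
    have "pmf \<pi> x * pmf (K x) y
      = measure_pmf.expectation lev (\<lambda>l. if fst x \<le> l \<and> fst y \<le> l then pmf \<pi> x * pmf \<pi> y / P\<^sub>l l else 0)"
      if "x \<noteq> y" for x y
    proof -
      have "pmf \<pi> x * pmf (K x) y = measure_pmf.expectation lev (\<lambda>l. pmf \<pi> x * pmf (if fst x \<le> l then \<pi>\<^sub>l l else return_pmf x) y)"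
        by (simp add: K_def pmf_bind)
      also have "\<dots> = measure_pmf.expectation lev (\<lambda>l. if fst x \<le> l \<and> fst y \<le> l then pmf \<pi> x * pmf \<pi> y / P\<^sub>l l else 0)"
        using that by (intro Bochner_Integration.integral_cong) (auto simp: pmf_\<pi>\<^sub>l)
      finally show ?thesis .
    qed
    note * = this
    show ?thesis
      unfolding *[OF False] *[OF not_sym[OF False]]
      by (intro Bochner_Integration.integral_cong) (auto simp: mult.commute)
  qed simp
qed

sublocale reversible_kernel \<pi> K
  by (rule reversible_kernel)

lemma K_pos: "pmf (K x) y > 0"
proof -
  have "\<exists>l \<in> set_pmf lev. max (fst x) (fst y) \<le> l"
  proof (rule ccontr)
    assume "\<not> ?thesis"
    then have "set_pmf lev \<subseteq> {..<max (fst x) (fst y)}" by auto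
    then have "measure (measure_pmf lev) {..<max (fst x) (fst y)} = 1"
      by (simp add: measure_pmf.prob_eq_1 AE_measure_pmf_iff subset_iff)
    then show False using lev_unbounded by (metis less_irrefl)
  qed
  then have "y \<in> set_pmf (K x)" by (auto simp: K_def set_\<pi>\<^sub>l)
  then show ?thesis by (simp add: pmf_positive)
qed

text \<open>The reason for refreshing from a conditioned law: of \<pi> conditioned on the types up
  to \<open>m\<close>, the part with types up to \<open>k\<close> is itself proportional to \<pi>.
  So a refresh at a level \<open>k < m\<close> changes nothing, while for \<open>k \<ge> m\<close>
  every state is refreshed.\<close>

lemma bind_\<pi>\<^sub>l_refresh: "bind_pmf (\<pi>\<^sub>l m) (\<lambda>x. if fst x \<le> k then \<pi>\<^sub>l k else return_pmf x) = \<pi>\<^sub>l (max m k)"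
proof (cases "m \<le> k")
  case True
  have "bind_pmf (\<pi>\<^sub>l m) (\<lambda>x. if fst x \<le> k then \<pi>\<^sub>l k else return_pmf x) = bind_pmf (\<pi>\<^sub>l m) (\<lambda>x. \<pi>\<^sub>l k)"
    using True by (intro bind_pmf_cong) (auto simp: set_\<pi>\<^sub>l)
  then show ?thesis using True by (simp add: max_def)
next
  case False
  then have km: "k < m" by simp
  have mk: "measure (measure_pmf (\<pi>\<^sub>l m)) {x. fst x \<le> k} = P\<^sub>l k / P\<^sub>l m"
  proof -
    have "measure (measure_pmf (\<pi>\<^sub>l m)) {x. fst x \<le> k} = measure (measure_pmf (map_pmf fst (\<pi>\<^sub>l m))) {..k}"
      by (simp add: vimage_def)
    also have "\<dots> = measure (measure_pmf (cond_pmf p {..m})) {..k}"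
      by (simp add: \<pi>\<^sub>l_def map_fst_pair_pmf)
    also have "\<dots> = P\<^sub>l k / P\<^sub>l m"
    proof -
      have "{..m} \<inter> {..k} = {..k}" using km by auto
      then show ?thesis
        using km unfolding P\<^sub>l_def
        by (subst cond_pmf.rep_eq[OF cond_nonempty]) (simp add: measure_uniform_measure emeasure_pmf_single
          measure_pmf.emeasure_eq_measure measure_def[of "uniform_measure _ _"] P\<^sub>l_pos[unfolded P\<^sub>l_def] emeasure_uniform_measure divide_ennreal)
    qed
    finally show ?thesis .
  qed
  show ?thesis
  proof (rule pmf_eqI)
    fix y
    have "pmf (bind_pmf (\<pi>\<^sub>l m) (\<lambda>x. if fst x \<le> k then \<pi>\<^sub>l k else return_pmf x)) y
      = measure_pmf.expectation (\<pi>\<^sub>l m) (\<lambda>x. indicator {x. fst x \<le> k} x * pmf (\<pi>\<^sub>l k) y + indicator ({y} \<inter> {x. \<not> fst x \<le> k}) x)"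
      unfolding pmf_bind by (intro Bochner_Integration.integral_cong) (auto simp: indicator_def)
    also have "\<dots> = P\<^sub>l k / P\<^sub>l m * pmf (\<pi>\<^sub>l k) y + measure (measure_pmf (\<pi>\<^sub>l m)) ({y} \<inter> {x. \<not> fst x \<le> k})"
      by (subst Bochner_Integration.integral_add) (auto simp: mk integrable_indicator_iff measure_pmf.emeasure_eq_measure intro!: integrable_mult_left)
    also have "measure (measure_pmf (\<pi>\<^sub>l m)) ({y} \<inter> {x. \<not> fst x \<le> k}) = (if fst y \<le> k then 0 else pmf (\<pi>\<^sub>l m) y)"
      by (cases "fst y \<le> k") (auto simp: measure_pmf_single Int_absorb2)
    finally show "pmf (bind_pmf (\<pi>\<^sub>l m) (\<lambda>x. if fst x \<le> k then \<pi>\<^sub>l k else return_pmf x)) y = pmf (\<pi>\<^sub>l (max m k)) y"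
      using km P\<^sub>l_pos[of k] by (auto simp: pmf_\<pi>\<^sub>l)
  qed
qed

lemma integrable_pmf_pmf: "integrable (measure_pmf q) (\<lambda>z. pmf (f z) y)"
  by (intro integrable_pmf_bounded[where B=1]) (auto simp: pmf_le_1)

text \<open>By \<open>bind_\<pi>\<^sub>l_refresh\<close> the law after \<open>n\<close> steps is a
  mixture of conditioned laws whose levels are at least \<open>m\<close>, and conditioning only
  increases the mass of an allowed state.\<close>

lemma pmf_\<pi>\<^sub>l_Kn: "fst y \<le> m \<Longrightarrow> pmf (bind_pmf (\<pi>\<^sub>l m) (Kn n)) y \<ge> pmf \<pi> y"
proof (induction n arbitrary: m)
  case 0
  have "bind_pmf (\<pi>\<^sub>l m) (Kn 0) = \<pi>\<^sub>l m" using bind_return_pmf'[of "\<pi>\<^sub>l m"] by (simp cong: bind_pmf_cong)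
  moreover have "pmf \<pi> y \<le> pmf \<pi> y / P\<^sub>l m"
    using P\<^sub>l_pos[of m] P\<^sub>l_le_1[of m] by (simp add: le_divide_eq mult_left_le)
  ultimately show ?case using 0 by (simp add: pmf_\<pi>\<^sub>l del: Kn_0)
next
  case (Suc n)
  have "bind_pmf (\<pi>\<^sub>l m) K = bind_pmf lev (\<lambda>k. \<pi>\<^sub>l (max m k))"
    unfolding K_def by (subst bind_commute_pmf) (simp add: bind_\<pi>\<^sub>l_refresh)
  then have "bind_pmf (\<pi>\<^sub>l m) (Kn (Suc n)) = bind_pmf lev (\<lambda>k. bind_pmf (\<pi>\<^sub>l (max m k)) (Kn n))"
    by (simp add: Kn_Suc flip: bind_assoc_pmf cong: bind_pmf_cong)
  then have "pmf (bind_pmf (\<pi>\<^sub>l m) (Kn (Suc n))) y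
     = measure_pmf.expectation lev (\<lambda>k. pmf (bind_pmf (\<pi>\<^sub>l (max m k)) (Kn n)) y)"
    by (simp only: pmf_bind[of lev])
  also have "\<dots> \<ge> measure_pmf.expectation lev (\<lambda>k. pmf \<pi> y)"
    using Suc by (intro integral_mono integrable_pmf_pmf) auto
  finally show ?case by simp
qed

text \<open>At the first level that reaches both types the state is refreshed from a conditioned law
  that allows \<open>y\<close>, and \<open>pmf_\<pi>\<^sub>l_Kn\<close> takes over; the power of
  \<open>s\<close> is the probability that no such level occurs in \<open>n\<close> steps.\<close>

lemma pmf_Kn_ge: "pmf (Kn n x) y \<ge> pmf \<pi> y * (1 - s (max (fst x) (fst y)) ^ n)"
proof (induction n arbitrary: x)
  case (Suc n)
  define m where "m = max (fst x) (fst y)"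
  let ?R = "\<lambda>l. if fst x \<le> l then \<pi>\<^sub>l l else return_pmf x"
  have le: "pmf \<pi> y * (1 - s m ^ n) \<le> pmf \<pi> y" using s_bounds(1)[of m] by (simp add: mult_left_le)
  have l: "pmf (bind_pmf (?R l) (Kn n)) y \<ge> (if l < m then pmf \<pi> y * (1 - s m ^ n) else pmf \<pi> y)" for l
  proof (cases "l < m")
    case True
    show ?thesis
    proof (cases "fst x \<le> l")
      case x: True
      \<comment> \<open>A refresh at a level below the maximum is possible only if \<open>y\<close>
        has the larger type; the fresh type is again smaller, so the maximum is unchanged.\<close>
      then have my: "m = fst y" "l < fst y" using True by (auto simp: m_def)
      have "pmf \<pi> y * (1 - s m ^ n) = measure_pmf.expectation (\<pi>\<^sub>l l) (\<lambda>z. pmf \<pi> y * (1 - s m ^ n))" by simp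
      also have "\<dots> \<le> measure_pmf.expectation (\<pi>\<^sub>l l) (\<lambda>z. pmf (Kn n z) y)"
      proof (intro integral_mono_AE integrable_pmf_pmf AE_pmfI)
        fix z assume "z \<in> set_pmf (\<pi>\<^sub>l l)"
        then have "max (fst z) (fst y) = m" using my by (auto simp: set_\<pi>\<^sub>l)
        then show "pmf \<pi> y * (1 - s m ^ n) \<le> pmf (Kn n z) y" using Suc[of z] by simp
      qed simp
      finally show ?thesis using x True by (simp add: pmf_bind)
    next
      case False
      then show ?thesis using True Suc[of x] by (simp add: bind_return_pmf m_def)
    qed
  next
    case False
    then show ?thesis using pmf_\<pi>\<^sub>l_Kn[of y l n] by (auto simp: m_def)
  qed
  have "Kn (Suc n) x = bind_pmf lev (\<lambda>l. bind_pmf (?R l) (Kn n))"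
    by (simp add: Kn_Suc K_def bind_assoc_pmf)
  then have "pmf (Kn (Suc n) x) y = measure_pmf.expectation lev (\<lambda>l. pmf (bind_pmf (?R l) (Kn n)) y)"
    by (simp only: pmf_bind[of lev])
  also have "\<dots> \<ge> measure_pmf.expectation lev (\<lambda>l. pmf \<pi> y - pmf \<pi> y * s m ^ n * indicator {..<m} l)"
  proof (intro integral_mono integrable_pmf_pmf)
    show "integrable (measure_pmf lev) (\<lambda>l. pmf \<pi> y - pmf \<pi> y * s m ^ n * indicator {..<m} l)"
      by (intro Bochner_Integration.integrable_diff integrable_mult_right)
         (auto simp: integrable_indicator_iff measure_pmf.emeasure_eq_measure)
    fix k
    show "pmf \<pi> y - pmf \<pi> y * s m ^ n * indicator {..<m} k \<le> pmf (bind_pmf (?R k) (Kn n)) y"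
      using l[of k] by (cases "k < m") (simp_all only: indicator_def lessThan_iff if_True if_False of_bool_eq, simp_all add: algebra_simps)
  qed
  also have "measure_pmf.expectation lev (\<lambda>l. pmf \<pi> y - pmf \<pi> y * s m ^ n * indicator {..<m} l)
     = pmf \<pi> y - pmf \<pi> y * s m ^ n * s m"
    by (subst Bochner_Integration.integral_diff)
       (auto simp: integrable_indicator_iff measure_pmf.emeasure_eq_measure s_def intro!: integrable_mult_right)
  finally show ?case by (simp add: m_def algebra_simps)
qed simp

lemma pmf_Kn_ge': "pmf (Kn n x) y \<ge> pmf \<pi> y * (1 - s (fst x) ^ n - s (fst y) ^ n)"
proof -
  have "s (max (fst x) (fst y)) ^ n \<le> s (fst x) ^ n + s (fst y) ^ n"
    using s_bounds(1) by (simp add: max_def)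
  then have "pmf \<pi> y * (1 - s (fst x) ^ n - s (fst y) ^ n) \<le> pmf \<pi> y * (1 - s (max (fst x) (fst y)) ^ n)"
    by (intro mult_left_mono) auto
  then show ?thesis using pmf_Kn_ge[of y x n] pmf_Kn_ge by (meson order_trans)
qed

lemma expectation_\<pi>_fst:
  fixes f :: "nat \<Rightarrow> 'b :: {banach, second_countable_topology}"
  shows "measure_pmf.expectation \<pi> (\<lambda>x. f (fst x)) = measure_pmf.expectation p f"
proof -
  have "measure_pmf.expectation p f = measure_pmf.expectation (map_pmf fst \<pi>) f"
    by (simp add: \<pi>_def map_fst_pair_pmf)
  then show ?thesis by simp
qed

lemma integrable_\<pi>_fst:
  fixes f :: "nat \<Rightarrow> 'b :: {banach, second_countable_topology}"
  shows "integrable (measure_pmf \<pi>) (\<lambda>x. f (fst x)) \<longleftrightarrow> integrable (measure_pmf p) f"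
proof -
  have "integrable (measure_pmf (map_pmf fst \<pi>)) f \<longleftrightarrow> integrable (measure_pmf \<pi>) (\<lambda>x. f (fst x))"
    unfolding map_pmf_rep_eq by (subst integrable_distr_eq) auto
  then show ?thesis by (simp add: \<pi>_def map_fst_pair_pmf)
qed

lemma expectation_pair_coin_odd:
  fixes h :: "nat \<Rightarrow> real"
  assumes "\<And>t. \<bar>h t\<bar> \<le> B"
  shows "measure_pmf.expectation (pair_pmf q coin) (\<lambda>x. h (fst x) * sg (snd x)) = 0"
  unfolding pair_pmf_def using assms
  by (subst integral_bind_pmf_real[where B=B] | simp add: abs_mult expectation_coin sg_def)+

text \<open>At a refresh the fair sign averages an odd function to 0, and with probability
  \<open>s (fst x)\<close> the state is kept.\<close>

lemma expectation_Kn_odd: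
  fixes h :: "nat \<Rightarrow> real"
  assumes h: "\<And>t. \<bar>h t\<bar> \<le> B"
  shows "measure_pmf.expectation (Kn n x) (\<lambda>x. h (fst x) * sg (snd x)) = s (fst x) ^ n * (h (fst x) * sg (snd x))"
proof -
  have b: "\<bar>h (fst x) * sg (snd x)\<bar> \<le> B" for x using h by (simp add: abs_mult)
  have K: "measure_pmf.expectation (K x) (\<lambda>x. h (fst x) * sg (snd x)) = s (fst x) * (h (fst x) * sg (snd x))"
    if h: "\<And>t. \<bar>h t\<bar> \<le> B" for h :: "nat \<Rightarrow> real" and B x
  proof -
    have b: "\<bar>h (fst x) * sg (snd x)\<bar> \<le> B" for x using h by (simp add: abs_mult)
    have "measure_pmf.expectation (K x) (\<lambda>x. h (fst x) * sg (snd x))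
      = measure_pmf.expectation lev (\<lambda>l. measure_pmf.expectation (if fst x \<le> l then \<pi>\<^sub>l l else return_pmf x) (\<lambda>x. h (fst x) * sg (snd x)))"
      unfolding K_def by (rule integral_bind_pmf_real[OF b])
    also have "\<dots> = measure_pmf.expectation lev (\<lambda>l. indicator {..<fst x} l * (h (fst x) * sg (snd x)))"
      by (intro Bochner_Integration.integral_cong refl)
         (auto simp: indicator_def \<pi>\<^sub>l_def expectation_pair_coin_odd[of h B, OF h])
    also have "\<dots> = s (fst x) * (h (fst x) * sg (snd x))" by (simp add: s_def)
    finally show ?thesis .
  qed
  show ?thesis
  proof (induction n arbitrary: x)
    case (Suc n)
    have "measure_pmf.expectation (Kn (Suc n) x) (\<lambda>x. h (fst x) * sg (snd x))
      = measure_pmf.expectation (K x) (\<lambda>y. measure_pmf.expectation (Kn n y) (\<lambda>x. h (fst x) * sg (snd x)))"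
      unfolding Kn_Suc by (rule integral_bind_pmf_real[OF b])
    also have "\<dots> = measure_pmf.expectation (K x) (\<lambda>x. (s (fst x) ^ n * h (fst x)) * sg (snd x))"
      by (simp add: Suc mult.assoc)
    also have "\<dots> = s (fst x) * ((s (fst x) ^ n * h (fst x)) * sg (snd x))"
    proof (rule K)
      fix t
      have "s t ^ n * \<bar>h t\<bar> \<le> 1 * B"
        using s_bounds(1,3)[of t] h[of t] by (intro mult_mono power_le_one) auto
      then show "\<bar>s t ^ n * h t\<bar> \<le> B" using s_bounds(1)[of t] by (simp add: abs_mult)
    qed
    finally show ?case by simp
  qed simp
qed

end

text \<open>The variance of a sum of \<open>n\<close> centred terms with unit variance and
  correlations \<open>s ^ |k - l|\<close>.\<close>

definition \<Gamma> :: "nat \<Rightarrow> real \<Rightarrow> real" where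
  "\<Gamma> n s = (\<Sum>k=1..n. \<Sum>l=1..n. s ^ nat \<bar>int k - int l\<bar>)"

locale level_process = level_chain p lev + chain_process M \<pi> K Z
  for p lev :: "nat pmf" and M :: "'a measure" and Z :: "int \<Rightarrow> 'a \<Rightarrow> nat \<times> bool"
begin

lemma mixing:
  fixes v :: "nat \<times> bool \<Rightarrow> real"
  shows "alpha_mix M (\<lambda>k \<omega>. v (Z k \<omega>)) n \<le> beta_mix M (\<lambda>k \<omega>. v (Z k \<omega>)) n"
    and "beta_mix M (\<lambda>k \<omega>. v (Z k \<omega>)) n \<le> 2 * measure_pmf.expectation p (\<lambda>t. s t ^ n)"
proof -
  have d: "0 \<le> s t ^ n" "s t ^ n \<le> 1" for t
    using s_bounds(1,3)[of t] by (auto intro: power_le_one)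
  show "alpha_mix M (\<lambda>k \<omega>. v (Z k \<omega>)) n \<le> beta_mix M (\<lambda>k \<omega>. v (Z k \<omega>)) n"
    by (rule mixing_bounds(1)[OF set_\<pi> d pmf_Kn_ge'])
  show "beta_mix M (\<lambda>k \<omega>. v (Z k \<omega>)) n \<le> 2 * measure_pmf.expectation p (\<lambda>t. s t ^ n)"
    using mixing_bounds(2)[OF set_\<pi> d pmf_Kn_ge'] by (simp add: expectation_\<pi>_fst[of "\<lambda>t. s t ^ n"])
qed

definition signed :: "(nat \<Rightarrow> real) \<Rightarrow> int \<Rightarrow> 'a \<Rightarrow> real" where
  "signed h k \<omega> = h (fst (Z k \<omega>)) * sg (snd (Z k \<omega>))"

lemma measurable_odd [measurable]: "signed h k \<in> borel_measurable M"
  unfolding signed_def[abs_def] by (rule measurable_compose[OF measurable_Z]) simp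

lemma odd_square: "(signed h k \<omega>)\<^sup>2 = (h (fst (Z k \<omega>)))\<^sup>2"
  by (simp add: signed_def power_mult_distrib)

lemma integrable_odd_square:
  assumes "integrable (measure_pmf p) (\<lambda>t. (h t)\<^sup>2)"
  shows "integrable M (\<lambda>\<omega>. (signed h k \<omega>)\<^sup>2)"
  unfolding odd_square using assms integrable_Z[of "\<lambda>x. (h (fst x))\<^sup>2" k] integrable_\<pi>_fst[of "\<lambda>t. (h t)\<^sup>2"] by simp

lemma integrable_odd:
  assumes "integrable (measure_pmf p) (\<lambda>t. (h t)\<^sup>2)"
  shows "integrable M (signed h k)"
  by (rule square_integrable_imp_integrable[OF measurable_odd integrable_odd_square[OF assms]])

lemma integrable_odd_odd:
  assumes "integrable (measure_pmf p) (\<lambda>t. (h t)\<^sup>2)"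
  shows "integrable M (\<lambda>\<omega>. signed h k \<omega> * signed h l \<omega>)"
proof (rule Bochner_Integration.integrable_bound)
  show "integrable M (\<lambda>\<omega>. (signed h k \<omega>)\<^sup>2 + (signed h l \<omega>)\<^sup>2)"
    using integrable_odd_square[OF assms] by auto
  show "AE \<omega> in M. norm (signed h k \<omega> * signed h l \<omega>) \<le> norm ((signed h k \<omega>)\<^sup>2 + (signed h l \<omega>)\<^sup>2)"
  proof (rule AE_I2)
    fix \<omega>
    show "norm (signed h k \<omega> * signed h l \<omega>) \<le> norm ((signed h k \<omega>)\<^sup>2 + (signed h l \<omega>)\<^sup>2)"
      using abs_mult_le_squares[of "signed h k \<omega>" "signed h l \<omega>"] by simp
  qed
qed simp

lemma expectation_odd_odd_bounded:
  assumes h: "\<And>t. \<bar>h t\<bar> \<le> B"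
  shows "expectation (\<lambda>\<omega>. signed h k \<omega> * signed h (k + int n) \<omega>) = measure_pmf.expectation p (\<lambda>t. (h t)\<^sup>2 * s t ^ n)"
proof -
  have b: "\<bar>h (fst x) * sg (snd x)\<bar> \<le> B" for x using h by (simp add: abs_mult)
  have "expectation (\<lambda>\<omega>. signed h k \<omega> * signed h (k + int n) \<omega>)
     = measure_pmf.expectation \<pi> (\<lambda>x. (h (fst x) * sg (snd x)) * (s (fst x) ^ n * (h (fst x) * sg (snd x))))"
    unfolding signed_def
    by (subst expectation_Z_Z[of "\<lambda>x. h (fst x) * sg (snd x)" B "\<lambda>x. h (fst x) * sg (snd x)" B, OF b b])
       (simp only: expectation_Kn_odd[of h B, OF h])
  also have "\<dots> = measure_pmf.expectation \<pi> (\<lambda>x. (h (fst x))\<^sup>2 * s (fst x) ^ n)"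
    by (intro Bochner_Integration.integral_cong refl) (simp add: sg_def power2_eq_square)
  finally show ?thesis by (simp add: expectation_\<pi>_fst[of "\<lambda>t. (h t)\<^sup>2 * s t ^ n"])
qed

lemma expectation_odd_odd:
  assumes h: "integrable (measure_pmf p) (\<lambda>t. (h t)\<^sup>2)"
  shows "expectation (\<lambda>\<omega>. signed h k \<omega> * signed h (k + int n) \<omega>) = measure_pmf.expectation p (\<lambda>t. (h t)\<^sup>2 * s t ^ n)"
proof -
  \<comment> \<open>Truncation at type \<open>N\<close> leaves finitely many values, so
    \<open>hN N\<close> is bounded; the passage to the limit is dominated by the squares through
    \<open>|x * y| \<le> x^2 + y^2\<close>.\<close>
  define hN where "hN N t = (if t \<le> N then h t else 0)" for N t
  have b: "\<bar>hN N t\<bar> \<le> (\<Sum>i\<le>N. \<bar>h i\<bar>)" for N t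
    by (auto simp: hN_def sum_nonneg intro!: member_le_sum)
  have lim: "(\<lambda>N. hN N t) \<longlonglongrightarrow> h t" for t
    by (rule tendsto_eventually) (auto simp: hN_def eventually_sequentially intro!: exI[of _ t])
  have le: "\<bar>hN N t\<bar> \<le> \<bar>h t\<bar>" for N t by (simp add: hN_def)
  have "(\<lambda>N. expectation (\<lambda>\<omega>. signed (hN N) k \<omega> * signed (hN N) (k + int n) \<omega>)) \<longlonglongrightarrow> expectation (\<lambda>\<omega>. signed h k \<omega> * signed h (k + int n) \<omega>)"
  proof (rule integral_dominated_convergence)
    show "integrable M (\<lambda>\<omega>. (signed h k \<omega>)\<^sup>2 + (signed h (k + int n) \<omega>)\<^sup>2)"
      using integrable_odd_square[OF h] by auto
    show "AE \<omega> in M. (\<lambda>N. signed (hN N) k \<omega> * signed (hN N) (k + int n) \<omega>) \<longlonglongrightarrow> signed h k \<omega> * signed h (k + int n) \<omega>"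
      unfolding signed_def by (intro AE_I2 tendsto_intros lim)
    fix N
    show "AE \<omega> in M. norm (signed (hN N) k \<omega> * signed (hN N) (k + int n) \<omega>) \<le> (signed h k \<omega>)\<^sup>2 + (signed h (k + int n) \<omega>)\<^sup>2"
    proof (rule AE_I2)
      fix \<omega>
      have "norm (signed (hN N) k \<omega> * signed (hN N) (k + int n) \<omega>) \<le> \<bar>signed h k \<omega>\<bar> * \<bar>signed h (k + int n) \<omega>\<bar>"
        unfolding signed_def by (simp add: abs_mult, intro mult_mono le) auto
      also have "\<dots> \<le> (signed h k \<omega>)\<^sup>2 + (signed h (k + int n) \<omega>)\<^sup>2"
        using abs_mult_le_squares[of "signed h k \<omega>" "signed h (k + int n) \<omega>"] by (simp add: abs_mult)
      finally show "norm (signed (hN N) k \<omega> * signed (hN N) (k + int n) \<omega>) \<le> (signed h k \<omega>)\<^sup>2 + (signed h (k + int n) \<omega>)\<^sup>2" .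
    qed
  qed auto
  moreover have "(\<lambda>N. measure_pmf.expectation p (\<lambda>t. (hN N t)\<^sup>2 * s t ^ n)) \<longlonglongrightarrow> measure_pmf.expectation p (\<lambda>t. (h t)\<^sup>2 * s t ^ n)"
  proof (rule integral_dominated_convergence[OF _ _ h])
    show "AE t in measure_pmf p. (\<lambda>N. (hN N t)\<^sup>2 * s t ^ n) \<longlonglongrightarrow> (h t)\<^sup>2 * s t ^ n"
      by (intro AE_I2 tendsto_intros lim)
    fix N
    show "AE t in measure_pmf p. norm ((hN N t)\<^sup>2 * s t ^ n) \<le> (h t)\<^sup>2"
    proof (rule AE_I2)
      fix t
      have "(hN N t)\<^sup>2 * s t ^ n \<le> (h t)\<^sup>2 * 1"
        using s_bounds(1,3)[of t] le[of N t] by (intro mult_mono power_le_one) (auto simp: abs_le_square_iff)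
      then show "norm ((hN N t)\<^sup>2 * s t ^ n) \<le> (h t)\<^sup>2" using s_bounds(1)[of t] by simp
    qed
  qed auto
  ultimately show ?thesis
    unfolding expectation_odd_odd_bounded[OF b] by (rule LIMSEQ_unique)
qed

lemma expectation_odd_odd':
  assumes h: "integrable (measure_pmf p) (\<lambda>t. (h t)\<^sup>2)"
  shows "expectation (\<lambda>\<omega>. signed h k \<omega> * signed h l \<omega>) = measure_pmf.expectation p (\<lambda>t. (h t)\<^sup>2 * s t ^ nat \<bar>k - l\<bar>)"
proof (cases "k \<le> l")
  case True
  then show ?thesis using expectation_odd_odd[OF h, of k "nat (l - k)"] by simp
next
  case False
  then show ?thesis using expectation_odd_odd[OF h, of l "nat (k - l)"] by (simp add: mult.commute)
qed

lemma expectation_odd: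
  assumes h: "integrable (measure_pmf p) (\<lambda>t. (h t)\<^sup>2)"
  shows "expectation (signed h k) = 0"
proof -
  have "expectation (signed h k) = measure_pmf.expectation \<pi> (\<lambda>x. h (fst x) * sg (snd x))"
    unfolding signed_def[abs_def] by (rule expectation_Z)
  moreover have "measure_pmf.expectation \<pi> (\<lambda>x. h (fst x) * sg (snd x))
      = measure_pmf.expectation (map_pmf (apsnd Not) \<pi>) (\<lambda>x. h (fst x) * sg (snd x))"
  proof -
    have "map_pmf Not coin = coin"
      unfolding coin_def by (subst map_pmf_of_set_inj) (auto simp: inj_def surj_def intro!: arg_cong[where f=pmf_of_set])
    then have "map_pmf (apsnd Not) \<pi> = \<pi>"
      unfolding \<pi>_def by (simp flip: pair_map_pmf2)
    then show ?thesis by simp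
  qed
  moreover have "\<dots> = - measure_pmf.expectation \<pi> (\<lambda>x. h (fst x) * sg (snd x))"
    by (simp add: sg_def if_distrib[of uminus] flip: Bochner_Integration.integral_minus) (intro Bochner_Integration.integral_cong, auto simp: sg_def)
  ultimately show ?thesis by simp
qed

lemma expectation_sum_odd_square:
  assumes h: "integrable (measure_pmf p) (\<lambda>t. (h t)\<^sup>2)"
  shows "integrable M (\<lambda>\<omega>. (\<Sum>k=1..n. signed h (int k) \<omega>)\<^sup>2)"
    and "expectation (\<lambda>\<omega>. (\<Sum>k=1..n. signed h (int k) \<omega>)\<^sup>2) = measure_pmf.expectation p (\<lambda>t. (h t)\<^sup>2 * \<Gamma> n (s t))"
proof -
  have eq: "(\<Sum>k=1..n. signed h (int k) \<omega>)\<^sup>2 = (\<Sum>k=1..n. \<Sum>l=1..n. signed h (int k) \<omega> * signed h (int l) \<omega>)" for \<omega>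
    by (simp add: power2_eq_square sum_product)
  show "integrable M (\<lambda>\<omega>. (\<Sum>k=1..n. signed h (int k) \<omega>)\<^sup>2)"
    unfolding eq using integrable_odd_odd[OF h] by (intro Bochner_Integration.integrable_sum)
  have i: "integrable (measure_pmf p) (\<lambda>t. (h t)\<^sup>2 * s t ^ m)" for m
  proof (rule Bochner_Integration.integrable_bound[OF h])
    show "AE t in measure_pmf p. norm ((h t)\<^sup>2 * s t ^ m) \<le> norm ((h t)\<^sup>2)"
      using s_bounds(1,3) by (intro AE_I2) (simp add: mult_left_le power_le_one)
  qed simp
  have "expectation (\<lambda>\<omega>. (\<Sum>k=1..n. signed h (int k) \<omega>)\<^sup>2)
     = (\<Sum>k=1..n. \<Sum>l=1..n. measure_pmf.expectation p (\<lambda>t. (h t)\<^sup>2 * s t ^ nat \<bar>int k - int l\<bar>))"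
    unfolding eq using integrable_odd_odd[OF h]
    by (simp add: expectation_odd_odd'[OF h])
  also have "\<dots> = measure_pmf.expectation p (\<lambda>t. (h t)\<^sup>2 * \<Gamma> n (s t))"
    unfolding \<Gamma>_def sum_distrib_left using i by simp
  finally show "expectation (\<lambda>\<omega>. (\<Sum>k=1..n. signed h (int k) \<omega>)\<^sup>2) = measure_pmf.expectation p (\<lambda>t. (h t)\<^sup>2 * \<Gamma> n (s t))" .
qed

end

section \<open>Characteristic functions of partial sums\<close>

context reversible_kernel
begin

text \<open>One step of the kernel weighted by \<open>F\<close>. Iterated on the constant 1 with a
  unimodular \<open>F\<close> it yields characteristic functions of sums along the chain.\<close>

definition G :: "('s \<Rightarrow> complex) \<Rightarrow> ('s \<Rightarrow> complex) \<Rightarrow> 's \<Rightarrow> complex" where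
  "G F u x = measure_pmf.expectation (K x) (\<lambda>y. F y * u y)"

lemma norm_expectation_le:
  fixes f :: "'b \<Rightarrow> complex"
  assumes "\<And>x. norm (f x) \<le> B"
  shows "norm (measure_pmf.expectation q f) \<le> B"
proof -
  have "integrable (measure_pmf q) f" by (rule integrable_pmf_bounded[OF assms])
  then have "norm (measure_pmf.expectation q f) \<le> measure_pmf.expectation q (\<lambda>x. norm (f x))"
    by simp
  also have "\<dots> \<le> B"
    using assms by (intro measure_pmf.integral_le_const integrable_pmf_bounded[where B=B]) auto
  finally show ?thesis .
qed

lemma norm_mult_le: "norm a \<le> 1 \<Longrightarrow> norm b \<le> B \<Longrightarrow> norm (a * b :: complex) \<le> B"
  using mult_mono[of "norm a" 1 "norm b" B] by (simp add: norm_mult)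

lemma G_bound:
  assumes F: "\<And>x. norm (F x) \<le> 1" and u: "\<And>x. norm (u x) \<le> B"
  shows "norm (G F u x) \<le> B"
  unfolding G_def by (intro norm_expectation_le norm_mult_le F u)

lemma Gn_bound:
  assumes F: "\<And>x. norm (F x) \<le> 1" and u: "\<And>x. norm (u x) \<le> B"
  shows "norm ((G F ^^ n) u x) \<le> B"
  by (induction n arbitrary: x) (auto simp: u intro: G_bound[OF F])

lemma G_linear:
  assumes F: "\<And>x. norm (F x) \<le> 1" and u: "\<And>x. norm (u x) \<le> B" and v: "\<And>x. norm (v x) \<le> C"
  shows "G F (\<lambda>x. \<alpha> * u x + v x) = (\<lambda>x. \<alpha> * G F u x + G F v x)"
proof
  fix x
  have "integrable (measure_pmf (K x)) (\<lambda>y. F y * u y)" "integrable (measure_pmf (K x)) (\<lambda>y. F y * v y)"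
    by (intro integrable_pmf_bounded[where B=B] norm_mult_le F u)
       (intro integrable_pmf_bounded[where B=C] norm_mult_le F v)
  then have "measure_pmf.expectation (K x) (\<lambda>y. \<alpha> * (F y * u y) + F y * v y) = \<alpha> * G F u x + G F v x"
    by (simp add: G_def)
  then show "G F (\<lambda>x. \<alpha> * u x + v x) x = \<alpha> * G F u x + G F v x"
    by (simp add: G_def algebra_simps)
qed

lemma Gn_linear:
  assumes F: "\<And>x. norm (F x) \<le> 1" and u: "\<And>x. norm (u x) \<le> B" and v: "\<And>x. norm (v x) \<le> C"
  shows "(G F ^^ n) (\<lambda>x. \<alpha> * u x + v x) = (\<lambda>x. \<alpha> * (G F ^^ n) u x + (G F ^^ n) v x)"
proof (induction n)
  case (Suc n)
  show ?case
    using G_linear[where F=F and u="(G F ^^ n) u" and B=B and v="(G F ^^ n) v" and C=C and \<alpha>=\<alpha>] Gn_bound[OF F] F u v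
    by (simp add: Suc)
qed simp

text \<open>A contraction in the L1 norm of the stationary law, by invariance of \<pi>. In this norm
  an error that is supported on rare types is small although it may be of order 1 there.\<close>

lemma G_L1:
  assumes F: "\<And>x. norm (F x) \<le> 1" and u: "\<And>x. norm (u x) \<le> B"
  shows "measure_pmf.expectation \<pi> (\<lambda>x. norm (G F u x)) \<le> measure_pmf.expectation \<pi> (\<lambda>x. norm (u x))"
proof -
  have b: "\<bar>norm (u x)\<bar> \<le> B" for x using u by simp
  have b': "\<bar>measure_pmf.expectation (K x) (\<lambda>y. norm (u y))\<bar> \<le> B" for x
  proof -
    have "measure_pmf.expectation (K x) (\<lambda>y. norm (u y)) \<le> B"
      using u by (intro measure_pmf.integral_le_const integrable_pmf_bounded[where B=B]) auto
    moreover have "0 \<le> measure_pmf.expectation (K x) (\<lambda>y. norm (u y))" by simp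
    ultimately show ?thesis by simp
  qed
  have "norm (G F u x) \<le> measure_pmf.expectation (K x) (\<lambda>y. norm (u y))" for x
  proof -
    have "norm (G F u x) \<le> measure_pmf.expectation (K x) (\<lambda>y. norm (F y * u y))"
      unfolding G_def by simp
    also have "\<dots> \<le> measure_pmf.expectation (K x) (\<lambda>y. norm (u y))"
      using F u by (intro integral_mono integrable_pmf_bounded[where B=B])
        (auto simp: norm_mult intro: mult_left_le_one_le order_trans[OF mult_left_le_one_le])
    finally show ?thesis .
  qed
  then have "measure_pmf.expectation \<pi> (\<lambda>x. norm (G F u x))
     \<le> measure_pmf.expectation \<pi> (\<lambda>x. measure_pmf.expectation (K x) (\<lambda>y. norm (u y)))"
    using G_bound[OF F u] b' by (intro integral_mono integrable_pmf_bounded[where B=B]) auto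
  also have "\<dots> = measure_pmf.expectation (bind_pmf \<pi> K) (\<lambda>y. norm (u y))"
    by (rule integral_bind_pmf_real[symmetric, OF b])
  finally show ?thesis by (simp add: bind_stationary)
qed

lemma Gn_L1:
  assumes F: "\<And>x. norm (F x) \<le> 1" and u: "\<And>x. norm (u x) \<le> B"
  shows "norm (measure_pmf.expectation \<pi> ((G F ^^ n) u)) \<le> measure_pmf.expectation \<pi> (\<lambda>x. norm (u x))"
proof -
  have "measure_pmf.expectation \<pi> (\<lambda>x. norm ((G F ^^ n) u x)) \<le> measure_pmf.expectation \<pi> (\<lambda>x. norm (u x))"
  proof (induction n)
    case (Suc n)
    have "measure_pmf.expectation \<pi> (\<lambda>x. norm ((G F ^^ Suc n) u x)) \<le> measure_pmf.expectation \<pi> (\<lambda>x. norm ((G F ^^ n) u x))"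
      using G_L1[OF F, of "(G F ^^ n) u" B] Gn_bound[OF F u] by simp
    then show ?case using Suc by linarith
  qed simp
  moreover have "norm (measure_pmf.expectation \<pi> ((G F ^^ n) u)) \<le> measure_pmf.expectation \<pi> (\<lambda>x. norm ((G F ^^ n) u x))"
    by simp
  ultimately show ?thesis by linarith
qed

text \<open>With \<open>G F w = l * w + d\<close>, each of the \<open>n\<close> applications adds
  the L1 norm of \<open>d\<close>, and nothing is amplified since \<open>norm l \<le> 1\<close> and
  \<open>G F\<close> is a contraction.\<close>

lemma expectation_Gn_perturb:
  assumes F: "\<And>x. norm (F x) \<le> 1" and w: "\<And>x. norm (w x) \<le> B" and l: "norm l \<le> 1"
    and e: "measure_pmf.expectation \<pi> (\<lambda>x. norm (G F w x - l * w x)) \<le> e"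
  shows "norm (measure_pmf.expectation \<pi> ((G F ^^ n) w) - l ^ n * measure_pmf.expectation \<pi> w) \<le> real n * e"
proof (induction n)
  case (Suc n)
  define d where "d x = G F w x - l * w x" for x
  have d: "norm (d x) \<le> 2 * B" for x
  proof -
    have "norm (d x) \<le> norm (G F w x) + norm (l * w x)" unfolding d_def by (rule norm_triangle_ineq4)
    also have "norm (G F w x) \<le> B" by (rule G_bound[OF F w])
    also have "norm (l * w x) \<le> B" by (rule norm_mult_le[OF l w])
    finally show ?thesis by simp
  qed
  have "(G F ^^ Suc n) w = (G F ^^ n) (\<lambda>x. l * w x + d x)"
    unfolding funpow_Suc_right by (simp add: d_def comp_def)
  also have "\<dots> = (\<lambda>x. l * (G F ^^ n) w x + (G F ^^ n) d x)"
    by (rule Gn_linear[OF F w d])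
  finally have "measure_pmf.expectation \<pi> ((G F ^^ Suc n) w)
      = l * measure_pmf.expectation \<pi> ((G F ^^ n) w) + measure_pmf.expectation \<pi> ((G F ^^ n) d)"
    using integrable_pmf_bounded[where f="(G F ^^ n) w" and p=\<pi>, OF Gn_bound[OF F w]]
      integrable_pmf_bounded[where f="(G F ^^ n) d" and p=\<pi>, OF Gn_bound[OF F d]] by simp
  then have "measure_pmf.expectation \<pi> ((G F ^^ Suc n) w) - l ^ Suc n * measure_pmf.expectation \<pi> w
     = l * (measure_pmf.expectation \<pi> ((G F ^^ n) w) - l ^ n * measure_pmf.expectation \<pi> w)
       + measure_pmf.expectation \<pi> ((G F ^^ n) d)"
    by (simp add: algebra_simps)
  also have "norm \<dots> \<le> norm (l * (measure_pmf.expectation \<pi> ((G F ^^ n) w) - l ^ n * measure_pmf.expectation \<pi> w))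
      + norm (measure_pmf.expectation \<pi> ((G F ^^ n) d))"
    by (rule norm_triangle_ineq)
  also have "\<dots> \<le> real n * e + e"
  proof (intro add_mono)
    show "norm (l * (measure_pmf.expectation \<pi> ((G F ^^ n) w) - l ^ n * measure_pmf.expectation \<pi> w)) \<le> real n * e"
      by (rule norm_mult_le[OF l Suc])
    show "norm (measure_pmf.expectation \<pi> ((G F ^^ n) d)) \<le> e"
      by (rule order_trans[OF Gn_L1[where F=F and u=d and B="2 * B", OF F d] e[folded d_def]])
  qed
  finally show ?case by (simp add: algebra_simps)
qed simp

end

lemma (in chain_process) expectation_prod_G:
  assumes F: "\<And>x. norm (F x) \<le> 1"
  shows "expectation (\<lambda>\<omega>. \<Prod>i=1..n. F (Z (int i) \<omega>)) = measure_pmf.expectation \<pi> ((G F ^^ n) (\<lambda>_. 1))"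
proof -
  have "G F = (\<lambda>u x. measure_pmf.expectation (K x) (\<lambda>y. F y * u y))"
    by (simp add: fun_eq_iff G_def)
  then show ?thesis using expectation_prod[OF F] by simp
qed

section \<open>The contribution of a single type to the characteristic function\<close>

context level_chain
begin

text \<open>The probability that a step draws \<open>j\<close> as fresh type, used or not. Such a
  draw comes with a level at least \<open>j\<close>, so from a type below \<open>j\<close> it is the
  probability of entering \<open>j\<close>.\<close>

definition \<zeta> :: "nat \<Rightarrow> real" where
  "\<zeta> j = measure_pmf.expectation lev (\<lambda>l. pmf (cond_pmf p {..l}) j)"

definition \<tau> :: "nat \<Rightarrow> real" where
  "\<tau> j = measure (measure_pmf p) {j<..}"

lemma pmf_cond_p: "pmf (cond_pmf p {..l}) j = (if j \<le> l then pmf p j / P\<^sub>l l else 0)"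
  by (simp add: pmf_cond[OF cond_nonempty] P\<^sub>l_def)

lemma P\<^sub>l_mono: "l \<le> l' \<Longrightarrow> P\<^sub>l l \<le> P\<^sub>l l'"
  unfolding P\<^sub>l_def by (intro measure_pmf.finite_measure_mono) auto

lemma P\<^sub>l_\<tau>: "P\<^sub>l j = 1 - \<tau> j"
proof -
  have "measure (measure_pmf p) (UNIV - {..j}) = 1 - measure (measure_pmf p) {..j}"
    using measure_pmf.prob_compl[of "{..j}" p] by simp
  moreover have "UNIV - {..j} = {j<..}" by auto
  ultimately show ?thesis by (simp add: P\<^sub>l_def \<tau>_def)
qed

lemma \<zeta>_bounds: "(1 - s j) * pmf p j \<le> \<zeta> j" "\<zeta> j \<le> (1 - s j) * pmf p j / P\<^sub>l j" "0 < \<zeta> j" "\<zeta> j \<le> 1"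
proof -
  have m: "measure_pmf.expectation lev (\<lambda>l. indicator {j..} l * c) = (1 - s j) * c" for c :: real
  proof -
    have "measure (measure_pmf lev) (UNIV - {..<j}) = 1 - s j"
      using measure_pmf.prob_compl[of "{..<j}" lev] by (simp add: s_def)
    moreover have "UNIV - {..<j} = {j..}" by auto
    ultimately show ?thesis by simp
  qed
  have i: "integrable (measure_pmf lev) (\<lambda>l. indicator {j..} l * c)" for c :: real
    by (intro integrable_mult_left) (auto simp: integrable_indicator_iff measure_pmf.emeasure_eq_measure)
  have "(1 - s j) * pmf p j = measure_pmf.expectation lev (\<lambda>l. indicator {j..} l * pmf p j)"
    by (rule m[symmetric])
  also have "\<dots> \<le> \<zeta> j"
    unfolding \<zeta>_def using P\<^sub>l_pos P\<^sub>l_le_1 pmf_p_pos[of j]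
    by (intro integral_mono i integrable_pmf_pmf) (auto simp: pmf_cond_p indicator_def le_divide_eq mult_left_le)
  finally show 1: "(1 - s j) * pmf p j \<le> \<zeta> j" .
  have "\<zeta> j \<le> measure_pmf.expectation lev (\<lambda>l. indicator {j..} l * (pmf p j / P\<^sub>l j))"
    unfolding \<zeta>_def using P\<^sub>l_pos P\<^sub>l_mono
    by (intro integral_mono i integrable_pmf_pmf) (auto simp: pmf_cond_p indicator_def intro!: divide_left_mono mult_pos_pos)
  also have "\<dots> = (1 - s j) * (pmf p j / P\<^sub>l j)" by (rule m)
  finally show "\<zeta> j \<le> (1 - s j) * pmf p j / P\<^sub>l j" by simp
  show "0 < \<zeta> j" using 1 s_bounds(2)[of j] pmf_p_pos[of j] by (smt (verit) mult_pos_pos)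
  show "\<zeta> j \<le> 1"
    unfolding \<zeta>_def by (intro measure_pmf.integral_le_const integrable_pmf_pmf) (auto simp: pmf_le_1)
qed

lemma expectation_pair_coin:
  fixes u :: "nat \<times> bool \<Rightarrow> complex"
  assumes "\<And>x. norm (u x) \<le> B"
  shows "measure_pmf.expectation (pair_pmf q coin) u = measure_pmf.expectation q (\<lambda>t. (u (t, True) + u (t, False)) / 2)"
proof -
  have "measure_pmf.expectation (pair_pmf q coin) u
     = measure_pmf.expectation q (\<lambda>t. measure_pmf.expectation (bind_pmf coin (\<lambda>b. return_pmf (t, b))) u)"
    unfolding pair_pmf_def by (rule integral_bind_pmf_complex[OF assms])
  also have "\<dots> = measure_pmf.expectation q (\<lambda>t. (u (t, True) + u (t, False)) / 2)"
    by (simp add: integral_bind_pmf_complex[OF assms] expectation_coin scaleR_conv_of_real)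
  finally show ?thesis .
qed

definition F\<^sub>j :: "nat \<Rightarrow> real \<Rightarrow> nat \<times> bool \<Rightarrow> complex" where
  "F\<^sub>j j \<theta> x = (if fst x = j then cis (\<theta> * sg (snd x)) else 1)"

text \<open>On type \<open>j\<close> this is the generating function of the remaining holding time:
  there are \<open>k\<close> further stays with probability \<open>(1 - s j) * s j ^ k\<close>, each
  with phase \<theta> times the sign.\<close>

definition w\<^sub>j :: "nat \<Rightarrow> real \<Rightarrow> nat \<times> bool \<Rightarrow> complex" where
  "w\<^sub>j j \<theta> x = (if fst x = j then of_real (1 - s j) / (1 - of_real (s j) * cis (\<theta> * sg (snd x))) else 1)"

text \<open>The characteristic function of a complete cluster with random sign: its first visit
  contributes \<open>F\<^sub>j\<close>, the remaining ones \<open>w\<^sub>j\<close>.\<close>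

definition \<kappa> :: "nat \<Rightarrow> real \<Rightarrow> complex" where
  "\<kappa> j \<theta> = (F\<^sub>j j \<theta> (j, True) * w\<^sub>j j \<theta> (j, True) + F\<^sub>j j \<theta> (j, False) * w\<^sub>j j \<theta> (j, False)) / 2"

lemma norm_F\<^sub>j: "norm (F\<^sub>j j \<theta> x) \<le> 1"
  by (simp add: F\<^sub>j_def)

lemma denominator_ne: "1 - of_real (s j) * cis \<theta> \<noteq> 0" and norm_denominator: "1 - s j \<le> norm (1 - of_real (s j) * cis \<theta>)"
proof -
  have "norm (1 :: complex) - norm (of_real (s j) * cis \<theta>) \<le> norm (1 - of_real (s j) * cis \<theta>)"
    by (rule norm_triangle_ineq2)
  then show *: "1 - s j \<le> norm (1 - of_real (s j) * cis \<theta>)"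
    using s_bounds(1)[of j] by (simp add: norm_mult)
  show "1 - of_real (s j) * cis \<theta> \<noteq> 0" using * s_bounds(2)[of j] by auto
qed

lemma norm_w\<^sub>j: "norm (w\<^sub>j j \<theta> x) \<le> 1"
proof (cases "fst x = j")
  case True
  have "norm (1 - complex_of_real (s j) * cis (\<theta> * sg (snd x))) > 0" using denominator_ne by simp
  then show ?thesis
    using True norm_denominator[of j "\<theta> * sg (snd x)"] s_bounds(3)[of j]
    by (simp add: w\<^sub>j_def norm_divide divide_le_eq del: of_real_diff)
qed (simp add: w\<^sub>j_def)

lemma norm_\<kappa>: "norm (\<kappa> j \<theta>) \<le> 1"
proof -
  have "norm (F\<^sub>j j \<theta> (j, b) * w\<^sub>j j \<theta> (j, b)) \<le> 1" for b
    by (rule norm_mult_le[OF norm_F\<^sub>j norm_w\<^sub>j])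
  then have "norm (F\<^sub>j j \<theta> (j, True) * w\<^sub>j j \<theta> (j, True) + F\<^sub>j j \<theta> (j, False) * w\<^sub>j j \<theta> (j, False)) \<le> 1 + 1"
    by (intro norm_triangle_le add_mono)
  then show ?thesis by (simp add: \<kappa>_def norm_divide)
qed

lemma w\<^sub>j_fixpoint: "fst x = j \<Longrightarrow> of_real (s j) * (F\<^sub>j j \<theta> x * w\<^sub>j j \<theta> x) + of_real (1 - s j) = w\<^sub>j j \<theta> x"
  using denominator_ne[of j "\<theta> * sg (snd x)"]
  by (simp add: w\<^sub>j_def F\<^sub>j_def divide_simps del: of_real_diff) (simp add: algebra_simps)

text \<open>Up to an error on types \<open>\<ge> j\<close>, which are rare, \<open>w\<^sub>j\<close> is an eigenfunction.\<close>

lemma expectation_char_type: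
  "norm (measure_pmf.expectation \<pi> ((G (F\<^sub>j j \<theta>) ^^ n) (\<lambda>_. 1)) - (1 - of_real (\<zeta> j) * (1 - \<kappa> j \<theta>)) ^ n)
    \<le> 4 * pmf p j + real n * (4 * \<zeta> j * pmf p j + 2 * \<tau> j)"
proof -
  let ?F = "F\<^sub>j j \<theta>" and ?w = "w\<^sub>j j \<theta>" and ?k = "\<kappa> j \<theta>"
  \<comment> \<open>The factor per step: with probability \<open>\<zeta> j\<close> a new cluster
    starts and contributes \<open>\<kappa> j \<theta>\<close>, otherwise the factor is 1.\<close>
  define l where "l = 1 - of_real (\<zeta> j) * (1 - ?k)"
  note F = norm_F\<^sub>j[of j \<theta>] and w = norm_w\<^sub>j[of j \<theta>]
  have l1: "norm l \<le> 1"
  proof -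
    have "l = of_real (1 - \<zeta> j) + of_real (\<zeta> j) * ?k" by (simp add: l_def algebra_simps)
    then have "norm l \<le> norm (of_real (1 - \<zeta> j) :: complex) + norm (of_real (\<zeta> j) * ?k)"
      by (metis norm_triangle_ineq)
    also have "\<dots> \<le> (1 - \<zeta> j) + \<zeta> j * 1"
      using \<zeta>_bounds(3,4)[of j] norm_\<kappa>[of j \<theta>]
      by (intro add_mono) (simp_all add: norm_mult del: of_real_diff)
    finally show ?thesis by simp
  qed
  have Fw: "norm (?F y * ?w y) \<le> 1" for y by (rule norm_mult_le[OF F w])
  have \<pi>l: "measure_pmf.expectation (\<pi>\<^sub>l m) (\<lambda>y. ?F y * ?w y) = 1 - of_real (pmf (cond_pmf p {..m}) j) * (1 - ?k)" for m
  proof -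
    have "measure_pmf.expectation (\<pi>\<^sub>l m) (\<lambda>y. ?F y * ?w y)
       = measure_pmf.expectation (cond_pmf p {..m}) (\<lambda>t. 1 - (indicator {j} t) *\<^sub>R (1 - ?k))"
      unfolding \<pi>\<^sub>l_def expectation_pair_coin[where u="\<lambda>y. ?F y * ?w y", OF Fw]
      by (intro Bochner_Integration.integral_cong refl) (auto simp: indicator_def \<kappa>_def F\<^sub>j_def w\<^sub>j_def)
    also have "\<dots> = 1 - of_real (pmf (cond_pmf p {..m}) j) * (1 - ?k)"
      by (subst Bochner_Integration.integral_diff)
         (auto simp: measure_pmf_single scaleR_conv_of_real integrable_indicator_iff measure_pmf.emeasure_eq_measure intro!: integrable_scaleR_left)
    finally show ?thesis .
  qed
  have Gw: "G ?F ?w x = measure_pmf.expectation lev (\<lambda>m. if fst x \<le> m then 1 - of_real (pmf (cond_pmf p {..m}) j) * (1 - ?k) else ?F x * ?w x)" for x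
    unfolding G_def K_def integral_bind_pmf_complex[where f="\<lambda>y. ?F y * ?w y", OF Fw]
    by (intro Bochner_Integration.integral_cong refl) (simp add: \<pi>l)
  have iz: "integrable (measure_pmf lev) (\<lambda>m. complex_of_real (pmf (cond_pmf p {..m}) j) * c)" for c
    by (intro integrable_mult_left integrable_of_real integrable_pmf_pmf)
  have zc: "measure_pmf.expectation lev (\<lambda>m. complex_of_real (pmf (cond_pmf p {..m}) j) * c) = of_real (\<zeta> j) * c" for c
    using integrable_pmf_pmf[of lev "\<lambda>m. cond_pmf p {..m}" j] by (simp add: \<zeta>_def)
  have low: "G ?F ?w x = l" if "fst x < j" for x
  proof -
    have "G ?F ?w x = measure_pmf.expectation lev (\<lambda>m. 1 - of_real (pmf (cond_pmf p {..m}) j) * (1 - ?k))"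
      unfolding Gw using that by (intro Bochner_Integration.integral_cong refl) (auto simp: pmf_cond_p F\<^sub>j_def w\<^sub>j_def)
    also have "\<dots> = l" unfolding l_def using iz[of "1 - ?k"] zc[of "1 - ?k"] by (subst Bochner_Integration.integral_diff) auto
    finally show ?thesis .
  qed
  have eq: "G ?F ?w x = ?w x - of_real (\<zeta> j) * (1 - ?k)" if "fst x = j" for x
  proof -
    have "G ?F ?w x = measure_pmf.expectation lev (\<lambda>m. 1 + indicator {..<j} m *\<^sub>R (?F x * ?w x - 1) - of_real (pmf (cond_pmf p {..m}) j) * (1 - ?k))"
      unfolding Gw using that by (intro Bochner_Integration.integral_cong refl) (auto simp: pmf_cond_p indicator_def)
    also have "\<dots> = 1 + of_real (s j) * (?F x * ?w x - 1) - of_real (\<zeta> j) * (1 - ?k)"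
    proof -
      have i1: "integrable (measure_pmf lev) (\<lambda>m. indicator {..<j} m *\<^sub>R (?F x * ?w x - 1))"
        by (intro integrable_scaleR_left) (auto simp: integrable_indicator_iff measure_pmf.emeasure_eq_measure)
      then show ?thesis
        using iz[of "1 - ?k"] zc[of "1 - ?k"]
        by (simp add: s_def scaleR_conv_of_real)
    qed
    also have "\<dots> = ?w x - of_real (\<zeta> j) * (1 - ?k)"
      using w\<^sub>j_fixpoint[OF that, of \<theta>] by (simp add: algebra_simps)
    finally show ?thesis .
  qed
  have k2: "norm (1 - ?k) \<le> 2"
    using norm_triangle_ineq4[of 1 ?k] norm_\<kappa>[of j \<theta>] by simp
  \<comment> \<open>Below \<open>j\<close> the eigenvalue equation is exact. On type
    \<open>j\<close> the defect is \<open>\<zeta> j * (1 - ?k) * (?w x - 1)\<close>, of norm at most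
    \<open>4 * \<zeta> j\<close>; above \<open>j\<close> the trivial bound 2 is used.\<close>
  have err: "norm (G ?F ?w x - l * ?w x) \<le> 4 * \<zeta> j * indicator {j} (fst x) + 2 * indicator {j<..} (fst x)" for x
  proof (cases "fst x" j rule: linorder_cases)
    case less
    then show ?thesis using low by (simp add: w\<^sub>j_def)
  next
    case equal
    have "G ?F ?w x - l * ?w x = of_real (\<zeta> j) * (1 - ?k) * (?w x - 1)"
      using eq[OF equal] by (simp add: l_def algebra_simps)
    also have "norm \<dots> \<le> \<zeta> j * 2 * 2"
      unfolding norm_mult using k2 \<zeta>_bounds(3)[of j] norm_triangle_ineq4[of "?w x" 1] w[of x]
      by (intro mult_mono) auto
    finally show ?thesis using equal by simp
  next
    case greater
    have "norm (G ?F ?w x - l * ?w x) \<le> norm (G ?F ?w x) + norm (l * ?w x)" by (rule norm_triangle_ineq4)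
    also have "\<dots> \<le> 1 + 1"
      by (intro add_mono G_bound norm_mult_le F w l1)
    finally show ?thesis using greater by simp
  qed
  have ib: "integrable (measure_pmf q) (\<lambda>x. c * indicator A (f x))" for c :: real and q :: "'q pmf" and A :: "nat set" and f
    by (intro integrable_pmf_bounded[where B="\<bar>c\<bar>"]) (auto simp: indicator_def)
  have pj: "measure_pmf.expectation \<pi> (\<lambda>x. c * indicator {j} (fst x)) = c * pmf p j" for c :: real
    unfolding expectation_\<pi>_fst[of "\<lambda>t. c * indicator {j} t"] by (simp add: measure_pmf_single)
  have tj: "measure_pmf.expectation \<pi> (\<lambda>x. c * indicator {j<..} (fst x)) = c * \<tau> j" for c :: real
    unfolding expectation_\<pi>_fst[of "\<lambda>t. c * indicator {j<..} t"] by (simp add: \<tau>_def)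
  have "measure_pmf.expectation \<pi> (\<lambda>x. norm (G ?F ?w x - l * ?w x))
     \<le> measure_pmf.expectation \<pi> (\<lambda>x. 4 * \<zeta> j * indicator {j} (fst x) + 2 * indicator {j<..} (fst x))"
  proof (intro integral_mono err)
    have "norm (G ?F ?w x - l * ?w x) \<le> 4 * \<zeta> j + 2" for x
    proof -
      have "4 * \<zeta> j * indicator {j} (fst x) \<le> 4 * \<zeta> j" "2 * indicator {j<..} (fst x) \<le> (2 :: real)"
        using \<zeta>_bounds(3)[of j] by (auto simp: indicator_def)
      then show ?thesis using err[of x] by linarith
    qed
    then show "integrable (measure_pmf \<pi>) (\<lambda>x. norm (G ?F ?w x - l * ?w x))"
      by (intro integrable_pmf_bounded[where B="4 * \<zeta> j + 2"]) auto
  qed (intro Bochner_Integration.integrable_add ib)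
  also have "\<dots> = 4 * \<zeta> j * pmf p j + 2 * \<tau> j"
    by (subst Bochner_Integration.integral_add[OF ib ib]) (simp only: pj tj)
  finally have e: "measure_pmf.expectation \<pi> (\<lambda>x. norm (G ?F ?w x - l * ?w x)) \<le> 4 * \<zeta> j * pmf p j + 2 * \<tau> j" .
  have 1: "norm (measure_pmf.expectation \<pi> ((G ?F ^^ n) ?w) - l ^ n * measure_pmf.expectation \<pi> ?w)
     \<le> real n * (4 * \<zeta> j * pmf p j + 2 * \<tau> j)"
    by (rule expectation_Gn_perturb[OF F w l1 e])
  have w1: "norm (1 - ?w x) \<le> 2 * indicator {j} (fst x)" for x
  proof (cases "fst x = j")
    case True
    then show ?thesis using norm_triangle_ineq4[of 1 "?w x"] w[of x] by simp
  qed (simp add: w\<^sub>j_def)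
  have w1b: "norm (1 - ?w x) \<le> 2" for x using norm_triangle_ineq4[of 1 "?w x"] w[of x] by simp
  have Ew: "measure_pmf.expectation \<pi> (\<lambda>x. norm (1 - ?w x)) \<le> 2 * pmf p j"
  proof -
    have "measure_pmf.expectation \<pi> (\<lambda>x. norm (1 - ?w x)) \<le> measure_pmf.expectation \<pi> (\<lambda>x. 2 * indicator {j} (fst x))"
      using w1b by (intro integral_mono ib w1) (auto intro!: integrable_pmf_bounded[where B=2])
    then show ?thesis by (simp only: pj)
  qed
  \<comment> \<open>\<open>?w\<close> differs from 1 only on type \<open>j\<close>. Replacing 1 by
    \<open>?w\<close> as initial function here, and the mean of \<open>?w\<close> by 1 in the next
    estimate, costs \<open>2 * pmf p j\<close> each.\<close>
  have 2: "norm (measure_pmf.expectation \<pi> ((G ?F ^^ n) (\<lambda>_. 1)) - measure_pmf.expectation \<pi> ((G ?F ^^ n) ?w)) \<le> 2 * pmf p j"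
  proof -
    have "(G ?F ^^ n) (\<lambda>x. 1 * ?w x + (1 - ?w x)) = (\<lambda>x. 1 * (G ?F ^^ n) ?w x + (G ?F ^^ n) (\<lambda>x. 1 - ?w x) x)"
      by (rule Gn_linear[OF F w w1b])
    then have "(G ?F ^^ n) (\<lambda>_. 1) = (\<lambda>x. (G ?F ^^ n) ?w x + (G ?F ^^ n) (\<lambda>x. 1 - ?w x) x)" by simp
    then have "measure_pmf.expectation \<pi> ((G ?F ^^ n) (\<lambda>_. 1)) - measure_pmf.expectation \<pi> ((G ?F ^^ n) ?w)
       = measure_pmf.expectation \<pi> ((G ?F ^^ n) (\<lambda>x. 1 - ?w x))"
      using integrable_pmf_bounded[where f="(G ?F ^^ n) ?w" and p=\<pi>, OF Gn_bound[OF F w]]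
        integrable_pmf_bounded[where f="(G ?F ^^ n) (\<lambda>x. 1 - ?w x)" and p=\<pi>, OF Gn_bound[where F="?F" and u="\<lambda>x. 1 - ?w x", OF F w1b]] by simp
    then show ?thesis
      using order_trans[OF Gn_L1[where F="?F" and u="\<lambda>x. 1 - ?w x" and n=n, OF F w1b] Ew] by simp
  qed
  have 3: "norm (l ^ n * measure_pmf.expectation \<pi> ?w - l ^ n) \<le> 2 * pmf p j"
  proof -
    have "1 - measure_pmf.expectation \<pi> ?w = measure_pmf.expectation \<pi> (\<lambda>x. 1 - ?w x)"
      using integrable_pmf_bounded[of ?w 1 \<pi>, OF w] by simp
    then have "norm (1 - measure_pmf.expectation \<pi> ?w) \<le> measure_pmf.expectation \<pi> (\<lambda>x. norm (1 - ?w x))"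
      by (simp only: integral_norm_bound)
    then have a: "norm (measure_pmf.expectation \<pi> ?w - 1) \<le> 2 * pmf p j" using Ew by (simp add: norm_minus_commute)
    have "l ^ n * measure_pmf.expectation \<pi> ?w - l ^ n = l ^ n * (measure_pmf.expectation \<pi> ?w - 1)" by (simp add: algebra_simps)
    moreover have "norm (l ^ n) \<le> 1" using l1 by (simp add: norm_power power_le_one)
    ultimately show ?thesis using norm_mult_le[OF _ a] by simp
  qed
  have "norm (measure_pmf.expectation \<pi> ((G ?F ^^ n) (\<lambda>_. 1)) - l ^ n)
    \<le> 2 * pmf p j + (real n * (4 * \<zeta> j * pmf p j + 2 * \<tau> j) + 2 * pmf p j)"
  proof -
    have "measure_pmf.expectation \<pi> ((G ?F ^^ n) (\<lambda>_. 1)) - l ^ n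
      = (measure_pmf.expectation \<pi> ((G ?F ^^ n) (\<lambda>_. 1)) - measure_pmf.expectation \<pi> ((G ?F ^^ n) ?w))
       + ((measure_pmf.expectation \<pi> ((G ?F ^^ n) ?w) - l ^ n * measure_pmf.expectation \<pi> ?w)
        + (l ^ n * measure_pmf.expectation \<pi> ?w - l ^ n))" by simp
    also have "norm \<dots> \<le> 2 * pmf p j + (real n * (4 * \<zeta> j * pmf p j + 2 * \<tau> j) + 2 * pmf p j)"
      by (intro norm_triangle_le add_mono 1 2 3)
    finally show ?thesis .
  qed
  then show ?thesis by (simp add: l_def)
qed

end

section \<open>The compound Poisson limit law\<close>

lemma exp_decay_integral:
  fixes c :: complex
  assumes c: "Re c < 0"
  shows "set_integrable lborel {0<..} (\<lambda>x. exp (c * of_real x))"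
    and "(LBINT x:{0<..}. exp (c * of_real x)) = - 1 / c"
proof -
  have ne: "c \<noteq> 0" using c by auto
  have ei: "einterval 0 \<infinity> = {0<..}" by (auto simp: einterval_def)
  have i1: "set_integrable lborel (einterval 0 \<infinity>) (\<lambda>x. exp (Re c * x))"
  proof (rule interval_integral_FTC_nonneg(1))
    show "DERIV (\<lambda>x. exp (Re c * x) / Re c) x :> exp (Re c * x)" for x
      using c by (auto intro!: derivative_eq_intros)
    show "(((\<lambda>x. exp (Re c * x) / Re c) \<circ> real_of_ereal) \<longlongrightarrow> 1 / Re c) (at_right 0)"
    proof -
      have "isCont (\<lambda>x. exp (Re c * x) / Re c) 0" using c by (intro continuous_intros) auto
      then show ?thesis
        unfolding zero_ereal_def ereal_tendsto_simps by (simp add: isCont_def filterlim_at_split)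
    qed
    have "((\<lambda>x. exp (Re c * x) / Re c) \<longlongrightarrow> 0) at_top"
      using c by real_asymp
    then show "(((\<lambda>x. exp (Re c * x) / Re c) \<circ> real_of_ereal) \<longlongrightarrow> 0) (at_left \<infinity>)"
      unfolding ereal_tendsto_simps .
  qed auto
  then show i: "set_integrable lborel {0<..} (\<lambda>x. exp (c * of_real x))"
    unfolding ei set_integrable_def
    by (rule Bochner_Integration.integrable_bound) (auto simp: indicator_def norm_exp_eq_Re)
  have "(LBINT x=0..\<infinity>. exp (c * of_real x)) = 0 - 1 / c"
  proof (rule interval_integral_FTC_integrable)
    show "((\<lambda>x. exp (c * of_real x) / c) has_vector_derivative exp (c * of_real x)) (at x)" for x
    proof -
      have "((\<lambda>z. exp (c * z) / c) has_field_derivative exp (c * of_real x)) (at (of_real x))"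
        using ne by (auto intro!: derivative_eq_intros)
      then show ?thesis by (rule has_vector_derivative_real_field)
    qed
    show "isCont (\<lambda>x. exp (c * complex_of_real x)) x" for x by (intro continuous_intros)
    show "set_integrable lborel (einterval 0 \<infinity>) (\<lambda>x. exp (c * of_real x))" using i by (simp add: ei)
    show "(((\<lambda>x. exp (c * of_real x) / c) \<circ> real_of_ereal) \<longlongrightarrow> 1 / c) (at_right 0)"
      unfolding zero_ereal_def ereal_tendsto_simps by (rule tendsto_eq_intros ne | simp)+
    have "((\<lambda>x. norm (exp (c * complex_of_real x) / c)) \<longlongrightarrow> 0) at_top"
    proof -
      have "((\<lambda>x. exp (Re c * x) / norm c) \<longlongrightarrow> 0) at_top"
        using c ne by real_asymp
      then show ?thesis by (simp add: norm_divide norm_exp_eq_Re)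
    qed
    then have "((\<lambda>x. exp (c * complex_of_real x) / c) \<longlongrightarrow> 0) at_top"
      by (rule tendsto_norm_zero_cancel)
    then show "(((\<lambda>x. exp (c * of_real x) / c) \<circ> real_of_ereal) \<longlongrightarrow> 0) (at_left \<infinity>)"
      unfolding ereal_tendsto_simps .
  qed auto
  then show "(LBINT x:{0<..}. exp (c * of_real x)) = - 1 / c"
    unfolding zero_ereal_def interval_integral_to_infinity_eq by simp
qed

lemma laplace_integral:
  "integrable lborel (\<lambda>x. iexp (t * x) * of_real (exp (- \<bar>x\<bar>) / 2))"
  "integral\<^sup>L lborel (\<lambda>x. iexp (t * x) * of_real (exp (- \<bar>x\<bar>) / 2)) = of_real (1 / (1 + t\<^sup>2))"
proof -
  let ?f = "\<lambda>x. iexp (t * x) * complex_of_real (exp (- \<bar>x\<bar>) / 2)"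
  define c where "c = \<i> * of_real t - 1"
  define d where "d = - \<i> * of_real t - 1"
  have cd: "Re c < 0" "Re d < 0" by (simp_all add: c_def d_def)
  let ?p = "\<lambda>x. (indicator {0<..} x *\<^sub>R exp (c * of_real x)) / 2 :: complex"
  let ?m = "\<lambda>x. (indicator {0<..} x *\<^sub>R exp (d * of_real x)) / 2 :: complex"
  have ip: "integrable lborel ?p" "integral\<^sup>L lborel ?p = - 1 / (2 * c)"
    using exp_decay_integral[OF cd(1)] by (auto simp: set_integrable_def set_lebesgue_integral_def)
  have im: "integrable lborel ?m" "integral\<^sup>L lborel ?m = - 1 / (2 * d)"
    using exp_decay_integral[OF cd(2)] by (auto simp: set_integrable_def set_lebesgue_integral_def)
  have im': "integrable lborel (\<lambda>x. ?m (- x))" "integral\<^sup>L lborel (\<lambda>x. ?m (- x)) = - 1 / (2 * d)"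
    using im lborel_integrable_real_affine[of ?m "- 1" 0] lborel_integral_real_affine[of "- 1" ?m 0] by simp_all
  \<comment> \<open>The two halves both miss the point 0, which is a null set.\<close>
  have ae: "AE x in lborel. ?f x = ?p x + ?m (- x)"
  proof -
    have "AE x in lborel. x \<noteq> (0 :: real)" by (rule AE_lborel_singleton)
    then show ?thesis
    proof eventually_elim
      case (elim x)
      then consider "x > 0" | "x < 0" by linarith
      then show ?case
      proof cases
        case 1
        then have "?f x = exp (\<i> * of_real (t * x)) * exp (of_real (- x)) / 2" by (simp add: exp_of_real[symmetric])
        also have "\<dots> = exp (c * of_real x) / 2" by (simp add: c_def algebra_simps flip: exp_add)
        finally show ?thesis using 1 by simp
      next
        case 2
        then have "?f x = exp (\<i> * of_real (t * x)) * exp (of_real x) / 2" by (simp add: exp_of_real[symmetric])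
        also have "\<dots> = exp (d * of_real (- x)) / 2" by (simp add: d_def algebra_simps flip: exp_add)
        finally show ?thesis using 2 by simp
      qed
    qed
  qed
  have m: "?f \<in> borel_measurable lborel" "(\<lambda>x. ?p x + ?m (- x)) \<in> borel_measurable lborel"
    using ip(1) im'(1) by (auto intro: borel_measurable_add borel_measurable_integrable)
  show "integrable lborel ?f"
    by (subst integrable_cong_AE[OF m ae]) (intro Bochner_Integration.integrable_add ip im')
  have "integral\<^sup>L lborel ?f = integral\<^sup>L lborel (\<lambda>x. ?p x + ?m (- x))"
    by (rule integral_cong_AE[OF m ae])
  also have "\<dots> = - 1 / (2 * c) + - 1 / (2 * d)"
    using ip im' by (simp add: mult.commute)
  also have "\<dots> = of_real (1 / (1 + t\<^sup>2))"
  proof -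
    have ne: "c \<noteq> 0" "d \<noteq> 0" using cd by auto
    have cd1: "c * d = of_real (1 + t\<^sup>2)" "c + d = - 2"
      by (simp_all add: c_def d_def algebra_simps power2_eq_square flip: of_real_mult)
    have "- 1 / (2 * c) + - 1 / (2 * d) = - (c + d) / (2 * (c * d))"
      using ne by (simp add: field_simps)
    moreover have "- (- 2) / (2 * z) = 1 / z" for z :: complex by simp
    ultimately show ?thesis unfolding cd1 by (simp only: of_real_divide of_real_1)
  qed
  finally show "integral\<^sup>L lborel ?f = of_real (1 / (1 + t\<^sup>2))" .
qed

lemma prob_space_laplace: "prob_space laplace_measure"
proof
  have i: "integrable lborel (\<lambda>x :: real. exp (- \<bar>x\<bar>) / 2)"
    using integrable_norm[OF laplace_integral(1)[of 0]] by simp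
  have "of_real (integral\<^sup>L lborel (\<lambda>x :: real. exp (- \<bar>x\<bar>) / 2)) = (1 :: complex)"
    using laplace_integral(2)[of 0] by (subst integral_complex_of_real[symmetric]) simp
  then have "integral\<^sup>L lborel (\<lambda>x :: real. exp (- \<bar>x\<bar>) / 2) = 1"
    using of_real_eq_1_iff by blast
  then show "emeasure laplace_measure (space laplace_measure) = 1"
    using i by (simp add: laplace_measure_def emeasure_density nn_integral_eq_integral)
qed

lemma sets_laplace [simp, measurable_cong]: "sets laplace_measure = sets borel"
  by (simp add: laplace_measure_def)

lemma char_laplace: "char laplace_measure t = of_real (1 / (1 + t\<^sup>2))"
proof -
  have "char laplace_measure t = integral\<^sup>L lborel (\<lambda>x. (exp (- \<bar>x\<bar>) / 2) *\<^sub>R iexp (t * x))"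
    unfolding char_def laplace_measure_def by (rule integral_density) auto
  also have "\<dots> = integral\<^sup>L lborel (\<lambda>x. iexp (t * x) * of_real (exp (- \<bar>x\<bar>) / 2))"
    by (simp add: scaleR_conv_of_real mult.commute)
  also note laplace_integral(2)
  finally show ?thesis .
qed

lemma char_laplace_sum:
  "char (distr (\<Pi>\<^sub>M k\<in>(UNIV :: nat set). laplace_measure) borel (\<lambda>\<eta>. \<Sum>k=1..N. \<eta> k)) t = of_real (1 / (1 + t\<^sup>2)) ^ N"
proof -
  interpret L: prob_space laplace_measure by (rule prob_space_laplace)
  interpret P: product_prob_space "\<lambda>_ :: nat. laplace_measure" UNIV ..
  let ?P = "\<Pi>\<^sub>M k\<in>(UNIV :: nat set). laplace_measure"
  have d: "distr ?P borel (\<lambda>\<eta>. \<eta> k) = laplace_measure" for k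
  proof -
    have "distr ?P borel (\<lambda>\<eta>. \<eta> k) = distr ?P laplace_measure (\<lambda>\<eta>. \<eta> k)"
      by (rule distr_cong) auto
    also have "\<dots> = laplace_measure" by (rule P.PiM_component) simp
    finally show ?thesis .
  qed
  have "P.indep_vars (\<lambda>_. borel) (\<lambda>k \<eta>. \<eta> k) UNIV"
  proof (subst P.indep_vars_iff_distr_eq_PiM)
    show "distr ?P (\<Pi>\<^sub>M i\<in>UNIV. borel) (\<lambda>x. \<lambda>i\<in>UNIV. x i) = (\<Pi>\<^sub>M i\<in>UNIV. distr ?P borel (\<lambda>x. x i))"
    proof -
      have "distr ?P (\<Pi>\<^sub>M i\<in>UNIV. borel) (\<lambda>x. \<lambda>i\<in>UNIV. x i) = distr ?P ?P (\<lambda>x. x)"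
        by (rule distr_cong) (auto intro!: sets_PiM_cong)
      then show ?thesis unfolding d by simp
    qed
  qed auto
  then have "P.indep_vars (\<lambda>_. borel) (\<lambda>k \<eta>. \<eta> k) {1..N}"
    by (rule P.indep_vars_subset) simp
  from P.char_distr_sum[OF this, of t] show ?thesis
    by (simp add: d char_laplace)
qed

lemma measurable_random_sum:
  "(\<lambda>(N, \<eta>). \<Sum>k=1..N. \<eta> k) \<in> borel_measurable (measure_pmf (poisson_pmf 1) \<Otimes>\<^sub>M (\<Pi>\<^sub>M k\<in>(UNIV :: nat set). laplace_measure))"
proof -
  have s: "sets (measure_pmf (poisson_pmf 1) \<Otimes>\<^sub>M (\<Pi>\<^sub>M k\<in>(UNIV :: nat set). laplace_measure))
     = sets (count_space UNIV \<Otimes>\<^sub>M (\<Pi>\<^sub>M k\<in>(UNIV :: nat set). laplace_measure))"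
    by (intro sets_pair_measure_cong) auto
  have "(\<lambda>p. \<Sum>k=1..fst p. snd p k) \<in> borel_measurable (count_space UNIV \<Otimes>\<^sub>M (\<Pi>\<^sub>M k\<in>(UNIV :: nat set). laplace_measure))"
    by (rule measurable_compose_countable[where g=fst and f="\<lambda>N p. \<Sum>k=1..N. snd p k"]) measurable
  then show ?thesis
    unfolding measurable_cong_sets[OF s refl] by (simp add: case_prod_beta')
qed

lemma real_distribution_mu_P1sL: "real_distribution mu_P1sL"
proof -
  interpret L: prob_space laplace_measure by (rule prob_space_laplace)
  interpret P: product_prob_space "\<lambda>_ :: nat. laplace_measure" UNIV ..
  interpret N: prob_space "measure_pmf (poisson_pmf 1)" by (rule measure_pmf.prob_space_axioms)
  interpret NP: pair_prob_space "measure_pmf (poisson_pmf 1)" "\<Pi>\<^sub>M k\<in>(UNIV :: nat set). laplace_measure" ..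
  show ?thesis
    unfolding mu_P1sL_def by (rule NP.real_distribution_distr[OF measurable_random_sum])
qed

text \<open>Given \<open>N\<close> the sum has characteristic function \<open>z ^ N\<close>, and
  averaging over the Poisson law gives its generating function \<open>exp (z - 1)\<close>.\<close>

lemma char_mu_P1sL: "char mu_P1sL t = exp (of_real (1 / (1 + t\<^sup>2)) - 1)"
proof -
  interpret L: prob_space laplace_measure by (rule prob_space_laplace)
  interpret P: product_prob_space "\<lambda>_ :: nat. laplace_measure" UNIV ..
  interpret N: prob_space "measure_pmf (poisson_pmf 1)" by (rule measure_pmf.prob_space_axioms)
  let ?P = "\<Pi>\<^sub>M k\<in>(UNIV :: nat set). laplace_measure"
  interpret NP: pair_prob_space "measure_pmf (poisson_pmf 1)" ?P ..
  define z where "z = complex_of_real (1 / (1 + t\<^sup>2))"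
  have z: "norm z \<le> 1"
    unfolding z_def norm_of_real by (simp add: divide_le_eq add_pos_nonneg add_nonneg_eq_0_iff)
  have m[measurable]: "(\<lambda>p. iexp (t * (case p of (N, \<eta>) \<Rightarrow> \<Sum>k=1..N. \<eta> k))) \<in> borel_measurable (measure_pmf (poisson_pmf 1) \<Otimes>\<^sub>M ?P)"
    using measurable_random_sum by measurable
  have "char mu_P1sL t = integral\<^sup>L (measure_pmf (poisson_pmf 1) \<Otimes>\<^sub>M ?P) (\<lambda>p. iexp (t * (case p of (N, \<eta>) \<Rightarrow> \<Sum>k=1..N. \<eta> k)))"
    unfolding char_def mu_P1sL_def by (rule integral_distr[OF measurable_random_sum]) auto
  also have "\<dots> = integral\<^sup>L (measure_pmf (poisson_pmf 1)) (\<lambda>N. integral\<^sup>L ?P (\<lambda>\<eta>. iexp (t * (\<Sum>k=1..N. \<eta> k))))"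
  proof (subst NP.integral_fst'[symmetric])
    show "integrable (measure_pmf (poisson_pmf 1) \<Otimes>\<^sub>M ?P) (\<lambda>p. iexp (t * (case p of (N, \<eta>) \<Rightarrow> \<Sum>k=1..N. \<eta> k)))"
      by (rule NP.integrable_const_bound[where B=1]) auto
  qed simp
  also have "\<dots> = integral\<^sup>L (measure_pmf (poisson_pmf 1)) (\<lambda>N. z ^ N)"
  proof (rule Bochner_Integration.integral_cong[OF refl])
    fix N
    have "char (distr ?P borel (\<lambda>\<eta>. \<Sum>k=1..N. \<eta> k)) t = integral\<^sup>L ?P (\<lambda>\<eta>. iexp (t * (\<Sum>k=1..N. \<eta> k)))"
      unfolding char_def by (rule integral_distr) measurable
    then show "integral\<^sup>L ?P (\<lambda>\<eta>. iexp (t * (\<Sum>k=1..N. \<eta> k))) = z ^ N"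
      unfolding char_laplace_sum z_def by simp
  qed
  also have "\<dots> = integral\<^sup>L (count_space UNIV) (\<lambda>N. pmf (poisson_pmf 1) N *\<^sub>R z ^ N)"
    unfolding measure_pmf_eq_density by (rule integral_density) auto
  also have "\<dots> = exp (z - 1)"
  proof -
    have "summable (\<lambda>N. norm (exp (- 1 :: complex) * (z ^ N /\<^sub>R fact N)))"
      using summable_mult[OF summable_norm_exp[of z], of "norm (exp (- 1) :: complex)"] by (simp add: norm_mult mult_ac)
    then have i: "integrable (count_space UNIV) (\<lambda>N. exp (- 1 :: complex) * (z ^ N /\<^sub>R fact N))"
      by (simp add: integrable_count_space_nat_iff)
    have s: "(\<lambda>N. exp (- 1 :: complex) * (z ^ N /\<^sub>R fact N)) sums (exp (- 1) * exp z)"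
      by (intro sums_mult exp_converges)
    have "(\<lambda>N. pmf (poisson_pmf 1) N *\<^sub>R z ^ N) = (\<lambda>N. exp (- 1 :: complex) * (z ^ N /\<^sub>R fact N))"
    proof
      fix N
      have "complex_of_real (exp (- 1)) = exp (- 1)" by (metis exp_of_real of_real_1 of_real_minus)
      then show "pmf (poisson_pmf 1) N *\<^sub>R z ^ N = exp (- 1 :: complex) * (z ^ N /\<^sub>R fact N)"
        by (simp add: scaleR_conv_of_real divide_inverse)
    qed
    then have "integral\<^sup>L (count_space UNIV) (\<lambda>N. pmf (poisson_pmf 1) N *\<^sub>R z ^ N) = exp (- 1) * exp z"
      using sums_integral_count_space_nat[OF i] s sums_unique2 by metis
    then show ?thesis by (simp add: exp_diff exp_minus divide_inverse mult.commute)
  qed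
  finally show ?thesis by (simp add: z_def)
qed

section \<open>Decay of the characteristic function\<close>

text \<open>From \<open>cos x = 1 - 2 * (sin y)^2\<close> with \<open>y = |x| / 2\<close> and
  \<open>sin y \<ge> 5 / 6 * y\<close>; the resulting coefficient 25/72 of \<open>x^2\<close>
  exceeds 1/4.\<close>

lemma abs_cos_le_exp:
  fixes x :: real
  assumes "\<bar>x\<bar> \<le> 1"
  shows "\<bar>cos x\<bar> \<le> exp (- (x\<^sup>2 / 4))"
proof -
  define y where "y = \<bar>x\<bar> / 2"
  have y: "0 \<le> y" "y \<le> 1 / 2" using assms by (auto simp: y_def)
  have "\<bar>sin y - (\<Sum>m<3. sin_coeff m * y ^ m)\<bar> \<le> inverse (fact 3) * \<bar>y\<bar> ^ 3"
    by (rule Maclaurin_sin_bound)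
  then have "\<bar>sin y - y\<bar> \<le> y ^ 3 / 6"
    using y by (simp add: sin_coeff_def numeral_3_eq_3 fact_reduce)
  then have "sin y \<ge> y - y ^ 3 / 6" by linarith
  then have "sin y \<ge> y - y * (y * y) / 6" by (simp add: power3_eq_cube mult.assoc)
  moreover have "y * (y * y) \<le> y * 1"
    using y by (intro mult_left_mono mult_le_one) auto
  ultimately have "sin y \<ge> 5 / 6 * y" by simp
  then have "(sin y)\<^sup>2 \<ge> (5 / 6 * y)\<^sup>2" using y by (intro power_mono) auto
  moreover have "cos x = 1 - 2 * (sin y)\<^sup>2"
    using cos_double_sin[of y] by (simp add: y_def)
  moreover have "(5 / 6 * y)\<^sup>2 * 2 \<ge> x\<^sup>2 / 4"
    by (simp add: y_def power_mult_distrib power_divide)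
  ultimately have "cos x \<le> 1 + - (x\<^sup>2 / 4)" by linarith
  also have "\<dots> \<le> exp (- (x\<^sup>2 / 4))" by (rule exp_ge_add_one_self)
  finally have "cos x \<le> exp (- (x\<^sup>2 / 4))" .
  moreover have "cos x \<ge> 0"
    using assms pi_gt3 by (intro cos_ge_zero) auto
  ultimately show ?thesis by simp
qed

text \<open>Functionals of innovation lists are bounded only for lists of the right length, so the
  bound is asked for on the support alone.\<close>

lemma integral_bind_pmf_real':
  fixes f :: "'b \<Rightarrow> real"
  assumes "\<And>x. x \<in> set_pmf (bind_pmf p K) \<Longrightarrow> \<bar>f x\<bar> \<le> B"
  shows "measure_pmf.expectation (bind_pmf p K) f
       = measure_pmf.expectation p (\<lambda>x. measure_pmf.expectation (K x) f)"
proof -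
  define g where "g x = (if \<bar>f x\<bar> \<le> B then f x else 0)" for x
  have B: "B \<ge> 0"
    using assms set_pmf_not_empty[of "bind_pmf p K"] by (meson abs_ge_zero ex_in_conv order_trans)
  have "measure_pmf.expectation (bind_pmf p K) f = measure_pmf.expectation (bind_pmf p K) g"
    using assms by (intro integral_cong_AE) (auto simp: g_def AE_measure_pmf_iff)
  also have "\<dots> = measure_pmf.expectation p (\<lambda>x. measure_pmf.expectation (K x) g)"
    using B by (intro integral_bind_pmf_real[where B=B]) (auto simp: g_def)
  also have "\<dots> = measure_pmf.expectation p (\<lambda>x. measure_pmf.expectation (K x) f)"
  proof (rule integral_cong_AE)
    show "AE x in measure_pmf p. measure_pmf.expectation (K x) g = measure_pmf.expectation (K x) f"
    proof (rule AE_pmfI)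
      fix x assume "x \<in> set_pmf p"
      then show "measure_pmf.expectation (K x) g = measure_pmf.expectation (K x) f"
        using assms by (intro integral_cong_AE) (auto simp: g_def AE_measure_pmf_iff)
    qed
  qed auto
  finally show ?thesis .
qed

lemma replicate_pmf_Suc': "replicate_pmf (Suc n) q = bind_pmf q (\<lambda>u. map_pmf ((#) u) (replicate_pmf n q))"
  by (simp add: map_pmf_def)

lemma length_replicate_pmf: "us \<in> set_pmf (replicate_pmf n q) \<Longrightarrow> length us = n"
  by (simp add: set_replicate_pmf)

lemma expectation_replicate_Suc:
  fixes f :: "'u list \<Rightarrow> real"
  assumes "\<And>us. length us = Suc n \<Longrightarrow> \<bar>f us\<bar> \<le> B"
  shows "measure_pmf.expectation (replicate_pmf (Suc n) q) f
    = measure_pmf.expectation q (\<lambda>u. measure_pmf.expectation (replicate_pmf n q) (\<lambda>us. f (u # us)))"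
proof -
  have "measure_pmf.expectation (replicate_pmf (Suc n) q) f
    = measure_pmf.expectation q (\<lambda>u. measure_pmf.expectation (map_pmf ((#) u) (replicate_pmf n q)) f)"
    unfolding replicate_pmf_Suc'
  proof (rule integral_bind_pmf_real')
    fix us assume "us \<in> set_pmf (q \<bind> (\<lambda>u. map_pmf ((#) u) (replicate_pmf n q)))"
    then have "us \<in> set_pmf (replicate_pmf (Suc n) q)" by (simp only: replicate_pmf_Suc')
    then show "\<bar>f us\<bar> \<le> B" using assms length_replicate_pmf by blast
  qed
  then show ?thesis by simp
qed

text \<open>The list records the successive innovations \<open>(level, fresh type)\<close>. The signs of the clusters
  being independent given the innovations, they are integrated out: \<open>\<Psi>\<close> is the product of the
  cosines of the cluster phases, \<open>c\<close> being the phase of the current cluster of type \<open>i\<close>.\<close>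

fun \<Psi> :: "(nat \<Rightarrow> real) \<Rightarrow> nat \<Rightarrow> real \<Rightarrow> (nat \<times> nat) list \<Rightarrow> real" where
  "\<Psi> \<alpha> i c [] = cos c"
| "\<Psi> \<alpha> i c ((l, r) # us) = (if l < i then \<Psi> \<alpha> i (c + \<alpha> i) us else cos c * \<Psi> \<alpha> r (\<alpha> r) us)"

definition step :: "nat \<times> nat \<Rightarrow> nat \<Rightarrow> nat" where
  "step u i = (if fst u < i then i else snd u)"

fun occ :: "nat set \<Rightarrow> nat \<Rightarrow> (nat \<times> nat) list \<Rightarrow> nat" where
  "occ A i [] = 0"
| "occ A i (u # us) = (if step u i \<in> A then 1 else 0) + occ A (step u i) us"

text \<open>Counts draws of \<open>j\<close> even where the state is kept. This bounds the number of
  newly started clusters of type \<open>j\<close> from above and has a binomial law under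
  independent innovations.\<close>

definition cnt :: "nat \<Rightarrow> (nat \<times> nat) list \<Rightarrow> nat" where
  "cnt j us = length (filter (\<lambda>u. snd u = j) us)"

text \<open>A run of \<open>N\<close> consecutive levels below \<open>j\<close>, of which
  \<open>k\<close> have already been seen. A cluster of type \<open>j\<close> goes on only through
  levels below \<open>j\<close>, so without such a run no cluster is longer than
  \<open>N\<close>.\<close>

fun long :: "nat \<Rightarrow> nat \<Rightarrow> nat \<Rightarrow> (nat \<times> nat) list \<Rightarrow> bool" where
  "long j N k [] = False"
| "long j N k (u # us) = (if fst u < j then N \<le> Suc k \<or> long j N (Suc k) us else long j N 0 us)"

lemma abs_\<Psi>_le_1: "\<bar>\<Psi> \<alpha> i c us\<bar> \<le> 1"
  by (induction \<alpha> i c us rule: \<Psi>.induct) (auto simp: abs_mult intro!: mult_le_one)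

text \<open>The elementary bound \<open>len\<^sup>2 \<ge> 2 \<mu> len - \<mu>\<^sup>2\<close> turns the sum of the squared cluster lengths into the
  additive functional \<open>2 \<mu> occ - \<mu>\<^sup>2 cnt\<close>.\<close>

lemma \<Psi>_pathwise:
  assumes cos_le: "\<And>m. m \<le> N \<Longrightarrow> \<bar>cos (real m * \<alpha> j)\<bar> \<le> exp (- (\<beta> * (real m)\<^sup>2))"
    and \<beta>: "\<beta> \<ge> 0" and N: "N \<ge> 1"
    and us: "\<forall>u\<in>set us. snd u \<le> fst u" and nl: "\<not> long j N k us"
  shows "i \<noteq> j \<Longrightarrow> \<bar>\<Psi> \<alpha> i c us\<bar> \<le> exp (- (\<beta> * (2 * \<mu> * real (occ {j} i us) - \<mu>\<^sup>2 * real (cnt j us))))"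
    and "m \<le> Suc k \<Longrightarrow> m \<le> N \<Longrightarrow> \<bar>\<Psi> \<alpha> j (real m * \<alpha> j) us\<bar>
       \<le> exp (- (\<beta> * (2 * \<mu> * (real m + real (occ {j} j us)) - \<mu>\<^sup>2 - \<mu>\<^sup>2 * real (cnt j us))))"
  using us nl
proof (induction us arbitrary: i c k m)
  case Nil
  {
    case 1
    show ?case by (simp add: cnt_def)
  next
    case 2
    have "2 * \<mu> * real m - \<mu>\<^sup>2 \<le> (real m)\<^sup>2"
      using zero_le_power2[of "real m - \<mu>"] by (simp add: power2_diff algebra_simps)
    then have "\<beta> * (2 * \<mu> * real m - \<mu>\<^sup>2) \<le> \<beta> * (real m)\<^sup>2" using \<beta> by (rule mult_left_mono)
    then have "exp (- (\<beta> * (real m)\<^sup>2)) \<le> exp (- (\<beta> * (2 * \<mu> * real m - \<mu>\<^sup>2)))" by simp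
    then have "\<bar>cos (real m * \<alpha> j)\<bar> \<le> exp (- (\<beta> * (2 * \<mu> * real m - \<mu>\<^sup>2)))"
      using cos_le[OF 2(2)] by (rule order_trans[rotated])
    then show ?case by (simp add: cnt_def)
  }
next
  case (Cons u us)
  obtain l r where u: "u = (l, r)" by (cases u)
  have us': "\<forall>u\<in>set us. snd u \<le> fst u" and rl: "r \<le> l"
    if "\<forall>u\<in>set (u # us). snd u \<le> fst u" using that by (auto simp: u)
  have cnt_Cons: "cnt j (u # us) = (if r = j then 1 else 0) + cnt j us" by (simp add: cnt_def u)
  have refresh: "\<bar>\<Psi> \<alpha> r (\<alpha> r) us\<bar>
      \<le> exp (- (\<beta> * (2 * \<mu> * real ((if r = j then 1 else 0) + occ {j} r us) - \<mu>\<^sup>2 * real (cnt j (u # us)))))"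
    if r: "\<forall>u\<in>set (u # us). snd u \<le> fst u" and nl: "\<not> long j N k (u # us)" for k
  proof (cases "r = j")
    case True
    \<comment> \<open>The fresh type does not exceed the level, so \<open>r = j\<close> forces the
      level to be at least \<open>j\<close>: the run counter restarts at 0 together with the
      cluster.\<close>
    then have "\<not> long j N 0 us" using nl rl[OF r] by (auto simp: u)
    then have "\<bar>\<Psi> \<alpha> j (real 1 * \<alpha> j) us\<bar>
       \<le> exp (- (\<beta> * (2 * \<mu> * (real 1 + real (occ {j} j us)) - \<mu>\<^sup>2 - \<mu>\<^sup>2 * real (cnt j us))))"
      using N us'[OF r] by (intro Cons.IH(2)) auto
    then show ?thesis using True by (simp add: cnt_Cons algebra_simps)
  next
    case False
    have "\<exists>k. \<not> long j N k us" using nl by (auto simp: u split: if_splits)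
    then show ?thesis using Cons.IH(1)[OF False us'[OF r]] False by (auto simp: cnt_Cons)
  qed
  {
    case 1
    show ?case
    proof (cases "l < i")
      case True
      have "\<exists>k. \<not> long j N k us" using 1 by (auto simp: u split: if_splits)
      then have "\<bar>\<Psi> \<alpha> i (c + \<alpha> i) us\<bar> \<le> exp (- (\<beta> * (2 * \<mu> * real (occ {j} i us) - \<mu>\<^sup>2 * real (cnt j us))))"
        using Cons.IH(1)[OF 1(1) us'[OF 1(2)]] by blast
      also have "\<dots> \<le> exp (- (\<beta> * (2 * \<mu> * real (occ {j} i us) - \<mu>\<^sup>2 * real (cnt j (u # us)))))"
        using \<beta> by (auto simp: cnt_Cons intro!: mult_left_mono)
      finally show ?thesis using True 1(1) by (simp add: u step_def)
    next
      case False
      have "\<bar>cos c * \<Psi> \<alpha> r (\<alpha> r) us\<bar> \<le> 1 * \<bar>\<Psi> \<alpha> r (\<alpha> r) us\<bar>"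
        unfolding abs_mult by (intro mult_right_mono) auto
      then show ?thesis using refresh[OF 1(2,3)] False by (simp add: u step_def)
    qed
  next
    case (2 k m)
    show ?case
    proof (cases "l < j")
      case True
      then have n: "\<not> long j N (Suc k) us" "Suc k < N" using 2(4) by (auto simp: u)
      have "\<bar>\<Psi> \<alpha> j (real (Suc m) * \<alpha> j) us\<bar>
        \<le> exp (- (\<beta> * (2 * \<mu> * (real (Suc m) + real (occ {j} j us)) - \<mu>\<^sup>2 - \<mu>\<^sup>2 * real (cnt j us))))"
        using 2 n us'[OF 2(3)] by (intro Cons.IH(2)) auto
      moreover have "r \<noteq> j" using True rl[OF 2(3)] by auto
      ultimately show ?thesis using True by (simp add: u step_def cnt_def algebra_simps)
    next
      case False
      have "2 * \<mu> * real m - \<mu>\<^sup>2 \<le> (real m)\<^sup>2"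
        using zero_le_power2[of "real m - \<mu>"] by (simp add: power2_diff algebra_simps)
      then have "\<beta> * (2 * \<mu> * real m - \<mu>\<^sup>2) \<le> \<beta> * (real m)\<^sup>2" using \<beta> by (rule mult_left_mono)
      then have "exp (- (\<beta> * (real m)\<^sup>2)) \<le> exp (- (\<beta> * (2 * \<mu> * real m - \<mu>\<^sup>2)))" by simp
      then have "\<bar>cos (real m * \<alpha> j)\<bar> \<le> exp (- (\<beta> * (2 * \<mu> * real m - \<mu>\<^sup>2)))"
        using cos_le[OF 2(2)] by (rule order_trans[rotated])
      then have "\<bar>cos (real m * \<alpha> j) * \<Psi> \<alpha> r (\<alpha> r) us\<bar> \<le> exp (- (\<beta> * (2 * \<mu> * real m - \<mu>\<^sup>2)))
         * exp (- (\<beta> * (2 * \<mu> * real ((if r = j then 1 else 0) + occ {j} r us) - \<mu>\<^sup>2 * real (cnt j (u # us)))))"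
        unfolding abs_mult using refresh[OF 2(3,4)] by (intro mult_mono) auto
      then show ?thesis using False by (simp add: u step_def algebra_simps flip: exp_add)
    qed
  }
qed

context level_chain
begin

text \<open>One innovation. The fresh type is drawn also when the state will be kept, so that a list
  of innovations is independent and identically distributed, whatever the states are.\<close>

definition U :: "(nat \<times> nat) pmf" where
  "U = bind_pmf lev (\<lambda>l. map_pmf (Pair l) (cond_pmf p {..l}))"

lemma set_U: "u \<in> set_pmf U \<Longrightarrow> snd u \<le> fst u"
  by (auto simp: U_def set_cond_pmf[OF cond_nonempty])

lemma expectation_U:
  fixes f :: "nat \<times> nat \<Rightarrow> real"
  assumes "\<And>u. \<bar>f u\<bar> \<le> B"
  shows "measure_pmf.expectation U f
    = measure_pmf.expectation lev (\<lambda>l. measure_pmf.expectation (cond_pmf p {..l}) (\<lambda>r. f (l, r)))"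
  unfolding U_def by (simp add: integral_bind_pmf_real[where B=B, OF assms])

lemma expectation_bound:
  fixes f :: "'b \<Rightarrow> real"
  assumes "\<And>x. \<bar>f x\<bar> \<le> B"
  shows "\<bar>measure_pmf.expectation q f\<bar> \<le> B"
proof -
  have "\<bar>measure_pmf.expectation q f\<bar> \<le> measure_pmf.expectation q (\<lambda>x. \<bar>f x\<bar>)"
    by (rule integral_abs_bound)
  also have "\<dots> \<le> B"
    using assms by (intro measure_pmf.integral_le_const integrable_pmf_bounded[where B=B]) auto
  finally show ?thesis .
qed

definition e\<Psi> :: "(nat \<Rightarrow> real) \<Rightarrow> nat \<Rightarrow> nat \<Rightarrow> real \<Rightarrow> real" where
  "e\<Psi> \<alpha> n i c = measure_pmf.expectation (replicate_pmf n U) (\<Psi> \<alpha> i c)"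

lemma abs_e\<Psi>: "\<bar>e\<Psi> \<alpha> n i c\<bar> \<le> 1"
  unfolding e\<Psi>_def by (rule expectation_bound[OF abs_\<Psi>_le_1])

lemma e\<Psi>_Suc:
  "e\<Psi> \<alpha> (Suc n) i c = measure_pmf.expectation lev (\<lambda>l. if l < i then e\<Psi> \<alpha> n i (c + \<alpha> i)
     else cos c * measure_pmf.expectation (cond_pmf p {..l}) (\<lambda>r. e\<Psi> \<alpha> n r (\<alpha> r)))"
proof -
  have "e\<Psi> \<alpha> (Suc n) i c = measure_pmf.expectation U (\<lambda>u. measure_pmf.expectation (replicate_pmf n U) (\<lambda>us. \<Psi> \<alpha> i c (u # us)))"
    unfolding e\<Psi>_def by (rule expectation_replicate_Suc[where B=1]) (rule abs_\<Psi>_le_1)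
  also have "\<dots> = measure_pmf.expectation lev (\<lambda>l. measure_pmf.expectation (cond_pmf p {..l}) (\<lambda>r. measure_pmf.expectation (replicate_pmf n U) (\<lambda>us. \<Psi> \<alpha> i c ((l, r) # us))))"
    by (rule expectation_U[where B=1]) (intro expectation_bound abs_\<Psi>_le_1)
  also have "\<dots> = measure_pmf.expectation lev (\<lambda>l. if l < i then e\<Psi> \<alpha> n i (c + \<alpha> i)
     else cos c * measure_pmf.expectation (cond_pmf p {..l}) (\<lambda>r. e\<Psi> \<alpha> n r (\<alpha> r)))"
    by (intro Bochner_Integration.integral_cong refl) (simp add: e\<Psi>_def)
  finally show ?thesis .
qed

definition Fv :: "(nat \<Rightarrow> real) \<Rightarrow> nat \<times> bool \<Rightarrow> complex" where
  "Fv \<alpha> x = cis (\<alpha> (fst x) * sg (snd x))"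

lemma norm_Fv: "norm (Fv \<alpha> x) \<le> 1"
  by (simp add: Fv_def)

text \<open>An average over the sign of the current cluster with accumulated phase \<open>c\<close>:
  while the cluster lasts, the phase grows by \<open>\<alpha> i\<close>, and when it ends,
  \<open>(cis c + cis (- c)) / 2 = cos c\<close> splits off. The signs disappear and a real quantity
  remains.\<close>

lemma G_Fv_\<Psi>:
  "(cis c * (G (Fv \<alpha>) ^^ n) (\<lambda>_. 1) (i, True) + cis (- c) * (G (Fv \<alpha>) ^^ n) (\<lambda>_. 1) (i, False)) / 2
    = of_real (e\<Psi> \<alpha> n i c)"
proof (induction n arbitrary: i c)
  case 0
  have "cis c + cis (- c) = of_real (2 * cos c)" by (simp add: complex_eq_iff)
  then show ?case by (simp add: e\<Psi>_def)
next
  case (Suc n)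
  let ?u = "(G (Fv \<alpha>) ^^ n) (\<lambda>_. 1)"
  have ub: "norm (?u x) \<le> 1" for x by (rule Gn_bound[OF norm_Fv]) simp
  have Fu: "norm (Fv \<alpha> y * ?u y) \<le> 1" for y by (rule norm_mult_le[OF norm_Fv ub])
  define X where "X l = measure_pmf.expectation (cond_pmf p {..l}) (\<lambda>r. e\<Psi> \<alpha> n r (\<alpha> r))" for l
  have "measure_pmf.expectation (\<pi>\<^sub>l l) (\<lambda>y. Fv \<alpha> y * ?u y) = of_real (X l)" for l
  proof -
    have "measure_pmf.expectation (\<pi>\<^sub>l l) (\<lambda>y. Fv \<alpha> y * ?u y)
      = measure_pmf.expectation (cond_pmf p {..l}) (\<lambda>r. (cis (\<alpha> r) * ?u (r, True) + cis (- \<alpha> r) * ?u (r, False)) / 2)"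
      unfolding \<pi>\<^sub>l_def expectation_pair_coin[where u="\<lambda>y. Fv \<alpha> y * ?u y", OF Fu] by (simp add: Fv_def sg_def)
    then show ?thesis unfolding Suc X_def by simp
  qed
  then have G: "G (Fv \<alpha>) ?u x = measure_pmf.expectation lev (\<lambda>l. if fst x \<le> l then of_real (X l) else Fv \<alpha> x * ?u x)" for x
    unfolding G_def K_def integral_bind_pmf_complex[where f="\<lambda>y. Fv \<alpha> y * ?u y", OF Fu]
    by (intro Bochner_Integration.integral_cong refl) simp
  have Xb: "\<bar>X l\<bar> \<le> 1" for l unfolding X_def by (rule expectation_bound[OF abs_e\<Psi>])
  have int: "integrable (measure_pmf lev) (\<lambda>l. if fst x \<le> l then of_real (X l) else Fv \<alpha> x * ?u x)" for x
    using Xb Fu by (intro integrable_pmf_bounded[where B=1]) auto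
  have "(cis c * G (Fv \<alpha>) ?u (i, True) + cis (- c) * G (Fv \<alpha>) ?u (i, False)) / 2
    = measure_pmf.expectation lev (\<lambda>l. (cis c * (if i \<le> l then of_real (X l) else Fv \<alpha> (i, True) * ?u (i, True))
       + cis (- c) * (if i \<le> l then of_real (X l) else Fv \<alpha> (i, False) * ?u (i, False))) / 2)"
    unfolding G using int[of "(i, True)"] int[of "(i, False)"] by simp
  also have "\<dots> = measure_pmf.expectation lev (\<lambda>l. of_real (if l < i then e\<Psi> \<alpha> n i (c + \<alpha> i) else cos c * X l))"
  proof (intro Bochner_Integration.integral_cong refl)
    fix l
    have "(cis c + cis (- c)) / 2 = complex_of_real (cos c)" by (simp add: complex_eq_iff)
    moreover have "(cis c * of_real (X l) + cis (- c) * of_real (X l)) / 2 = (cis c + cis (- c)) / 2 * of_real (X l)"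
      by (simp only: distrib_right[symmetric] times_divide_eq_left)
    ultimately have 1: "(cis c * of_real (X l) + cis (- c) * of_real (X l)) / 2 = of_real (cos c * X l)"
      by simp
    have 2: "(cis c * (Fv \<alpha> (i, True) * ?u (i, True)) + cis (- c) * (Fv \<alpha> (i, False) * ?u (i, False))) / 2
       = of_real (e\<Psi> \<alpha> n i (c + \<alpha> i))"
      unfolding Suc[of "c + \<alpha> i" i, symmetric] by (simp add: Fv_def sg_def mult.assoc[symmetric] cis_mult)
    show "(cis c * (if i \<le> l then of_real (X l) else Fv \<alpha> (i, True) * ?u (i, True))
       + cis (- c) * (if i \<le> l then of_real (X l) else Fv \<alpha> (i, False) * ?u (i, False))) / 2
       = of_real (if l < i then e\<Psi> \<alpha> n i (c + \<alpha> i) else cos c * X l)"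
      using 1 2 by (auto simp: not_less)
  qed
  also have "\<dots> = of_real (e\<Psi> \<alpha> (Suc n) i c)"
    unfolding e\<Psi>_Suc X_def by simp
  finally show ?case by simp
qed

text \<open>The initial phase is 0 because the state at time 0 is not part of the sum.\<close>

lemma expectation_\<pi>_G_Fv:
  "norm (measure_pmf.expectation \<pi> ((G (Fv \<alpha>) ^^ n) (\<lambda>_. 1)))
    \<le> measure_pmf.expectation (pair_pmf p (replicate_pmf n U)) (\<lambda>(i, us). \<bar>\<Psi> \<alpha> i 0 us\<bar>)"
proof -
  have b: "norm ((G (Fv \<alpha>) ^^ n) (\<lambda>_. 1) x) \<le> 1" for x by (rule Gn_bound[OF norm_Fv]) simp
  have "measure_pmf.expectation \<pi> ((G (Fv \<alpha>) ^^ n) (\<lambda>_. 1)) = measure_pmf.expectation p (\<lambda>i. of_real (e\<Psi> \<alpha> n i 0))"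
    unfolding \<pi>_def expectation_pair_coin[OF b] using G_Fv_\<Psi>[where c=0 and \<alpha>=\<alpha> and n=n] by simp
  then have "norm (measure_pmf.expectation \<pi> ((G (Fv \<alpha>) ^^ n) (\<lambda>_. 1))) = \<bar>measure_pmf.expectation p (\<lambda>i. e\<Psi> \<alpha> n i 0)\<bar>"
    by simp
  also have "measure_pmf.expectation p (\<lambda>i. e\<Psi> \<alpha> n i 0) = measure_pmf.expectation (pair_pmf p (replicate_pmf n U)) (\<lambda>(i, us). \<Psi> \<alpha> i 0 us)"
  proof -
    have *: "\<bar>case x of (i, us) \<Rightarrow> \<Psi> \<alpha> i 0 us\<bar> \<le> 1" for x by (cases x) (simp add: abs_\<Psi>_le_1)
    show ?thesis
      unfolding pair_pmf_def e\<Psi>_def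
      by (simp add: integral_bind_pmf_real[where B=1, OF *])
  qed
  also have "\<bar>\<dots>\<bar> \<le> measure_pmf.expectation (pair_pmf p (replicate_pmf n U)) (\<lambda>x. \<bar>case x of (i, us) \<Rightarrow> \<Psi> \<alpha> i 0 us\<bar>)"
    by (rule integral_abs_bound)
  finally show ?thesis by (simp add: case_prod_beta')
qed

end

section \<open>Runs, counts and occupation times of the innovations\<close>

context level_chain
begin

lemma expectation_lev_if:
  "measure_pmf.expectation lev (\<lambda>l. if l < j then x else y) = s j * x + (1 - s j) * (y :: real)"
proof -
  have "measure_pmf.expectation lev (\<lambda>l. if l < j then x else y)
     = measure_pmf.expectation lev (\<lambda>l. y + indicator {..<j} l * (x - y))"
    by (intro Bochner_Integration.integral_cong) (auto simp: indicator_def)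
  also have "\<dots> = y + s j * (x - y)"
    by (subst Bochner_Integration.integral_add)
       (auto simp: s_def integrable_indicator_iff measure_pmf.emeasure_eq_measure intro!: integrable_mult_left)
  finally show ?thesis by (simp add: algebra_simps)
qed

lemma map_fst_U: "map_pmf fst U = lev"
  unfolding U_def by (simp add: map_bind_pmf map_pmf_comp bind_return_pmf')

lemma expectation_U_fst: "measure_pmf.expectation U (\<lambda>u. f (fst u)) = measure_pmf.expectation lev (f :: nat \<Rightarrow> real)"
proof -
  have "measure_pmf.expectation (map_pmf fst U) f = measure_pmf.expectation U (\<lambda>u. f (fst u))" by simp
  then show ?thesis by (simp only: map_fst_U)
qed

text \<open>A union bound over the starting points of a run: the present run is completed with
  probability at most \<open>s j ^ (N - k)\<close>, and each later one starts after a level that is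
  at least \<open>j\<close>, which explains the factor \<open>1 - s j\<close>.\<close>

lemma prob_long:
  assumes "k < N"
  shows "measure_pmf.expectation (replicate_pmf n U) (\<lambda>us. of_bool (long j N k us))
    \<le> s j ^ (N - k) + real n * (1 - s j) * s j ^ N"
  using assms
proof (induction n arbitrary: k)
  case 0
  show ?case using s_bounds(1)[of j] by simp
next
  case (Suc n)
  let ?B = "\<lambda>k. measure_pmf.expectation (replicate_pmf n U) (\<lambda>us. of_bool (long j N k us) :: real)"
  have "measure_pmf.expectation (replicate_pmf (Suc n) U) (\<lambda>us. of_bool (long j N k us) :: real)
     = measure_pmf.expectation U (\<lambda>u. measure_pmf.expectation (replicate_pmf n U) (\<lambda>us. of_bool (long j N k (u # us))))"
    by (rule expectation_replicate_Suc[where B=1]) auto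
  also have "\<dots> = measure_pmf.expectation U (\<lambda>u. if fst u < j then (if N \<le> Suc k then 1 else ?B (Suc k)) else ?B 0)"
    by (intro Bochner_Integration.integral_cong) auto
  also have "\<dots> = s j * (if N \<le> Suc k then 1 else ?B (Suc k)) + (1 - s j) * ?B 0"
    using expectation_U_fst[of "\<lambda>l. if l < j then (if N \<le> Suc k then 1 else ?B (Suc k)) else ?B 0"]
    by (simp only: expectation_lev_if)
  also have "\<dots> \<le> s j * (s j ^ (N - Suc k) + real n * (1 - s j) * s j ^ N) + (1 - s j) * (s j ^ N + real n * (1 - s j) * s j ^ N)"
  proof (intro add_mono mult_left_mono)
    show "(if N \<le> Suc k then 1 else ?B (Suc k)) \<le> s j ^ (N - Suc k) + real n * (1 - s j) * s j ^ N"
      using Suc.IH[of "Suc k"] s_bounds[of j] by auto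
    show "?B 0 \<le> s j ^ N + real n * (1 - s j) * s j ^ N"
      using Suc.IH[of 0] Suc.prems by simp
  qed (use s_bounds[of j] in auto)
  also have "\<dots> = s j ^ Suc (N - Suc k) + real (Suc n) * (1 - s j) * s j ^ N"
    by (simp add: algebra_simps)
  also have "Suc (N - Suc k) = N - k" using Suc.prems by simp
  finally show ?case .
qed

lemma expectation_U_snd: "measure_pmf.expectation U (\<lambda>u. of_bool (snd u = j)) = \<zeta> j"
proof -
  have i: "(\<lambda>r. of_bool (r = j)) = (indicator {j} :: nat \<Rightarrow> real)"
    by (auto simp: indicator_def fun_eq_iff)
  have "measure_pmf.expectation U (\<lambda>u. of_bool (snd u = j) :: real)
    = measure_pmf.expectation lev (\<lambda>l. measure_pmf.expectation (cond_pmf p {..l}) (\<lambda>r. of_bool (r = j)))"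
    by (subst expectation_U[where B=1]) auto
  then show ?thesis unfolding i by (simp add: \<zeta>_def measure_pmf_single)
qed

lemma cnt_le_length: "cnt j us \<le> length us"
  by (simp add: cnt_def)

text \<open>A binomial variance; the free shift \<open>z\<close> lets the induction absorb the first
  innovation.\<close>

lemma variance_cnt:
  "measure_pmf.expectation (replicate_pmf n U) (\<lambda>us. (z + (real (cnt j us) - real n * \<zeta> j))\<^sup>2)
    = z\<^sup>2 + real n * \<zeta> j * (1 - \<zeta> j)"
proof (induction n arbitrary: z)
  case 0
  show ?case by (simp add: cnt_def)
next
  case (Suc n)
  have "measure_pmf.expectation (replicate_pmf (Suc n) U) (\<lambda>us. (z + (real (cnt j us) - real (Suc n) * \<zeta> j))\<^sup>2)
     = measure_pmf.expectation U (\<lambda>u. measure_pmf.expectation (replicate_pmf n U) (\<lambda>us. (z + (real (cnt j (u # us)) - real (Suc n) * \<zeta> j))\<^sup>2))"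
  proof (rule expectation_replicate_Suc)
    fix us :: "(nat \<times> nat) list" assume l: "length us = Suc n"
    have "\<bar>z + (real (cnt j us) - real (Suc n) * \<zeta> j)\<bar> \<le> \<bar>z\<bar> + real (Suc n) + real (Suc n) * \<zeta> j"
      using cnt_le_length[of j us] l mult_nonneg_nonneg[of "real (Suc n)" "\<zeta> j"] \<zeta>_bounds(3)[of j] by linarith
    then show "\<bar>(z + (real (cnt j us) - real (Suc n) * \<zeta> j))\<^sup>2\<bar> \<le> (\<bar>z\<bar> + real (Suc n) + real (Suc n) * \<zeta> j)\<^sup>2"
      unfolding abs_power2 by (subst power2_abs[symmetric]) (rule power_mono, auto)
  qed
  also have "\<dots> = measure_pmf.expectation U (\<lambda>u. (z + of_bool (snd u = j) - \<zeta> j)\<^sup>2 + real n * \<zeta> j * (1 - \<zeta> j))"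
  proof (intro Bochner_Integration.integral_cong refl)
    fix u
    have "z + (real (cnt j (u # us)) - real (Suc n) * \<zeta> j) = (z + of_bool (snd u = j) - \<zeta> j) + (real (cnt j us) - real n * \<zeta> j)" for us
      by (simp add: cnt_def algebra_simps)
    then show "measure_pmf.expectation (replicate_pmf n U) (\<lambda>us. (z + (real (cnt j (u # us)) - real (Suc n) * \<zeta> j))\<^sup>2)
       = (z + of_bool (snd u = j) - \<zeta> j)\<^sup>2 + real n * \<zeta> j * (1 - \<zeta> j)"
      using Suc[of "z + of_bool (snd u = j) - \<zeta> j"] by (simp only:)
  qed
  also have "\<dots> = measure_pmf.expectation U (\<lambda>u. ((z - \<zeta> j)\<^sup>2 + real n * \<zeta> j * (1 - \<zeta> j)) + (2 * (z - \<zeta> j) + 1) * of_bool (snd u = j))"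
    by (intro Bochner_Integration.integral_cong refl) (auto simp: power2_eq_square algebra_simps)
  also have "\<dots> = ((z - \<zeta> j)\<^sup>2 + real n * \<zeta> j * (1 - \<zeta> j)) + (2 * (z - \<zeta> j) + 1) * \<zeta> j"
    by (subst Bochner_Integration.integral_add)
       (auto simp: expectation_U_snd intro!: integrable_mult_right integrable_pmf_bounded[where B=1])
  finally show ?case by (simp add: power2_eq_square algebra_simps)
qed

fun S\<^sub>f :: "(nat \<Rightarrow> real) \<Rightarrow> nat \<Rightarrow> (nat \<times> nat) list \<Rightarrow> real" where
  "S\<^sub>f f i [] = 0"
| "S\<^sub>f f i (u # us) = f (step u i) + S\<^sub>f f (step u i) us"

lemma step_stationary: "bind_pmf p (\<lambda>i. map_pmf (\<lambda>u. step u i) U) = p"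
proof -
  have K: "map_pmf fst (K x) = map_pmf (\<lambda>u. step u (fst x)) U" for x
    unfolding K_def U_def map_bind_pmf map_pmf_comp
  proof (intro bind_pmf_cong refl)
    fix l
    show "map_pmf fst (if fst x \<le> l then \<pi>\<^sub>l l else return_pmf x) = map_pmf (\<lambda>r. step (l, r) (fst x)) (cond_pmf p {..l})"
      by (auto simp: \<pi>\<^sub>l_def map_fst_pair_pmf step_def not_le map_pmf_const)
  qed
  have "p = map_pmf fst (bind_pmf \<pi> K)"
    by (simp add: bind_stationary) (simp add: \<pi>_def map_fst_pair_pmf)
  also have "\<dots> = bind_pmf \<pi> (\<lambda>x. map_pmf (\<lambda>u. step u (fst x)) U)"
    by (simp add: map_bind_pmf K)
  also have "\<dots> = bind_pmf (map_pmf fst \<pi>) (\<lambda>i. map_pmf (\<lambda>u. step u i) U)"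
    by (simp add: bind_map_pmf)
  finally show ?thesis by (simp add: \<pi>_def map_fst_pair_pmf)
qed

lemma expectation_step_stationary:
  fixes h :: "nat \<Rightarrow> real"
  assumes "\<And>i. \<bar>h i\<bar> \<le> B"
  shows "measure_pmf.expectation p (\<lambda>i. measure_pmf.expectation U (\<lambda>u. h (step u i))) = measure_pmf.expectation p h"
proof -
  have "measure_pmf.expectation p h = measure_pmf.expectation (bind_pmf p (\<lambda>i. map_pmf (\<lambda>u. step u i) U)) h"
    by (simp add: step_stationary)
  also have "\<dots> = measure_pmf.expectation p (\<lambda>i. measure_pmf.expectation U (\<lambda>u. h (step u i)))"
    by (subst integral_bind_pmf_real[where B=B, OF assms]) simp
  finally show ?thesis ..
qed

lemma S\<^sub>f_bound: "(\<And>i. \<bar>f i\<bar> \<le> C) \<Longrightarrow> \<bar>S\<^sub>f f i us\<bar> \<le> real (length us) * C"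
proof (induction us arbitrary: i)
  case (Cons u us)
  have "\<bar>S\<^sub>f f i (u # us)\<bar> \<le> \<bar>f (step u i)\<bar> + \<bar>S\<^sub>f f (step u i) us\<bar>" by simp
  also have "\<dots> \<le> C + real (length us) * C" using Cons by (intro add_mono) auto
  finally show ?case by (simp add: algebra_simps)
qed simp

lemma expectation_abs_le_set:
  fixes f :: "'b \<Rightarrow> real"
  assumes "\<And>x. x \<in> set_pmf q \<Longrightarrow> \<bar>f x\<bar> \<le> B"
  shows "\<bar>measure_pmf.expectation q f\<bar> \<le> B" "integrable (measure_pmf q) f"
proof -
  show i: "integrable (measure_pmf q) f"
    using assms by (intro measure_pmf.integrable_const_bound[where B=B]) (auto simp: AE_measure_pmf_iff)
  have "\<bar>measure_pmf.expectation q f\<bar> \<le> measure_pmf.expectation q (\<lambda>x. \<bar>f x\<bar>)"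
    by (rule integral_abs_bound)
  also have "\<dots> \<le> B"
    using assms i by (intro measure_pmf.integral_le_const) (auto simp: AE_measure_pmf_iff)
  finally show "\<bar>measure_pmf.expectation q f\<bar> \<le> B" .
qed

lemma S\<^sub>f_replicate:
  assumes "\<And>i. \<bar>f i\<bar> \<le> C" "us \<in> set_pmf (replicate_pmf n U)"
  shows "\<bar>S\<^sub>f f i us\<bar> \<le> real n * C"
  using S\<^sub>f_bound[where f=f and C=C and i=i and us=us, OF assms(1)] length_replicate_pmf[OF assms(2)] by simp

lemma expectation_S\<^sub>f:
  assumes f: "\<And>i. \<bar>f i\<bar> \<le> C" and eig: "\<And>i. measure_pmf.expectation U (\<lambda>u. f (step u i)) = \<rho> * f i"
  shows "measure_pmf.expectation (replicate_pmf n U) (S\<^sub>f f i) = (\<Sum>k=1..n. \<rho> ^ k) * f i"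
proof (induction n arbitrary: i)
  case 0
  show ?case by simp
next
  case (Suc n)
  have "measure_pmf.expectation (replicate_pmf (Suc n) U) (S\<^sub>f f i)
    = measure_pmf.expectation U (\<lambda>u. measure_pmf.expectation (replicate_pmf n U) (\<lambda>us. f (step u i) + S\<^sub>f f (step u i) us))"
  proof (subst expectation_replicate_Suc[where B="real (Suc n) * C"])
    show "\<bar>S\<^sub>f f i us\<bar> \<le> real (Suc n) * C" if "length us = Suc n" for us
      using S\<^sub>f_bound[where f=f and C=C and i=i and us=us, OF f] that by simp
  qed simp
  also have "\<dots> = measure_pmf.expectation U (\<lambda>u. f (step u i) + (\<Sum>k=1..n. \<rho> ^ k) * f (step u i))"
  proof (intro Bochner_Integration.integral_cong refl)
    fix u
    have "integrable (measure_pmf (replicate_pmf n U)) (S\<^sub>f f (step u i))"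
      by (rule expectation_abs_le_set(2)[OF S\<^sub>f_replicate[OF f]])
    then show "measure_pmf.expectation (replicate_pmf n U) (\<lambda>us. f (step u i) + S\<^sub>f f (step u i) us)
       = f (step u i) + (\<Sum>k=1..n. \<rho> ^ k) * f (step u i)"
      using Suc[of "step u i"] by simp
  qed
  also have "\<dots> = measure_pmf.expectation U (\<lambda>u. (1 + (\<Sum>k=1..n. \<rho> ^ k)) * f (step u i))"
    by (simp add: algebra_simps)
  also have "\<dots> = (1 + (\<Sum>k=1..n. \<rho> ^ k)) * (\<rho> * f i)"
    unfolding eig[symmetric] by simp
  also have "\<dots> = (\<Sum>k=1..Suc n. \<rho> ^ k) * f i"
  proof -
    have "(\<Sum>k=1..Suc n. \<rho> ^ k) = \<rho> + (\<Sum>k=1..n. \<rho> ^ Suc k)"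
      by (subst sum.atLeast_Suc_atMost) (auto simp: sum.shift_bounds_cl_Suc_ivl simp del: sum.cl_ivl_Suc)
    then show ?thesis by (simp add: algebra_simps sum_distrib_left del: sum.cl_ivl_Suc)
  qed
  finally show ?case .
qed

text \<open>For an eigenfunction the later terms have as conditional mean the current value times
  some \<open>c \<le> 1 / (1 - \<rho>)\<close>, so under the stationary law each step adds at most
  \<open>(1 + 2 / (1 - \<rho>)) * C\<^sup>2\<close>: the growth is linear in
  \<open>n\<close>.\<close>

lemma second_moment_S\<^sub>f:
  assumes f: "\<And>i. \<bar>f i\<bar> \<le> C" and eig: "\<And>i. measure_pmf.expectation U (\<lambda>u. f (step u i)) = \<rho> * f i"
    and \<rho>: "0 \<le> \<rho>" "\<rho> < 1"
  shows "measure_pmf.expectation p (\<lambda>i. measure_pmf.expectation (replicate_pmf n U) (\<lambda>us. (S\<^sub>f f i us)\<^sup>2))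
    \<le> real n * ((1 + 2 / (1 - \<rho>)) * C\<^sup>2)"
proof (induction n)
  case 0
  show ?case by simp
next
  case (Suc n)
  let ?q = "\<lambda>n i. measure_pmf.expectation (replicate_pmf n U) (\<lambda>us. (S\<^sub>f f i us)\<^sup>2)"
  define c where "c = (\<Sum>k=1..n. \<rho> ^ k)"
  have c: "0 \<le> c" "c \<le> 1 / (1 - \<rho>)"
  proof -
    show "0 \<le> c" using \<rho> by (simp add: c_def sum_nonneg)
    have "c \<le> (\<Sum>k<Suc n. \<rho> ^ k)" unfolding c_def using \<rho> by (intro sum_mono2) auto
    also have "\<dots> = (1 - \<rho> ^ Suc n) / (1 - \<rho>)" using \<rho> by (subst sum_gp_strict) auto
    also have "\<dots> \<le> 1 / (1 - \<rho>)" using \<rho> by (intro divide_right_mono) auto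
    finally show "c \<le> 1 / (1 - \<rho>)" .
  qed
  have C: "C \<ge> 0" using f[of 0] by linarith
  have f2: "(f i)\<^sup>2 \<le> C\<^sup>2" for i using power_mono[OF f[of i], of 2] by simp
  have S2: "(S\<^sub>f f i us)\<^sup>2 \<le> (real m * C)\<^sup>2" if "length us = m" for i us m
    using power_mono[OF S\<^sub>f_bound[where f=f and C=C and i=i and us=us, OF f], of 2] that by simp
  have qb: "\<bar>?q m i\<bar> \<le> (real m * C)\<^sup>2" for m i
    by (intro expectation_abs_le_set(1)) (simp only: abs_power2 S2[OF length_replicate_pmf])
  have q_Suc: "?q (Suc n) i = measure_pmf.expectation U (\<lambda>u. (1 + 2 * c) * (f (step u i))\<^sup>2 + ?q n (step u i))" for i
  proof -
    have "?q (Suc n) i = measure_pmf.expectation U (\<lambda>u. measure_pmf.expectation (replicate_pmf n U) (\<lambda>us. (f (step u i) + S\<^sub>f f (step u i) us)\<^sup>2))"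
    proof (subst expectation_replicate_Suc[where B="(real (Suc n) * C)\<^sup>2"])
      show "\<bar>(S\<^sub>f f i us)\<^sup>2\<bar> \<le> (real (Suc n) * C)\<^sup>2" if "length us = Suc n" for us
        using S2[OF that, of i] by simp
    qed simp
    also have "\<dots> = measure_pmf.expectation U (\<lambda>u. (1 + 2 * c) * (f (step u i))\<^sup>2 + ?q n (step u i))"
    proof (intro Bochner_Integration.integral_cong refl)
      fix u
      let ?i = "step u i"
      have i1: "integrable (measure_pmf (replicate_pmf n U)) (S\<^sub>f f ?i)"
        by (rule expectation_abs_le_set(2)[OF S\<^sub>f_replicate[OF f]])
      have i2: "integrable (measure_pmf (replicate_pmf n U)) (\<lambda>us. (S\<^sub>f f ?i us)\<^sup>2)"
        by (intro expectation_abs_le_set(2)[where B="(real n * C)\<^sup>2"]) (simp only: abs_power2 S2[OF length_replicate_pmf])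
      have "measure_pmf.expectation (replicate_pmf n U) (\<lambda>us. (f ?i + S\<^sub>f f ?i us)\<^sup>2)
        = measure_pmf.expectation (replicate_pmf n U) (\<lambda>us. (f ?i)\<^sup>2 + (2 * f ?i) * S\<^sub>f f ?i us + (S\<^sub>f f ?i us)\<^sup>2)"
        by (intro Bochner_Integration.integral_cong refl) (simp add: power2_eq_square algebra_simps)
      also have "\<dots> = (f ?i)\<^sup>2 + (2 * f ?i) * (c * f ?i) + ?q n ?i"
        using i1 i2 by (simp add: expectation_S\<^sub>f[OF f eig] c_def)
      finally show "measure_pmf.expectation (replicate_pmf n U) (\<lambda>us. (f ?i + S\<^sub>f f ?i us)\<^sup>2) = (1 + 2 * c) * (f ?i)\<^sup>2 + ?q n ?i"
        by (simp add: power2_eq_square algebra_simps)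
    qed
    finally show ?thesis .
  qed
  have hb: "\<bar>(1 + 2 * c) * (f i)\<^sup>2 + ?q n i\<bar> \<le> (1 + 2 * c) * C\<^sup>2 + (real n * C)\<^sup>2" for i
  proof -
    have "\<bar>(1 + 2 * c) * (f i)\<^sup>2 + ?q n i\<bar> \<le> \<bar>(1 + 2 * c) * (f i)\<^sup>2\<bar> + \<bar>?q n i\<bar>" by (rule abs_triangle_ineq)
    also have "\<dots> \<le> (1 + 2 * c) * C\<^sup>2 + (real n * C)\<^sup>2"
      using c f2 by (intro add_mono qb) (auto simp: abs_mult intro!: mult_left_mono)
    finally show ?thesis .
  qed
  have "measure_pmf.expectation p (?q (Suc n)) = measure_pmf.expectation p (\<lambda>i. (1 + 2 * c) * (f i)\<^sup>2 + ?q n i)"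
    unfolding q_Suc by (rule expectation_step_stationary[OF hb])
  also have "\<dots> = (1 + 2 * c) * measure_pmf.expectation p (\<lambda>i. (f i)\<^sup>2) + measure_pmf.expectation p (?q n)"
  proof -
    have "integrable (measure_pmf p) (\<lambda>i. (f i)\<^sup>2)" using f2 by (intro integrable_pmf_bounded[where B="C\<^sup>2"]) auto
    moreover have "integrable (measure_pmf p) (?q n)" using qb by (intro integrable_pmf_bounded[where B="(real n * C)\<^sup>2"]) simp
    ultimately show ?thesis by simp
  qed
  also have "\<dots> \<le> (1 + 2 / (1 - \<rho>)) * C\<^sup>2 + real n * ((1 + 2 / (1 - \<rho>)) * C\<^sup>2)"
  proof (intro add_mono Suc.IH mult_mono)
    show "measure_pmf.expectation p (\<lambda>i. (f i)\<^sup>2) \<le> C\<^sup>2"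
      using f2 by (intro measure_pmf.integral_le_const integrable_pmf_bounded[where B="C\<^sup>2"]) auto
  qed (use c \<rho> in auto)
  finally show ?case by (simp only: of_nat_Suc distrib_right mult_1)
qed

text \<open>Constant below \<open>j\<close>, zero above, with mean 0 under \<open>p\<close>. Its
  additive functional compares the time spent in \<open>j\<close> with the time spent below
  (\<open>S\<^sub>f_eig\<close>); together with a bound on the time above \<open>j\<close> this
  yields the occupation of \<open>j\<close> up to a fluctuation of order the square root of
  \<open>n\<close>.\<close>

definition eig :: "nat \<Rightarrow> nat \<Rightarrow> real" where
  "eig j t = (if t = j then 1 / pmf p j else if t < j then - 1 / P\<^sub>l (j - 1) else 0)"

text \<open>A level below \<open>j\<close> preserves being below, at or above \<open>j\<close>. A
  level \<open>l \<ge> j\<close> either refreshes, and \<open>eig j\<close> has mean 0 under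
  \<open>p\<close> conditioned on \<open>{..l}\<close>, or meets a type above \<open>j\<close>,
  where \<open>eig j\<close> vanishes.\<close>

lemma eig_eigen:
  assumes j: "j \<ge> 1"
  shows "measure_pmf.expectation U (\<lambda>u. eig j (step u i)) = s j * eig j i"
proof -
  obtain B where B: "\<And>t. \<bar>eig j t\<bar> \<le> B"
  proof (rule that)
    fix t show "\<bar>eig j t\<bar> \<le> 1 / pmf p j + 1 / P\<^sub>l (j - 1)"
      using pmf_p_pos[of j] P\<^sub>l_pos[of "j - 1"] by (auto simp: eig_def)
  qed
  have "measure_pmf.expectation U (\<lambda>u. eig j (step u i))
    = measure_pmf.expectation lev (\<lambda>l. measure_pmf.expectation (cond_pmf p {..l}) (\<lambda>r. eig j (step (l, r) i)))"
    by (rule expectation_U[OF B])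
  also have "\<dots> = measure_pmf.expectation lev (\<lambda>l. if l < j then eig j i else 0)"
  proof (intro Bochner_Integration.integral_cong refl)
    fix l
    show "measure_pmf.expectation (cond_pmf p {..l}) (\<lambda>r. eig j (step (l, r) i)) = (if l < j then eig j i else 0)"
    proof (cases "l < i")
      case True
      then show ?thesis by (auto simp: step_def eig_def)
    next
      case False
      show ?thesis
      proof (cases "l < j")
        case True
        have "measure_pmf.expectation (cond_pmf p {..l}) (\<lambda>r. eig j (step (l, r) i)) = measure_pmf.expectation (cond_pmf p {..l}) (\<lambda>r. eig j i)"
          using True False by (intro integral_cong_AE) (auto simp: AE_measure_pmf_iff set_cond_pmf[OF cond_nonempty] step_def eig_def)
        then show ?thesis using True by simp
      next
        case jl: False
        have "measure_pmf.expectation (cond_pmf p {..l}) (\<lambda>r. eig j (step (l, r) i))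
          = measure_pmf.expectation (cond_pmf p {..l}) (\<lambda>r. indicator {j} r * (1 / pmf p j) - indicator {..j - 1} r * (1 / P\<^sub>l (j - 1)))"
          using False j by (intro Bochner_Integration.integral_cong refl) (auto simp: step_def eig_def indicator_def)
        also have "\<dots> = pmf (cond_pmf p {..l}) j * (1 / pmf p j) - measure (measure_pmf (cond_pmf p {..l})) {..j - 1} * (1 / P\<^sub>l (j - 1))"
          by (subst Bochner_Integration.integral_diff)
             (auto simp: measure_pmf_single integrable_indicator_iff measure_pmf.emeasure_eq_measure intro!: integrable_mult_left integrable_divide)
        also have "measure (measure_pmf (cond_pmf p {..l})) {..j - 1} = P\<^sub>l (j - 1) / P\<^sub>l l"
        proof -
          have "measure (measure_pmf (cond_pmf p {..l})) {..j - 1} = (\<Sum>t\<le>j - 1. pmf (cond_pmf p {..l}) t)"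
            by (rule measure_measure_pmf_finite) simp
          also have "\<dots> = (\<Sum>t\<le>j - 1. pmf p t) / P\<^sub>l l"
            using jl j by (subst sum_divide_distrib) (auto simp: pmf_cond_p intro!: sum.cong)
          also have "(\<Sum>t\<le>j - 1. pmf p t) = P\<^sub>l (j - 1)"
            unfolding P\<^sub>l_def by (rule measure_measure_pmf_finite[symmetric]) simp
          finally show ?thesis .
        qed
        also have "pmf (cond_pmf p {..l}) j * (1 / pmf p j) - P\<^sub>l (j - 1) / P\<^sub>l l * (1 / P\<^sub>l (j - 1)) = 0"
          using jl pmf_p_pos[of j] P\<^sub>l_pos[of "j - 1"] P\<^sub>l_pos[of l] by (simp add: pmf_cond_p)
        finally show ?thesis using jl by simp
      qed
    qed
  qed
  finally show ?thesis by (simp add: expectation_lev_if)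
qed

lemma S\<^sub>f_eig:
  assumes "j \<ge> 1"
  shows "S\<^sub>f (eig j) i us = real (occ {j} i us) / pmf p j - real (occ {..<j} i us) / P\<^sub>l (j - 1)"
  by (induction us arbitrary: i) (auto simp: eig_def add_divide_distrib)

lemma occ_total: "occ {j} i us + occ {..<j} i us + occ {j<..} i us = length us"
proof (induction us arbitrary: i)
  case (Cons u us)
  show ?case using Cons[of "step u i"] by (cases "step u i" j rule: linorder_cases) auto
qed simp

lemma occ_le_length: "occ A i us \<le> length us"
  by (induction us arbitrary: i) (auto intro: le_SucI)

lemma abs_occ_le: "us \<in> set_pmf (replicate_pmf n q) \<Longrightarrow> \<bar>real (occ A i us)\<bar> \<le> real n"
  using occ_le_length[of A i us] length_replicate_pmf[of us n q] by simp

lemma expectation_occ: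
  "measure_pmf.expectation p (\<lambda>i. measure_pmf.expectation (replicate_pmf n U) (\<lambda>us. real (occ A i us)))
   = real n * measure (measure_pmf p) A"
proof (induction n)
  case 0
  show ?case by simp
next
  case (Suc n)
  let ?o = "\<lambda>n i. measure_pmf.expectation (replicate_pmf n U) (\<lambda>us. real (occ A i us))"
  have ob: "\<bar>?o m i\<bar> \<le> real m" for m i
    by (intro expectation_abs_le_set(1) abs_occ_le)
  have o_Suc: "?o (Suc n) i = measure_pmf.expectation U (\<lambda>u. indicator A (step u i) + ?o n (step u i))" for i
  proof -
    have "?o (Suc n) i = measure_pmf.expectation U (\<lambda>u. measure_pmf.expectation (replicate_pmf n U) (\<lambda>us. real (occ A i (u # us))))"
    proof (rule expectation_replicate_Suc[where B="real (Suc n)"])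
      fix us :: "(nat \<times> nat) list" assume "length us = Suc n"
      then show "\<bar>real (occ A i us)\<bar> \<le> real (Suc n)" using occ_le_length[of A i us] by simp
    qed
    also have "\<dots> = measure_pmf.expectation U (\<lambda>u. indicator A (step u i) + ?o n (step u i))"
    proof (intro Bochner_Integration.integral_cong refl)
      fix u
      have "integrable (measure_pmf (replicate_pmf n U)) (\<lambda>us. real (occ A (step u i) us))"
        by (intro expectation_abs_le_set(2)[where B="real n"] abs_occ_le)
      then show "measure_pmf.expectation (replicate_pmf n U) (\<lambda>us. real (occ A i (u # us))) = indicator A (step u i) + ?o n (step u i)"
        by (simp add: indicator_def)
    qed
    finally show ?thesis .
  qed
  have "measure_pmf.expectation p (?o (Suc n)) = measure_pmf.expectation p (\<lambda>i. indicator A i + ?o n i)"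
    unfolding o_Suc
  proof (rule expectation_step_stationary)
    fix i show "\<bar>indicator A i + ?o n i\<bar> \<le> 1 + real n" using ob[of n i] by (auto simp: indicator_def)
  qed
  also have "\<dots> = measure (measure_pmf p) A + real n * measure (measure_pmf p) A"
    using Suc ob by (subst Bochner_Integration.integral_add)
      (auto simp: integrable_indicator_iff measure_pmf.emeasure_eq_measure intro!: integrable_pmf_bounded[where B="real n"])
  finally show ?case by (simp add: algebra_simps)
qed

end

lemma prob_square_ge:
  fixes f :: "'b \<Rightarrow> real"
  assumes f: "\<And>x. x \<in> set_pmf q \<Longrightarrow> \<bar>f x\<bar> \<le> B" and \<epsilon>: "\<epsilon> > 0"
  shows "measure (measure_pmf q) {x. \<epsilon> \<le> \<bar>f x\<bar>} \<le> measure_pmf.expectation q (\<lambda>x. (f x)\<^sup>2) / \<epsilon>\<^sup>2"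
proof -
  have i: "integrable (measure_pmf q) (\<lambda>x. (f x)\<^sup>2 / \<epsilon>\<^sup>2)"
  proof (rule integrable_divide, rule measure_pmf.integrable_const_bound[where B="B\<^sup>2"], rule AE_pmfI)
    fix x assume "x \<in> set_pmf q"
    from power_mono[OF f[OF this], of 2] show "norm ((f x)\<^sup>2) \<le> B\<^sup>2" by simp
  qed simp
  have "measure (measure_pmf q) {x. \<epsilon> \<le> \<bar>f x\<bar>} = measure_pmf.expectation q (indicator {x. \<epsilon> \<le> \<bar>f x\<bar>})"
    by simp
  also have "\<dots> \<le> measure_pmf.expectation q (\<lambda>x. (f x)\<^sup>2 / \<epsilon>\<^sup>2)"
  proof (rule integral_mono[OF _ i])
    show "integrable (measure_pmf q) (indicator {x. \<epsilon> \<le> \<bar>f x\<bar>} :: _ \<Rightarrow> real)"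
      by (simp add: integrable_indicator_iff measure_pmf.emeasure_eq_measure)
    fix x
    show "indicator {x. \<epsilon> \<le> \<bar>f x\<bar>} x \<le> (f x)\<^sup>2 / \<epsilon>\<^sup>2"
    proof (cases "\<epsilon> \<le> \<bar>f x\<bar>")
      case True
      then have "\<epsilon>\<^sup>2 \<le> (f x)\<^sup>2" using power_mono[OF True, of 2] \<epsilon> by simp
      then show ?thesis using \<epsilon> True by simp
    qed simp
  qed
  finally show ?thesis by simp
qed

lemma prob_ge_expectation:
  fixes f :: "'b \<Rightarrow> real"
  assumes f: "\<And>x. x \<in> set_pmf q \<Longrightarrow> \<bar>f x\<bar> \<le> B" "\<And>x. f x \<ge> 0" and \<epsilon>: "\<epsilon> > 0"
  shows "measure (measure_pmf q) {x. \<epsilon> \<le> f x} \<le> measure_pmf.expectation q f / \<epsilon>"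
proof -
  have i: "integrable (measure_pmf q) (\<lambda>x. f x / \<epsilon>)"
    by (rule integrable_divide, rule measure_pmf.integrable_const_bound[where B=B], rule AE_pmfI)
       (auto simp: f(1) real_norm_def)
  have "measure (measure_pmf q) {x. \<epsilon> \<le> f x} = measure_pmf.expectation q (indicator {x. \<epsilon> \<le> f x})"
    by simp
  also have "\<dots> \<le> measure_pmf.expectation q (\<lambda>x. f x / \<epsilon>)"
  proof (rule integral_mono[OF _ i])
    show "integrable (measure_pmf q) (indicator {x. \<epsilon> \<le> f x} :: _ \<Rightarrow> real)"
      by (simp add: integrable_indicator_iff measure_pmf.emeasure_eq_measure)
    show "indicator {x. \<epsilon> \<le> f x} x \<le> f x / \<epsilon>" for x
      using f(2)[of x] \<epsilon> by (auto simp: indicator_def)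
  qed
  finally show ?thesis by simp
qed

context level_chain
begin

lemma expectation_pair_replicate:
  fixes f :: "nat \<times> (nat \<times> nat) list \<Rightarrow> real"
  assumes "\<And>i us. us \<in> set_pmf (replicate_pmf n U) \<Longrightarrow> \<bar>f (i, us)\<bar> \<le> B"
  shows "measure_pmf.expectation (pair_pmf p (replicate_pmf n U)) f
    = measure_pmf.expectation p (\<lambda>i. measure_pmf.expectation (replicate_pmf n U) (\<lambda>us. f (i, us)))"
proof -
  have "measure_pmf.expectation (pair_pmf p (replicate_pmf n U)) f
    = measure_pmf.expectation p (\<lambda>i. measure_pmf.expectation (bind_pmf (replicate_pmf n U) (\<lambda>us. return_pmf (i, us))) f)"
    unfolding pair_pmf_def using assms by (intro integral_bind_pmf_real'[where B=B]) auto
  also have "\<dots> = measure_pmf.expectation p (\<lambda>i. measure_pmf.expectation (replicate_pmf n U) (\<lambda>us. f (i, us)))"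
    by (simp add: map_pmf_def[symmetric])
  finally show ?thesis .
qed

lemma eig_bound: "\<bar>eig j t\<bar> \<le> 1 / pmf p j + 1 / P\<^sub>l (j - 1)"
  using pmf_p_pos[of j] P\<^sub>l_pos[of "j - 1"] by (auto simp: eig_def)

text \<open>The constant of \<open>second_moment_S\<^sub>f\<close> for \<open>eig j\<close>.\<close>

definition D\<^sub>j :: "nat \<Rightarrow> real" where
  "D\<^sub>j j = (1 + 2 / (1 - s j)) * (1 / pmf p j + 1 / P\<^sub>l (j - 1))\<^sup>2"

text \<open>The last four terms bound the probabilities of exceptional events: an overlong run, an
  atypical number of draws of \<open>j\<close>, unbalanced occupation of \<open>j\<close> and the
  lower types, and too much time above \<open>j\<close>. Outside them \<open>\<Psi>_pathwise\<close>
  gives the exponential, where \<open>\<beta> * (L / 2)\<^sup>2\<close> accounts for a cluster of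
  type \<open>j\<close> that is running at time 0.\<close>

lemma characteristic_bound:
  assumes j: "j \<ge> 1" "pmf p j \<le> 1 / 8" "\<tau> j \<le> 1 / 8" and n: "n \<ge> 1" and N: "N \<ge> 1" "real N * \<bar>\<alpha> j\<bar> \<le> 1"
  defines "L \<equiv> 1 / (1 - s j)" and "\<beta> \<equiv> (\<alpha> j)\<^sup>2 / 4"
  shows "norm (measure_pmf.expectation \<pi> ((G (Fv \<alpha>) ^^ n) (\<lambda>_. 1)))
    \<le> exp (\<beta> * (L / 2)\<^sup>2 - \<beta> * (real n * L * pmf p j / 3)) + real (Suc n) * s j ^ N
      + 64 / (real n * \<zeta> j) + 64 * D\<^sub>j j / real n + 8 * \<tau> j"
proof -
  define q where "q = pair_pmf p (replicate_pmf n U)"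
  \<comment> \<open>Half the mean cluster length, so that the gain \<open>2 * \<mu> * occ\<close>
    outweighs the cost \<open>\<mu>\<^sup>2 * cnt\<close> despite the crude constants 2/3 and 9/28
    below; their difference exceeds 1/3.\<close>
  define \<mu> where "\<mu> = L / 2"
  have n0: "real n > 0" using n by simp
  have L: "L > 0" using s_bounds(2)[of j] by (simp add: L_def)
  have \<beta>: "\<beta> \<ge> 0" by (simp add: \<beta>_def)
  note pj = pmf_p_pos[of j] and zj = \<zeta>_bounds(3)[of j]
  have set_q: "us \<in> set_pmf (replicate_pmf n U)" if "(i, us) \<in> set_pmf q" for i us
    using that by (simp add: q_def)
  define E\<^sub>1 :: "(nat \<times> (nat \<times> nat) list) set" where "E\<^sub>1 = {x. long j N 0 (snd x)}"
  define E\<^sub>2 :: "(nat \<times> (nat \<times> nat) list) set" where "E\<^sub>2 = {x. real n * \<zeta> j / 8 \<le> \<bar>real (cnt j (snd x)) - real n * \<zeta> j\<bar>}"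
  define E\<^sub>3 where "E\<^sub>3 = {x. real n / 8 \<le> \<bar>S\<^sub>f (eig j) (fst x) (snd x)\<bar>}"
  define E\<^sub>4 where "E\<^sub>4 = {x. real n / 8 \<le> real (occ {j<..} (fst x) (snd x))}"
  define e where "e = exp (\<beta> * \<mu>\<^sup>2 - \<beta> * (real n * L * pmf p j / 3))"
  have good: "\<bar>\<Psi> \<alpha> i 0 us\<bar> \<le> e" if x: "(i, us) \<in> set_pmf q" and g: "(i, us) \<notin> E\<^sub>1" "(i, us) \<notin> E\<^sub>2" "(i, us) \<notin> E\<^sub>3" "(i, us) \<notin> E\<^sub>4" for i us
  proof -
    have us: "length us = n" "\<forall>u\<in>set us. snd u \<le> fst u"
      using set_q[OF x] set_U by (auto simp: set_replicate_pmf lists_eq_set subset_iff)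
    have nl: "\<not> long j N 0 us" using g(1) by (simp add: E\<^sub>1_def)
    have cos_le: "\<bar>cos (real m * \<alpha> j)\<bar> \<le> exp (- (\<beta> * (real m)\<^sup>2))" if "m \<le> N" for m
    proof -
      have "\<bar>real m * \<alpha> j\<bar> \<le> real N * \<bar>\<alpha> j\<bar>" using that by (simp add: abs_mult mult_right_mono)
      then have "\<bar>cos (real m * \<alpha> j)\<bar> \<le> exp (- ((real m * \<alpha> j)\<^sup>2 / 4))"
        using N(2) by (intro abs_cos_le_exp) linarith
      then show ?thesis by (simp add: \<beta>_def power_mult_distrib mult.commute)
    qed
    define a where "a = 2 * \<mu> * real (occ {j} i us) - \<mu>\<^sup>2 * real (cnt j us)"
    have "\<bar>\<Psi> \<alpha> i 0 us\<bar> \<le> exp (\<beta> * \<mu>\<^sup>2 - \<beta> * a)"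
    proof (cases "i = j")
      case True
      have "\<bar>\<Psi> \<alpha> j (real 0 * \<alpha> j) us\<bar> \<le> exp (- (\<beta> * (2 * \<mu> * (real 0 + real (occ {j} j us)) - \<mu>\<^sup>2 - \<mu>\<^sup>2 * real (cnt j us))))"
        by (rule \<Psi>_pathwise(2)[where \<alpha>=\<alpha> and j=j and \<beta>=\<beta> and \<mu>=\<mu> and N=N and k=0, OF cos_le \<beta> N(1) us(2) nl]) auto
      then show ?thesis using True by (simp add: a_def algebra_simps)
    next
      case False
      have "\<bar>\<Psi> \<alpha> i 0 us\<bar> \<le> exp (- (\<beta> * (2 * \<mu> * real (occ {j} i us) - \<mu>\<^sup>2 * real (cnt j us))))"
        by (rule \<Psi>_pathwise(1)[where \<alpha>=\<alpha> and j=j and \<beta>=\<beta> and \<mu>=\<mu> and N=N and k=0, OF cos_le \<beta> N(1) us(2) nl False])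
      also have "\<dots> \<le> exp (\<beta> * \<mu>\<^sup>2 - \<beta> * a)" using \<beta> by (simp add: a_def)
      finally show ?thesis .
    qed
    also have "\<dots> \<le> e"
    proof -
      let ?o = "real (occ {j} i us)" and ?lo = "real (occ {..<j} i us)" and ?hi = "real (occ {j<..} i us)"
      have tot: "?o + ?lo + ?hi = real n" using occ_total[of j i us] us(1) by (simp flip: of_nat_add)
      have hi: "?hi < real n / 8" using g(4) by (simp add: E\<^sub>4_def)
      have S: "?o / pmf p j - ?lo / P\<^sub>l (j - 1) \<ge> - (real n / 8)"
      proof -
        have "\<bar>S\<^sub>f (eig j) i us\<bar> < real n / 8" using g(3) by (simp add: E\<^sub>3_def not_le)
        then show ?thesis unfolding S\<^sub>f_eig[OF j(1)] by linarith
      qed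
      have "?lo \<le> ?lo / P\<^sub>l (j - 1)"
        using P\<^sub>l_pos[of "j - 1"] P\<^sub>l_le_1[of "j - 1"] by (simp add: le_divide_eq mult_left_le)
      then have "?o / pmf p j \<ge> ?lo - real n / 8" using S by linarith
      then have "?o / pmf p j + ?o \<ge> real n * (3 / 4)" using tot hi by linarith
      moreover have "?o \<le> ?o / pmf p j * (1 / 8)"
      proof -
        have "?o * (8 * pmf p j) \<le> ?o * 1" using j(2) by (intro mult_left_mono) auto
        then show ?thesis using pj by (simp add: field_simps)
      qed
      \<comment> \<open>The 3/4 is what two losses of 1/8 leave, one from the types above
        \<open>j\<close> and one from the fluctuation of \<open>eig j\<close>; since
        \<open>?o\<close> is at most 1/8 of the quotient, 2/3 remains.\<close>
      moreover have "x \<ge> m * (2 / 3)" if "x + y \<ge> m * (3 / 4)" "y \<le> x * (1 / 8)" for x y m :: real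
        using that by linarith
      ultimately have "?o / pmf p j \<ge> real n * (2 / 3)" by blast
      then have o: "?o \<ge> real n * pmf p j * (2 / 3)" using pj by (simp add: field_simps)
      have c: "real (cnt j us) \<le> real n * \<zeta> j * (9 / 8)"
      proof -
        have "\<bar>real (cnt j us) - real n * \<zeta> j\<bar> < real n * \<zeta> j / 8" using g(2) by (simp add: E\<^sub>2_def not_le)
        then show ?thesis by linarith
      qed
      have z: "\<zeta> j \<le> pmf p j / L * (8 / 7)"
      proof -
        have "\<zeta> j \<le> (1 - s j) * pmf p j / P\<^sub>l j" by (rule \<zeta>_bounds(2))
        also have "\<dots> \<le> (1 - s j) * pmf p j / (7 / 8)"
          using j(3) pj s_bounds(2)[of j] by (intro divide_left_mono mult_nonneg_nonneg mult_pos_pos) (auto simp: P\<^sub>l_\<tau>)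
        finally show ?thesis by (simp add: L_def mult.commute)
      qed
      have "\<mu>\<^sup>2 * real (cnt j us) \<le> \<mu>\<^sup>2 * (real n * (pmf p j / L * (8 / 7)) * (9 / 8))"
        by (intro mult_left_mono order_trans[OF c] mult_right_mono z) auto
      also have "\<dots> = real n * L * pmf p j * (9 / 28)"
        using L by (simp add: \<mu>_def power2_eq_square field_simps)
      finally have "\<mu>\<^sup>2 * real (cnt j us) \<le> real n * L * pmf p j * (9 / 28)" .
      moreover have "2 * \<mu> * ?o \<ge> real n * L * pmf p j * (2 / 3)"
        using mult_left_mono[OF o, of L] L by (simp add: \<mu>_def algebra_simps)
      ultimately have "a \<ge> real n * L * pmf p j * (2 / 3) - real n * L * pmf p j * (9 / 28)"
        unfolding a_def by linarith
      moreover have "real n * L * pmf p j \<ge> 0" using n0 L pj by simp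
      ultimately have "a \<ge> real n * L * pmf p j / 3" by linarith
      then have "\<beta> * (real n * L * pmf p j / 3) \<le> \<beta> * a" using \<beta> by (rule mult_left_mono)
      then show ?thesis unfolding e_def by simp
    qed
    finally show ?thesis .
  qed
  have e0: "e \<ge> 0" by (simp add: e_def)
  have "measure_pmf.expectation q (\<lambda>(i, us). \<bar>\<Psi> \<alpha> i 0 us\<bar>)
     \<le> measure_pmf.expectation q (\<lambda>x. e + indicator E\<^sub>1 x + indicator E\<^sub>2 x + indicator E\<^sub>3 x + indicator E\<^sub>4 x)"
  proof (rule integral_mono_AE)
    show "integrable (measure_pmf q) (\<lambda>(i, us). \<bar>\<Psi> \<alpha> i 0 us\<bar>)"
      using abs_\<Psi>_le_1 by (intro integrable_pmf_bounded[where B=1]) auto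
    show "integrable (measure_pmf q) (\<lambda>x. e + indicator E\<^sub>1 x + indicator E\<^sub>2 x + indicator E\<^sub>3 x + indicator E\<^sub>4 x)"
      by (auto simp: integrable_indicator_iff measure_pmf.emeasure_eq_measure)
    show "AE x in measure_pmf q. (case x of (i, us) \<Rightarrow> \<bar>\<Psi> \<alpha> i 0 us\<bar>)
       \<le> e + indicator E\<^sub>1 x + indicator E\<^sub>2 x + indicator E\<^sub>3 x + indicator E\<^sub>4 x"
    proof (rule AE_pmfI, clarify)
      fix i us assume x: "(i, us) \<in> set_pmf q"
      show "\<bar>\<Psi> \<alpha> i 0 us\<bar> \<le> e + indicator E\<^sub>1 (i, us) + indicator E\<^sub>2 (i, us) + indicator E\<^sub>3 (i, us) + indicator E\<^sub>4 (i, us)"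
      proof (cases "(i, us) \<in> E\<^sub>1 \<or> (i, us) \<in> E\<^sub>2 \<or> (i, us) \<in> E\<^sub>3 \<or> (i, us) \<in> E\<^sub>4")
        case True
        then have "1 \<le> e + indicator E\<^sub>1 (i, us) + indicator E\<^sub>2 (i, us) + indicator E\<^sub>3 (i, us) + (indicator E\<^sub>4 (i, us) :: real)"
          using e0 by (auto simp: indicator_def)
        then show ?thesis using abs_\<Psi>_le_1[of \<alpha> i 0 us] by linarith
      next
        case False
        then show ?thesis using good[OF x] by simp
      qed
    qed
  qed
  also have "\<dots> = e + measure (measure_pmf q) E\<^sub>1 + measure (measure_pmf q) E\<^sub>2 + measure (measure_pmf q) E\<^sub>3 + measure (measure_pmf q) E\<^sub>4"
    by (simp add: integrable_indicator_iff measure_pmf.emeasure_eq_measure)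
  also have "\<dots> \<le> e + real (Suc n) * s j ^ N + 64 / (real n * \<zeta> j) + 64 * D\<^sub>j j / real n + 8 * \<tau> j"
  proof (intro add_mono order_refl)
    have "measure (measure_pmf q) E\<^sub>1 = measure_pmf.expectation q (\<lambda>x. of_bool (long j N 0 (snd x)))"
    proof -
      have "(\<lambda>x. of_bool (long j N 0 (snd x))) = (indicator E\<^sub>1 :: _ \<Rightarrow> real)" by (auto simp: E\<^sub>1_def indicator_def fun_eq_iff)
      then show ?thesis by simp
    qed
    also have "\<dots> = measure_pmf.expectation (map_pmf snd q) (\<lambda>us. of_bool (long j N 0 us))" by simp
    also have "\<dots> \<le> s j ^ (N - 0) + real n * (1 - s j) * s j ^ N"
      unfolding q_def map_snd_pair_pmf using N(1) by (intro prob_long) simp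
    also have "\<dots> \<le> s j ^ N + real n * 1 * s j ^ N"
      using s_bounds[of j] by (intro add_mono mult_right_mono mult_left_mono) auto
    finally show "measure (measure_pmf q) E\<^sub>1 \<le> real (Suc n) * s j ^ N" by (simp add: algebra_simps)
  next
    have b: "\<bar>real (cnt j (snd x)) - real n * \<zeta> j\<bar> \<le> real n" if "x \<in> set_pmf q" for x
    proof -
      have "length (snd x) = n" using that set_q[of "fst x" "snd x"] length_replicate_pmf by simp
      then have "real (cnt j (snd x)) \<le> real n" using cnt_le_length[of j "snd x"] by simp
      moreover have "0 \<le> real n * \<zeta> j" "real n * \<zeta> j \<le> real n" using zj \<zeta>_bounds(4)[of j] by (auto simp: mult_left_le)
      ultimately show ?thesis using of_nat_0_le_iff[of "cnt j (snd x)"] by linarith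
    qed
    have "measure (measure_pmf q) E\<^sub>2 \<le> measure_pmf.expectation q (\<lambda>x. (real (cnt j (snd x)) - real n * \<zeta> j)\<^sup>2) / (real n * \<zeta> j / 8)\<^sup>2"
      unfolding E\<^sub>2_def using n0 zj by (intro prob_square_ge[OF b]) auto
    also have "measure_pmf.expectation q (\<lambda>x. (real (cnt j (snd x)) - real n * \<zeta> j)\<^sup>2)
      = measure_pmf.expectation (map_pmf snd q) (\<lambda>us. (0 + (real (cnt j us) - real n * \<zeta> j))\<^sup>2)" by simp
    also have "\<dots> = real n * \<zeta> j * (1 - \<zeta> j)"
      unfolding q_def map_snd_pair_pmf variance_cnt by simp
    also have "real n * \<zeta> j * (1 - \<zeta> j) / (real n * \<zeta> j / 8)\<^sup>2 \<le> real n * \<zeta> j / (real n * \<zeta> j / 8)\<^sup>2"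
      using n0 zj by (intro divide_right_mono) (auto simp: mult_left_le)
    also have "\<dots> = 64 / (real n * \<zeta> j)"
      using n0 zj by (simp add: power2_eq_square field_simps)
    finally show "measure (measure_pmf q) E\<^sub>2 \<le> 64 / (real n * \<zeta> j)" .
  next
    let ?C = "1 / pmf p j + 1 / P\<^sub>l (j - 1)"
    have b: "\<bar>S\<^sub>f (eig j) (fst x) (snd x)\<bar> \<le> real n * ?C" if "x \<in> set_pmf q" for x
    proof -
      have "snd x \<in> set_pmf (replicate_pmf n U)" using that set_q[of "fst x" "snd x"] by simp
      then show ?thesis by (rule S\<^sub>f_replicate[OF eig_bound])
    qed
    have "measure (measure_pmf q) E\<^sub>3 \<le> measure_pmf.expectation q (\<lambda>x. (S\<^sub>f (eig j) (fst x) (snd x))\<^sup>2) / (real n / 8)\<^sup>2"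
      unfolding E\<^sub>3_def using n0 by (intro prob_square_ge[OF b]) auto
    also have "measure_pmf.expectation q (\<lambda>x. (S\<^sub>f (eig j) (fst x) (snd x))\<^sup>2)
      = measure_pmf.expectation p (\<lambda>i. measure_pmf.expectation (replicate_pmf n U) (\<lambda>us. (S\<^sub>f (eig j) i us)\<^sup>2))"
    proof (unfold q_def, subst expectation_pair_replicate)
      show "\<bar>(S\<^sub>f (eig j) (fst (i, us)) (snd (i, us)))\<^sup>2\<bar> \<le> (real n * ?C)\<^sup>2" if "us \<in> set_pmf (replicate_pmf n U)" for i us
        using power_mono[OF S\<^sub>f_replicate[where f="eig j" and C="?C" and us=us and n=n and i=i, OF eig_bound that], of 2] by simp
    qed simp
    also have "\<dots> / (real n / 8)\<^sup>2 \<le> real n * D\<^sub>j j / (real n / 8)\<^sup>2"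
      unfolding D\<^sub>j_def using s_bounds(1,2)[of j]
      by (intro divide_right_mono second_moment_S\<^sub>f eig_bound eig_eigen j(1)) auto
    also have "\<dots> = 64 * D\<^sub>j j / real n"
      using n0 by (simp add: power2_eq_square field_simps)
    finally show "measure (measure_pmf q) E\<^sub>3 \<le> 64 * D\<^sub>j j / real n" .
  next
    have "measure (measure_pmf q) E\<^sub>4 \<le> measure_pmf.expectation q (\<lambda>x. real (occ {j<..} (fst x) (snd x))) / (real n / 8)"
      unfolding E\<^sub>4_def
    proof (rule prob_ge_expectation)
      show "\<bar>real (occ {j<..} (fst x) (snd x))\<bar> \<le> real n" if "x \<in> set_pmf q" for x
        using that set_q[of "fst x" "snd x"] abs_occ_le[of "snd x" n U] by simp
    qed (use n0 in auto)
    also have "measure_pmf.expectation q (\<lambda>x. real (occ {j<..} (fst x) (snd x))) = real n * \<tau> j"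
      unfolding q_def \<tau>_def expectation_occ[symmetric]
      by (subst expectation_pair_replicate[where B="real n"]) (simp_all only: fst_conv snd_conv abs_occ_le)
    finally show "measure (measure_pmf q) E\<^sub>4 \<le> 8 * \<tau> j" using n0 by (simp add: field_simps)
  qed
  finally show ?thesis
    using expectation_\<pi>_G_Fv[where \<alpha>=\<alpha> and n=n] unfolding q_def e_def \<mu>_def by linarith
qed

end

section \<open>Concentration functions\<close>

text \<open>The indicator of an interval is dominated by a multiple of a Gaussian, which is the
  characteristic function of a standard normal variable.\<close>

lemma concentration_le_char:
  assumes \<nu>: "real_distribution \<nu>" and c: "c > 0"
  shows "measure \<nu> {r - c<..<r + c} \<le> exp (1 / 2) * (\<integral>x. norm (char \<nu> (x / c)) \<partial>std_normal_distribution)"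
proof -
  interpret \<nu>: real_distribution \<nu> by fact
  let ?N = std_normal_distribution
  interpret N: real_distribution ?N by (rule real_dist_normal_dist)
  interpret P: pair_prob_space \<nu> ?N ..
  let ?g = "\<lambda>y. exp (- (((y - r) / c)\<^sup>2) / 2)"
  let ?f = "\<lambda>(y, x). iexp ((y - r) / c * x)"
  have g: "complex_of_real (?g y) = (\<integral>x. iexp ((y - r) / c * x) \<partial>?N)" for y
    using fun_cong[OF char_std_normal_distribution, of "(y - r) / c"] by (simp add: char_def)
  have int: "integrable (\<nu> \<Otimes>\<^sub>M ?N) ?f"
  proof (rule P.integrable_const_bound[where B=1])
    show "?f \<in> borel_measurable (\<nu> \<Otimes>\<^sub>M ?N)" by measurable
  qed (auto simp: split_beta)
  have ig: "integrable \<nu> ?g" by (rule \<nu>.integrable_const_bound[where B=1]) auto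
  have "complex_of_real (\<integral>y. ?g y \<partial>\<nu>) = (\<integral>y. (\<integral>x. iexp ((y - r) / c * x) \<partial>?N) \<partial>\<nu>)"
    unfolding g[symmetric] by simp
  also have "\<dots> = (\<integral>x. (\<integral>y. iexp ((y - r) / c * x) \<partial>\<nu>) \<partial>?N)"
    by (rule P.Fubini_integral[symmetric, OF int])
  also have "\<dots> = (\<integral>x. iexp (- (r * x / c)) * char \<nu> (x / c) \<partial>?N)"
  proof (rule Bochner_Integration.integral_cong[OF refl])
    fix x
    have "(\<integral>y. iexp ((y - r) / c * x) \<partial>\<nu>) = (\<integral>y. iexp (- (r * x / c)) * iexp (x / c * y) \<partial>\<nu>)"
    proof (rule Bochner_Integration.integral_cong[OF refl])
      fix y
      have "(y - r) / c * x = - (r * x / c) + x / c * y" using c by (simp add: field_simps)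
      then show "iexp ((y - r) / c * x) = iexp (- (r * x / c)) * iexp (x / c * y)"
        by (simp only: of_real_add distrib_left exp_add)
    qed
    then show "(\<integral>y. iexp ((y - r) / c * x) \<partial>\<nu>) = iexp (- (r * x / c)) * char \<nu> (x / c)"
      by (simp add: char_def)
  qed
  finally have eq: "complex_of_real (\<integral>y. ?g y \<partial>\<nu>) = (\<integral>x. iexp (- (r * x / c)) * char \<nu> (x / c) \<partial>?N)" .
  have g0: "0 \<le> (\<integral>y. ?g y \<partial>\<nu>)" by (intro integral_nonneg_AE) auto
  have "(\<integral>y. ?g y \<partial>\<nu>) = norm (complex_of_real (\<integral>y. ?g y \<partial>\<nu>))"
    unfolding norm_of_real using g0 by simp
  also have "\<dots> \<le> (\<integral>x. norm (iexp (- (r * x / c)) * char \<nu> (x / c)) \<partial>?N)"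
    unfolding eq by (rule integral_norm_bound)
  also have "\<dots> = (\<integral>x. norm (char \<nu> (x / c)) \<partial>?N)"
    by (simp add: norm_mult)
  finally have gb: "(\<integral>y. ?g y \<partial>\<nu>) \<le> (\<integral>x. norm (char \<nu> (x / c)) \<partial>?N)" .
  have "measure \<nu> {r - c<..<r + c} = (\<integral>y. indicator {r - c<..<r + c} y \<partial>\<nu>)" by simp
  also have "\<dots> \<le> (\<integral>y. exp (1 / 2) * ?g y \<partial>\<nu>)"
  proof (rule integral_mono)
    show "integrable \<nu> (indicator {r - c<..<r + c} :: real \<Rightarrow> real)"
      by (simp add: integrable_indicator_iff \<nu>.emeasure_eq_measure)
    show "integrable \<nu> (\<lambda>y. exp (1 / 2) * ?g y)" using ig by simp
    fix y
    show "indicator {r - c<..<r + c} y \<le> exp (1 / 2) * ?g y"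
    proof (cases "y \<in> {r - c<..<r + c}")
      case True
      \<comment> \<open>On the interval the Gaussian is at least \<open>exp (- 1 / 2)\<close>,
        whence the constant in front.\<close>
      then have "\<bar>(y - r) / c\<bar> \<le> 1" using c by (auto simp: abs_le_iff field_simps)
      then have "((y - r) / c)\<^sup>2 \<le> 1" by (simp add: abs_square_le_1)
      then have "0 \<le> 1 / 2 + - (((y - r) / c)\<^sup>2) / 2" by simp
      then have "1 \<le> exp (1 / 2 + - (((y - r) / c)\<^sup>2) / 2)" by simp
      then show ?thesis using True by (simp only: indicator_simps exp_add)
    qed simp
  qed
  also have "\<dots> = exp (1 / 2) * (\<integral>y. ?g y \<partial>\<nu>)" by simp
  also have "\<dots> \<le> exp (1 / 2) * (\<integral>x. norm (char \<nu> (x / c)) \<partial>?N)"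
    using gb by (intro mult_left_mono) auto
  finally show ?thesis .
qed

text \<open>The bound of \<open>concentration_le_char\<close> does not involve \<open>r\<close>, so
  it covers the supremum. Characteristic functions are bounded by 1 and the exceptional point 0 is a
  null set, so dominated convergence applies.\<close>

lemma concentration_tendsto_0:
  fixes \<nu> :: "nat \<Rightarrow> real measure"
  assumes \<nu>: "\<And>n. real_distribution (\<nu> n)" and c: "c > 0"
    and lim: "\<And>t. t \<noteq> 0 \<Longrightarrow> (\<lambda>n. char (\<nu> n) t) \<longlonglongrightarrow> 0"
  shows "(\<lambda>n. SUP r. measure (\<nu> n) {r - c<..<r + c}) \<longlonglongrightarrow> 0"
proof -
  let ?N = std_normal_distribution
  interpret N: real_distribution ?N by (rule real_dist_normal_dist)
  have "(\<lambda>n. \<integral>x. norm (char (\<nu> n) (x / c)) \<partial>?N) \<longlonglongrightarrow> (\<integral>x. 0 \<partial>?N)"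
  proof (rule integral_dominated_convergence[where w="\<lambda>_. 1"])
    show "(\<lambda>x. norm (char (\<nu> n) (x / c))) \<in> borel_measurable ?N" for n
      using real_distribution.char_measurable[OF \<nu>[of n]] by measurable
    have "AE x in lborel. x \<noteq> (0 :: real)" by (rule AE_lborel_singleton)
    then have "AE x in ?N. x \<noteq> 0" by (auto simp: AE_density elim: eventually_mono)
    then show "AE x in ?N. (\<lambda>n. norm (char (\<nu> n) (x / c))) \<longlonglongrightarrow> 0"
    proof eventually_elim
      case (elim x)
      then have "(\<lambda>n. char (\<nu> n) (x / c)) \<longlonglongrightarrow> 0" using c by (intro lim) auto
      then show ?case by (rule tendsto_norm_zero)
    qed
    show "AE x in ?N. norm (norm (char (\<nu> n) (x / c))) \<le> 1" for n
    proof (rule AE_I2)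
      fix x
      interpret \<nu>: real_distribution "\<nu> n" by (rule \<nu>)
      show "norm (norm (char (\<nu> n) (x / c))) \<le> 1" using \<nu>.cmod_char_le_1[of "x / c"] by simp
    qed
  qed auto
  then have lim0: "(\<lambda>n. exp (1 / 2) * (\<integral>x. norm (char (\<nu> n) (x / c)) \<partial>?N)) \<longlonglongrightarrow> 0"
    by (intro tendsto_mult_right_zero) simp
  show ?thesis
  proof (rule tendsto_sandwich[OF _ _ tendsto_const lim0]; intro always_eventually allI)
    fix n
    have bdd: "bdd_above (range (\<lambda>r. measure (\<nu> n) {r - c<..<r + c}))"
      using concentration_le_char[OF \<nu> c] by (auto intro!: bdd_aboveI2)
    have "0 \<le> measure (\<nu> n) {0 - c<..<0 + c}" by simp
    also have "\<dots> \<le> (SUP r. measure (\<nu> n) {r - c<..<r + c})" by (rule cSUP_upper[OF _ bdd]) simp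
    finally show "0 \<le> (SUP r. measure (\<nu> n) {r - c<..<r + c})" .
    show "(SUP r. measure (\<nu> n) {r - c<..<r + c}) \<le> exp (1 / 2) * (\<integral>x. norm (char (\<nu> n) (x / c)) \<partial>?N)"
      by (rule cSUP_least) (auto intro: concentration_le_char[OF \<nu> c])
  qed
qed

section \<open>Vanishing of the characteristic function at the square root scale\<close>

context level_chain
begin

lemma \<tau>_tendsto: "\<tau> \<longlonglongrightarrow> 0"
proof -
  have "(\<lambda>j. measure (measure_pmf p) {..j}) \<longlonglongrightarrow> measure (measure_pmf p) (\<Union>j. {..j})"
    by (rule measure_pmf.finite_Lim_measure_incseq) (auto simp: incseq_def)
  moreover have "(\<Union>j :: nat. {..j}) = UNIV" by auto
  ultimately have "P\<^sub>l \<longlonglongrightarrow> 1" by (simp add: P\<^sub>l_def[abs_def])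
  then have "(\<lambda>j. 1 - P\<^sub>l j) \<longlonglongrightarrow> 1 - 1" by (intro tendsto_intros)
  then show ?thesis by (simp add: P\<^sub>l_\<tau>)
qed

lemma pmf_p_le_\<tau>: "pmf p (Suc j) \<le> \<tau> j"
  unfolding \<tau>_def measure_pmf_single[symmetric] by (intro measure_pmf.finite_measure_mono) auto

lemma pmf_p_tendsto: "pmf p \<longlonglongrightarrow> 0"
proof -
  have "(\<lambda>j. pmf p (Suc j)) \<longlonglongrightarrow> 0"
    by (rule tendsto_sandwich[OF _ _ tendsto_const \<tau>_tendsto]) (auto simp: pmf_p_le_\<tau>)
  then show ?thesis by (simp add: filterlim_sequentially_Suc)
qed

text \<open>First \<open>j\<close> is chosen so that its rate makes
  \<open>exp (- (t\<^sup>2 * ?v j / 12))\<close> small and \<open>8 * \<tau> j\<close> is small too;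
  all other terms of \<open>characteristic_bound\<close> vanish as \<open>n\<close> tends to
  infinity with \<open>j\<close> fixed.\<close>

lemma characteristic_tendsto_0:
  assumes a: "\<And>i. a i > 0" and v: "filterlim (\<lambda>j. (a j)\<^sup>2 * pmf p j / (1 - s j)) at_top sequentially"
    and t: "t \<noteq> 0"
  shows "(\<lambda>n. measure_pmf.expectation \<pi> ((G (Fv (\<lambda>i. t / sqrt (real n) * a i)) ^^ n) (\<lambda>_. 1))) \<longlonglongrightarrow> 0"
proof -
  let ?A = "\<lambda>n. norm (measure_pmf.expectation \<pi> ((G (Fv (\<lambda>i. t / sqrt (real n) * a i)) ^^ n) (\<lambda>_. 1)))"
  have "\<forall>\<^sub>F n in sequentially. ?A n < \<epsilon>" if \<epsilon>: "\<epsilon> > 0" for \<epsilon> :: real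
  proof -
    let ?v = "\<lambda>j. (a j)\<^sup>2 * pmf p j / (1 - s j)"
    have "((\<lambda>x. exp (- (t\<^sup>2 * x / 12))) \<longlongrightarrow> 0) at_top"
      using t by real_asymp
    from filterlim_compose[OF this v] have "(\<lambda>j. exp (- (t\<^sup>2 * ?v j / 12))) \<longlonglongrightarrow> 0" .
    from order_tendstoD(2)[OF this, of "\<epsilon> / 8"] order_tendstoD(2)[OF \<tau>_tendsto, of "min (\<epsilon> / 64) (1 / 8)"]
      order_tendstoD(2)[OF pmf_p_tendsto, of "1 / 8"] eventually_ge_at_top[of 1]
    have "\<forall>\<^sub>F j in sequentially. exp (- (t\<^sup>2 * ?v j / 12)) < \<epsilon> / 8 \<and> \<tau> j < min (\<epsilon> / 64) (1 / 8) \<and> pmf p j < 1 / 8 \<and> j \<ge> 1"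
      using \<epsilon> by (auto elim: eventually_elim2 intro!: eventually_conj)
    then obtain j where j: "exp (- (t\<^sup>2 * ?v j / 12)) < \<epsilon> / 8" "\<tau> j < \<epsilon> / 64" "\<tau> j < 1 / 8" "pmf p j < 1 / 8" "j \<ge> 1"
      by (auto simp: eventually_sequentially)
    define L where "L = 1 / (1 - s j)"
    define k where "k = \<bar>t\<bar> * a j"
    have k: "k > 0" using t a by (simp add: k_def)
    \<comment> \<open>The largest \<open>N\<close> that keeps the phase
      \<open>N * |\<alpha> j|\<close> at most 1. It is of order the square root of \<open>n\<close>,
      so \<open>(n + 1) * s j ^ N\<close> still tends to 0.\<close>
    define N where "N n = nat \<lfloor>sqrt (real n) / k\<rfloor>" for n
    \<comment> \<open>A positive base also when \<open>s j = 0\<close>, so that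
      \<open>- ln s'\<close> is a positive rate.\<close>
    define s' where "s' = max (s j) (1 / 2)"
    have s': "0 < s'" "s' < 1" "s j \<le> s'" using s_bounds[of j] by (auto simp: s'_def)
    define d where "d = - ln s'"
    have d: "d > 0" using s' by (simp add: d_def)
    define B where "B n = exp (t\<^sup>2 * (a j)\<^sup>2 * L\<^sup>2 / 16 / real n - t\<^sup>2 * ?v j / 12) + real (Suc n) * exp (- d * (sqrt (real n) / k - 1))
       + 64 / (real n * \<zeta> j) + 64 * D\<^sub>j j / real n + 8 * \<tau> j" for n
    have "B \<longlonglongrightarrow> exp (0 - t\<^sup>2 * ?v j / 12) + 0 + 0 + 0 + 8 * \<tau> j"
      unfolding B_def[abs_def]
    proof (intro tendsto_add tendsto_exp tendsto_diff tendsto_const)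
      show "(\<lambda>n. t\<^sup>2 * (a j)\<^sup>2 * L\<^sup>2 / 16 / real n) \<longlonglongrightarrow> 0" by real_asymp
      show "(\<lambda>n. real (Suc n) * exp (- d * (sqrt (real n) / k - 1))) \<longlonglongrightarrow> 0" using d k by real_asymp
      show "(\<lambda>n. 64 / (real n * \<zeta> j)) \<longlonglongrightarrow> 0" using \<zeta>_bounds(3)[of j] by real_asymp
      show "(\<lambda>n. 64 * D\<^sub>j j / real n) \<longlonglongrightarrow> 0" by real_asymp
    qed
    moreover have "exp (0 - t\<^sup>2 * ?v j / 12) + 0 + 0 + 0 + 8 * \<tau> j < \<epsilon>"
      using j(1,2) \<epsilon> by simp
    ultimately have "\<forall>\<^sub>F n in sequentially. B n < \<epsilon>" by (rule order_tendstoD(2))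
    moreover have "\<forall>\<^sub>F n in sequentially. sqrt (real n) \<ge> k" by real_asymp
    ultimately show ?thesis using eventually_ge_at_top[of 1]
    proof eventually_elim
      case (elim n)
      let ?\<alpha> = "\<lambda>i. t / sqrt (real n) * a i"
      have sn: "sqrt (real n) > 0" using elim by simp
      have N1: "real (N n) \<le> sqrt (real n) / k" "real (N n) \<ge> sqrt (real n) / k - 1"
        using k sn by (auto simp: N_def)
      have "1 \<le> sqrt (real n) / k" using elim k by simp
      then have N2: "N n \<ge> 1" unfolding N_def by (simp add: le_nat_iff)
      have "real (N n) * \<bar>?\<alpha> j\<bar> = real (N n) * k / sqrt (real n)"
        using a[of j] by (simp add: k_def abs_mult)
      also have "\<dots> \<le> 1" using N1(1) k sn by (simp add: field_simps)
      finally have N3: "real (N n) * \<bar>?\<alpha> j\<bar> \<le> 1" .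
      have "?A n \<le> exp ((?\<alpha> j)\<^sup>2 / 4 * (1 / (1 - s j) / 2)\<^sup>2 - (?\<alpha> j)\<^sup>2 / 4 * (real n * (1 / (1 - s j)) * pmf p j / 3))
          + real (Suc n) * s j ^ N n + 64 / (real n * \<zeta> j) + 64 * D\<^sub>j j / real n + 8 * \<tau> j"
        using j(3,4) elim by (intro characteristic_bound[where \<alpha>="?\<alpha>" and j=j and n=n and N="N n", OF j(5) _ _ _ N2 N3]) auto
      also have "\<dots> \<le> B n"
        unfolding B_def
      proof (intro add_mono order_refl mult_left_mono)
        have 1: "(?\<alpha> j)\<^sup>2 = t\<^sup>2 * (a j)\<^sup>2 / real n"
          using sn by (simp add: power_mult_distrib power_divide)
        have "(?\<alpha> j)\<^sup>2 / 4 * (1 / (1 - s j) / 2)\<^sup>2 = t\<^sup>2 * (a j)\<^sup>2 * L\<^sup>2 / 16 / real n"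
          unfolding 1 L_def[symmetric] by (simp add: power_divide)
        moreover have "(?\<alpha> j)\<^sup>2 / 4 * (real n * (1 / (1 - s j)) * pmf p j / 3) = t\<^sup>2 * ?v j / 12"
          unfolding 1 using elim by simp
        ultimately show "exp ((?\<alpha> j)\<^sup>2 / 4 * (1 / (1 - s j) / 2)\<^sup>2 - (?\<alpha> j)\<^sup>2 / 4 * (real n * (1 / (1 - s j)) * pmf p j / 3))
          \<le> exp (t\<^sup>2 * (a j)\<^sup>2 * L\<^sup>2 / 16 / real n - t\<^sup>2 * ?v j / 12)" by (simp only: order_refl)
        have "s j ^ N n \<le> s' ^ N n" using s' s_bounds(1)[of j] by (intro power_mono) auto
        also have "\<dots> = s' powr real (N n)" using s' by (simp add: powr_realpow)
        also have "\<dots> = exp (- d * real (N n))" using s' by (simp add: powr_def d_def mult.commute)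
        also have "\<dots> \<le> exp (- d * (sqrt (real n) / k - 1))" using N1(2) d by simp
        finally show "s j ^ N n \<le> exp (- d * (sqrt (real n) / k - 1))" .
      qed simp
      also have "\<dots> < \<epsilon>" by fact
      finally show ?case .
    qed
  qed
  then have "?A \<longlonglongrightarrow> 0"
    by (intro order_tendstoI) (auto intro: always_eventually less_le_trans[OF _ norm_ge_zero])
  then show ?thesis by (rule tendsto_norm_zero_cancel)
qed

end

context level_process
begin

lemma expectation_iexp_sum:
  "expectation (\<lambda>\<omega>. iexp (t * (\<Sum>k=1..n. signed h (int k) \<omega>)))
    = measure_pmf.expectation \<pi> ((G (Fv (\<lambda>i. t * h i)) ^^ n) (\<lambda>_. 1))"
proof -
  have "iexp (t * (\<Sum>k=1..n. signed h (int k) \<omega>)) = (\<Prod>k=1..n. Fv (\<lambda>i. t * h i) (Z (int k) \<omega>))" for \<omega>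
  proof -
    have "Fv (\<lambda>i. t * h i) (Z k \<omega>) = iexp (t * signed h k \<omega>)" for k
      by (simp add: Fv_def signed_def cis_conv_exp mult.assoc)
    then show ?thesis by (simp add: sum_distrib_left exp_sum)
  qed
  then show ?thesis using expectation_prod_G[OF norm_Fv] by simp
qed

lemma char_sum:
  "char (distr M borel (\<lambda>\<omega>. (\<Sum>k=1..n. signed h (int k) \<omega>) / b)) t
    = measure_pmf.expectation \<pi> ((G (Fv (\<lambda>i. t / b * h i)) ^^ n) (\<lambda>_. 1))"
proof -
  have "char (distr M borel (\<lambda>\<omega>. (\<Sum>k=1..n. signed h (int k) \<omega>) / b)) t
     = expectation (\<lambda>\<omega>. iexp (t * ((\<Sum>k=1..n. signed h (int k) \<omega>) / b)))"
    unfolding char_def by (rule integral_distr) auto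
  also have "\<dots> = expectation (\<lambda>\<omega>. iexp (t / b * (\<Sum>k=1..n. signed h (int k) \<omega>)))"
    by simp
  finally show ?thesis by (simp only: expectation_iexp_sum)
qed

lemma concentration_sum:
  assumes a: "\<And>i. a i > 0" and v: "filterlim (\<lambda>j. (a j)\<^sup>2 * pmf p j / (1 - s j)) at_top sequentially"
    and c: "c > 0"
  shows "(\<lambda>n. SUP r. prob {\<omega>\<in>space M. r - c < (\<Sum>k=1..n. signed a (int k) \<omega>) / sqrt (real n)
      \<and> (\<Sum>k=1..n. signed a (int k) \<omega>) / sqrt (real n) < r + c}) \<longlonglongrightarrow> 0"
proof -
  let ?\<nu> = "\<lambda>n. distr M borel (\<lambda>\<omega>. (\<Sum>k=1..n. signed a (int k) \<omega>) / sqrt (real n))"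
  have "measure (?\<nu> n) {r - c<..<r + c} = prob {\<omega>\<in>space M. r - c < (\<Sum>k=1..n. signed a (int k) \<omega>) / sqrt (real n)
      \<and> (\<Sum>k=1..n. signed a (int k) \<omega>) / sqrt (real n) < r + c}" for n r
    by (subst measure_distr) (auto intro!: arg_cong[where f=prob])
  moreover have "(\<lambda>n. SUP r. measure (?\<nu> n) {r - c<..<r + c}) \<longlonglongrightarrow> 0"
  proof (rule concentration_tendsto_0[OF _ c])
    show "real_distribution (?\<nu> n)" for n by (rule real_distribution_distr) simp
    show "(\<lambda>n. char (?\<nu> n) t) \<longlonglongrightarrow> 0" if "t \<noteq> 0" for t
      unfolding char_sum by (rule characteristic_tendsto_0[OF a v that])
  qed
  ultimately show ?thesis by simp
qed

end

section \<open>Variances of partial sums\<close>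

lemma \<Gamma>_le_square: "0 \<le> r \<Longrightarrow> r \<le> 1 \<Longrightarrow> \<Gamma> n r \<le> (real n)\<^sup>2"
proof -
  assume r: "0 \<le> r" "r \<le> 1"
  have "\<Gamma> n r \<le> (\<Sum>k=1..n. \<Sum>l=1..n. 1)"
    unfolding \<Gamma>_def using r by (intro sum_mono power_le_one)
  then show ?thesis by (simp add: power2_eq_square)
qed

lemma \<Gamma>_ge_square: "0 \<le> r \<Longrightarrow> r \<le> 1 \<Longrightarrow> (real n)\<^sup>2 * r ^ n \<le> \<Gamma> n r"
proof -
  assume r: "0 \<le> r" "r \<le> 1"
  have "(\<Sum>k=1..n. \<Sum>l=1..n. r ^ n) \<le> \<Gamma> n r"
    unfolding \<Gamma>_def using r by (intro sum_mono power_decreasing) auto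
  then show ?thesis by (simp add: power2_eq_square)
qed

lemma \<Gamma>_nonneg: "0 \<le> r \<Longrightarrow> 0 \<le> \<Gamma> n r"
  unfolding \<Gamma>_def by (intro sum_nonneg) auto

lemma \<Gamma>_0: "\<Gamma> n 0 = real n"
proof -
  have "(\<Sum>l=1..n. (0 :: real) ^ nat \<bar>int k - int l\<bar>) = 1" if "k \<in> {1..n}" for k
  proof -
    have "(\<Sum>l=1..n. (0 :: real) ^ nat \<bar>int k - int l\<bar>) = (\<Sum>l=1..n. if l = k then 1 else 0)"
      by (intro sum.cong) (auto simp: power_0_left)
    then show ?thesis using that by simp
  qed
  then show ?thesis by (simp add: \<Gamma>_def)
qed

lemma \<Gamma>_Suc: "\<Gamma> (Suc n) r = \<Gamma> n r + 1 + 2 * (\<Sum>k=1..n. r ^ k)"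
proof -
  have "nat \<bar>int k - int (Suc n)\<bar> = Suc n - k" if "k \<in> {1..n}" for k using that by auto
  then have "(\<Sum>k=1..n. r ^ nat \<bar>int k - int (Suc n)\<bar>) = (\<Sum>k=1..n. r ^ (Suc n - k))"
    by (intro sum.cong) auto
  also have "\<dots> = (\<Sum>k=1..n. r ^ k)"
    by (rule sum.reindex_bij_witness[where i="\<lambda>k. Suc n - k" and j="\<lambda>k. Suc n - k"]) auto
  finally have e: "(\<Sum>k=1..n. r ^ nat \<bar>int k - int (Suc n)\<bar>) = (\<Sum>k=1..n. r ^ k)" .
  have e': "(\<Sum>l=1..n. r ^ nat \<bar>int (Suc n) - int l\<bar>) = (\<Sum>k=1..n. r ^ k)"
    unfolding e[symmetric] by (simp add: abs_minus_commute)
  show ?thesis using e e' by (simp add: \<Gamma>_def sum.distrib)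
qed

lemma sum_power_le: "0 \<le> r \<Longrightarrow> r < 1 \<Longrightarrow> (\<Sum>k=1..n. r ^ k) \<le> r / (1 - (r :: real))"
proof -
  assume r: "0 \<le> r" "r < 1"
  have "(\<Sum>k=1..n. r ^ k) = r * (\<Sum>k<n. r ^ k)"
    unfolding sum_distrib_left by (rule sum.reindex_bij_witness[where i=Suc and j="\<lambda>k. k - 1"]) (auto simp flip: power_Suc)
  also have "(\<Sum>k<n. r ^ k) = (1 - r ^ n) / (1 - r)" using r by (subst sum_gp_strict) auto
  also have "r * ((1 - r ^ n) / (1 - r)) \<le> r * (1 / (1 - r))"
    using r by (intro mult_left_mono divide_right_mono) auto
  finally show ?thesis by simp
qed

lemma \<Gamma>_le_linear: "0 \<le> r \<Longrightarrow> r < 1 \<Longrightarrow> \<Gamma> n r \<le> 2 / (1 - r) * real n"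
proof (induction n)
  case 0
  then show ?case by (simp add: \<Gamma>_def)
next
  case (Suc n)
  have "\<Gamma> (Suc n) r \<le> 2 / (1 - r) * real n + 1 + 2 * (r / (1 - r))"
    using Suc sum_power_le[of r n] by (simp add: \<Gamma>_Suc)
  also have "2 / (1 - r) * real n + 1 + 2 * (r / (1 - r)) \<le> 2 / (1 - r) * real (Suc n)"
  proof -
    have "1 + 2 * (r / (1 - r)) = (1 + r) / (1 - r)" using Suc.prems by (simp add: field_simps)
    also have "\<dots> \<le> 2 / (1 - r)" using Suc.prems by (intro divide_right_mono) auto
    finally have "1 + 2 * (r / (1 - r)) \<le> 2 / (1 - r)" .
    moreover have "2 / (1 - r) * real (Suc n) = 2 / (1 - r) * real n + 2 / (1 - r)"
      by (simp only: of_nat_Suc distrib_left mult_1_right add.commute)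
    ultimately show ?thesis by linarith
  qed
  finally show ?case .
qed

text \<open>The increments tend to \<open>(1 + r) / (1 - r)\<close>, hence exceed
  \<open>3 / (4 * (1 - r))\<close> from some \<open>n0\<close> on; for \<open>n \<ge> 3 * n0\<close>
  at least two thirds of the steps have this size, and 2/3 times 3/4 is 1/2.\<close>

lemma \<Gamma>_asymptotic:
  assumes r: "0 \<le> r" "r < 1"
  shows "\<forall>\<^sub>F n in sequentially. real n / (2 * (1 - r)) \<le> \<Gamma> n r"
proof -
  define f where "f n = (\<Sum>k=1..n. r ^ k)" for n
  have "f n = r * (1 - r ^ n) / (1 - r)" for n
  proof -
    have "f n = r * (\<Sum>k<n. r ^ k)"
      unfolding f_def sum_distrib_left by (rule sum.reindex_bij_witness[where i=Suc and j="\<lambda>k. k - 1"]) (auto simp flip: power_Suc)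
    also have "(\<Sum>k<n. r ^ k) = (1 - r ^ n) / (1 - r)" using r by (subst sum_gp_strict) auto
    finally show ?thesis by simp
  qed
  moreover have "(\<lambda>n. r * (1 - r ^ n) / (1 - r)) \<longlonglongrightarrow> r * (1 - 0) / (1 - r)"
    using r by (intro tendsto_intros LIMSEQ_power_zero) auto
  ultimately have "f \<longlonglongrightarrow> r / (1 - r)" by (subst tendsto_cong[of f]) auto
  then have "(\<lambda>n. 1 + 2 * f n) \<longlonglongrightarrow> 1 + 2 * (r / (1 - r))" by (intro tendsto_intros)
  moreover have "1 + 2 * (r / (1 - r)) > 3 / (4 * (1 - r))"
  proof -
    have "3 / (4 * (1 - r)) = (3 / 4) / (1 - r)" by simp
    also have "\<dots> < (1 + r) / (1 - r)" using r by (intro divide_strict_right_mono) auto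
    also have "\<dots> = 1 + 2 * (r / (1 - r))" using r by (simp add: field_simps)
    finally show ?thesis .
  qed
  ultimately have "\<forall>\<^sub>F n in sequentially. 1 + 2 * f n > 3 / (4 * (1 - r))" by (rule order_tendstoD(1))
  then obtain n0 where n0: "\<And>n. n \<ge> n0 \<Longrightarrow> 1 + 2 * f n > 3 / (4 * (1 - r))"
    by (auto simp: eventually_sequentially)
  have "\<Gamma> (n0 + m) r \<ge> real m * (3 / (4 * (1 - r)))" for m
  proof (induction m)
    case 0
    show ?case using \<Gamma>_nonneg[OF r(1)] by simp
  next
    case (Suc m)
    have "real (Suc m) * (3 / (4 * (1 - r))) = real m * (3 / (4 * (1 - r))) + 3 / (4 * (1 - r))"
      by (simp only: of_nat_Suc distrib_right mult_1 add.commute)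
    then show ?case using Suc n0[of "n0 + m"] \<Gamma>_Suc[of "n0 + m" r] unfolding f_def add_Suc_right by linarith
  qed
  moreover have "real n / (2 * (1 - r)) \<le> real (n - n0) * (3 / (4 * (1 - r)))" if "n \<ge> 3 * n0" for n
  proof -
    have "real n * 2 \<le> real (n - n0) * 3" using that by linarith
    then have "real n * 2 / (4 * (1 - r)) \<le> real (n - n0) * 3 / (4 * (1 - r))"
      using r by (intro divide_right_mono) auto
    moreover have "real n * 2 / (4 * (1 - r)) = real n / (2 * (1 - r))" using r by (simp add: divide_simps)
    ultimately show ?thesis by simp
  qed
  moreover have "n0 + (n - n0) = n" if "n \<ge> 3 * n0" for n using that by simp
  ultimately have "real n / (2 * (1 - r)) \<le> \<Gamma> n r" if "n \<ge> 3 * n0" for n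
    using that by (metis order_trans)
  then show ?thesis by (auto simp: eventually_sequentially)
qed

section \<open>Second moments over blocks and reduction to one type\<close>

context level_process
begin

lemma level_process_shift: "level_process p lev M (\<lambda>k. Z (k + m))"
  using level_chain_axioms chain_process_shift by (rule level_process.intro)

lemma expectation_block_square:
  assumes h: "integrable (measure_pmf p) (\<lambda>t. (h t)\<^sup>2)"
  shows "integrable M (\<lambda>\<omega>. (\<Sum>k=1..n. signed h (int k + m) \<omega>)\<^sup>2)"
    and "expectation (\<lambda>\<omega>. (\<Sum>k=1..n. signed h (int k + m) \<omega>)\<^sup>2) = measure_pmf.expectation p (\<lambda>t. (h t)\<^sup>2 * \<Gamma> n (s t))"
proof -
  interpret S: level_process p lev M "\<lambda>k. Z (k + m)" by (rule level_process_shift)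
  have "S.signed h k = signed h (k + m)" for k
    by (simp add: fun_eq_iff S.signed_def signed_def)
  then show "integrable M (\<lambda>\<omega>. (\<Sum>k=1..n. signed h (int k + m) \<omega>)\<^sup>2)"
    "expectation (\<lambda>\<omega>. (\<Sum>k=1..n. signed h (int k + m) \<omega>)\<^sup>2) = measure_pmf.expectation p (\<lambda>t. (h t)\<^sup>2 * \<Gamma> n (s t))"
    using S.expectation_sum_odd_square[OF h, of n] by simp_all
qed

text \<open>Cauchy-Schwarz over \<open>N\<close> blocks of length \<open>n\<close>, which have equal
  second moments by stationarity.\<close>

lemma expectation_square_multiple:
  assumes h: "integrable (measure_pmf p) (\<lambda>t. (h t)\<^sup>2)"
  shows "expectation (\<lambda>\<omega>. (\<Sum>k=1..N * n. signed h (int k) \<omega>)\<^sup>2) \<le> (real N)\<^sup>2 * expectation (\<lambda>\<omega>. (\<Sum>k=1..n. signed h (int k) \<omega>)\<^sup>2)"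
proof -
  have split: "(\<Sum>k=1..N * n. f k) = (\<Sum>b<N. \<Sum>k=1..n. f (k + b * n))" for f :: "nat \<Rightarrow> real"
  proof (induction N)
    case (Suc N)
    have "{1..Suc N * n} = {1..N * n} \<union> {N * n + 1..N * n + n}" by auto
    then have "(\<Sum>k=1..Suc N * n. f k) = (\<Sum>k=1..N * n. f k) + (\<Sum>k=N * n + 1..N * n + n. f k)"
      by (simp add: sum.union_disjoint)
    also have "(\<Sum>k=N * n + 1..N * n + n. f k) = (\<Sum>k=1..n. f (k + N * n))"
      by (rule sum.reindex_bij_witness[where i="\<lambda>k. k + N * n" and j="\<lambda>k. k - N * n"]) auto
    finally show ?case using Suc by simp
  qed simp
  let ?y = "\<lambda>b \<omega>. \<Sum>k=1..n. signed h (int k + int (b * n)) \<omega>"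
  have "(\<Sum>k=1..N * n. signed h (int k) \<omega>)\<^sup>2 \<le> real N * (\<Sum>b<N. (?y b \<omega>)\<^sup>2)" for \<omega>
    using sum_squared_le_sum_of_squares[of "\<lambda>b. ?y b \<omega>" "{..<N}"] split[of "\<lambda>k. signed h (int k) \<omega>"]
    by (simp add: mult.commute)
  then have "expectation (\<lambda>\<omega>. (\<Sum>k=1..N * n. signed h (int k) \<omega>)\<^sup>2) \<le> expectation (\<lambda>\<omega>. real N * (\<Sum>b<N. (?y b \<omega>)\<^sup>2))"
    using expectation_sum_odd_square(1)[OF h] expectation_block_square(1)[OF h] by (intro integral_mono) auto
  also have "\<dots> = real N * (\<Sum>b<N. expectation (\<lambda>\<omega>. (?y b \<omega>)\<^sup>2))"
    using expectation_block_square(1)[OF h] by simp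
  also have "\<dots> = (real N)\<^sup>2 * measure_pmf.expectation p (\<lambda>t. (h t)\<^sup>2 * \<Gamma> n (s t))"
    unfolding expectation_block_square(2)[OF h] by (simp add: power2_eq_square)
  finally show ?thesis unfolding expectation_sum_odd_square(2)[OF h] .
qed

lemma type_union_bound: "prob {\<omega>\<in>space M. \<exists>k\<in>{1..n}. j < fst (Z (int k) \<omega>)} \<le> real n * \<tau> j"
proof -
  have "{\<omega>\<in>space M. \<exists>k\<in>{1..n}. j < fst (Z (int k) \<omega>)} = (\<Union>k\<in>{1..n}. {\<omega>\<in>space M. Z (int k) \<omega> \<in> {x. j < fst x}})" by auto
  also have "prob \<dots> \<le> (\<Sum>k\<in>{1..n}. prob {\<omega>\<in>space M. Z (int k) \<omega> \<in> {x. j < fst x}})"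
    by (rule measure_UNION_le) auto
  also have "\<dots> = real n * measure (measure_pmf \<pi>) {x. j < fst x}" unfolding prob_Z by simp
  also have "measure (measure_pmf \<pi>) {x. j < fst x} = \<tau> j"
  proof -
    have "measure (measure_pmf (map_pmf fst \<pi>)) {j<..} = measure (measure_pmf \<pi>) {x. j < fst x}"
      by (simp add: vimage_def)
    then show ?thesis by (simp add: \<tau>_def \<pi>_def map_fst_pair_pmf)
  qed
  finally show ?thesis .
qed

text \<open>Only the type \<open>j\<close> matters at time \<open>n\<close> if the lower types have small variance and higher
  types are not seen.\<close>

lemma reduce_to_type:
  assumes h: "integrable (measure_pmf p) (\<lambda>i. (h i)\<^sup>2)"
  shows "norm (expectation (\<lambda>\<omega>. iexp (t * (\<Sum>k=1..n. signed h (int k) \<omega>)))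
     - expectation (\<lambda>\<omega>. iexp (t * (\<Sum>k=1..n. signed (\<lambda>i. if i = j then h j else 0) (int k) \<omega>))))
   \<le> \<bar>t\<bar> * sqrt (real n * (\<Sum>i<j. 2 * pmf p i * (h i)\<^sup>2 / (1 - s i))) + 2 * (real n * \<tau> j)"
proof -
  let ?m = "\<lambda>i. if i = j then h j else 0" and ?l = "\<lambda>i. if i < j then h i else 0"
  let ?S = "\<lambda>h \<omega>. \<Sum>k=1..n. signed h (int k) \<omega>"
  define E where "E = {\<omega>\<in>space M. \<exists>k\<in>{1..n}. j < fst (Z (int k) \<omega>)}"
  have E[measurable]: "E \<in> events" unfolding E_def by measurable
  have il: "integrable (measure_pmf p) (\<lambda>i. (?l i)\<^sup>2)"
    by (rule Bochner_Integration.integrable_bound[OF h]) auto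
  have l2: "expectation (\<lambda>\<omega>. (?S ?l \<omega>)\<^sup>2) \<le> real n * (\<Sum>i<j. 2 * pmf p i * (h i)\<^sup>2 / (1 - s i))"
  proof -
    have "expectation (\<lambda>\<omega>. (?S ?l \<omega>)\<^sup>2) = measure_pmf.expectation p (\<lambda>i. (?l i)\<^sup>2 * \<Gamma> n (s i))"
      by (rule expectation_sum_odd_square(2)[OF il])
    also have "\<dots> = (\<Sum>i<j. pmf p i * ((h i)\<^sup>2 * \<Gamma> n (s i)))"
      by (subst integral_measure_pmf[where A="{..<j}"]) (auto split: if_splits)
    also have "\<dots> \<le> (\<Sum>i<j. pmf p i * ((h i)\<^sup>2 * (2 / (1 - s i) * real n)))"
      using s_bounds by (intro sum_mono mult_left_mono \<Gamma>_le_linear) auto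
    also have "\<dots> = real n * (\<Sum>i<j. 2 * pmf p i * (h i)\<^sup>2 / (1 - s i))"
      by (simp add: sum_distrib_left mult_ac)
    finally show ?thesis .
  qed
  have i2: "integrable M (\<lambda>\<omega>. (?S ?l \<omega>)\<^sup>2)" by (rule expectation_sum_odd_square(1)[OF il])
  have i1: "integrable M (?S ?l)" by (rule square_integrable_imp_integrable[OF _ i2]) measurable
  \<comment> \<open>Nonnegativity of the variance of \<open>|?S ?l|\<close> bounds the first
    absolute moment by the root of the second moment.\<close>
  have l1: "expectation (\<lambda>\<omega>. \<bar>?S ?l \<omega>\<bar>) \<le> sqrt (real n * (\<Sum>i<j. 2 * pmf p i * (h i)\<^sup>2 / (1 - s i)))"
  proof (rule real_le_rsqrt)
    have "(expectation (\<lambda>\<omega>. \<bar>?S ?l \<omega>\<bar>))\<^sup>2 \<le> expectation (\<lambda>\<omega>. \<bar>?S ?l \<omega>\<bar>\<^sup>2)"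
    proof -
      have "0 \<le> variance (\<lambda>\<omega>. \<bar>?S ?l \<omega>\<bar>)" by simp
      also have "\<dots> = expectation (\<lambda>\<omega>. \<bar>?S ?l \<omega>\<bar>\<^sup>2) - (expectation (\<lambda>\<omega>. \<bar>?S ?l \<omega>\<bar>))\<^sup>2"
        using i1 i2 by (intro variance_eq) auto
      finally show ?thesis by simp
    qed
    then show "(expectation (\<lambda>\<omega>. \<bar>?S ?l \<omega>\<bar>))\<^sup>2 \<le> real n * (\<Sum>i<j. 2 * pmf p i * (h i)\<^sup>2 / (1 - s i))"
      using l2 by simp
  qed
  have pt: "norm (iexp (t * ?S h \<omega>) - iexp (t * ?S ?m \<omega>)) \<le> \<bar>t\<bar> * \<bar>?S ?l \<omega>\<bar> + 2 * indicator E \<omega>" if "\<omega> \<in> space M" for \<omega>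
  proof (cases "\<omega> \<in> E")
    case True
    have "norm (iexp (t * ?S h \<omega>) - iexp (t * ?S ?m \<omega>)) \<le> norm (iexp (t * ?S h \<omega>)) + norm (iexp (t * ?S ?m \<omega>))"
      by (rule norm_triangle_ineq4)
    also have "\<dots> = 2" by (simp add: norm_exp_i_times)
    also have "\<dots> \<le> \<bar>t\<bar> * \<bar>?S ?l \<omega>\<bar> + 2 * indicator E \<omega>" using True by simp
    finally show ?thesis .
  next
    case False
    have "signed h (int k) \<omega> = signed ?m (int k) \<omega> + signed ?l (int k) \<omega>" if "k \<in> {1..n}" for k
    proof -
      have "\<not> j < fst (Z (int k) \<omega>)" using False that \<open>\<omega> \<in> space M\<close> by (auto simp: E_def)
      then show ?thesis by (auto simp: signed_def)
    qed
    then have S: "?S h \<omega> = ?S ?m \<omega> + ?S ?l \<omega>" by (simp add: sum.distrib)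
    have "iexp (t * ?S h \<omega>) - iexp (t * ?S ?m \<omega>) = iexp (t * ?S ?m \<omega>) * (iexp (t * ?S ?l \<omega>) - 1)"
      unfolding S by (simp add: algebra_simps exp_add)
    then have "norm (iexp (t * ?S h \<omega>) - iexp (t * ?S ?m \<omega>)) = norm (iexp (t * ?S ?l \<omega>) - 1)"
      by (simp add: norm_mult norm_exp_i_times)
    also have "\<dots> \<le> \<bar>t * ?S ?l \<omega>\<bar>"
      using iexp_approx1[of "t * ?S ?l \<omega>" 0] by simp
    finally show ?thesis using False by (simp add: abs_mult)
  qed
  have ie: "integrable M (\<lambda>\<omega>. iexp (t * ?S f \<omega>))" for f
    by (rule integrable_const_bound[where B=1]) (auto simp: norm_exp_i_times)
  have "norm (expectation (\<lambda>\<omega>. iexp (t * ?S h \<omega>)) - expectation (\<lambda>\<omega>. iexp (t * ?S ?m \<omega>)))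
     = norm (expectation (\<lambda>\<omega>. iexp (t * ?S h \<omega>) - iexp (t * ?S ?m \<omega>)))"
    using ie[of h] ie[of ?m] by (subst Bochner_Integration.integral_diff) auto
  also have "\<dots> \<le> expectation (\<lambda>\<omega>. norm (iexp (t * ?S h \<omega>) - iexp (t * ?S ?m \<omega>)))"
    by (rule integral_norm_bound)
  also have "\<dots> \<le> expectation (\<lambda>\<omega>. \<bar>t\<bar> * \<bar>?S ?l \<omega>\<bar> + 2 * indicator E \<omega>)"
    using ie[of h] ie[of ?m] i1 by (intro integral_mono pt) (auto simp: integrable_indicator_iff emeasure_eq_measure)
  also have "\<dots> = \<bar>t\<bar> * expectation (\<lambda>\<omega>. \<bar>?S ?l \<omega>\<bar>) + 2 * prob E"
    using i1 by (subst Bochner_Integration.integral_add) (auto simp: integrable_indicator_iff emeasure_eq_measure)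
  also have "\<dots> \<le> \<bar>t\<bar> * sqrt (real n * (\<Sum>i<j. 2 * pmf p i * (h i)\<^sup>2 / (1 - s i))) + 2 * (real n * \<tau> j)"
    using l1 type_union_bound[of n j] unfolding E_def by (intro add_mono mult_left_mono) auto
  finally show ?thesis .
qed

end

section \<open>Convergence to the compound Poisson law\<close>

text \<open>\<open>1 - u\<close> and \<open>exp (- u)\<close> both have norm at most 1, so their
  \<open>J\<close>-th powers differ by at most \<open>J\<close> times their difference, which is of
  second order in \<open>u\<close>; this leaves the convergent \<open>J * norm u\<close> times a
  null sequence.\<close>

lemma compound_power_tendsto:
  fixes u :: "nat \<Rightarrow> complex" and J :: "nat \<Rightarrow> nat"
  assumes u: "\<And>j. norm (1 - u j) \<le> 1" "\<And>j. Re (u j) \<ge> 0" "(\<lambda>j. u j) \<longlonglongrightarrow> 0"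
    and lim: "(\<lambda>j. of_nat (J j) * u j) \<longlonglongrightarrow> c"
  shows "(\<lambda>j. (1 - u j) ^ J j) \<longlonglongrightarrow> exp (- c)"
proof -
  have le: "norm ((1 - u j) ^ J j - exp (- (of_nat (J j) * u j))) \<le> norm (of_nat (J j) * u j) * (exp (norm (u j)) * norm (u j))" for j
  proof -
    have "exp (- (of_nat (J j) * u j)) = exp (- u j) ^ J j" by (simp add: exp_of_nat_mult[symmetric])
    then have "norm ((1 - u j) ^ J j - exp (- (of_nat (J j) * u j))) \<le> real (J j) * norm ((1 - u j) - exp (- u j))"
      using norm_power_diff[of "1 - u j" "exp (- u j)" "J j"] u(1,2)[of j] by (simp add: norm_exp_eq_Re)
    moreover have "norm ((1 - u j) - exp (- u j)) \<le> exp (norm (u j)) * (norm (u j))\<^sup>2"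
    proof -
      have "norm (exp (- u j) - (\<Sum>k\<le>1. (- u j) ^ k / fact k)) \<le> exp \<bar>Re (- u j)\<bar> * norm (- u j) ^ Suc 1 / fact 1"
        by (rule Taylor_exp)
      then have "norm ((1 - u j) - exp (- u j)) \<le> exp \<bar>Re (u j)\<bar> * (norm (u j))\<^sup>2"
        by (simp add: norm_minus_commute power2_eq_square)
      also have "\<dots> \<le> exp (norm (u j)) * (norm (u j))\<^sup>2"
        using abs_Re_le_cmod[of "u j"] by (intro mult_right_mono) auto
      finally show ?thesis .
    qed
    ultimately have "norm ((1 - u j) ^ J j - exp (- (of_nat (J j) * u j))) \<le> real (J j) * (exp (norm (u j)) * (norm (u j))\<^sup>2)"
      by (meson mult_left_mono of_nat_0_le_iff order_trans)
    then show ?thesis by (simp add: norm_mult power2_eq_square mult_ac)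
  qed
  have "(\<lambda>j. norm (of_nat (J j) * u j) * (exp (norm (u j)) * norm (u j))) \<longlonglongrightarrow> norm c * (exp (norm (0 :: complex)) * norm (0 :: complex))"
    by (intro tendsto_intros lim u)
  then have "(\<lambda>j. norm (of_nat (J j) * u j) * (exp (norm (u j)) * norm (u j))) \<longlonglongrightarrow> 0" by simp
  then have "(\<lambda>j. (1 - u j) ^ J j - exp (- (of_nat (J j) * u j))) \<longlonglongrightarrow> 0"
    by (rule Lim_null_comparison[rotated]) (use le in auto)
  moreover have "(\<lambda>j. exp (- (of_nat (J j) * u j))) \<longlonglongrightarrow> exp (- c)" by (intro tendsto_intros lim)
  ultimately have "(\<lambda>j. ((1 - u j) ^ J j - exp (- (of_nat (J j) * u j))) + exp (- (of_nat (J j) * u j))) \<longlonglongrightarrow> 0 + exp (- c)"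
    by (rule tendsto_add)
  then show ?thesis by simp
qed

context level_process
begin

text \<open>A geometric length with success probability \<open>1 - s j\<close>, scaled by
  \<open>1 - s j\<close>, becomes exponential with characteristic function
  \<open>1 / (1 - \<i> * x)\<close>; averaging over the two signs gives the Laplace law.\<close>

lemma \<kappa>_tendsto:
  assumes s1: "s \<longlonglongrightarrow> 1"
  shows "(\<lambda>j. \<kappa> j (t * (1 - s j))) \<longlonglongrightarrow> of_real (1 / (1 + t\<^sup>2))"
proof -
  define q where "q j = 1 - s j" for j
  have q: "q j > 0" for j using s_bounds(2)[of j] by (simp add: q_def)
  have "q \<longlonglongrightarrow> 1 - 1" unfolding q_def[abs_def] by (intro tendsto_intros s1)
  then have qlim: "filterlim q (at_right 0) sequentially"
    using q by (intro tendsto_imp_filterlim_at_right) auto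
  have half: "(\<lambda>j. cis (x * q j) * (of_real (q j) / (1 - of_real (s j) * cis (x * q j)))) \<longlonglongrightarrow> 1 / (1 - \<i> * of_real x)" for x
  proof -
    have "((\<lambda>q :: real. (1 - cos (x * q)) / q) \<longlongrightarrow> 0) (at_right 0)" by real_asymp
    from filterlim_compose[OF this qlim] have 1: "(\<lambda>j. (1 - cos (x * q j)) / q j) \<longlonglongrightarrow> 0" .
    have "((\<lambda>q :: real. sin (x * q) / q) \<longlongrightarrow> x) (at_right 0)" by real_asymp
    from filterlim_compose[OF this qlim] have 2: "(\<lambda>j. sin (x * q j) / q j) \<longlonglongrightarrow> x" .
    have 3: "(\<lambda>j. cis (x * q j)) \<longlonglongrightarrow> cis (x * 0)"
      using \<open>q \<longlonglongrightarrow> 1 - 1\<close> by (intro tendsto_intros) simp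
    have "(\<lambda>j. of_real ((1 - cos (x * q j)) / q j) - \<i> * of_real (sin (x * q j) / q j) + cis (x * q j)) \<longlonglongrightarrow> of_real 0 - \<i> * of_real x + cis (x * 0)"
      by (intro tendsto_intros tendsto_of_real 1 2 3)
    moreover have "of_real ((1 - cos (x * q j)) / q j) - \<i> * of_real (sin (x * q j) / q j) + cis (x * q j)
       = (1 - of_real (s j) * cis (x * q j)) / of_real (q j)" for j
    proof -
      have c: "cis (x * q j) = of_real (cos (x * q j)) + \<i> * of_real (sin (x * q j))" by (simp add: complex_eq_iff)
      have sj: "of_real (s j) = (1 - of_real (q j) :: complex)" by (simp add: q_def)
      show ?thesis unfolding c sj using q[of j] by (simp add: field_simps)
    qed
    ultimately have "(\<lambda>j. (1 - of_real (s j) * cis (x * q j)) / of_real (q j)) \<longlonglongrightarrow> 1 - \<i> * of_real x" by simp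
    moreover have ne: "1 - \<i> * of_real x \<noteq> 0" by (simp add: complex_eq_iff)
    ultimately have "(\<lambda>j. cis (x * q j) / ((1 - of_real (s j) * cis (x * q j)) / of_real (q j))) \<longlonglongrightarrow> cis (x * 0) / (1 - \<i> * of_real x)"
      by (intro tendsto_divide 3)
    then show ?thesis by simp
  qed
  have A: "(\<lambda>j. (cis (t * q j) * (of_real (q j) / (1 - of_real (s j) * cis (t * q j)))
     + cis (- t * q j) * (of_real (q j) / (1 - of_real (s j) * cis (- t * q j)))) / 2)
    \<longlonglongrightarrow> (1 / (1 - \<i> * of_real t) + 1 / (1 - \<i> * of_real (- t))) / 2"
    by (intro tendsto_intros half) auto
  have B: "\<kappa> j (t * (1 - s j)) = (cis (t * q j) * (of_real (q j) / (1 - of_real (s j) * cis (t * q j)))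
     + cis (- t * q j) * (of_real (q j) / (1 - of_real (s j) * cis (- t * q j)))) / 2" for j
    by (simp add: \<kappa>_def F\<^sub>j_def w\<^sub>j_def sg_def q_def)
  have C: "(1 / (1 - \<i> * of_real t) + 1 / (1 - \<i> * of_real (- t))) / 2 = complex_of_real (1 / (1 + t\<^sup>2))"
  proof -
    have ne: "1 - \<i> * of_real t \<noteq> 0" "1 - \<i> * of_real (- t) \<noteq> 0" by (simp_all add: complex_eq_iff)
    have m: "(1 - \<i> * of_real t) * (1 - \<i> * of_real (- t)) = complex_of_real (1 + t\<^sup>2)"
      by (simp add: algebra_simps power2_eq_square)
    have "(1 / (1 - \<i> * of_real t) + 1 / (1 - \<i> * of_real (- t))) / 2
      = ((1 - \<i> * of_real (- t)) + (1 - \<i> * of_real t)) / (2 * ((1 - \<i> * of_real t) * (1 - \<i> * of_real (- t))))"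
      using ne by (simp add: divide_simps)
    also have "\<dots> = 2 / (2 * complex_of_real (1 + t\<^sup>2))" unfolding m by simp
    also have "\<dots> = 1 / complex_of_real (1 + t\<^sup>2)" 
    proof -
      have "2 / (2 * z) = 1 / z" for z :: complex by simp
      then show ?thesis .
    qed
    also have "\<dots> = complex_of_real (1 / (1 + t\<^sup>2))" by (simp only: of_real_divide of_real_1)
    finally show ?thesis .
  qed
  show ?thesis using A unfolding B C .
qed

text \<open>Three approximations of the characteristic function: discarding the other types,
  justified by \<open>low\<close> and the second part of \<open>J\<close>; replacing the sum over
  type \<open>j\<close> by a power, through \<open>expectation_char_type\<close>; and the limit of
  that power, where \<open>J j * \<zeta> j\<close> tending to 1 gives the Poisson mean 1. With the
  norming \<open>a j / (1 - s j)\<close> a visit to type \<open>j\<close> has phase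
  \<open>t * (1 - s j)\<close>.\<close>

theorem weak_conv_compound_Poisson:
  fixes J :: "nat \<Rightarrow> nat"
  assumes a: "\<And>i. a i > 0" "integrable (measure_pmf p) (\<lambda>i. (a i)\<^sup>2)"
    and s1: "s \<longlonglongrightarrow> 1"
    and J: "(\<lambda>j. real (J j) * \<zeta> j) \<longlonglongrightarrow> 1" "(\<lambda>j. real (J j) * \<tau> j) \<longlonglongrightarrow> 0"
    and low: "(\<lambda>j. real (J j) * (\<Sum>i<j. 2 * pmf p i * (a i)\<^sup>2 / (1 - s i)) / (a j / (1 - s j))\<^sup>2) \<longlonglongrightarrow> 0"
  shows "weak_conv_m (\<lambda>j. distr M borel (\<lambda>\<omega>. (\<Sum>k=1..J j. signed a (int k) \<omega>) / (a j / (1 - s j)))) mu_P1sL"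
proof (rule levy_continuity)
  let ?b = "\<lambda>j. a j / (1 - s j)"
  let ?\<nu> = "\<lambda>j. distr M borel (\<lambda>\<omega>. (\<Sum>k=1..J j. signed a (int k) \<omega>) / ?b j)"
  show "real_distribution (?\<nu> j)" for j by (rule real_distribution_distr) simp
  show "real_distribution mu_P1sL" by (rule real_distribution_mu_P1sL)
  fix t
  have b: "?b j > 0" for j using a s_bounds(2)[of j] by simp
  define A where "A j = measure_pmf.expectation \<pi> ((G (F\<^sub>j j (t * (1 - s j))) ^^ J j) (\<lambda>_. 1))" for j
  have 1: "norm (char (?\<nu> j) t - A j) \<le> \<bar>t\<bar> * sqrt (real (J j) * (\<Sum>i<j. 2 * pmf p i * (a i)\<^sup>2 / (1 - s i)) / (?b j)\<^sup>2) + 2 * (real (J j) * \<tau> j)" for j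
  proof -
    have "char (?\<nu> j) t = expectation (\<lambda>\<omega>. iexp (t / ?b j * (\<Sum>k=1..J j. signed a (int k) \<omega>)))"
      unfolding char_sum expectation_iexp_sum ..
    moreover have "A j = expectation (\<lambda>\<omega>. iexp (t / ?b j * (\<Sum>k=1..J j. signed (\<lambda>i. if i = j then a j else 0) (int k) \<omega>)))"
    proof -
      have "Fv (\<lambda>i. t / ?b j * (if i = j then a j else 0)) = F\<^sub>j j (t * (1 - s j))"
        using a(1)[of j] by (auto simp: fun_eq_iff Fv_def F\<^sub>j_def mult.assoc)
      then show ?thesis unfolding expectation_iexp_sum A_def by simp
    qed
    moreover have "\<bar>t / ?b j\<bar> * sqrt (real (J j) * (\<Sum>i<j. 2 * pmf p i * (a i)\<^sup>2 / (1 - s i)))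
       = \<bar>t\<bar> * sqrt (real (J j) * (\<Sum>i<j. 2 * pmf p i * (a i)\<^sup>2 / (1 - s i)) / (?b j)\<^sup>2)"
      using b[of j] by (simp only: real_sqrt_divide real_sqrt_abs abs_divide) (simp only: times_divide_eq_left times_divide_eq_right)
    ultimately show ?thesis using reduce_to_type[OF a(2), of "t / ?b j" "J j" j] by simp
  qed
  have "(\<lambda>j. \<bar>t\<bar> * sqrt (real (J j) * (\<Sum>i<j. 2 * pmf p i * (a i)\<^sup>2 / (1 - s i)) / (?b j)\<^sup>2) + 2 * (real (J j) * \<tau> j)) \<longlonglongrightarrow> \<bar>t\<bar> * sqrt 0 + 2 * 0"
    by (intro tendsto_intros low J)
  then have "(\<lambda>j. \<bar>t\<bar> * sqrt (real (J j) * (\<Sum>i<j. 2 * pmf p i * (a i)\<^sup>2 / (1 - s i)) / (?b j)\<^sup>2) + 2 * (real (J j) * \<tau> j)) \<longlonglongrightarrow> 0" by simp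
  from Lim_null_comparison[OF always_eventually[OF allI[OF 1]] this]
  have lim1: "(\<lambda>j. char (?\<nu> j) t - A j) \<longlonglongrightarrow> 0" .
  define u where "u j = of_real (\<zeta> j) * (1 - \<kappa> j (t * (1 - s j)))" for j
  have 2: "norm (A j - (1 - u j) ^ J j) \<le> 4 * pmf p j + (4 * (real (J j) * \<zeta> j) * pmf p j + 2 * (real (J j) * \<tau> j))" for j
    using expectation_char_type[where j=j and \<theta>="t * (1 - s j)" and n="J j"] by (simp add: A_def u_def algebra_simps)
  have "(\<lambda>j. 4 * pmf p j + (4 * (real (J j) * \<zeta> j) * pmf p j + 2 * (real (J j) * \<tau> j))) \<longlonglongrightarrow> 4 * 0 + (4 * 1 * 0 + 2 * 0)"
    by (intro tendsto_intros J pmf_p_tendsto)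
  then have "(\<lambda>j. 4 * pmf p j + (4 * (real (J j) * \<zeta> j) * pmf p j + 2 * (real (J j) * \<tau> j))) \<longlonglongrightarrow> 0" by simp
  from Lim_null_comparison[OF always_eventually[OF allI[OF 2]] this]
  have lim2: "(\<lambda>j. A j - (1 - u j) ^ J j) \<longlonglongrightarrow> 0" .
  have \<zeta>0: "\<zeta> \<longlonglongrightarrow> 0"
  proof (rule tendsto_sandwich[OF _ _ tendsto_const])
    have "\<zeta> j \<le> (1 - s j) * 1 / P\<^sub>l 0" for j
    proof -
      have "\<zeta> j \<le> (1 - s j) * pmf p j / P\<^sub>l j" by (rule \<zeta>_bounds(2))
      also have "\<dots> \<le> (1 - s j) * 1 / P\<^sub>l 0"
        using s_bounds(2)[of j] P\<^sub>l_pos P\<^sub>l_mono[of 0 j] by (intro frac_le mult_left_mono mult_nonneg_nonneg) (auto simp: pmf_le_1)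
      finally show ?thesis .
    qed
    then show "\<forall>\<^sub>F j in sequentially. \<zeta> j \<le> (1 - s j) * 1 / P\<^sub>l 0" by simp
    have "(\<lambda>j. (1 - s j) * 1 / P\<^sub>l 0) \<longlonglongrightarrow> (1 - 1) * 1 / P\<^sub>l 0"
      using P\<^sub>l_pos[of 0] by (intro tendsto_intros s1) auto
    then show "(\<lambda>j. (1 - s j) * 1 / P\<^sub>l 0) \<longlonglongrightarrow> 0" by simp
    show "\<forall>\<^sub>F j in sequentially. 0 \<le> \<zeta> j" using \<zeta>_bounds(3) by (auto intro: always_eventually less_imp_le)
  qed
  have lim3: "(\<lambda>j. (1 - u j) ^ J j) \<longlonglongrightarrow> exp (- (1 - of_real (1 / (1 + t\<^sup>2))))"
  proof (rule compound_power_tendsto)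
    fix j
    note k = norm_\<kappa>[of j "t * (1 - s j)"] and z = \<zeta>_bounds(3,4)[of j]
    have "1 - u j = of_real (1 - \<zeta> j) + of_real (\<zeta> j) * \<kappa> j (t * (1 - s j))" by (simp add: u_def algebra_simps)
    then have "norm (1 - u j) \<le> norm (of_real (1 - \<zeta> j) :: complex) + norm (of_real (\<zeta> j) * \<kappa> j (t * (1 - s j)))"
      by (metis norm_triangle_ineq)
    also have "\<dots> \<le> (1 - \<zeta> j) + \<zeta> j * 1"
      using z k by (intro add_mono) (simp_all add: norm_mult del: of_real_diff)
    finally show "norm (1 - u j) \<le> 1" by simp
    have "Re (\<kappa> j (t * (1 - s j))) \<le> 1" using complex_Re_le_cmod k by (rule order_trans)
    then show "Re (u j) \<ge> 0" using z by (simp add: u_def)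
  next
    have "(\<lambda>j. of_real (\<zeta> j) * (1 - \<kappa> j (t * (1 - s j)))) \<longlonglongrightarrow> of_real 0 * (1 - of_real (1 / (1 + t\<^sup>2)))"
      by (intro tendsto_intros tendsto_of_real \<zeta>0 \<kappa>_tendsto s1)
    then show "(\<lambda>j. u j) \<longlonglongrightarrow> 0" by (simp add: u_def)
    have "(\<lambda>j. of_real (real (J j) * \<zeta> j) * (1 - \<kappa> j (t * (1 - s j)))) \<longlonglongrightarrow> of_real 1 * (1 - of_real (1 / (1 + t\<^sup>2)))"
      by (intro tendsto_intros tendsto_of_real J \<kappa>_tendsto s1)
    then show "(\<lambda>j. of_nat (J j) * u j) \<longlonglongrightarrow> 1 - of_real (1 / (1 + t\<^sup>2))" by (simp add: u_def mult.assoc)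
  qed
  have "(\<lambda>j. (char (?\<nu> j) t - A j) + (A j - (1 - u j) ^ J j) + (1 - u j) ^ J j) \<longlonglongrightarrow> 0 + 0 + exp (- (1 - of_real (1 / (1 + t\<^sup>2))))"
    by (intro tendsto_add lim1 lim2 lim3)
  then show "(\<lambda>j. char (?\<nu> j) t) \<longlonglongrightarrow> char mu_P1sL t"
    unfolding char_mu_P1sL by simp
qed

end

section \<open>Choice of the parameters\<close>

lemma exists_nat_pmf:
  fixes f :: "nat \<Rightarrow> real"
  assumes "\<And>n. 0 \<le> f n" "f sums 1"
  shows "\<exists>r. \<forall>n. pmf r n = f n"
proof -
  have "(\<integral>\<^sup>+n. ennreal (f n) \<partial>count_space UNIV) = (\<Sum>n. ennreal (f n))"
    by (rule nn_integral_count_space_nat)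
  also have "\<dots> = ennreal (\<Sum>n. f n)"
    using assms by (intro suminf_ennreal2) (auto simp: sums_iff)
  also have "\<dots> = 1" using assms(2) by (simp add: sums_iff)
  finally have "(\<integral>\<^sup>+n. ennreal (f n) \<partial>count_space UNIV) = 1" .
  then have "\<forall>n. pmf (embed_pmf f) n = f n"
    using assms(1) by (simp add: pmf_embed_pmf)
  then show ?thesis by blast
qed

lemma expectation_nat_pmf:
  fixes f :: "nat \<Rightarrow> real"
  assumes nn: "\<And>n. 0 \<le> f n" and s: "summable (\<lambda>n. pmf r n * f n)"
  shows "integrable (measure_pmf r) f" "measure_pmf.expectation r f = (\<Sum>n. pmf r n * f n)"
proof -
  have i: "integrable (count_space UNIV) (\<lambda>n. pmf r n * f n)"
    using s nn by (simp add: integrable_count_space_nat_iff)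
  show "integrable (measure_pmf r) f"
    unfolding measure_pmf_eq_density using i by (subst integrable_density) auto
  have "measure_pmf.expectation r f = integral\<^sup>L (count_space UNIV) (\<lambda>n. pmf r n *\<^sub>R f n)"
    unfolding measure_pmf_eq_density by (rule integral_density) auto
  then show "measure_pmf.expectation r f = (\<Sum>n. pmf r n * f n)"
    using integral_count_space_nat[OF i] by simp
qed

text \<open>The ratio \<open>(t + 1)^3\<close> of successive terms makes the terms before
  \<open>vv j\<close> sum to at most \<open>vv j / j^2\<close>, and constants are of order at most
  \<open>vv j / j^3\<close>; both are small against \<open>vv j / j\<close>, the rate of type
  \<open>j\<close> at time \<open>L j / j\<close>.\<close>

definition vv :: "nat \<Rightarrow> real" where
  "vv t = (fact t) ^ 3"

lemma vv_ge_1: "vv t \<ge> 1"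
  unfolding vv_def by (rule one_le_power[OF fact_ge_1])

lemma vv_Suc: "vv (Suc t) = (real (Suc t)) ^ 3 * vv t"
  by (simp add: vv_def power_mult_distrib)

lemma vv_mono: "t \<le> t' \<Longrightarrow> vv t \<le> vv t'"
  unfolding vv_def by (intro power_mono fact_mono) auto

lemma sum_vv: "(\<Sum>i=1..<j. vv i) \<le> vv j / (real j)\<^sup>2"
proof (cases j)
  case (Suc t)
  have "(\<Sum>i=1..<j. vv i) \<le> (\<Sum>i=1..<j. vv t)"
    using Suc by (intro sum_mono vv_mono) auto
  also have "\<dots> \<le> real j * vv t" using vv_ge_1[of t] Suc by simp
  also have "\<dots> = vv j / (real j)\<^sup>2"
    unfolding Suc vv_Suc by (simp add: power2_eq_square power3_eq_cube del: of_nat_Suc)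
  finally show ?thesis .
qed simp

lemma vv_ge_cube: "vv t \<ge> (real t) ^ 3"
proof -
  have "real t \<le> real (fact t)" using fact_ge_self[of t] by (simp only: of_nat_le_iff)
  then have "real t \<le> fact t" by simp
  then show ?thesis unfolding vv_def by (rule power_mono) simp
qed

text \<open>States of type \<open>t\<close> have probability \<open>e t = exp (- 2 \<Lambda> t)\<close>, values \<open>\<plusminus> a t\<close> and mean holding time
  \<open>L t\<close>, and contribute \<open>c t * L t = vv t\<close> to the asymptotic variance. The choice \<open>\<Lambda> = L powr (q / (1 - q))\<close>
  is dictated by \<open>n powr q \<le> \<Lambda> t + n / L t\<close>, which balances rarity against holding time. Each \<open>L (t + 1)\<close> is
  taken so large that its type is invisible to the variance until \<open>g\<close> exceeds \<open>2 \<Sum>i\<le>t+1. vv i\<close>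
  (at \<open>Mt (t + 1)\<close>) and on the time scales of the earlier types.\<close>

locale construction =
  fixes q :: real and g :: "real \<Rightarrow> real" and L :: "nat \<Rightarrow> nat" and Mt :: "nat \<Rightarrow> real"
  assumes q: "0 < q" "q < 1"
    and g1: "\<And>x. 1 \<le> x \<Longrightarrow> 1 \<le> g x"
    and Mt: "\<And>t. 1 \<le> Mt t" "\<And>t. real t \<le> Mt t" "\<And>t x. Mt t \<le> x \<Longrightarrow> 1 + 2 * (\<Sum>i=1..t. vv i) \<le> g x"
    and L0: "L 0 = 1"
    and L_less: "\<And>t. L t < L (Suc t)"
    and L_dvd: "\<And>t. Suc t dvd L (Suc t)"
    and L_powr: "\<And>t. real (Suc t) + 1 \<le> real (L (Suc t)) powr (q / (1 - q))"
    and L_Mt: "\<And>t. vv (Suc t) * 2 ^ (Suc t + 2) * Mt (Suc t) \<le> real (L (Suc t))"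
    and L_prev: "\<And>t. vv (Suc t) * 2 ^ Suc t * real (L t) \<le> real (L (Suc t))"
    and e_prev: "\<And>t. exp (- 2 * real (L (Suc t)) powr (q / (1 - q)))
        \<le> exp (- 2 * real (L t) powr (q / (1 - q))) / (4 * (real t + 2) * real (L t))"
    and a_prev: "\<And>t. vv t / (real (L t) * exp (- 2 * real (L t) powr (q / (1 - q)))) + 1
        \<le> vv (Suc t) / (real (L (Suc t)) * exp (- 2 * real (L (Suc t)) powr (q / (1 - q))))"
begin

definition \<Lambda> :: "nat \<Rightarrow> real" where "\<Lambda> t = real (L t) powr (q / (1 - q))"

definition e :: "nat \<Rightarrow> real" where "e t = exp (- 2 * \<Lambda> t)"

text \<open>Chosen so that \<open>pmf p t * (a t)\<^sup>2 * L t = vv t\<close> for positive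
  \<open>t\<close>. The value 1/2 at type 0 keeps its share of the second moment at most 1/4, the
  first term of the geometric bound \<open>c_le\<close>.\<close>

definition a :: "nat \<Rightarrow> real" where "a t = (if t = 0 then 1 / 2 else sqrt (vv t / (real (L t) * e t)))"

lemma L_mono: "t \<le> t' \<Longrightarrow> L t \<le> L t'"
  by (rule lift_Suc_mono_le[of L]) (simp_all add: L_less less_imp_le)

lemma L_pos: "L t \<ge> 1"
  using L_mono[of 0 t] by (simp add: L0)

lemma L_real: "real (L t) \<ge> 1" "real (L t) > 0"
  using L_pos[of t] by (auto intro: less_le_trans[of _ 1])

lemma L_ge: "L t \<ge> Suc t"
proof (induction t)
  case (Suc t)
  then show ?case using L_less[of t] by simp
qed (simp add: L0)

lemma e_pos: "e t > 0"
  by (simp add: e_def)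

lemma \<Lambda>_ge: "t \<ge> 1 \<Longrightarrow> \<Lambda> t \<ge> real t + 1"
  using L_powr[of "t - 1"] by (simp add: \<Lambda>_def)

lemma exp_m_le: "exp (- real n) \<le> (1 / 2) ^ n"
proof -
  have "exp (- 1 :: real) \<le> 1 / 2"
    using exp_ge_add_one_self[of 1] by (simp add: exp_minus field_simps)
  then have "exp (- 1 :: real) ^ n \<le> (1 / 2) ^ n" by (intro power_mono) auto
  then show ?thesis by (simp flip: exp_of_nat_mult)
qed

lemma exp_\<Lambda>_le: "t \<ge> 1 \<Longrightarrow> exp (- \<Lambda> t) \<le> (1 / 2) ^ Suc t"
  using \<Lambda>_ge[of t] by (intro order_trans[OF _ exp_m_le[of "Suc t"]]) simp

lemma e_le: "t \<ge> 1 \<Longrightarrow> e t \<le> (1 / 2) ^ Suc t"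
  using exp_\<Lambda>_le[of t] \<Lambda>_ge[of t] by (intro order_trans[OF _ exp_\<Lambda>_le]) (auto simp: e_def)

lemma e_Suc: "e (Suc t) \<le> e t / (4 * (real t + 2) * real (L t))"
  using e_prev[of t] by (simp add: e_def \<Lambda>_def)

lemma e_half: "e (Suc t) \<le> e t / 2"
proof -
  have "e t / (4 * (real t + 2) * real (L t)) \<le> e t / 2"
  proof (rule divide_left_mono)
    have "2 * 1 \<le> (4 * (real t + 2)) * real (L t)" using L_real[of t] by (intro mult_mono) auto
    then show "2 \<le> 4 * (real t + 2) * real (L t)" by simp
  qed (use L_real[of t] e_pos[of t] in auto)
  then show ?thesis using e_Suc[of t] by linarith
qed

lemma e_power: "e (t + k) \<le> e t * (1 / 2) ^ k"
proof (induction k)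
  case (Suc k)
  then show ?case using e_half[of "t + k"] by simp
qed simp

lemma sums_half: "(\<lambda>k. (1 / 2 :: real) ^ k) sums 2"
  using geometric_sums[of "1 / 2 :: real"] by simp

lemma summable_e: "summable (\<lambda>k. e (t + k))"
proof (rule summable_comparison_test')
  show "summable (\<lambda>k. e t * (1 / 2) ^ k)" using sums_half by (intro summable_mult) (rule sums_summable)
  show "norm (e (t + k)) \<le> e t * (1 / 2) ^ k" for k using e_power[of t k] e_pos[of "t + k"] by simp
qed

lemma suminf_e: "(\<Sum>k. e (t + k)) \<le> 2 * e t"
proof -
  have "(\<Sum>k. e (t + k)) \<le> (\<Sum>k. e t * (1 / 2) ^ k)"
    using sums_half by (intro suminf_le e_power summable_e summable_mult) (rule sums_summable)
  also have "\<dots> = e t * 2" using sums_half by (subst suminf_mult) (auto simp: sums_iff)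
  finally show ?thesis by simp
qed

definition p0 :: real where "p0 = 1 - (\<Sum>k. e (1 + k))"

lemma p0_pos: "p0 \<ge> 1 / 2"
  using suminf_e[of 1] e_le[of 1] by (simp add: p0_def power2_eq_square)

lemma exists_p: "\<exists>r. \<forall>t. pmf r t = (if t = 0 then p0 else e t)"
proof (rule exists_nat_pmf)
  show "0 \<le> (if t = 0 then p0 else e t)" for t using p0_pos e_pos[of t] by auto
  have "(\<lambda>k. e (Suc k)) sums (\<Sum>k. e (1 + k))" using summable_sums[OF summable_e[of 1]] by simp
  then have "(\<lambda>k. if Suc k = 0 then p0 else e (Suc k)) sums (1 - p0)" by (simp add: p0_def)
  then show "(\<lambda>t. if t = 0 then p0 else e t) sums 1"
    using sums_Suc_iff[of "\<lambda>t. if t = 0 then p0 else e t" "1 - p0"] by simp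
qed

lemma inverse_L_tendsto: "(\<lambda>t. 1 / real (L t)) \<longlonglongrightarrow> 0"
proof (rule tendsto_sandwich[OF _ _ tendsto_const])
  have "1 / real (L t) \<le> 1 / real (Suc t)" for t
    using L_ge[of t] by (intro divide_left_mono) (simp_all only: of_nat_le_iff, use L_real[of t] in simp)
  then show "\<forall>\<^sub>F t in sequentially. 1 / real (L t) \<le> 1 / real (Suc t)" by (intro always_eventually allI)
  show "(\<lambda>t. 1 / real (Suc t)) \<longlonglongrightarrow> 0" by real_asymp
qed auto

lemma exists_lev: "\<exists>r. \<forall>t. pmf r t = 1 / real (L t) - 1 / real (L (Suc t))"
proof (rule exists_nat_pmf)
  show "0 \<le> 1 / real (L t) - 1 / real (L (Suc t))" for t
    using L_less[of t] L_real[of t] by (simp add: frac_le)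
  show "(\<lambda>t. 1 / real (L t) - 1 / real (L (Suc t))) sums 1"
    using telescope_sums'[OF inverse_L_tendsto] by (simp add: L0)
qed

definition p :: "nat pmf" where "p = (SOME r. \<forall>t. pmf r t = (if t = 0 then p0 else e t))"

definition lev :: "nat pmf" where "lev = (SOME r. \<forall>t. pmf r t = 1 / real (L t) - 1 / real (L (Suc t)))"

lemma pmf_p: "pmf p t = (if t = 0 then p0 else e t)"
  using someI_ex[OF exists_p] by (simp add: p_def)

lemma pmf_lev: "pmf lev t = 1 / real (L t) - 1 / real (L (Suc t))"
  using someI_ex[OF exists_lev] by (simp add: lev_def)

lemma measure_lev: "measure (measure_pmf lev) {..<t} = 1 - 1 / real (L t)"
proof -
  have "measure (measure_pmf lev) {..<t} = (\<Sum>m<t. pmf lev m)"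
    by (rule measure_measure_pmf_finite) simp
  also have "\<dots> = 1 - 1 / real (L t)"
    by (induction t) (auto simp: pmf_lev L0)
  finally show ?thesis .
qed

sublocale level_chain p lev
proof
  show "set_pmf p = UNIV"
    using p0_pos e_pos by (auto simp: set_pmf_iff pmf_p) (metis less_irrefl)
  show "measure (measure_pmf lev) {..<t} < 1" for t
    using L_real[of t] by (simp add: measure_lev)
qed

lemma s_eq: "s t = 1 - 1 / real (L t)"
  by (simp add: s_def measure_lev)

lemma s_tendsto: "s \<longlonglongrightarrow> 1"
proof -
  have "(\<lambda>t. 1 - 1 / real (L t)) \<longlonglongrightarrow> 1 - 0" by (intro tendsto_intros inverse_L_tendsto)
  then show ?thesis by (simp add: s_eq[abs_def])
qed

lemma a_pos: "a t > 0"
  using vv_ge_1[of t] L_real[of t] e_pos[of t] by (simp add: a_def less_le_trans[OF zero_less_one])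

lemma a_square: "t \<ge> 1 \<Longrightarrow> (a t)\<^sup>2 = vv t / (real (L t) * e t)"
  using vv_ge_1[of t] L_real[of t] e_pos[of t] by (simp add: a_def)

text \<open>Distinct moduli make the values of the states injective and turn tail events of the
  modulus into tails of the type. The summand 1 in \<open>a_prev\<close> covers the step from type
  0, whose modulus is not given by the root.\<close>

lemma a_less: "a t < a (Suc t)"
proof -
  have 1: "vv t / (real (L t) * e t) + 1 \<le> vv (Suc t) / (real (L (Suc t)) * e (Suc t))"
    using a_prev[of t] by (simp add: e_def \<Lambda>_def)
  have 0: "vv t / (real (L t) * e t) \<ge> 0"
    using vv_ge_1[of t] L_real[of t] e_pos[of t] by simp
  have "(a t)\<^sup>2 < (a (Suc t))\<^sup>2"
  proof (cases "t = 0")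
    case True
    then have "(a t)\<^sup>2 = 1 / 4" by (simp add: a_def power2_eq_square)
    then show ?thesis using 0 1 a_square[of "Suc t"] by simp
  next
    case False
    then show ?thesis using 1 a_square[of t] a_square[of "Suc t"] by simp
  qed
  then show ?thesis using a_pos[of "Suc t"] by (meson less_imp_le power2_less_imp_less)
qed

lemma a_strict_mono: "strict_mono a"
  using a_less by (simp add: strict_mono_Suc_iff)

lemma a_ge_half: "a t \<ge> 1 / 2"
  using strict_mono_leD[OF a_strict_mono, of 0 t] by (simp add: a_def)

definition c :: "nat \<Rightarrow> real" where "c t = pmf p t * (a t)\<^sup>2"

lemma c_eq: "t \<ge> 1 \<Longrightarrow> c t = vv t / real (L t)"
  using e_pos[of t] L_real[of t] by (simp add: c_def a_square pmf_p)

lemma c_nonneg: "c t \<ge> 0"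
  by (simp add: c_def)

lemma c_pos: "c t > 0"
  using pmf_p_pos[of t] a_pos[of t] by (simp add: c_def)

lemma c0_le: "c 0 \<le> 1 / 4"
  using pmf_le_1[of p 0] by (simp add: c_def a_def power2_eq_square)

text \<open>Up to time \<open>Mt t\<close> the type contributes at most
  \<open>c t * n^2 \<le> n * (c t * Mt t)\<close> to the variance, a geometrically small multiple of
  \<open>n\<close>: it is invisible until \<open>g\<close> has grown enough.\<close>

lemma c_Mt_le: "t \<ge> 1 \<Longrightarrow> c t * Mt t \<le> (1 / 2) ^ (t + 2)"
proof -
  assume t: "t \<ge> 1"
  have "vv t * 2 ^ (t + 2) * Mt t \<le> real (L t)" using L_Mt[of "t - 1"] t by simp
  then have "vv t * Mt t \<le> real (L t) / 2 ^ (t + 2)" by (simp add: field_simps)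
  then have "vv t * Mt t / real (L t) \<le> real (L t) / 2 ^ (t + 2) / real (L t)"
    using L_real[of t] by (intro divide_right_mono) auto
  also have "\<dots> = (1 / 2) ^ (t + 2)" using L_real[of t] by (simp add: power_one_over)
  also have "vv t * Mt t / real (L t) = c t * Mt t" using t by (simp add: c_eq)
  finally show ?thesis .
qed

lemma c_le: "c t \<le> (1 / 2) ^ (t + 2)"
proof (cases "t = 0")
  case True
  then show ?thesis using c0_le by (simp add: power2_eq_square)
next
  case False
  have "c t * 1 \<le> c t * Mt t" using Mt(1) c_nonneg by (intro mult_left_mono) auto
  then show ?thesis using c_Mt_le[of t] False by simp
qed

text \<open>Likewise, up to time \<open>L t\<close> all later types together contribute at most a
  constant multiple of \<open>n\<close> to the variance.\<close>

lemma c_prev: "t < i \<Longrightarrow> c i * real (L t) \<le> (1 / 2) ^ i"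
proof -
  assume ti: "t < i"
  have "L t \<le> L (i - 1)" using ti by (intro L_mono) simp
  have "vv i * 2 ^ i * real (L (i - 1)) \<le> real (L i)" using L_prev[of "i - 1"] ti by simp
  moreover have "vv i * 2 ^ i * real (L t) \<le> vv i * 2 ^ i * real (L (i - 1))"
    using \<open>L t \<le> L (i - 1)\<close> vv_ge_1[of i] by (intro mult_left_mono) auto
  ultimately have "vv i * 2 ^ i * real (L t) \<le> real (L i)" by linarith
  then have "vv i * real (L t) \<le> real (L i) / 2 ^ i" by (simp add: field_simps)
  then have "vv i * real (L t) / real (L i) \<le> real (L i) / 2 ^ i / real (L i)"
    using L_real[of i] by (intro divide_right_mono) auto
  also have "\<dots> = (1 / 2) ^ i" using L_real[of i] by (simp add: power_one_over)
  also have "vv i * real (L t) / real (L i) = c i * real (L t)" using ti by (simp add: c_eq)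
  finally show ?thesis .
qed

lemma summable_half: "summable (\<lambda>t. (1 / 2 :: real) ^ (t + k))"
  using sums_summable[OF sums_half] by (simp add: power_add summable_mult2)

lemma suminf_half: "(\<Sum>t. (1 / 2 :: real) ^ (t + k)) = 2 * (1 / 2) ^ k"
  using sums_half suminf_mult2[OF sums_summable[OF sums_half], of "(1 / 2) ^ k"]
  by (simp add: power_add sums_iff)

lemma summable_c: "summable c"
  by (rule summable_comparison_test'[OF summable_half[of 2]]) (use c_le c_nonneg in auto)

lemma integrable_a: "integrable (measure_pmf p) (\<lambda>t. (a t)\<^sup>2)"
  using summable_c by (intro expectation_nat_pmf(1)) (auto simp: c_def[abs_def])

lemma expectation_a:
  assumes f: "\<And>t. 0 \<le> f t" "\<And>t. f t \<le> B"
  shows "summable (\<lambda>t. c t * f t)" "measure_pmf.expectation p (\<lambda>t. (a t)\<^sup>2 * f t) = (\<Sum>t. c t * f t)"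
proof -
  show s: "summable (\<lambda>t. c t * f t)"
    using f c_nonneg by (intro summable_comparison_test'[OF summable_mult2[OF summable_c, of B]])
      (auto simp: abs_mult intro!: mult_left_mono)
  then show "measure_pmf.expectation p (\<lambda>t. (a t)\<^sup>2 * f t) = (\<Sum>t. c t * f t)"
    using f by (subst expectation_nat_pmf(2)) (auto simp: c_def mult.assoc)
qed

lemma \<tau>_le: "\<tau> j \<le> 2 * e (Suc j)"
proof -
  have "summable (\<lambda>t. pmf p (Suc t))" using summable_e[of 1] by (simp add: pmf_p)
  then have "summable (\<lambda>t. pmf p t)" by (rule summable_Suc_iff[THEN iffD1])
  then have s: "summable (\<lambda>t. pmf p t * indicator {j<..} t)"
    by (rule summable_comparison_test') (auto simp: indicator_def)
  have "\<tau> j = measure_pmf.expectation p (indicator {j<..})" by (simp add: \<tau>_def)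
  also have "\<dots> = (\<Sum>t. pmf p t * indicator {j<..} t)"
    by (rule expectation_nat_pmf(2)[OF _ s]) simp
  also have "\<dots> = (\<Sum>k. pmf p (k + Suc j) * indicator {j<..} (k + Suc j))"
    using suminf_split_initial_segment[OF s, of "Suc j"] by (simp add: indicator_def)
  also have "\<dots> = (\<Sum>k. e (Suc j + k))" by (simp add: pmf_p add.commute)
  also have "\<dots> \<le> 2 * e (Suc j)" by (rule suminf_e)
  finally show ?thesis .
qed

end

context construction
begin

section \<open>Mixing rate and variances of the constructed chain\<close>

text \<open>The two terms take over on either side of \<open>n = L t powr (1 / (1 - q))\<close>:
  below it \<open>n powr q \<le> \<Lambda> t\<close> by monotonicity, above it
  \<open>n powr (q - 1) \<le> 1 / L t\<close>.\<close>

lemma powr_q_le: "real n powr q \<le> \<Lambda> t + real n / real (L t)"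
proof (cases "real n \<le> real (L t) powr (1 / (1 - q))")
  case True
  have "real n powr q \<le> (real (L t) powr (1 / (1 - q))) powr q"
    using True q by (intro powr_mono2) auto
  also have "\<dots> = \<Lambda> t" by (simp add: powr_powr \<Lambda>_def)
  finally show ?thesis using L_real(2)[of t] by (simp add: add_increasing2)
next
  case False
  have L: "real (L t) powr (1 / (1 - q)) > 0" using L_real(2)[of t] by simp
  with False have n: "real n > 0" by linarith
  have "real n powr q = real n powr (q - 1) * real n"
    using n by (simp add: powr_diff)
  also have "real n powr (q - 1) \<le> (real (L t) powr (1 / (1 - q))) powr (q - 1)"
    using False L q by (intro powr_mono2') auto
  also have "(real (L t) powr (1 / (1 - q))) powr (q - 1) = real (L t) powr (- 1)"
  proof -
    have "1 / (1 - q) * (q - 1) = - 1" using q by (simp add: field_simps)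
    then show ?thesis by (simp only: powr_powr)
  qed
  also have "\<dots> = 1 / real (L t)" using L_real(2)[of t] by (simp add: powr_minus_divide)
  finally show ?thesis using n by (simp add: \<Lambda>_def add_increasing)
qed

text \<open>One factor \<open>exp (- \<Lambda> t)\<close> of \<open>e t\<close> and
  \<open>s t ^ n \<le> exp (- n / L t)\<close> give the rate by \<open>powr_q_le\<close>; the other
  factor is at most \<open>(1 / 2) ^ (t + 1)\<close>, whose sum 1/2 over the positive types absorbs
  the factor 2. Type 0 is refreshed at every step and drops out.\<close>

lemma expectation_s_power:
  assumes "n \<ge> 1"
  shows "2 * measure_pmf.expectation p (\<lambda>t. s t ^ n) \<le> exp (- (real n powr q))"
proof -
  let ?X = "exp (- (real n powr q))"
  have s01: "0 \<le> s t ^ n" "s t ^ n \<le> 1" for t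
    using s_bounds(1,3)[of t] by (auto intro: power_le_one)
  have le: "pmf p (Suc t) * s (Suc t) ^ n \<le> (1 / 2) ^ (t + 2) * ?X" for t
  proof -
    let ?t = "Suc t"
    have "s ?t \<le> exp (- (1 / real (L ?t)))"
      using exp_ge_add_one_self[of "- (1 / real (L ?t))"] by (simp add: s_eq)
    then have "s ?t ^ n \<le> exp (- (1 / real (L ?t))) ^ n"
      using s_bounds(1)[of ?t] by (intro power_mono) auto
    also have "\<dots> = exp (- (real n / real (L ?t)))" by (simp flip: exp_of_nat_mult)
    finally have "e ?t * s ?t ^ n \<le> e ?t * exp (- (real n / real (L ?t)))"
      using e_pos[of ?t] by (intro mult_left_mono) auto
    also have "\<dots> = exp (- \<Lambda> ?t) * exp (- (\<Lambda> ?t + real n / real (L ?t)))"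
      by (simp add: e_def flip: exp_add)
    also have "\<dots> \<le> (1 / 2) ^ (t + 2) * ?X"
      using exp_\<Lambda>_le[of ?t] powr_q_le[of n ?t] by (intro mult_mono) auto
    finally show ?thesis by (simp add: pmf_p)
  qed
  have sm: "summable (\<lambda>t. (1 / 2) ^ (t + 2) * ?X)" by (intro summable_mult2 summable_half)
  have s': "summable (\<lambda>t. pmf p (Suc t) * s (Suc t) ^ n)"
    by (rule summable_comparison_test'[OF sm]) (use le s01 in \<open>simp add: abs_mult\<close>)
  then have su: "summable (\<lambda>t. pmf p t * s t ^ n)" by (rule summable_Suc_iff[THEN iffD1])
  have "measure_pmf.expectation p (\<lambda>t. s t ^ n) = (\<Sum>t. pmf p t * s t ^ n)"
    by (rule expectation_nat_pmf(2)[OF s01(1) su])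
  also have "\<dots> = (\<Sum>t. pmf p (Suc t) * s (Suc t) ^ n)"
    using suminf_split_head[OF su] assms by (simp add: s_eq L0 power_0_left)
  also have "\<dots> \<le> (\<Sum>t. (1 / 2) ^ (t + 2) * ?X)" by (rule suminf_le[OF le s' sm])
  also have "\<dots> = ?X / 2"
    using suminf_half[of 2] by (subst suminf_mult2[symmetric]) (auto simp: summable_half power2_eq_square)
  finally show ?thesis by simp
qed

text \<open>The variance of the sum of the first \<open>n\<close> terms of the chain, as a series
  over the types.\<close>

definition H :: "nat \<Rightarrow> real" where "H n = (\<Sum>t. c t * \<Gamma> n (s t))"

lemma \<Gamma>_s: "0 \<le> \<Gamma> n (s t)" "\<Gamma> n (s t) \<le> (real n)\<^sup>2" "\<Gamma> n (s t) \<le> 2 * real (L t) * real n"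
  using \<Gamma>_nonneg[of "s t" n] \<Gamma>_le_square[of "s t" n] \<Gamma>_le_linear[of "s t" n] s_bounds(1-3)[of t]
  by (auto simp: s_eq)

lemma summable_H: "summable (\<lambda>t. c t * \<Gamma> n (s t))"
  by (rule expectation_a(1)[OF \<Gamma>_s(1,2)])

lemma expectation_a_\<Gamma>: "measure_pmf.expectation p (\<lambda>t. (a t)\<^sup>2 * \<Gamma> n (s t)) = H n"
  unfolding H_def by (rule expectation_a(2)[OF \<Gamma>_s(1,2)])

lemma H_ge: "c j * \<Gamma> n (s j) \<le> H n"
proof -
  have "(\<Sum>t\<in>{j}. c t * \<Gamma> n (s t)) \<le> H n" unfolding H_def
    by (rule sum_le_suminf[OF summable_H]) (use c_nonneg \<Gamma>_s(1) in auto)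
  then show ?thesis by simp
qed

lemma H_pos: "n \<ge> 1 \<Longrightarrow> H n > 0"
proof -
  assume "n \<ge> 1"
  then have "0 < c 0 * \<Gamma> n (s 0)" using c_pos[of 0] by (simp add: s_eq L0 \<Gamma>_0)
  then show ?thesis using H_ge[of 0 n] by linarith
qed

lemma H_le:
  assumes "\<And>t. c t * \<Gamma> n (s t) \<le> real n * f t" "f sums x"
  shows "H n \<le> real n * x"
  unfolding H_def using assms sums_mult[OF assms(2), of "real n"]
  by (intro sums_le[OF _ summable_sums[OF summable_H]]) auto

lemma vv_at_top: "filterlim vv at_top sequentially"
proof (rule filterlim_at_top_mono)
  show "filterlim (\<lambda>t. (real t) ^ 3) at_top sequentially" by real_asymp
  show "\<forall>\<^sub>F t in sequentially. (real t) ^ 3 \<le> vv t" by (simp add: vv_ge_cube)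
qed

text \<open>Each single type \<open>j\<close> eventually forces a rate of at least
  \<open>vv j / 2\<close>, and these are unbounded.\<close>

lemma H_at_top: "filterlim (\<lambda>n. H n / real n) at_top sequentially"
  unfolding filterlim_at_top
proof
  fix B :: real
  have "\<forall>\<^sub>F j in sequentially. 2 * B \<le> vv j \<and> j \<ge> 1"
    using filterlim_at_top[THEN iffD1, OF vv_at_top] eventually_ge_at_top[of 1] by (auto intro: eventually_conj)
  then obtain j where j: "2 * B \<le> vv j" "j \<ge> 1" by (auto simp: eventually_sequentially)
  show "\<forall>\<^sub>F n in sequentially. B \<le> H n / real n"
    using \<Gamma>_asymptotic[OF s_bounds(1,2), of j] eventually_gt_at_top[of 0]
  proof eventually_elim
    case (elim n)
    have "B * real n \<le> vv j / 2 * real n" using j by (intro mult_right_mono) auto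
    also have "\<dots> = c j * (real n / (2 * (1 - s j)))"
      using j L_real[of j] by (simp add: s_eq c_eq)
    also have "\<dots> \<le> c j * \<Gamma> n (s j)" using elim(1) c_nonneg by (intro mult_left_mono)
    also have "\<dots> \<le> H n" by (rule H_ge)
    finally show ?case using elim(2) by (simp add: field_simps)
  qed
qed

text \<open>The rate of a positive type \<open>t\<close>, counted from time \<open>Mt t\<close> on;
  before that time the type is covered by \<open>c_Mt_le\<close>.\<close>

definition vMt :: "real \<Rightarrow> nat \<Rightarrow> real" where
  "vMt x t = (if t \<ge> 1 \<and> Mt t \<le> x then vv t else 0)"

lemma vMt_nonneg: "vMt x t \<ge> 0"
  using vv_ge_1[of t] by (simp add: vMt_def)

lemma vMt_sums: "vMt x sums (\<Sum>t\<in>{1..nat \<lfloor>x\<rfloor>}. vMt x t)"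
proof (intro sums_finite)
  show "vMt x t = 0" if "t \<notin> {1..nat \<lfloor>x\<rfloor>}" for t
  proof (rule ccontr)
    assume "vMt x t \<noteq> 0"
    then have t: "t \<ge> 1" "real t \<le> x" using Mt(2)[of t] by (auto simp: vMt_def split: if_splits)
    then have "t \<le> nat \<lfloor>x\<rfloor>" by (simp add: le_nat_iff le_floor_iff)
    then show False using that t by simp
  qed
qed simp

text \<open>For the largest type \<open>T\<close> with \<open>Mt T \<le> x\<close>, the defining
  property of \<open>Mt T\<close> bounds the whole sum; the summand 1/2 is room for the types that
  are not yet visible.\<close>

lemma suminf_vMt:
  assumes x: "x \<ge> 1"
  shows "1 / 2 + 2 * (\<Sum>t. vMt x t) \<le> g x"
proof -
  let ?A = "{t\<in>{1..nat \<lfloor>x\<rfloor>}. Mt t \<le> x}"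
  have "(\<Sum>t\<in>{1..nat \<lfloor>x\<rfloor>}. vMt x t) = (\<Sum>t\<in>?A. vv t)"
    unfolding sum.inter_filter[OF finite_atLeastAtMost] by (intro sum.cong) (auto simp: vMt_def)
  then have eq: "(\<Sum>t. vMt x t) = (\<Sum>t\<in>?A. vv t)" using vMt_sums[of x] by (simp add: sums_iff)
  show ?thesis
  proof (cases "?A = {}")
    case True
    then show ?thesis unfolding eq True using g1[OF x] by simp
  next
    case False
    define T where "T = Max ?A"
    have T: "T \<in> ?A" unfolding T_def by (rule Max_in) (use False in auto)
    have "(\<Sum>t\<in>?A. vv t) \<le> (\<Sum>t\<in>{1..T}. vv t)"
    proof (rule sum_mono2)
      show "?A \<subseteq> {1..T}" unfolding T_def by auto
      show "0 \<le> vv b" for b using vv_ge_1[of b] by simp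
    qed simp
    then show ?thesis unfolding eq using Mt(3)[of T x] T by simp
  qed
qed

lemma half_sums: "(\<lambda>t. (1 / 2 :: real) ^ (t + 2)) sums (1 / 2)"
proof -
  have "2 * (1 / 2) ^ 2 = (1 / 2 :: real)" by (simp add: power2_eq_square)
  then show ?thesis using summable_sums[OF summable_half[of 2]] by (simp only: suminf_half)
qed

text \<open>Two bounds on \<Gamma> are combined: the linear one, with rate \<open>2 * vv t\<close>,
  once a type is visible, and the quadratic one, tamed by \<open>c_Mt_le\<close>, before that. The
  latter types and type 0 add at most 1/2.\<close>

lemma H_le_g:
  assumes n: "n \<ge> 1"
  shows "H n \<le> real n * g (real n)"
proof -
  have "c t * \<Gamma> n (s t) \<le> real n * ((1 / 2) ^ (t + 2) + 2 * vMt (real n) t)" for t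
  proof -
    consider "t = 0" | "t \<ge> 1" "Mt t \<le> real n" | "t \<ge> 1" "Mt t > real n" by fastforce
    then show ?thesis
    proof cases
      case 1
      then show ?thesis using c_le[of 0] mult_right_mono[OF c_le[of 0], of "real n"]
        by (simp add: vMt_def s_eq L0 \<Gamma>_0 mult.commute)
    next
      case 2
      have "c t * \<Gamma> n (s t) \<le> c t * (2 * real (L t) * real n)"
        using \<Gamma>_s(3) c_nonneg by (intro mult_left_mono)
      also have "\<dots> = real n * (2 * vMt (real n) t)" using 2 L_real[of t] by (simp add: c_eq vMt_def)
      finally show ?thesis by (simp add: distrib_left add_increasing)
    next
      case 3
      have "c t * \<Gamma> n (s t) \<le> c t * (Mt t * real n)"
        using 3 \<Gamma>_s(2)[of n t] c_nonneg
        by (intro mult_left_mono order_trans[OF \<Gamma>_s(2)]) (auto simp: power2_eq_square intro: mult_right_mono)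
      also have "\<dots> \<le> real n * (1 / 2) ^ (t + 2)"
        using mult_right_mono[OF c_Mt_le[OF 3(1)], of "real n"] by (simp add: mult_ac)
      finally show ?thesis using 3 by (simp add: vMt_def)
    qed
  qed
  moreover have "(\<lambda>t. (1 / 2) ^ (t + 2) + 2 * vMt (real n) t) sums (1 / 2 + 2 * (\<Sum>t. vMt (real n) t))"
    by (intro sums_add sums_mult half_sums summable_sums sums_summable[OF vMt_sums])
  ultimately have "H n \<le> real n * (1 / 2 + 2 * (\<Sum>t. vMt (real n) t))" by (rule H_le)
  also have "\<dots> \<le> real n * g (real n)" using n by (intro mult_left_mono suminf_vMt) auto
  finally show ?thesis .
qed

lemma inj_values: "inj (\<lambda>x. a (fst x) * sg (snd x))"
proof (rule injI)
  fix x y :: "nat \<times> bool" assume eq: "a (fst x) * sg (snd x) = a (fst y) * sg (snd y)"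
  then have "\<bar>a (fst x) * sg (snd x)\<bar> = \<bar>a (fst y) * sg (snd y)\<bar>" by simp
  then have "a (fst x) = a (fst y)" using a_pos[of "fst x"] a_pos[of "fst y"] by (simp add: abs_mult)
  then have "fst x = fst y" using strict_mono_eq[OF a_strict_mono] by simp
  moreover have "snd x = snd y"
    using eq a_pos[of "fst y"] \<open>a (fst x) = a (fst y)\<close> by (auto simp: sg_def split: if_splits)
  ultimately show "x = y" by (simp add: prod_eq_iff)
qed

text \<open>An inequality between numbers that is obtained from the variances of an actual
  chain.\<close>

lemma H_multiple: "H (N * n) \<le> (real N)\<^sup>2 * H n"
proof -
  obtain M :: "(int \<Rightarrow> real) measure" and Z where "chain_process M \<pi> K Z"
    using exists_chain_process[OF inj_values] by blast
  then interpret chain_process M \<pi> K Z .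
  interpret level_process p lev M Z ..
  show ?thesis
    using expectation_square_multiple[OF integrable_a, of N n]
    unfolding expectation_sum_odd_square(2)[OF integrable_a] expectation_a_\<Gamma> .
qed

text \<open>At time \<open>L j / j\<close> type \<open>j\<close> dominates the variance but is still in its quadratic regime, so that
  multiplying the time by \<open>N\<close> multiplies the variance by almost \<open>N\<^sup>2\<close>.\<close>

lemma limsup_H:
  assumes N: "N \<ge> 1"
  shows "limsup (\<lambda>n. ereal ((H (N * n) / real (N * n)) / (H n / real n))) = ereal (real N)"
proof (rule antisym)
  have ratio: "(H (N * n) / real (N * n)) / (H n / real n) = H (N * n) / (real N * H n)" if "n \<ge> 1" for n
    using that N by simp
  show "limsup (\<lambda>n. ereal ((H (N * n) / real (N * n)) / (H n / real n))) \<le> ereal (real N)"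
  proof (rule Limsup_bounded, rule eventually_mono[OF eventually_ge_at_top[of 1]])
    fix n :: nat assume n: "1 \<le> n"
    have "H (N * n) / (real N * H n) \<le> (real N)\<^sup>2 * H n / (real N * H n)"
      using H_pos[OF n] by (intro divide_right_mono H_multiple) auto
    also have "\<dots> = real N" using H_pos[OF n] N by (simp add: power2_eq_square)
    finally show "ereal ((H (N * n) / real (N * n)) / (H n / real n)) \<le> ereal (real N)"
      using ratio[OF n] by simp
  qed
  \<comment> \<open>By \<open>L_dvd\<close> the division is exact, so
    \<open>m j = L j / j\<close>.\<close>
  define m where "m j = L j div j" for j
  have m: "real (m j) = real (L j) / real j" "m j \<ge> 1" "m j \<le> L j" if "j \<ge> 1" for j
  proof -
    have "j dvd L j" using L_dvd[of "j - 1"] that by simp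
    then show 1: "real (m j) = real (L j) / real j" by (simp add: m_def real_of_nat_div)
    have "L j \<ge> j" using L_ge[of j] by simp
    then show "m j \<ge> 1" using div_le_mono[of j "L j" j] that by (simp add: m_def)
    show "m j \<le> L j" by (simp add: m_def)
  qed
  let ?B = "\<lambda>j. real N * (1 - real N / real j) / (1 + 2 / real j + 2 / (real j)\<^sup>2)"
  have B: "?B j \<le> (H (N * m j) / real (N * m j)) / (H (m j) / real (m j))" if j: "j \<ge> 1" "j \<ge> N" for j
  proof -
    let ?n = "m j"
    \<comment> \<open>Type 0 and the types above \<open>j\<close> contribute at most
      \<open>?n\<close> times a geometric series of sum 2; the types in between use the linear
      bound; type \<open>j\<close> uses the quadratic one, where
      \<open>c j * m j = vv j / j\<close>.\<close>
    have upper: "H ?n \<le> real ?n * (2 + (\<Sum>t\<in>{1..<j}. 2 * vv t) + vv j / real j)"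
    proof (rule H_le)
      fix t
      let ?w = "\<lambda>t. (1 / 2) ^ t + (if t \<in> {1..<j} then 2 * vv t else 0) + (if t = j then vv j / real j else 0)"
      consider "t = 0" | "t \<ge> 1" "t < j" | "t = j" | "t > j" by fastforce
      then show "c t * \<Gamma> ?n (s t) \<le> real ?n * ?w t"
      proof cases
        case 1
        have "c 0 \<le> 1" using c0_le by simp
        from mult_right_mono[OF this, of "real ?n"] show ?thesis
          using 1 j by (simp add: s_eq L0 \<Gamma>_0)
      next
        case 2
        have "c t * \<Gamma> ?n (s t) \<le> c t * (2 * real (L t) * real ?n)"
          using \<Gamma>_s(3) c_nonneg by (intro mult_left_mono)
        also have "\<dots> = real ?n * (2 * vv t)" using 2 L_real[of t] by (simp add: c_eq)
        finally show ?thesis using 2 by (simp add: distrib_left add_increasing)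
      next
        case 3
        have "c t * \<Gamma> ?n (s t) \<le> c t * (real ?n)\<^sup>2"
          using \<Gamma>_s(2) c_nonneg by (intro mult_left_mono)
        also have "\<dots> = real ?n * (vv j / real (L j) * real ?n)" using 3 j by (simp add: c_eq power2_eq_square)
        also have "vv j / real (L j) * real ?n = vv j / real j" using m(1)[OF j(1)] L_real[of j] by simp
        finally show ?thesis using 3 by (simp add: distrib_left add_increasing)
      next
        case 4
        have "c t * \<Gamma> ?n (s t) \<le> c t * (real ?n)\<^sup>2"
          using \<Gamma>_s(2) c_nonneg by (intro mult_left_mono)
        also have "\<dots> \<le> real ?n * (c t * real (L j))"
          using mult_left_mono[of "real ?n" "real (L j)" "real ?n * c t"] m(3)[OF j(1)] c_nonneg[of t]
          by (simp add: power2_eq_square mult_ac)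
        also have "\<dots> \<le> real ?n * (1 / 2) ^ t"
          using c_prev[OF 4] by (intro mult_left_mono) auto
        finally show ?thesis using 4 by simp
      qed
    next
      show "(\<lambda>t. (1 / 2) ^ t + (if t \<in> {1..<j} then 2 * vv t else 0) + (if t = j then vv j / real j else 0))
        sums (2 + (\<Sum>t\<in>{1..<j}. 2 * vv t) + vv j / real j)"
        by (intro sums_add sums_half sums_If_finite_set sums_single) auto
    qed
    have "(\<Sum>t\<in>{1..<j}. 2 * vv t) \<le> 2 * vv j / (real j)\<^sup>2"
      using sum_vv[of j] by (simp flip: sum_distrib_left)
    moreover have "2 \<le> 2 * vv j / (real j)\<^sup>2 / real j"
      using vv_ge_cube[of j] j by (simp add: field_simps power2_eq_square power3_eq_cube)
    ultimately have "2 + (\<Sum>t\<in>{1..<j}. 2 * vv t) + vv j / real j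
        \<le> 2 * vv j / (real j)\<^sup>2 / real j + 2 * vv j / (real j)\<^sup>2 + vv j / real j" by linarith
    also have "\<dots> = vv j / real j * (1 + 2 / real j + 2 / (real j)\<^sup>2)"
      using j by (simp add: field_simps power2_eq_square)
    finally have up: "H ?n \<le> real ?n * (vv j / real j * (1 + 2 / real j + 2 / (real j)\<^sup>2))"
      by (intro order_trans[OF upper] mult_left_mono) auto
    \<comment> \<open>Bernoulli's inequality, with \<open>N * m j / L j = N / j\<close>.\<close>
    have "1 - real N / real j \<le> s j ^ (N * ?n)"
    proof -
      have "1 + real (N * ?n) * (- 1 / real (L j)) \<le> (1 + (- 1 / real (L j))) ^ (N * ?n)"
        using L_real[of j] by (intro Bernoulli_inequality) (simp add: divide_le_eq)
      then show ?thesis using m(1)[OF j(1)] L_real[of j] by (simp add: s_eq)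
    qed
    then have "c j * ((real (N * ?n))\<^sup>2 * (1 - real N / real j)) \<le> c j * ((real (N * ?n))\<^sup>2 * s j ^ (N * ?n))"
      using c_nonneg by (intro mult_left_mono) auto
    also have "\<dots> \<le> c j * \<Gamma> (N * ?n) (s j)"
      using c_nonneg s_bounds(1,3)[of j] by (intro mult_left_mono \<Gamma>_ge_square) auto
    also have "\<dots> \<le> H (N * ?n)" by (rule H_ge)
    finally have lo: "c j * ((real (N * ?n))\<^sup>2 * (1 - real N / real j)) \<le> H (N * ?n)" .
    have "c j * ((real (N * ?n))\<^sup>2 * (1 - real N / real j)) = (real N)\<^sup>2 * real ?n * (vv j / real (L j) * real ?n) * (1 - real N / real j)"
      using j by (simp add: c_eq power2_eq_square)
    also have "vv j / real (L j) * real ?n = vv j / real j" using m(1)[OF j(1)] L_real[of j] by simp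
    finally have lo: "(real N)\<^sup>2 * real ?n * (vv j / real j) * (1 - real N / real j) \<le> H (N * ?n)" using lo by simp
    let ?D = "1 + 2 / real j + 2 / (real j)\<^sup>2"
    have D: "?D > 0" using j by (intro add_pos_nonneg) auto
    have N1: "0 \<le> 1 - real N / real j" using j by simp
    have "?B j * (real N * H ?n) \<le> ?B j * (real N * (real ?n * (vv j / real j * ?D)))"
      using up N1 D by (intro mult_left_mono) auto
    also have "\<dots> = (real N)\<^sup>2 * real ?n * (vv j / real j) * (1 - real N / real j)"
      using D by (simp add: power2_eq_square)
    finally have "?B j * (real N * H ?n) \<le> H (N * ?n)" using lo by linarith
    then show ?thesis using H_pos[OF m(2)[OF j(1)]] N ratio[OF m(2)[OF j(1)]] by (simp add: pos_le_divide_eq)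
  qed
  show "ereal (real N) \<le> limsup (\<lambda>n. ereal ((H (N * n) / real (N * n)) / (H n / real n)))"
  proof (rule ccontr)
    assume "\<not> ereal (real N) \<le> limsup (\<lambda>n. ereal ((H (N * n) / real (N * n)) / (H n / real n)))"
    then have "limsup (\<lambda>n. ereal ((H (N * n) / real (N * n)) / (H n / real n))) < ereal (real N)"
      by (simp only: not_le)
    from ereal_dense2[OF this] obtain z
      where z: "limsup (\<lambda>n. ereal ((H (N * n) / real (N * n)) / (H n / real n))) < ereal z" "ereal z < ereal (real N)"
      by auto
    from Limsup_lessD[OF z(1)]
    have ev: "\<forall>\<^sub>F n in sequentially. (H (N * n) / real (N * n)) / (H n / real n) < z" by simp
    \<comment> \<open>This makes \<open>m j\<close> tend to infinity, so that an eventual property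
      may be evaluated along it; it rests on \<open>L j \<ge> vv j \<ge> j^3\<close>.\<close>
    have "j \<le> m j" if j: "j \<ge> 1" for j
    proof -
      have "vv j * 1 * 1 \<le> vv j * 2 ^ (j + 2) * Mt j"
        using Mt(1)[of j] vv_ge_1[of j] one_le_power[of "2 :: real" "j + 2"] by (intro mult_mono) auto
      also have "\<dots> \<le> real (L j)" using L_Mt[of "j - 1"] j by simp
      finally have "real j ^ 3 \<le> real (L j)" using vv_ge_cube[of j] by linarith
      moreover have "real j * real j * 1 \<le> real j * real j * real j" using j by (intro mult_left_mono) auto
      ultimately have "real j * real j \<le> real (L j)" unfolding power3_eq_cube by linarith
      then have "real j \<le> real (m j)" using m(1)[OF j] j by (simp add: pos_le_divide_eq)
      then show ?thesis by simp
    qed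
    then have mj: "filterlim m at_top sequentially"
      by (intro filterlim_at_top_mono[OF filterlim_ident] eventually_mono[OF eventually_ge_at_top[of 1]])
    have "\<forall>\<^sub>F j in sequentially. (H (N * m j) / real (N * m j)) / (H (m j) / real (m j)) < z"
      using eventually_compose_filterlim[OF ev mj] .
    then have "\<forall>\<^sub>F j in sequentially. ?B j \<le> z"
      using eventually_ge_at_top[of "max 1 N"] by eventually_elim (use B in force)
    moreover have "?B \<longlonglongrightarrow> real N"
    proof -
      have "(\<lambda>j. real N * (1 - real N * (1 / real j)) / (1 + 2 * (1 / real j) + 2 * (1 / real j)\<^sup>2)) \<longlonglongrightarrow> real N * (1 - real N * 0) / (1 + 2 * 0 + 2 * 0\<^sup>2)"
        by (intro tendsto_intros lim_1_over_n) auto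
      then show ?thesis by (simp add: power_one_over divide_inverse power_inverse)
    qed
    ultimately have "real N \<le> z" by (intro tendsto_upperbound[of ?B]) auto
    then show False using z(2) by simp
  qed
qed

end

context construction
begin

section \<open>Norming sequences and the quantile function\<close>

lemma P\<^sub>l_half: "P\<^sub>l t \<ge> 1 / 2"
  using \<tau>_le[of t] e_le[of "Suc t"] power_decreasing[of 2 "t + 2" "1 / 2 :: real"]
  by (simp add: P\<^sub>l_\<tau> power2_eq_square)

lemma \<zeta>_ge: "t \<ge> 1 \<Longrightarrow> e t / real (L t) \<le> \<zeta> t"
  using \<zeta>_bounds(1)[of t] by (simp add: pmf_p s_eq)

lemma \<zeta>_le: "t \<ge> 1 \<Longrightarrow> \<zeta> t \<le> e t"
proof -
  assume t: "t \<ge> 1"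
  have L2: "real (L t) \<ge> 2" using L_ge[of t] t by simp
  have "\<zeta> t \<le> 1 / real (L t) * e t / P\<^sub>l t" using \<zeta>_bounds(2)[of t] t by (simp add: pmf_p s_eq)
  also have "\<dots> \<le> 1 / 2 * e t / (1 / 2)"
    using P\<^sub>l_half[of t] e_pos[of t] L2 by (intro frac_le mult_right_mono) auto
  finally show ?thesis by simp
qed

text \<open>\<open>\<zeta> j\<close> is the probability of drawing type \<open>j\<close> in one
  step, so \<open>1 / \<zeta> j\<close> steps give one draw in expectation, the mean of the Poisson
  variable.\<close>

definition block :: "nat \<Rightarrow> nat" where "block j = nat \<lceil>1 / \<zeta> j\<rceil>"

lemma block_bounds: "1 / \<zeta> j \<le> real (block j)" "real (block j) \<le> 1 / \<zeta> j + 1"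
  using \<zeta>_bounds(3)[of j] by (auto simp: block_def)

lemma block_pos: "block j > 0"
  using block_bounds(1)[of j] \<zeta>_bounds(3)[of j] by (metis gr0I not_le of_nat_0 zero_less_divide_1_iff)

lemma block_le: "t \<ge> 1 \<Longrightarrow> real (block t) \<le> 2 * real (L t) / e t"
proof -
  assume t: "t \<ge> 1"
  have "1 / \<zeta> t \<le> 1 / (e t / real (L t))"
    using \<zeta>_ge[OF t] \<zeta>_bounds(3)[of t] e_pos[of t] L_real[of t] by (intro divide_left_mono) auto
  moreover have "e t \<le> real (L t)"
    using e_le[OF t] power_le_one[of "1 / 2 :: real" "Suc t"] L_real(1)[of t] by linarith
  then have "1 \<le> real (L t) / e t" using e_pos[of t] by simp
  ultimately show ?thesis using block_bounds(2)[of t] by simp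
qed

text \<open>The purpose of \<open>e_prev\<close>: the next type is unlikely to be seen within
  \<open>block t\<close> steps, and the factor \<open>t + 2\<close> makes this probability tend to
  0.\<close>

lemma block_e_Suc: "t \<ge> 1 \<Longrightarrow> real (block t) * e (Suc t) \<le> 1 / (2 * (real t + 2))"
proof -
  assume t: "t \<ge> 1"
  have "real (block t) * e (Suc t) \<le> 2 * real (L t) / e t * (e t / (4 * (real t + 2) * real (L t)))"
    using block_le[OF t] e_Suc[of t] e_pos[of t] e_pos[of "Suc t"] L_real[of t] by (intro mult_mono) auto
  also have "\<dots> = 1 / (2 * (real t + 2))"
  proof -
    have "2 * l / E * (E / (4 * r * l)) = 1 / (2 * r)" if "l > 0" "E > 0" "r > 0" for l E r :: real
      using that by (simp add: field_simps)
    from this[OF L_real(2)[of t] e_pos[of t], of "real t + 2"] show ?thesis by simp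
  qed
  finally show ?thesis .
qed

lemma block_less: "t \<ge> 1 \<Longrightarrow> block t < block (Suc t)"
proof -
  assume t: "t \<ge> 1"
  have "real (block t) * e (Suc t) < 1"
    using block_e_Suc[OF t] by (rule le_less_trans) (simp add: field_simps)
  then have "real (block t) < 1 / e (Suc t)" using e_pos[of "Suc t"] by (simp add: pos_less_divide_eq)
  also have "\<dots> \<le> 1 / \<zeta> (Suc t)"
    using \<zeta>_le[of "Suc t"] \<zeta>_bounds(3)[of "Suc t"] e_pos[of "Suc t"] by (intro divide_left_mono) auto
  also have "\<dots> \<le> real (block (Suc t))" by (rule block_bounds)
  finally show ?thesis by simp
qed

lemma strict_mono_on_block: "strict_mono_on {1..} block"
proof (rule strict_mono_onI)
  fix r t :: nat assume "r \<in> {1..}" "t \<in> {1..}" "r < t"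
  moreover have "strict_mono (\<lambda>n. block (Suc n))" by (simp add: strict_mono_Suc_iff block_less)
  ultimately show "block r < block t"
    using strict_monoD[of "\<lambda>n. block (Suc n)" "r - 1" "t - 1"] by simp
qed

lemma \<zeta>_tendsto: "\<zeta> \<longlonglongrightarrow> 0"
proof (rule tendsto_sandwich[OF _ _ tendsto_const])
  show "\<forall>\<^sub>F t in sequentially. 0 \<le> \<zeta> t" using \<zeta>_bounds(3) by (simp add: less_imp_le)
  show "\<forall>\<^sub>F t in sequentially. \<zeta> t \<le> (1 / 2) ^ Suc t"
    using eventually_ge_at_top[of 1] by eventually_elim (use \<zeta>_le e_le in \<open>blast intro: order_trans\<close>)
  show "(\<lambda>t. (1 / 2 :: real) ^ Suc t) \<longlonglongrightarrow> 0" by real_asymp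
qed

lemma block_\<zeta>: "(\<lambda>j. real (block j) * \<zeta> j) \<longlonglongrightarrow> 1"
proof (rule tendsto_sandwich[OF _ _ tendsto_const])
  show "\<forall>\<^sub>F j in sequentially. 1 \<le> real (block j) * \<zeta> j"
    using block_bounds(1) \<zeta>_bounds(3) by (simp add: pos_divide_le_eq)
  have "real (block j) * \<zeta> j \<le> (1 / \<zeta> j + 1) * \<zeta> j" for j
    using block_bounds(2)[of j] \<zeta>_bounds(3)[of j] by (intro mult_right_mono) auto
  also have "(1 / \<zeta> j + 1) * \<zeta> j = 1 + \<zeta> j" for j using \<zeta>_bounds(3)[of j] by (simp add: field_simps)
  finally show "\<forall>\<^sub>F j in sequentially. real (block j) * \<zeta> j \<le> 1 + \<zeta> j" by simp
  show "(\<lambda>j. 1 + \<zeta> j) \<longlonglongrightarrow> 1" using tendsto_add[OF tendsto_const \<zeta>_tendsto, of 1] by simp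
qed

lemma block_\<tau>: "(\<lambda>j. real (block j) * \<tau> j) \<longlonglongrightarrow> 0"
proof (rule tendsto_sandwich[OF _ _ tendsto_const])
  show "\<forall>\<^sub>F j in sequentially. 0 \<le> real (block j) * \<tau> j" by (simp add: \<tau>_def)
  show "\<forall>\<^sub>F j in sequentially. real (block j) * \<tau> j \<le> 1 / (real j + 2)"
    using eventually_ge_at_top[of 1]
  proof eventually_elim
    case (elim j)
    have "real (block j) * \<tau> j \<le> real (block j) * (2 * e (Suc j))" by (intro mult_left_mono \<tau>_le) simp
    also have "\<dots> \<le> 2 * (1 / (2 * (real j + 2)))" using block_e_Suc[OF elim] by simp
    also have "\<dots> = 1 / (real j + 2)" by (simp add: field_simps)
    finally show ?case .
  qed
  show "(\<lambda>j. 1 / (real j + 2)) \<longlonglongrightarrow> 0" by real_asymp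
qed

text \<open>The modulus \<open>a j\<close> times the mean cluster length \<open>L j\<close>, the
  size of a typical cluster sum.\<close>

definition norming :: "nat \<Rightarrow> real" where "norming j = a j / (1 - s j)"

lemma norming_eq: "norming j = a j * real (L j)"
  by (simp add: norming_def s_eq)

lemma norming_pos: "norming j > 0"
  using a_pos[of j] L_real[of j] by (simp add: norming_eq)

lemma norming_at_top: "filterlim norming at_top sequentially"
proof (rule filterlim_at_top_mono)
  show "filterlim (\<lambda>j. 1 / 2 * real j) at_top sequentially" by real_asymp
  have "1 / 2 * real j \<le> a j * real (L j)" for j
    using a_ge_half[of j] L_ge[of j] by (intro mult_mono) auto
  then show "\<forall>\<^sub>F j in sequentially. 1 / 2 * real j \<le> norming j" by (simp add: norming_eq)
qed

text \<open>The lower types have total rate at most \<open>1 / 2 + 2 * vv j / j^2\<close> over a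
  block of at most \<open>2 * L j / e j\<close> steps, while
  \<open>(norming j)\<^sup>2 = vv j * L j / e j\<close>; the factor \<open>L j / e j\<close>
  cancels.\<close>

lemma block_low:
  "(\<lambda>j. real (block j) * (\<Sum>i<j. 2 * pmf p i * (a i)\<^sup>2 / (1 - s i)) / (norming j)\<^sup>2) \<longlonglongrightarrow> 0"
proof (rule tendsto_sandwich[OF _ _ tendsto_const])
  have eq: "2 * pmf p i * (a i)\<^sup>2 / (1 - s i) = 2 * c i * real (L i)" for i
    by (simp add: c_def s_eq)
  have nn: "0 \<le> 2 * c i * real (L i)" for i using c_nonneg[of i] by simp
  show "\<forall>\<^sub>F j in sequentially. 0 \<le> real (block j) * (\<Sum>i<j. 2 * pmf p i * (a i)\<^sup>2 / (1 - s i)) / (norming j)\<^sup>2"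
    unfolding eq using nn by (intro always_eventually allI divide_nonneg_nonneg mult_nonneg_nonneg[OF _ sum_nonneg]) auto
  show "\<forall>\<^sub>F j in sequentially. real (block j) * (\<Sum>i<j. 2 * pmf p i * (a i)\<^sup>2 / (1 - s i)) / (norming j)\<^sup>2
      \<le> 1 / (real j)^3 + 4 / (real j)\<^sup>2"
    using eventually_ge_at_top[of 1]
  proof eventually_elim
    case (elim j)
    have "(\<Sum>i<j. 2 * c i * real (L i)) = 2 * c 0 * real (L 0) + (\<Sum>i=1..<j. 2 * c i * real (L i))"
      using elim by (simp add: lessThan_atLeast0 sum.atLeast_Suc_lessThan)
    also have "(\<Sum>i=1..<j. 2 * c i * real (L i)) = (\<Sum>i=1..<j. 2 * vv i)"
      using L_real by (intro sum.cong) (auto simp: c_eq)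
    also have "2 * c 0 * real (L 0) + (\<Sum>i=1..<j. 2 * vv i) \<le> 1 / 2 + 2 * (vv j / (real j)\<^sup>2)"
      using c0_le sum_vv[of j] by (simp add: L0 flip: sum_distrib_left)
    finally have sum: "(\<Sum>i<j. 2 * c i * real (L i)) \<le> 1 / 2 + 2 * (vv j / (real j)\<^sup>2)" .
    have n2: "(norming j)\<^sup>2 = vv j * real (L j) / e j"
      using elim L_real[of j] e_pos[of j] by (simp add: norming_eq power_mult_distrib a_square power2_eq_square[of "real (L j)"])
    have n0: "(norming j)\<^sup>2 > 0" using norming_pos[of j] by simp
    have "real (block j) * (\<Sum>i<j. 2 * c i * real (L i)) / (norming j)\<^sup>2
        \<le> 2 * real (L j) / e j * (1 / 2 + 2 * (vv j / (real j)\<^sup>2)) / (norming j)\<^sup>2"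
      using block_le[OF elim] sum nn n0 e_pos[of j]
      by (intro divide_right_mono mult_mono sum_nonneg) auto
    also have "\<dots> = 1 / vv j + 4 / (real j)\<^sup>2"
      unfolding n2 using e_pos[of j] L_real[of j] vv_ge_1[of j] elim by (simp add: field_simps power2_eq_square)
    also have "\<dots> \<le> 1 / (real j)^3 + 4 / (real j)\<^sup>2"
      using vv_ge_cube[of j] elim by (intro add_mono divide_left_mono) (auto intro!: mult_pos_pos less_le_trans[OF zero_less_one vv_ge_1])
    finally show ?case unfolding eq .
  qed
  show "(\<lambda>j. 1 / (real j)^3 + 4 / (real j)\<^sup>2) \<longlonglongrightarrow> 0" by real_asymp
qed

text \<open>The quantile function of the modulus of a stationary state, expressed through the law of
  its type.\<close>

definition quant :: "real \<Rightarrow> real" where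
  "quant u = Inf {t. 0 \<le> t \<and> measure (measure_pmf p) {i. a i > t} \<le> u}"

text \<open>The quantile at \<open>u\<close> is at most \<open>a T\<close> for the least
  \<open>T\<close> with \<open>\<tau> T \<le> u\<close>; minimality gives
  \<open>u < \<tau> (T - 1) \<le> 2 * e T\<close>, so the term of \<open>T\<close> alone dominates.
  If \<open>T = 0\<close>, the constant 1/4 does.\<close>

lemma quant_square:
  assumes u: "u > 0"
  shows "ennreal ((quant u)\<^sup>2) \<le> ennreal (1 / 4) + (\<Sum>t. ennreal ((a (Suc t))\<^sup>2) * indicator {..<2 * e (Suc t)} u)"
proof -
  let ?S = "{t. 0 \<le> t \<and> measure (measure_pmf p) {i. a i > t} \<le> u}"
  have aS: "a T \<in> ?S" if "\<tau> T \<le> u" for T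
  proof -
    have "{i. a i > a T} = {T<..}" using strict_mono_less[OF a_strict_mono] by auto
    then show ?thesis using that a_pos[of T] by (simp add: \<tau>_def)
  qed
  obtain T0 where "\<tau> T0 < u"
    using order_tendstoD(2)[OF \<tau>_tendsto u] by (auto simp: eventually_sequentially)
  define T where "T = (LEAST T. \<tau> T \<le> u)"
  have T: "\<tau> T \<le> u" unfolding T_def by (rule LeastI[of _ T0]) (use \<open>\<tau> T0 < u\<close> in simp)
  have "quant u \<le> a T" unfolding quant_def by (rule cInf_lower[OF aS[OF T]]) (auto intro!: bdd_belowI)
  moreover have "0 \<le> quant u" unfolding quant_def by (rule cInf_greatest) (use aS[OF T] in auto)
  ultimately have Q: "(quant u)\<^sup>2 \<le> (a T)\<^sup>2" by (rule power_mono)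
  show ?thesis
  proof (cases T)
    case 0
    then have "ennreal ((quant u)\<^sup>2) \<le> ennreal (1 / 4)" using Q by (intro ennreal_leI) (simp add: a_def power2_eq_square)
    then show ?thesis by (simp add: add_increasing2)
  next
    case (Suc t)
    have "\<not> \<tau> t \<le> u" unfolding T_def using Suc by (intro not_less_Least) (simp add: T_def)
    then have "u < 2 * e (Suc t)" using \<tau>_le[of t] by simp
    then have "ennreal ((quant u)\<^sup>2) \<le> ennreal ((a (Suc t))\<^sup>2) * indicator {..<2 * e (Suc t)} u"
      using Q Suc by (simp add: ennreal_leI)
    also have "\<dots> \<le> (\<Sum>t. ennreal ((a (Suc t))\<^sup>2) * indicator {..<2 * e (Suc t)} u)"
    proof -
      have "f t \<le> (\<Sum>t. f t)" for f :: "nat \<Rightarrow> ennreal" using sum_le_suminf[of f "{t}"] by simp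
      then show ?thesis .
    qed
    finally show ?thesis by (simp add: add_increasing)
  qed
qed

text \<open>Measurability of the quantile function is not needed: if the integral does not exist, its value
  is \<open>0\<close>.\<close>

lemma integral_quant:
  fixes U :: real
  assumes U: "U > 0"
    and f: "\<And>t. c (Suc t) * min (U / e (Suc t)) 2 \<le> f t" "f sums x"
  shows "(LBINT u:{0<..<U}. (quant u)\<^sup>2) \<le> U / 4 + x"
  unfolding set_lebesgue_integral_def
proof (rule integral_real_bounded)
  have f0: "0 \<le> f t" for t
    by (rule order_trans[OF _ f(1)]) (use c_nonneg U e_pos[of "Suc t"] in auto)
  have x: "x \<ge> 0" using sums_le[OF f0 sums_zero f(2)] .
  show "0 \<le> U / 4 + x" using U x by simp
  have "(\<integral>\<^sup>+u. ennreal (indicator {0<..<U} u *\<^sub>R (quant u)\<^sup>2) \<partial>lborel)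
      \<le> (\<integral>\<^sup>+u. ennreal (1 / 4) * indicator {0<..<U} u
          + (\<Sum>t. ennreal ((a (Suc t))\<^sup>2) * indicator {0<..<min U (2 * e (Suc t))} u) \<partial>lborel)"
  proof (rule nn_integral_mono)
    fix u :: real
    show "ennreal (indicator {0<..<U} u *\<^sub>R (quant u)\<^sup>2) \<le> ennreal (1 / 4) * indicator {0<..<U} u
          + (\<Sum>t. ennreal ((a (Suc t))\<^sup>2) * indicator {0<..<min U (2 * e (Suc t))} u)"
    proof (cases "u \<in> {0<..<U}")
      case True
      then have "indicator {0<..<min U (2 * e (Suc t))} u = (indicator {..<2 * e (Suc t)} u :: ennreal)" for t
        by (auto simp: indicator_def)
      then show ?thesis using True quant_square[of u] by simp
    qed simp
  qed
  also have "\<dots> = (\<integral>\<^sup>+u. ennreal (1 / 4) * indicator {0<..<U} u \<partial>lborel)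
          + (\<Sum>t. \<integral>\<^sup>+u. ennreal ((a (Suc t))\<^sup>2) * indicator {0<..<min U (2 * e (Suc t))} u \<partial>lborel)"
    by (subst nn_integral_add) (auto intro!: nn_integral_suminf)
  also have "(\<integral>\<^sup>+u. ennreal (1 / 4) * indicator {0<..<U} u \<partial>lborel) = ennreal (U / 4)"
    using U by (simp add: nn_integral_cmult flip: ennreal_mult)
  also have "(\<Sum>t. \<integral>\<^sup>+u. ennreal ((a (Suc t))\<^sup>2) * indicator {0<..<min U (2 * e (Suc t))} u \<partial>lborel)
      = (\<Sum>t. ennreal (c (Suc t) * min (U / e (Suc t)) 2))"
  proof (rule suminf_cong)
    fix t
    have "(\<integral>\<^sup>+u. ennreal ((a (Suc t))\<^sup>2) * indicator {0<..<min U (2 * e (Suc t))} u \<partial>lborel)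
      = ennreal ((a (Suc t))\<^sup>2 * min U (2 * e (Suc t)))"
      using U e_pos[of "Suc t"] by (simp add: nn_integral_cmult flip: ennreal_mult)
    also have "(a (Suc t))\<^sup>2 * min U (2 * e (Suc t)) = c (Suc t) * min (U / e (Suc t)) 2"
      using e_pos[of "Suc t"] by (auto simp: c_def pmf_p min_def field_simps)
    finally show "(\<integral>\<^sup>+u. ennreal ((a (Suc t))\<^sup>2) * indicator {0<..<min U (2 * e (Suc t))} u \<partial>lborel)
      = ennreal (c (Suc t) * min (U / e (Suc t)) 2)" .
  qed
  also have "ennreal (U / 4) + (\<Sum>t. ennreal (c (Suc t) * min (U / e (Suc t)) 2)) \<le> ennreal (U / 4) + (\<Sum>t. ennreal (f t))"
    using f(1) by (intro add_left_mono suminf_le ennreal_leI) auto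
  also have "(\<Sum>t. ennreal (f t)) = ennreal x"
    using suminf_ennreal2[OF f0 sums_summable[OF f(2)]] f(2) by (simp add: sums_iff)
  also have "ennreal (U / 4) + ennreal x = ennreal (U / 4 + x)" using U x by simp
  finally show "(\<integral>\<^sup>+u. ennreal (indicator {0<..<U} u *\<^sub>R (quant u)\<^sup>2) \<partial>lborel) \<le> ennreal (U / 4 + x)" .
qed

end

text \<open>From \<open>ln z \<le> z\<close> at \<open>z = y / (2 * r)\<close>.\<close>

lemma powr_le_exp_half:
  fixes y r :: real
  assumes "y > 0" "r > 0"
  shows "y powr r \<le> (2 * r) powr r * exp (y / 2)"
proof -
  have "ln (y / (2 * r)) \<le> y / (2 * r)" using ln_bound[of "y / (2 * r)"] assms by simp
  then have "ln y \<le> y / (2 * r) + ln (2 * r)" using assms by (simp add: ln_div)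
  then have "r * ln y \<le> r * (y / (2 * r) + ln (2 * r))" using assms by (intro mult_left_mono) auto
  also have "\<dots> = y / 2 + r * ln (2 * r)" using assms by (simp add: field_simps)
  finally have "exp (r * ln y) \<le> exp (y / 2 + r * ln (2 * r))" by simp
  then show ?thesis using assms by (simp add: powr_def exp_add mult.commute)
qed

section \<open>The integral of the squared quantile function\<close>

context construction
begin

text \<open>The inverse of the exponent in \<Lambda>: it recovers
  \<open>L t = \<Lambda> t powr \<rho>\<close>, and for \<open>y = x powr q\<close> it gives
  \<open>y powr (- \<rho>) = (1 / x) powr (1 - q)\<close>.\<close>

definition \<rho> :: real where "\<rho> = (1 - q) / q"

lemma \<rho>_pos: "\<rho> > 0" using q by (simp add: \<rho>_def)

definition D :: real where "D = 2 * 4 powr \<rho> + (2 * \<rho>) powr \<rho>"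

lemma \<Lambda>_\<rho>: "\<Lambda> t powr \<rho> = real (L t)"
  using q L_real(2)[of t] by (simp add: \<Lambda>_def \<rho>_def powr_powr)

lemma exp_le_D: "y > 0 \<Longrightarrow> exp (- y / 2) \<le> D * y powr (- \<rho>)"
proof -
  assume y: "y > 0"
  have "exp (- y / 2) * y powr \<rho> \<le> exp (- y / 2) * ((2 * \<rho>) powr \<rho> * exp (y / 2))"
    using powr_le_exp_half[OF y \<rho>_pos] by (intro mult_left_mono) auto
  also have "\<dots> = (2 * \<rho>) powr \<rho>" by (simp add: exp_minus)
  also have "\<dots> \<le> D" by (simp add: D_def)
  finally show ?thesis using y by (simp add: powr_minus divide_inverse[symmetric] pos_le_divide_eq)
qed

text \<open>If \<open>y \<le> 4 * \<Lambda> t\<close>, the right-hand side is at least 2 since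
  \<open>L t = \<Lambda> t powr \<rho>\<close>; otherwise \<open>exp (- y) / e t = exp (2 *
  \<Lambda> t - y) \<le> exp (- y / 2)\<close>, which decays faster than the power. \<open>D\<close>
  adds the constants of the two regimes.\<close>

lemma min_le_D:
  assumes y: "y > 0" and t: "t \<ge> 1"
  shows "min (exp (- y) / e t) 2 \<le> D * real (L t) * y powr (- \<rho>)"
proof (cases "y \<le> 4 * \<Lambda> t")
  case True
  have "y powr \<rho> \<le> (4 * \<Lambda> t) powr \<rho>" using True y \<rho>_pos by (intro powr_mono2) auto
  also have "\<dots> = 4 powr \<rho> * real (L t)" using \<Lambda>_ge[OF t] by (simp add: powr_mult \<Lambda>_\<rho>)
  finally have "2 * y powr \<rho> \<le> 2 * 4 powr \<rho> * real (L t)" by simp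
  also have "\<dots> \<le> D * real (L t)" by (intro mult_right_mono) (simp_all add: D_def)
  finally have "2 \<le> D * real (L t) * y powr (- \<rho>)"
    using y by (simp add: powr_minus divide_inverse[symmetric] pos_le_divide_eq)
  then show ?thesis by simp
next
  case False
  have "exp (- y) / e t = exp (2 * \<Lambda> t - y)" by (simp add: e_def exp_diff exp_minus field_simps)
  also have "\<dots> \<le> exp (- y / 2)" using False by simp
  also have "\<dots> \<le> D * y powr (- \<rho>) * 1" using exp_le_D[OF y] by simp
  also have "\<dots> \<le> D * y powr (- \<rho>) * real (L t)"
    using L_real[of t] by (intro mult_left_mono) (auto simp: D_def)
  finally show ?thesis by (simp add: mult_ac)
qed

text \<open>With \<open>y = x powr q\<close> and \<open>X = (1 / x) powr (1 - q)\<close>, a type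
  with \<open>Mt t \<le> x\<close> contributes at most \<open>D * vv t * X\<close> by
  \<open>min_le_D\<close>, and these rates sum to at most a multiple of \<open>g x\<close>; any
  other type has \<open>c t \<le> (1 / 2) ^ (t + 2) / x\<close>, and
  \<open>1 / x \<le> X\<close>.\<close>

lemma integral_quant_le:
  assumes x: "x \<ge> 1"
  shows "(LBINT u:{0<..<exp (- (x powr q))}. (quant u)\<^sup>2) \<le> (2 * D + 1) * ((1 / x) powr (1 - q) * g x)"
proof -
  define y where "y = x powr q"
  define X where "X = (1 / x) powr (1 - q)"
  have y: "y > 0" using x by (simp add: y_def)
  have yX: "y powr (- \<rho>) = X"
    using x q by (simp add: y_def X_def \<rho>_def powr_powr powr_divide powr_minus_divide)
  have X0: "X \<ge> 0" by (simp add: X_def)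
  have D0: "D \<ge> 0" by (simp add: D_def)
  have xX: "1 / x \<le> X"
  proof -
    have "(1 / x) powr 1 \<le> (1 / x) powr (1 - q)" using x q by (intro powr_mono') auto
    then show ?thesis using x by (simp add: X_def)
  qed
  let ?f = "\<lambda>t. D * X * vMt x t + X * (1 / 2) ^ t"
  have f: "c t * min (exp (- y) / e t) 2 \<le> ?f t" if t: "t \<ge> 1" for t
  proof (cases "Mt t \<le> x")
    case True
    have "c t * min (exp (- y) / e t) 2 \<le> c t * (D * real (L t) * y powr (- \<rho>))"
      using min_le_D[OF y t] c_nonneg by (intro mult_left_mono) auto
    also have "\<dots> = D * X * vMt x t" using t True L_real[of t] by (simp add: c_eq yX vMt_def)
    finally show ?thesis using X0 by (simp add: add_increasing2)
  next
    case False
    have "c t * x \<le> c t * Mt t" using False c_nonneg by (intro mult_left_mono) auto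
    also have "\<dots> \<le> (1 / 2) ^ (t + 2)" by (rule c_Mt_le[OF t])
    finally have "c t \<le> (1 / 2) ^ (t + 2) / x" using x by (simp add: pos_le_divide_eq)
    have "c t * min (exp (- y) / e t) 2 \<le> c t * 2" using c_nonneg by (intro mult_left_mono) auto
    also have "\<dots> \<le> (1 / 2) ^ (t + 2) / x * 2" using \<open>c t \<le> _\<close> by (rule mult_right_mono) simp
    also have "\<dots> \<le> (1 / x) * (1 / 2) ^ t" using x by (simp add: frac_le)
    also have "\<dots> \<le> X * (1 / 2) ^ t" using xX by (intro mult_right_mono) auto
    finally show ?thesis using D0 X0 vMt_nonneg[of x t] by (simp add: add_increasing)
  qed
  have "?f sums (D * X * (\<Sum>t. vMt x t) + X * 2)"
    by (intro sums_add sums_mult sums_half summable_sums sums_summable[OF vMt_sums])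
  \<comment> \<open>\<open>?f 0 = X\<close>, because \<open>vMt x 0 = 0\<close>; it is split off
    since the series of \<open>integral_quant\<close> starts at type 1.\<close>
  moreover have "D * X * (\<Sum>t. vMt x t) + X * 2 = D * X * (\<Sum>t. vMt x t) + X + ?f 0"
    by (simp add: vMt_def[of x 0])
  ultimately have "?f sums (D * X * (\<Sum>t. vMt x t) + X + ?f 0)" by (simp only:)
  then have s: "(\<lambda>t. ?f (Suc t)) sums (D * X * (\<Sum>t. vMt x t) + X)"
    by (rule sums_Suc_iff[of ?f, THEN iffD2])
  have "(LBINT u:{0<..<exp (- y)}. (quant u)\<^sup>2) \<le> exp (- y) / 4 + (D * X * (\<Sum>t. vMt x t) + X)"
    by (rule integral_quant[OF _ f s]) auto
  also have "exp (- y) / 4 \<le> D * X"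
  proof -
    have "exp (- y) / 4 \<le> exp (- y)" by simp
    also have "\<dots> \<le> exp (- y / 2)" using y by simp
    also have "\<dots> \<le> D * y powr (- \<rho>)" by (rule exp_le_D[OF y])
    finally show ?thesis by (simp only: yX)
  qed
  also have "D * X + (D * X * (\<Sum>t. vMt x t) + X) = X * (D * (1 + (\<Sum>t. vMt x t)) + 1)" by (simp add: algebra_simps)
  also have "\<dots> \<le> X * (D * (2 * g x) + g x)"
  proof -
    have "0 \<le> (\<Sum>t. vMt x t)" by (intro suminf_nonneg vMt_nonneg sums_summable[OF vMt_sums])
    then have "1 + (\<Sum>t. vMt x t) \<le> 2 * g x" using suminf_vMt[OF x] g1[OF x] by linarith
    then show ?thesis using g1[OF x] X0 D0 by (intro mult_left_mono add_mono) auto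
  qed
  finally show ?thesis by (simp add: y_def X_def algebra_simps)
qed

lemma quant_bigo: "(\<lambda>x. LBINT u:{0<..<exp (- (x powr q))}. (quant u)\<^sup>2) \<in> O(\<lambda>x. (1 / x) powr (1 - q) * g x)"
proof (rule bigoI)
  show "\<forall>\<^sub>F x in at_top. norm (LBINT u:{0<..<exp (- (x powr q))}. (quant u)\<^sup>2)
      \<le> (2 * D + 1) * norm ((1 / x) powr (1 - q) * g x)"
    using eventually_ge_at_top[of 1]
  proof eventually_elim
    case (elim x)
    have "0 \<le> (LBINT u:{0<..<exp (- (x powr q))}. (quant u)\<^sup>2)"
      unfolding set_lebesgue_integral_def by (intro integral_nonneg_AE) auto
    then show ?case using integral_quant_le[OF elim] g1[OF elim] by simp
  qed
qed

end

text \<open>Apart from the divisibility, every requirement holds for all large real numbers, hence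
  for a large multiple of \<open>Suc t\<close>.\<close>

lemma exists_L_Suc:
  fixes r :: real and l t :: nat
  assumes r: "r > 0" and B: "B > 0" and V: "V > 0"
  shows "\<exists>l'. l < l' \<and> Suc t dvd l' \<and> real (Suc t) + 1 \<le> real l' powr r \<and> C \<le> real l'
    \<and> exp (- 2 * real l' powr r) \<le> B \<and> A \<le> V / (real l' * exp (- 2 * real l' powr r))"
proof -
  have "filterlim (\<lambda>y :: real. y powr r) at_top at_top" using r by real_asymp
  then have 1: "\<forall>\<^sub>F y in at_top. real (Suc t) + 1 \<le> y powr r" by (simp add: filterlim_at_top)
  have "((\<lambda>y. exp (- 2 * y powr r)) \<longlongrightarrow> 0) at_top" using r by real_asymp
  then have 2: "\<forall>\<^sub>F y in at_top. exp (- 2 * y powr r) < B" using B by (rule order_tendstoD)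
  have "filterlim (\<lambda>y. V / (y * exp (- 2 * y powr r))) at_top at_top" using r V by real_asymp
  then have 3: "\<forall>\<^sub>F y in at_top. A \<le> V / (y * exp (- 2 * y powr r))" by (simp add: filterlim_at_top)
  have "\<forall>\<^sub>F y in at_top. real l < y \<and> C \<le> y \<and> real (Suc t) + 1 \<le> y powr r
      \<and> exp (- 2 * y powr r) < B \<and> A \<le> V / (y * exp (- 2 * y powr r))"
    using eventually_gt_at_top[of "real l"] eventually_ge_at_top[of C] 1 2 3 by eventually_elim auto
  moreover have "filterlim (\<lambda>k :: nat. real (k * Suc t)) at_top sequentially" by real_asymp
  ultimately have "\<forall>\<^sub>F k in sequentially. real l < real (k * Suc t) \<and> C \<le> real (k * Suc t)
      \<and> real (Suc t) + 1 \<le> real (k * Suc t) powr r \<and> exp (- 2 * real (k * Suc t) powr r) < B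
      \<and> A \<le> V / (real (k * Suc t) * exp (- 2 * real (k * Suc t) powr r))"
    by (rule eventually_compose_filterlim)
  then obtain k where k: "real l < real (k * Suc t)" "C \<le> real (k * Suc t)"
      "real (Suc t) + 1 \<le> real (k * Suc t) powr r" "exp (- 2 * real (k * Suc t) powr r) < B"
      "A \<le> V / (real (k * Suc t) * exp (- 2 * real (k * Suc t) powr r))"
    by (auto simp: eventually_sequentially)
  then show ?thesis
    by (intro exI[of _ "k * Suc t"] conjI dvd_triv_right) (simp_all only: of_nat_less_iff less_imp_le)
qed

lemma exists_construction:
  assumes q: "0 < q" "q < 1" and g1: "\<And>x. 1 \<le> x \<Longrightarrow> 1 \<le> g x" and g: "filterlim g at_top at_top"
  shows "\<exists>L Mt. construction q g L Mt"
proof -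
  have "\<exists>y. 1 \<le> y \<and> real t \<le> y \<and> (\<forall>x\<ge>y. 1 + 2 * (\<Sum>i=1..t. vv i) \<le> g x)" for t
  proof -
    obtain y where "\<forall>x\<ge>y. 1 + 2 * (\<Sum>i=1..t. vv i) \<le> g x"
      using g by (auto simp: filterlim_at_top eventually_at_top_linorder)
    then show ?thesis by (intro exI[of _ "max y (max 1 (real t))"]) auto
  qed
  then obtain Mt where Mt: "\<And>t. 1 \<le> Mt t" "\<And>t. real t \<le> Mt t"
      "\<And>t x. Mt t \<le> x \<Longrightarrow> 1 + 2 * (\<Sum>i=1..t. vv i) \<le> g x"
    by metis
  define r where "r = q / (1 - q)"
  have r: "r > 0" using q by (simp add: r_def)
  \<comment> \<open>Dependent choice, since several requirements on \<open>L (Suc t)\<close> involve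
    \<open>L t\<close>; the invariant \<open>L t \<ge> 1\<close> keeps the bound on the exponential
    positive.\<close>
  have "\<exists>L. \<forall>t. (L t \<ge> 1 \<and> (t = 0 \<longrightarrow> L t = 1)) \<and> (L t < L (Suc t) \<and> Suc t dvd L (Suc t)
      \<and> real (Suc t) + 1 \<le> real (L (Suc t)) powr r
      \<and> max (vv (Suc t) * 2 ^ (Suc t + 2) * Mt (Suc t)) (vv (Suc t) * 2 ^ Suc t * real (L t)) \<le> real (L (Suc t))
      \<and> exp (- 2 * real (L (Suc t)) powr r) \<le> exp (- 2 * real (L t) powr r) / (4 * (real t + 2) * real (L t))
      \<and> vv t / (real (L t) * exp (- 2 * real (L t) powr r)) + 1
        \<le> vv (Suc t) / (real (L (Suc t)) * exp (- 2 * real (L (Suc t)) powr r)))"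
  proof (rule dependent_nat_choice)
    show "\<exists>l :: nat. l \<ge> 1 \<and> (0 = (0 :: nat) \<longrightarrow> l = 1)" by auto
    fix l t :: nat assume l: "l \<ge> 1 \<and> (t = 0 \<longrightarrow> l = 1)"
    have V: "vv (Suc t) > 0" using vv_ge_1[of "Suc t"] by linarith
    have B: "exp (- 2 * real l powr r) / (4 * (real t + 2) * real l) > 0" using l by simp
    from exists_L_Suc[OF r B V, of l t "max (vv (Suc t) * 2 ^ (Suc t + 2) * Mt (Suc t)) (vv (Suc t) * 2 ^ Suc t * real l)"
        "vv t / (real l * exp (- 2 * real l powr r)) + 1"]
    obtain l' where "l < l' \<and> Suc t dvd l' \<and> real (Suc t) + 1 \<le> real l' powr r
      \<and> max (vv (Suc t) * 2 ^ (Suc t + 2) * Mt (Suc t)) (vv (Suc t) * 2 ^ Suc t * real l) \<le> real l'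
      \<and> exp (- 2 * real l' powr r) \<le> exp (- 2 * real l powr r) / (4 * (real t + 2) * real l)
      \<and> vv t / (real l * exp (- 2 * real l powr r)) + 1 \<le> vv (Suc t) / (real l' * exp (- 2 * real l' powr r))"
      by blast
    then show "\<exists>l'. (1 \<le> l' \<and> (Suc t = 0 \<longrightarrow> l' = 1)) \<and> l < l' \<and> Suc t dvd l'
      \<and> real (Suc t) + 1 \<le> real l' powr r
      \<and> max (vv (Suc t) * 2 ^ (Suc t + 2) * Mt (Suc t)) (vv (Suc t) * 2 ^ Suc t * real l) \<le> real l'
      \<and> exp (- 2 * real l' powr r) \<le> exp (- 2 * real l powr r) / (4 * (real t + 2) * real l)
      \<and> vv t / (real l * exp (- 2 * real l powr r)) + 1 \<le> vv (Suc t) / (real l' * exp (- 2 * real l' powr r))"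
      by (intro exI[of _ l']) simp
  qed
  then obtain L where L: "\<And>t. (L t \<ge> 1 \<and> (t = 0 \<longrightarrow> L t = 1)) \<and> (L t < L (Suc t) \<and> Suc t dvd L (Suc t)
      \<and> real (Suc t) + 1 \<le> real (L (Suc t)) powr r
      \<and> max (vv (Suc t) * 2 ^ (Suc t + 2) * Mt (Suc t)) (vv (Suc t) * 2 ^ Suc t * real (L t)) \<le> real (L (Suc t))
      \<and> exp (- 2 * real (L (Suc t)) powr r) \<le> exp (- 2 * real (L t) powr r) / (4 * (real t + 2) * real (L t))
      \<and> vv t / (real (L t) * exp (- 2 * real (L t) powr r)) + 1
        \<le> vv (Suc t) / (real (L (Suc t)) * exp (- 2 * real (L (Suc t)) powr r)))"
    by blast
  have "construction q g L Mt"
  proof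
    fix t
    show "vv (Suc t) * 2 ^ (Suc t + 2) * Mt (Suc t) \<le> real (L (Suc t))"
      "vv (Suc t) * 2 ^ Suc t * real (L t) \<le> real (L (Suc t))"
      using L[of t] by (simp_all only: max.bounded_iff)
  qed (use q g1 Mt L in \<open>simp_all add: r_def\<close>)
  then show ?thesis by blast
qed

theorem corollary5p8:
  fixes q :: real and g :: "real \<Rightarrow> real"
  assumes "0 < q" and "q < 1"
    and "\<And>x. 1 \<le> x \<Longrightarrow> 1 \<le> g x"
    and "filterlim g at_top at_top"
  shows "\<exists>(M :: (int \<Rightarrow> real) measure) (X :: int \<Rightarrow> (int \<Rightarrow> real) \<Rightarrow> real) S.
    prob_space M \<and>
    strictly_stationary M X \<and>
    countable_markov_chain M X S \<and>
    chain_irreducible M X S \<and>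
    chain_aperiodic M X S \<and>
    reversible M X \<and>
    integrable M (\<lambda>\<omega>. (X 0 \<omega>)\<^sup>2) \<and>
    prob_space.expectation M (X 0) = 0 \<and>
    (\<lambda>x. LBINT u:{0<..<exp (- (x powr q))}. (quantile M (\<lambda>\<omega>. \<bar>X 0 \<omega>\<bar>) u)\<^sup>2)
      \<in> O(\<lambda>x. (1 / x) powr (1 - q) * g x) \<and>
    (\<forall>n\<ge>1. alpha_mix M X n \<le> beta_mix M X n \<and> beta_mix M X n \<le> exp (- (real n powr q))) \<and>
    filterlim (\<lambda>n. prob_space.variance M (psum X n) / real n) at_top sequentially \<and>
    (\<forall>c>0. (\<lambda>n. SUP r. \<P>(\<omega> in M. r - c < psum X n \<omega> / sqrt (real n) \<and>
                                  psum X n \<omega> / sqrt (real n) < r + c)) \<longlonglongrightarrow> 0) \<and>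
    (\<exists>(J :: nat \<Rightarrow> nat) (b :: nat \<Rightarrow> real).
       strict_mono_on {1..} J \<and> (\<forall>n\<ge>1. 0 < J n) \<and> (\<forall>n\<ge>1. 0 < b n) \<and>
       filterlim b at_top sequentially \<and>
       weak_conv_m (\<lambda>n. distr M borel (\<lambda>\<omega>. psum X (J n) \<omega> / b n)) mu_P1sL) \<and>
    (\<forall>n\<ge>1. norm_var M X n \<le> g (real n)) \<and>
    (\<forall>N\<ge>1. limsup (\<lambda>n. ereal (norm_var M X (N * n) / norm_var M X n)) = ereal (real N))"
proof -
  obtain L Mt where "construction q g L Mt" using exists_construction[OF assms] by blast
  then interpret construction q g L Mt .
  let ?v = "\<lambda>x. a (fst x) * sg (snd x)"
  obtain M :: "(int \<Rightarrow> real) measure" and Z where "chain_process M \<pi> K Z"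
    using exists_chain_process[OF inj_values] by blast
  then interpret chain_process M \<pi> K Z .
  interpret level_process p lev M Z ..
  let ?X = "\<lambda>k \<omega>. ?v (Z k \<omega>)"
  have X: "?X k = signed a k" for k by (simp add: fun_eq_iff signed_def)
  have psum: "psum ?X n = (\<lambda>\<omega>. \<Sum>k=1..n. signed a (int k) \<omega>)" for n
    unfolding X by (simp add: fun_eq_iff psum_def)
  have "expectation (psum ?X n) = 0" for n
    unfolding psum using integrable_odd[OF integrable_a] expectation_odd[OF integrable_a]
    by (subst Bochner_Integration.integral_sum) auto
  then have var: "variance (psum ?X n) = H n" for n
    using expectation_sum_odd_square(2)[OF integrable_a, of n] unfolding psum expectation_a_\<Gamma> by simp
  have nvar: "norm_var M ?X n = H n / real n" for n
    by (simp only: norm_var_def var)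
  have quant: "quantile M (\<lambda>\<omega>. \<bar>?X 0 \<omega>\<bar>) = quant"
  proof (rule ext)
    fix u
    have "\<P>(\<omega> in M. \<bar>?X 0 \<omega>\<bar> > t) = measure (measure_pmf p) {i. a i > t}" for t
    proof -
      have "\<P>(\<omega> in M. \<bar>?X 0 \<omega>\<bar> > t) = prob {\<omega>\<in>space M. Z 0 \<omega> \<in> fst -` {i. a i > t}}"
        using a_pos by (intro arg_cong[where f=prob]) (auto simp: abs_mult abs_of_pos)
      also have "\<dots> = measure (measure_pmf \<pi>) (fst -` {i. a i > t})" by (rule prob_Z)
      also have "\<dots> = measure (map_pmf fst \<pi>) {i. a i > t}" by simp
      finally show ?thesis by (simp add: \<pi>_def map_fst_pair_pmf)
    qed
    then show "quantile M (\<lambda>\<omega>. \<bar>?X 0 \<omega>\<bar>) u = quant u" by (simp add: quantile_def quant_def)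
  qed
  \<comment> \<open>The rate equals \<open>vv j\<close> for \<open>j \<ge> 1\<close>, whereas
    \<open>a 0\<close> is fixed separately; eventual equality settles the limit.\<close>
  have growth: "filterlim (\<lambda>j. (a j)\<^sup>2 * pmf p j / (1 - s j)) at_top sequentially"
  proof (rule filterlim_cong[THEN iffD1, OF refl refl _ vv_at_top])
    show "\<forall>\<^sub>F j in sequentially. vv j = (a j)\<^sup>2 * pmf p j / (1 - s j)"
      using eventually_ge_at_top[of 1]
    proof eventually_elim
      case (elim j)
      then show ?case using c_eq[OF elim] L_real[of j] by (simp add: c_def s_eq mult.commute)
    qed
  qed
  show ?thesis
  proof (intro exI[of _ M] exI[of _ ?X] exI[of _ "range ?v"] conjI allI impI)
    show "prob_space M" by (rule prob_space_axioms)
    show "strictly_stationary M ?X" by (rule strictly_stationary_values)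
    show "countable_markov_chain M ?X (range ?v)" by (rule countable_markov_chain_values[OF inj_values set_\<pi>])
    show "chain_irreducible M ?X (range ?v)" by (rule irreducible_values[OF inj_values set_\<pi> K_pos])
    show "chain_aperiodic M ?X (range ?v)" by (rule aperiodic_values[OF inj_values set_\<pi> K_pos])
    show "reversible M ?X" by (rule reversible_values)
    show "integrable M (\<lambda>\<omega>. (?X 0 \<omega>)\<^sup>2)" using integrable_odd_square[OF integrable_a, of 0] by (simp add: signed_def)
    show "expectation (?X 0) = 0" unfolding X by (rule expectation_odd[OF integrable_a])
    show "(\<lambda>x. LBINT u:{0<..<exp (- (x powr q))}. (quantile M (\<lambda>\<omega>. \<bar>?X 0 \<omega>\<bar>) u)\<^sup>2)
        \<in> O(\<lambda>x. (1 / x) powr (1 - q) * g x)"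
      unfolding quant by (rule quant_bigo)
    show "alpha_mix M ?X n \<le> beta_mix M ?X n" for n by (rule mixing(1))
    show "beta_mix M ?X n \<le> exp (- (real n powr q))" if "1 \<le> n" for n
      using mixing(2) expectation_s_power[OF that] by (rule order_trans)
    show "filterlim (\<lambda>n. variance (psum ?X n) / real n) at_top sequentially"
      unfolding var by (rule H_at_top)
    show "(\<lambda>n. SUP r. \<P>(\<omega> in M. r - c < psum ?X n \<omega> / sqrt (real n) \<and> psum ?X n \<omega> / sqrt (real n) < r + c))
        \<longlonglongrightarrow> 0" if "0 < c" for c
      unfolding psum by (rule concentration_sum[OF a_pos growth that])
    show "\<exists>(J :: nat \<Rightarrow> nat) (b :: nat \<Rightarrow> real).
       strict_mono_on {1..} J \<and> (\<forall>n\<ge>1. 0 < J n) \<and> (\<forall>n\<ge>1. 0 < b n) \<and> filterlim b at_top sequentially \<and>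
       weak_conv_m (\<lambda>n. distr M borel (\<lambda>\<omega>. psum ?X (J n) \<omega> / b n)) mu_P1sL"
    proof (intro exI[of _ block] exI[of _ norming] conjI allI impI)
      show "weak_conv_m (\<lambda>n. distr M borel (\<lambda>\<omega>. psum ?X (block n) \<omega> / norming n)) mu_P1sL"
        unfolding psum norming_def
        by (rule weak_conv_compound_Poisson[OF a_pos integrable_a s_tendsto block_\<zeta> block_\<tau> block_low[unfolded norming_def]])
    qed (rule strict_mono_on_block block_pos norming_pos norming_at_top)+
    show "norm_var M ?X n \<le> g (real n)" if "1 \<le> n" for n
      unfolding nvar using H_le_g[OF that] that by (simp add: divide_le_eq mult.commute)
    show "limsup (\<lambda>n. ereal (norm_var M ?X (N * n) / norm_var M ?X n)) = ereal (real N)" if "1 \<le> N" for N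
      unfolding nvar by (rule limsup_H[OF that])
  qed
qed

end
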